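(* The space $D_+$ is outgoing (with respect to the wave propagator $\mathcal{V}$ on $\mathcal{H}$). The map $T_+^\vee$ is the spectral translation representation, and thus the map $f\mapsto g_+^f(t,\omega)$ is the translation representation (with auxiliary Hilbert space $L^2(\Omega,\nu)$).
   Context: Let $\mathcal{T}$ be the $(q+1)$-regular tree with path metric $d$ and a fixed base vertex $o$. $A$ is the adjacency operator on functions on vertices, $[Af](v)=\sum_{w\sim v}f(w)$. $\Omega$ is the set of infinite non-backtracking paths modulo $\gamma_1\sim\gamma_2$ iff $\lim_n d(\gamma_1(n),\gamma_2(n))<\infty$; $\gamma_{o,\omega}$ is the representative of $\omega$ starting at $o$. $\Omega(v)$ is the set of $\omega$ with $\gamma_{o,\omega}$ passing through $v$ (these sets form a basis of the topology); $\nu$ is the probability measure with $\nu(\Omega(v))=\frac{1}{(q+1)q^{d(o,v)-1}}$ for $v\ne o$. $h_\omega(v)=\lim_{n}(n-d(\gamma_{o,\omega}(n),v))$. $S^1$ is the unit circle, with points written $q^{is}=e^{i\theta}$ and arclength measure $d\theta$ (total mass $2\pi$). $c(\xi)=\frac{\xi-q^{-1}\xi^{-1}}{\xi-\xi^{-1}}$. For finitely supported $f$, $[\mathrm{Hel}(f)](q^{is},\omega)=\sum_{x}f(x)q^{(\frac12+is)h_\omega(x)}$. Wave equation: $\frac{A_v}{2\sqrt q}u(v,t)=\frac{u(v,t+1)+u(v,t-1)}{2}$ for $u:\mathcal{T}\times\mathbb{Z}\to\mathbb{C}$, with $A_v$ meaning $A$ applied in $v$. $\mathcal{H}$ is the Hilbert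 space completion of the space of pairs of compactly supported functions for the energy form $[(g_1,g_2),(f_1,f_2)]=\langle(1-\frac{A^2}{4q})g_1,f_1\rangle+\langle g_2,f_2\rangle$. For $f=(f_1,f_2)\in\mathcal{H}$, $u^f$ is the solution with $u(v,0)=f_1(v)$, $\frac{u(v,1)-u(v,-1)}2=f_2(v)$. $\mathcal{V}$ is the unitary operator on $\mathcal{H}$ given by time-one propagation, $\mathcal{V}(f_1,f_2)=\big(\frac{A}{2\sqrt q}f_1+f_2,\ (\frac{A^2}{4q}-I)f_1+\frac{A}{2\sqrt q}f_2\big)$. $D_+$ is the subspace of initial data $f\in\mathcal{H}$ such that for all $t\ge0$, $u^f(\cdot,t)$ is supported outside of the ball of radius $t$ centered at $o$ (that is, $u^f(v,t)=0$ whenever $d(o,v)\le t$). General notions: for a unitary operator $V$ on a Hilbert space $H$, a subspace $D_+\subset H$ is outgoing if $VD_+\subset D_+$, $\bigcap_kV^kD_+=\{0\}$, and $\overline{\bigcup_kV^kD_+}=H$. The (outgoing) translation representation is then an isometry $W_+:H\to\ell^2(\mathbb{Z};N)$, $N$ an auxiliary Hilbert space, such that $V$ maps to the right shift operator and $D_+$ maps to $\ell^2(\mathbb{Z}_{\ge0};N)$; it is unique up to an isomorphism of $N$. The (outgoing) spectral representation, also called spectral translation representation, is $F\circ W_+$ where $[Fh](e^{i\theta})=\sum_nh(n)e^{in\theta}$; it takes $V$ to multiplication by $e^{i\theta}$. Here $L^2(S^1;L^2(\Omega,\nu))$ is identified with $L^2(S^1\times\Omega,d\theta\times d\nu)$.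 The map $T_+:\mathcal{H}\to L^2(S^1\times\Omega,d\theta\times d\nu)$ is defined by $$[T_+(f_1,f_2)](q^{is},\omega)=c(q^{-is})^{-1}\Big(\tfrac{q^{is}-q^{-is}}{2}[\mathrm{Hel}(f_1)](q^{-is},\omega)-[\mathrm{Hel}(f_2)](q^{-is},\omega)\Big)$$ (extended to $\mathcal{H}$ by continuity), and $[T_+^\vee f](q^{is},\omega)=[T_+f](q^{-is},\omega)$. The map $R_+$ is the one satisfying $T_+=\frac{q^{is}-q^{-1}q^{-is}}{1+q^{-1}}R_+$. Put $k_+^f(t,\omega)=\frac1{2\pi}\int_{S^1}[R_+f](q^{is},\omega)(q^{is})^t\,d\theta$ and $g_+^f(t,\omega)=\frac{1}{1+q^{-1}}\big(k_+^f(t+1,\omega)-q^{-1}k_+^f(t-1,\omega)\big)$.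
   Formalization: The isometry is onto ℓ²(Z;N) with N = L²(Ω,ν), inner product multiplied by (1+1/q)/2; unscaled it fails, as ||g_+^f||² is 2/(1+1/q) times the energy (e.g. f=(0,δ_o)). Also q ≥ 2 is assumed, since for q = 1 points of S^1 are not of the form q^{is}. *)

theory Defs
  imports "HOL-Probability.Probability"
begin

section \<open>Hilbert spaces given by representatives\<close>

text \<open>
  A complex Hilbert space is presented by a carrier of representatives and a positive semidefinite
  Hermitian form; its elements are the representatives modulo vectors of norm zero. This is the
  usual description both of \<open>L\<^sup>2\<close> (functions modulo null functions) and of the completion of a
  pre-Hilbert space (Cauchy sequences modulo null sequences). All identities between vectors below
  are meant up to \<open>heq\<close>. The form is linear in the first argument.
\<close>

record 'a hspace =
  carr :: "'a set"
  add :: "'a \<Rightarrow> 'a \<Rightarrow> 'a"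
  smul :: "complex \<Rightarrow> 'a \<Rightarrow> 'a"
  ip :: "'a \<Rightarrow> 'a \<Rightarrow> complex"

definition hnorm :: "'a hspace \<Rightarrow> 'a \<Rightarrow> real" where
  "hnorm S x = sqrt (Re (ip S x x))"

definition hdist :: "'a hspace \<Rightarrow> 'a \<Rightarrow> 'a \<Rightarrow> real" where
  "hdist S x y = hnorm S (add S x (smul S (-1) y))"

definition heq :: "'a hspace \<Rightarrow> 'a \<Rightarrow> 'a \<Rightarrow> bool" where
  "heq S x y \<longleftrightarrow> hdist S x y = 0"

definition hcauchy :: "'a hspace \<Rightarrow> (nat \<Rightarrow> 'a) \<Rightarrow> bool" where
  "hcauchy S X \<longleftrightarrow> (\<forall>e>0. \<exists>N. \<forall>m\<ge>N. \<forall>n\<ge>N. hdist S (X m) (X n) < e)"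

definition hlimit :: "'a hspace \<Rightarrow> (nat \<Rightarrow> 'a) \<Rightarrow> 'a \<Rightarrow> bool" where
  "hlimit S X x \<longleftrightarrow> x \<in> carr S \<and> (\<lambda>n. hdist S (X n) x) \<longlonglongrightarrow> 0"

text \<open>The vector space axioms, up to \<open>heq\<close>, follow from the sesquilinearity clauses.\<close>

definition hilbert_space :: "'a hspace \<Rightarrow> bool" where
  "hilbert_space S \<longleftrightarrow>
     carr S \<noteq> {} \<and>
     (\<forall>x\<in>carr S. \<forall>y\<in>carr S. add S x y \<in> carr S) \<and>
     (\<forall>a. \<forall>x\<in>carr S. smul S a x \<in> carr S) \<and>
     (\<forall>x\<in>carr S. \<forall>y\<in>carr S. \<forall>z\<in>carr S. ip S (add S x y) z = ip S x z + ip S y z) \<and>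
     (\<forall>a. \<forall>x\<in>carr S. \<forall>y\<in>carr S. ip S (smul S a x) y = a * ip S x y) \<and>
     (\<forall>x\<in>carr S. \<forall>y\<in>carr S. ip S y x = cnj (ip S x y)) \<and>
     (\<forall>x\<in>carr S. 0 \<le> Re (ip S x x)) \<and>
     (\<forall>X. (\<forall>n. X n \<in> carr S) \<and> hcauchy S X \<longrightarrow> (\<exists>x. hlimit S X x))"

definition hsubspace :: "'a hspace \<Rightarrow> 'a set \<Rightarrow> bool" where
  "hsubspace S D \<longleftrightarrow>
     D \<subseteq> carr S \<and> D \<noteq> {} \<and>
     (\<forall>x\<in>D. \<forall>y\<in>D. add S x y \<in> D) \<and>
     (\<forall>a. \<forall>x\<in>D. smul S a x \<in> D) \<and>
     (\<forall>x\<in>D. \<forall>y\<in>carr S. heq S x y \<longrightarrow> y \<in> D)"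

text \<open>Linear isometry of one Hilbert space onto another.\<close>

definition hilbert_iso :: "'a hspace \<Rightarrow> 'b hspace \<Rightarrow> ('a \<Rightarrow> 'b) \<Rightarrow> bool" where
  "hilbert_iso S S' U \<longleftrightarrow>
     hilbert_space S \<and> hilbert_space S' \<and>
     (\<forall>x\<in>carr S. U x \<in> carr S') \<and>
     (\<forall>x\<in>carr S. \<forall>y\<in>carr S. heq S' (U (add S x y)) (add S' (U x) (U y))) \<and>
     (\<forall>a. \<forall>x\<in>carr S. heq S' (U (smul S a x)) (smul S' a (U x))) \<and>
     (\<forall>x\<in>carr S. \<forall>y\<in>carr S. ip S' (U x) (U y) = ip S x y) \<and>
     (\<forall>z\<in>carr S'. \<exists>x\<in>carr S. heq S' (U x) z)"

definition completion :: "'a hspace \<Rightarrow> (nat \<Rightarrow> 'a) hspace" where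
  "completion P =
     \<lparr>carr = {X. (\<forall>n. X n \<in> carr P) \<and> hcauchy P X},
      add = (\<lambda>X Y n. add P (X n) (Y n)),
      smul = (\<lambda>a X n. smul P a (X n)),
      ip = (\<lambda>X Y. lim (\<lambda>n. ip P (X n) (Y n)))\<rparr>"

definition L2 :: "'a measure \<Rightarrow> ('a \<Rightarrow> complex) hspace" where
  "L2 M =
     \<lparr>carr = {f \<in> borel_measurable M. integrable M (\<lambda>x. (cmod (f x))\<^sup>2)},
      add = (\<lambda>f g x. f x + g x),
      smul = (\<lambda>a f x. a * f x),
      ip = (\<lambda>f g. \<integral>x. f x * cnj (g x) \<partial>M)\<rparr>"

definition ell2 :: "'a hspace \<Rightarrow> (int \<Rightarrow> 'a) hspace" where
  "ell2 N =
     \<lparr>carr = {h. (\<forall>n. h n \<in> carr N) \<and> (\<lambda>n. (hnorm N (h n))\<^sup>2) summable_on UNIV},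
      add = (\<lambda>g h n. add N (g n) (h n)),
      smul = (\<lambda>a h n. smul N a (h n)),
      ip = (\<lambda>g h. \<Sum>\<^sub>\<infinity>n. ip N (g n) (h n))\<rparr>"

definition ell2_nonneg :: "'a hspace \<Rightarrow> (int \<Rightarrow> 'a) set" where
  "ell2_nonneg N = {h \<in> carr (ell2 N). \<forall>n<0. hnorm N (h n) = 0}"

definition right_shift :: "(int \<Rightarrow> 'a) \<Rightarrow> int \<Rightarrow> 'a" where
  "right_shift h n = h (n - 1)"

text \<open>The same vector space with the inner product multiplied by \<open>c > 0\<close>.\<close>

definition rescale :: "real \<Rightarrow> 'a hspace \<Rightarrow> 'a hspace" where
  "rescale c S = S\<lparr>ip := (\<lambda>x y. complex_of_real c * ip S x y)\<rparr>"


section \<open>Outgoing subspaces, translation and spectral representations\<close>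

text \<open>\<open>V\<^sup>k D\<close> for an integer \<open>k\<close>; for \<open>k < 0\<close> it is the preimage of \<open>D\<close> under \<open>V\<^sup>-\<^sup>k\<close>.\<close>

definition pow_image :: "'a hspace \<Rightarrow> ('a \<Rightarrow> 'a) \<Rightarrow> 'a set \<Rightarrow> int \<Rightarrow> 'a set" where
  "pow_image S V D k =
     (if 0 \<le> k then {y \<in> carr S. \<exists>x\<in>D. heq S y ((V ^^ nat k) x)}
      else {y \<in> carr S. (V ^^ nat (- k)) y \<in> D})"

definition outgoing :: "'a hspace \<Rightarrow> ('a \<Rightarrow> 'a) \<Rightarrow> 'a set \<Rightarrow> bool" where
  "outgoing S V D \<longleftrightarrow>
     hilbert_iso S S V \<and> hsubspace S D \<and>
     V ` D \<subseteq> D \<and>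
     (\<Inter>k. pow_image S V D k) = {x \<in> carr S. hnorm S x = 0} \<and>
     (\<forall>x\<in>carr S. \<forall>e>0. \<exists>y\<in>(\<Union>k. pow_image S V D k). hdist S x y < e)"

definition translation_rep ::
  "'a hspace \<Rightarrow> ('a \<Rightarrow> 'a) \<Rightarrow> 'a set \<Rightarrow> 'b hspace \<Rightarrow> ('a \<Rightarrow> int \<Rightarrow> 'b) \<Rightarrow> bool" where
  "translation_rep S V D N W \<longleftrightarrow>
     hilbert_space N \<and> hilbert_iso S (ell2 N) W \<and>
     (\<forall>x\<in>carr S. heq (ell2 N) (W (V x)) (right_shift (W x))) \<and>
     (\<forall>x\<in>D. W x \<in> ell2_nonneg N) \<and>
     (\<forall>h\<in>ell2_nonneg N. \<exists>x\<in>D. heq (ell2 N) (W x) h)"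

text \<open>Arclength measure \<open>d\<theta>\<close> on the unit circle of the complex plane, of total mass \<open>2\<pi>\<close>.\<close>

definition circle :: "complex measure" where
  "circle = distr (restrict_space lborel {0..<2 * pi}) (restrict_space borel (sphere 0 1)) cis"

text \<open>
  \<open>\<phi>(\<xi>, y) = \<Sum>\<^sub>n h(n)(y) \<xi>\<^sup>n\<close>, where \<open>L\<^sup>2(S\<^sup>1; L\<^sup>2(M))\<close> is identified with \<open>L\<^sup>2(S\<^sup>1 \<times> M)\<close> and the
  series converges in this space.
\<close>

definition fourier_transform ::
  "'y measure \<Rightarrow> (int \<Rightarrow> 'y \<Rightarrow> complex) \<Rightarrow> (complex \<times> 'y \<Rightarrow> complex) \<Rightarrow> bool" where
  "fourier_transform M h \<phi> \<longleftrightarrow>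
     hlimit (L2 (circle \<Otimes>\<^sub>M M)) (\<lambda>K (\<xi>, y). \<Sum>n = - int K..int K. h n y * \<xi> powi n) \<phi>"

text \<open>
  Spectral representation with auxiliary Hilbert space \<open>L\<^sup>2(M)\<close>, the inner product of the latter
  being multiplied by \<open>c\<close>.
\<close>

definition spectral_rep ::
  "'a hspace \<Rightarrow> ('a \<Rightarrow> 'a) \<Rightarrow> 'a set \<Rightarrow> real \<Rightarrow> 'y measure \<Rightarrow>
     ('a \<Rightarrow> complex \<times> 'y \<Rightarrow> complex) \<Rightarrow> bool" where
  "spectral_rep S V D c M T \<longleftrightarrow>
     (\<exists>W. translation_rep S V D (rescale c (L2 M)) W \<and>
          (\<forall>x\<in>carr S. fourier_transform M (W x) (T x)))"


section \<open>The regular tree and its boundary\<close>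

definition regular_tree :: "nat \<Rightarrow> ('v \<Rightarrow> 'v \<Rightarrow> bool) \<Rightarrow> bool" where
  "regular_tree q adj \<longleftrightarrow>
     (\<forall>v w. adj v w \<longrightarrow> adj w v) \<and> (\<forall>v. \<not> adj v v) \<and>
     (\<forall>v w. adj\<^sup>*\<^sup>* v w) \<and>
     \<not> (\<exists>xs. length xs \<ge> 3 \<and> distinct xs \<and> successively adj xs \<and> adj (last xs) (hd xs)) \<and>
     (\<forall>v. finite {w. adj v w} \<and> card {w. adj v w} = q + 1)"

definition tdist :: "('v \<Rightarrow> 'v \<Rightarrow> bool) \<Rightarrow> 'v \<Rightarrow> 'v \<Rightarrow> nat" where
  "tdist adj v w = (LEAST n. (adj ^^ n) v w)"

definition nb_paths :: "('v \<Rightarrow> 'v \<Rightarrow> bool) \<Rightarrow> (nat \<Rightarrow> 'v) set" where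
  "nb_paths adj = {\<gamma>. \<forall>n. adj (\<gamma> n) (\<gamma> (n + 1)) \<and> \<gamma> (n + 2) \<noteq> \<gamma> n}"

definition path_equiv :: "('v \<Rightarrow> 'v \<Rightarrow> bool) \<Rightarrow> ((nat \<Rightarrow> 'v) \<times> (nat \<Rightarrow> 'v)) set" where
  "path_equiv adj =
     {(\<gamma>, \<gamma>'). \<gamma> \<in> nb_paths adj \<and> \<gamma>' \<in> nb_paths adj \<and>
               convergent (\<lambda>n. real (tdist adj (\<gamma> n) (\<gamma>' n)))}"

definition boundary :: "('v \<Rightarrow> 'v \<Rightarrow> bool) \<Rightarrow> (nat \<Rightarrow> 'v) set set" where
  "boundary adj = nb_paths adj // path_equiv adj"

definition geod :: "'v \<Rightarrow> (nat \<Rightarrow> 'v) set \<Rightarrow> nat \<Rightarrow> 'v" where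
  "geod x0 \<omega> = (THE \<gamma>. \<gamma> \<in> \<omega> \<and> \<gamma> 0 = x0)"

definition cylinder :: "('v \<Rightarrow> 'v \<Rightarrow> bool) \<Rightarrow> 'v \<Rightarrow> 'v \<Rightarrow> (nat \<Rightarrow> 'v) set set" where
  "cylinder adj x0 v = {\<omega> \<in> boundary adj. \<exists>n. geod x0 \<omega> n = v}"

text \<open>
  The cylinders are a countable basis of the topology of the boundary, so they generate its Borel
  sets, and the conditions below determine the measure.
\<close>

definition boundary_measure ::
  "nat \<Rightarrow> ('v \<Rightarrow> 'v \<Rightarrow> bool) \<Rightarrow> 'v \<Rightarrow> (nat \<Rightarrow> 'v) set measure \<Rightarrow> bool" where
  "boundary_measure q adj x0 \<nu> \<longleftrightarrow>
     space \<nu> = boundary adj \<and>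
     sets \<nu> = sigma_sets (boundary adj) (range (cylinder adj x0)) \<and>
     prob_space \<nu> \<and>
     (\<forall>v. v \<noteq> x0 \<longrightarrow>
        measure \<nu> (cylinder adj x0 v) = 1 / ((real q + 1) * real q ^ (tdist adj x0 v - 1)))"

text \<open>The sequence in the limit is eventually constant; the limit is taken in the discrete \<open>\<int>\<close>.\<close>

definition horo :: "('v \<Rightarrow> 'v \<Rightarrow> bool) \<Rightarrow> 'v \<Rightarrow> (nat \<Rightarrow> 'v) set \<Rightarrow> 'v \<Rightarrow> int" where
  "horo adj x0 \<omega> v = lim (\<lambda>n. int n - int (tdist adj (geod x0 \<omega> n) v))"


section \<open>Wave equation and energy space\<close>

definition adj_op :: "('v \<Rightarrow> 'v \<Rightarrow> bool) \<Rightarrow> ('v \<Rightarrow> complex) \<Rightarrow> 'v \<Rightarrow> complex" where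
  "adj_op adj f v = (\<Sum>w | adj v w. f w)"

definition finsupp :: "('v \<Rightarrow> complex) \<Rightarrow> bool" where
  "finsupp f \<longleftrightarrow> finite {v. f v \<noteq> 0}"

definition fin_ip :: "('v \<Rightarrow> complex) \<Rightarrow> ('v \<Rightarrow> complex) \<Rightarrow> complex" where
  "fin_ip g f = (\<Sum>v | g v \<noteq> 0 \<and> f v \<noteq> 0. g v * cnj (f v))"

type_synonym 'v data = "('v \<Rightarrow> complex) \<times> ('v \<Rightarrow> complex)"

definition energy_form :: "nat \<Rightarrow> ('v \<Rightarrow> 'v \<Rightarrow> bool) \<Rightarrow> 'v data \<Rightarrow> 'v data \<Rightarrow> complex" where
  "energy_form q adj g f =
     fin_ip (\<lambda>v. fst g v - adj_op adj (adj_op adj (fst g)) v / (4 * of_nat q)) (fst f)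
     + fin_ip (snd g) (snd f)"

definition fin_data :: "nat \<Rightarrow> ('v \<Rightarrow> 'v \<Rightarrow> bool) \<Rightarrow> 'v data hspace" where
  "fin_data q adj =
     \<lparr>carr = {f. finsupp (fst f) \<and> finsupp (snd f)},
      add = (\<lambda>f g. (\<lambda>v. fst f v + fst g v, \<lambda>v. snd f v + snd g v)),
      smul = (\<lambda>a f. (\<lambda>v. a * fst f v, \<lambda>v. a * snd f v)),
      ip = energy_form q adj\<rparr>"

definition energy_space :: "nat \<Rightarrow> ('v \<Rightarrow> 'v \<Rightarrow> bool) \<Rightarrow> (nat \<Rightarrow> 'v data) hspace" where
  "energy_space q adj = completion (fin_data q adj)"

definition prop_fin :: "nat \<Rightarrow> ('v \<Rightarrow> 'v \<Rightarrow> bool) \<Rightarrow> 'v data \<Rightarrow> 'v data" where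
  "prop_fin q adj f =
     (\<lambda>v. adj_op adj (fst f) v / (2 * of_real (sqrt (real q))) + snd f v,
      \<lambda>v. adj_op adj (adj_op adj (fst f)) v / (4 * of_nat q) - fst f v
          + adj_op adj (snd f) v / (2 * of_real (sqrt (real q))))"

definition propagator ::
  "nat \<Rightarrow> ('v \<Rightarrow> 'v \<Rightarrow> bool) \<Rightarrow> (nat \<Rightarrow> 'v data) \<Rightarrow> nat \<Rightarrow> 'v data" where
  "propagator q adj X n = prop_fin q adj (X n)"

text \<open>
  Point evaluations of both components are continuous for the energy norm when \<open>q \<ge> 2\<close>, so an
  element of the completion is a pair of functions, obtained as pointwise limits.
\<close>

definition data_fun :: "(nat \<Rightarrow> 'v data) \<Rightarrow> 'v data" where
  "data_fun X = (\<lambda>v. lim (\<lambda>n. fst (X n) v), \<lambda>v. lim (\<lambda>n. snd (X n) v))"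

definition wave_equation :: "nat \<Rightarrow> ('v \<Rightarrow> 'v \<Rightarrow> bool) \<Rightarrow> ('v \<Rightarrow> int \<Rightarrow> complex) \<Rightarrow> bool" where
  "wave_equation q adj u \<longleftrightarrow>
     (\<forall>v t. adj_op adj (\<lambda>w. u w t) v / (2 * of_real (sqrt (real q)))
              = (u v (t + 1) + u v (t - 1)) / 2)"

definition wave_solution ::
  "nat \<Rightarrow> ('v \<Rightarrow> 'v \<Rightarrow> bool) \<Rightarrow> 'v data \<Rightarrow> 'v \<Rightarrow> int \<Rightarrow> complex" where
  "wave_solution q adj f =
     (THE u. wave_equation q adj u \<and>
             (\<forall>v. u v 0 = fst f v) \<and> (\<forall>v. (u v 1 - u v (-1)) / 2 = snd f v))"

definition D_plus :: "nat \<Rightarrow> ('v \<Rightarrow> 'v \<Rightarrow> bool) \<Rightarrow> 'v \<Rightarrow> (nat \<Rightarrow> 'v data) set" where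
  "D_plus q adj x0 =
     {X \<in> carr (energy_space q adj).
        \<forall>t\<ge>0. \<forall>v. int (tdist adj x0 v) \<le> t \<longrightarrow> wave_solution q adj (data_fun X) v t = 0}"


section \<open>The maps \<open>T\<^sub>+\<close>, \<open>R\<^sub>+\<close> and \<open>g\<^sub>+\<close>\<close>

definition c_fun :: "nat \<Rightarrow> complex \<Rightarrow> complex" where
  "c_fun q \<xi> = (\<xi> - inverse (of_nat q) * inverse \<xi>) / (\<xi> - inverse \<xi>)"

text \<open>Here and below \<open>\<xi> = q\<^sup>i\<^sup>s\<close>, so \<open>q\<close> to the power \<open>(1/2 + is) h\<close> is \<open>q\<^sup>h\<^sup>/\<^sup>2 \<xi>\<^sup>h\<close>.\<close>

definition Hel ::
  "nat \<Rightarrow> ('v \<Rightarrow> 'v \<Rightarrow> bool) \<Rightarrow> 'v \<Rightarrow> ('v \<Rightarrow> complex) \<Rightarrow> complex \<times> (nat \<Rightarrow> 'v) set \<Rightarrow> complex" where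
  "Hel q adj x0 f = (\<lambda>(\<xi>, \<omega>). \<Sum>x | f x \<noteq> 0.
     f x * of_real (real q powr (real_of_int (horo adj x0 \<omega> x) / 2)) * \<xi> powi horo adj x0 \<omega> x)"

definition T_fin ::
  "nat \<Rightarrow> ('v \<Rightarrow> 'v \<Rightarrow> bool) \<Rightarrow> 'v \<Rightarrow> 'v data \<Rightarrow> complex \<times> (nat \<Rightarrow> 'v) set \<Rightarrow> complex" where
  "T_fin q adj x0 f = (\<lambda>(\<xi>, \<omega>). inverse (c_fun q (inverse \<xi>)) *
     ((\<xi> - inverse \<xi>) / 2 * Hel q adj x0 (fst f) (inverse \<xi>, \<omega>)
      - Hel q adj x0 (snd f) (inverse \<xi>, \<omega>)))"

text \<open>Extension by continuity to the completion; the value is determined almost everywhere.\<close>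

definition T_plus ::
  "nat \<Rightarrow> ('v \<Rightarrow> 'v \<Rightarrow> bool) \<Rightarrow> 'v \<Rightarrow> (nat \<Rightarrow> 'v) set measure \<Rightarrow> (nat \<Rightarrow> 'v data) \<Rightarrow>
     complex \<times> (nat \<Rightarrow> 'v) set \<Rightarrow> complex" where
  "T_plus q adj x0 \<nu> X =
     (SOME \<phi>. hlimit (L2 (circle \<Otimes>\<^sub>M \<nu>)) (\<lambda>n. T_fin q adj x0 (X n)) \<phi>)"

definition T_plus_check ::
  "nat \<Rightarrow> ('v \<Rightarrow> 'v \<Rightarrow> bool) \<Rightarrow> 'v \<Rightarrow> (nat \<Rightarrow> 'v) set measure \<Rightarrow> (nat \<Rightarrow> 'v data) \<Rightarrow>
     complex \<times> (nat \<Rightarrow> 'v) set \<Rightarrow> complex" where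
  "T_plus_check q adj x0 \<nu> X = (\<lambda>(\<xi>, \<omega>). T_plus q adj x0 \<nu> X (inverse \<xi>, \<omega>))"

text \<open>The factor in \<open>T\<^sub>+ = (\<xi> - q\<^sup>-\<^sup>1 \<xi>\<^sup>-\<^sup>1) / (1 + q\<^sup>-\<^sup>1) R\<^sub>+\<close> has no zero on the unit circle if \<open>q \<ge> 2\<close>.\<close>

definition R_plus ::
  "nat \<Rightarrow> ('v \<Rightarrow> 'v \<Rightarrow> bool) \<Rightarrow> 'v \<Rightarrow> (nat \<Rightarrow> 'v) set measure \<Rightarrow> (nat \<Rightarrow> 'v data) \<Rightarrow>
     complex \<times> (nat \<Rightarrow> 'v) set \<Rightarrow> complex" where
  "R_plus q adj x0 \<nu> X = (\<lambda>(\<xi>, \<omega>). T_plus q adj x0 \<nu> X (\<xi>, \<omega>) /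
     ((\<xi> - inverse (of_nat q) * inverse \<xi>) / (1 + inverse (of_nat q))))"

definition k_plus ::
  "nat \<Rightarrow> ('v \<Rightarrow> 'v \<Rightarrow> bool) \<Rightarrow> 'v \<Rightarrow> (nat \<Rightarrow> 'v) set measure \<Rightarrow> (nat \<Rightarrow> 'v data) \<Rightarrow>
     int \<Rightarrow> (nat \<Rightarrow> 'v) set \<Rightarrow> complex" where
  "k_plus q adj x0 \<nu> X t \<omega> =
     1 / (2 * of_real pi) * (\<integral>\<xi>. R_plus q adj x0 \<nu> X (\<xi>, \<omega>) * \<xi> powi t \<partial>circle)"

definition g_plus ::
  "nat \<Rightarrow> ('v \<Rightarrow> 'v \<Rightarrow> bool) \<Rightarrow> 'v \<Rightarrow> (nat \<Rightarrow> 'v) set measure \<Rightarrow> (nat \<Rightarrow> 'v data) \<Rightarrow>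
     int \<Rightarrow> (nat \<Rightarrow> 'v) set \<Rightarrow> complex" where
  "g_plus q adj x0 \<nu> X t \<omega> =
     1 / (1 + inverse (of_nat q)) *
       (k_plus q adj x0 \<nu> X (t + 1) \<omega> - inverse (of_nat q) * k_plus q adj x0 \<nu> X (t - 1) \<omega>)"

text \<open>
  With the normalisations above,
  \<open>\<integral>\<integral> |T\<^sub>+ f|\<^sup>2 d\<theta> d\<nu> = 4\<pi> / (1 + q\<^sup>-\<^sup>1)\<close> times the energy of \<open>f\<close> (for instance
  \<open>\<integral> |c|\<^sup>-\<^sup>2 d\<theta> = 4\<pi> / (1 + q\<^sup>-\<^sup>1)\<close> while the delta function at the base vertex, as second component,
  has energy 1), whereas \<open>h \<mapsto> \<Sum>\<^sub>n h(n) e\<^sup>i\<^sup>n\<^sup>\<theta>\<close> multiplies squared norms by \<open>2\<pi>\<close>. The translation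
  representation is therefore isometric for the inner product of \<open>L\<^sup>2(\<Omega>, \<nu>)\<close> times this constant.
\<close>

definition rep_const :: "nat \<Rightarrow> real" where
  "rep_const q = (1 + inverse (real q)) / 2"

end

theory Submission
  imports Defs
begin

text \<open>
  The wave propagator is diagonalised by explicit waves. Write \<open>S\<close> for the right shift of sequences
  indexed by time. For a vertex \<open>v\<close> at distance \<open>m\<close> from the base vertex (its level) put
  \<open>w\<^sub>v(n, \<omega>) = 2 q\<^bsup>(n+1)/2\<^esup>\<close> if \<open>n + 1 \<le> h\<^sub>\<omega>(v)\<close> and \<open>n + 1 \<equiv> m\<close> modulo 2, and \<open>0\<close> otherwise. Its Fourier
  series in \<open>n\<close> is geometric, with sum \<open>2 q\<^bsup>h/2\<^esup> \<xi>\<^sup>h / (\<xi> - q\<^sup>-\<^sup>1 \<xi>\<^sup>-\<^sup>1)\<close> where \<open>h = h\<^sub>\<omega>(v)\<close>; this is twice the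
  Helgason kernel divided by the numerator of \<open>c(\<xi>)\<close>. So \<open>T\<^sub>+\<close>, reflected, sends the data \<open>(0, \<delta>\<^sub>v)\<close>
  and \<open>(\<delta>\<^sub>v, 0)\<close> to the Fourier series of \<open>a\<^sub>v = - (S - S\<^sup>-\<^sup>1) w\<^sub>v / 2\<close> and \<open>b\<^sub>v = (S - S\<^sup>-\<^sup>1) a\<^sub>v / 2\<close>
  (\<open>eval_wave\<close>, \<open>vel_wave\<close>, \<open>pos_wave\<close>; lemma \<open>fourier_W0\<close>). Seen from an end, a vertex has one
  neighbour on the next horocycle and \<open>q\<close> neighbours on the preceding one, which gives
  \<open>(S + S\<^sup>-\<^sup>1) w\<^sub>v = q\<^bsup>-1/2\<^esup> \<Sum>\<^bsub>u \<sim> v\<^esub> w\<^sub>u\<close>; therefore the propagator becomes \<open>S\<close> (\<open>W0_prop\<close>).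

  Everything else rests on one computation, \<open>\<langle>a\<^sub>x, w\<^sub>v\<rangle> = 0\<close> and \<open>\<langle>S a\<^sub>x, w\<^sub>v\<rangle> = \<delta>\<^sub>x\<^sub>v\<close> (\<open>vel_wave_eval_wave_ip\<close>).
  At time \<open>n = 2j - m - 1\<close> the wave \<open>w\<^sub>v\<close> is a multiple of the indicator of the set of ends that agree
  with \<open>v\<close> up to level \<open>j\<close>; such sets, for two vertices, are nested or disjoint, so the inner product is
  a sum over levels of powers of \<open>q\<close>, and it telescopes. With the recursion above it follows that
  \<open>u(v, t) = \<langle>S\<^sup>t g, w\<^sub>v\<rangle>\<close> is the solution of the wave equation whose initial data are represented by \<open>g\<close>:
  pairing with \<open>w\<^sub>v\<close> evaluates the first component at \<open>v\<close>. Pairing with \<open>a\<^sub>v\<close> and \<open>b\<^sub>v\<close> gives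
  \<open>f\<^sub>2(v)\<close> and \<open>(f\<^sub>1 - A\<^sup>2 f\<^sub>1 / 4q)(v)\<close>, which is the statement that the representation preserves the energy
  form (\<open>W0_isometry\<close>). In particular that form is positive semidefinite, and the representation extends to
  the completion.

  Data lie in \<open>D\<^sub>+\<close> if and only if \<open>\<langle>S\<^sup>t g, w\<^sub>v\<rangle> = 0\<close> for all \<open>v\<close> and all \<open>t \<ge> m\<close>. This holds if \<open>g\<close> vanishes at
  negative times, because \<open>w\<^sub>v\<close> vanishes from time \<open>m\<close> on. Conversely, induction on the level shows that
  all integrals of \<open>g(n)\<close>, \<open>n < 0\<close>, over cylinders vanish (\<open>cylinder_integrals_of_orthogonal\<close>), and the
  cylinders generate the measurable sets. The same argument yields surjectivity: the image is complete,
  so it suffices that a vector \<open>g\<close> orthogonal to all \<open>S\<^sup>k a\<^sub>v\<close> is null. For such \<open>g\<close> the function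
  \<open>k \<mapsto> \<langle>S\<^sup>k g, w\<^sub>v\<rangle>\<close> has period two, and it tends to zero, so it vanishes
  (\<open>orthogonal_to_waves_null\<close>).

  Thus the energy space, the propagator and \<open>D\<^sub>+\<close> are identified with \<open>\<ell>\<^sup>2(\<int>; L\<^sup>2(\<Omega>, \<nu>))\<close>, the right shift and
  the sequences supported in \<open>{0, 1, \<dots>}\<close>, for which the axioms of an outgoing subspace are evident
  (\<open>shift_intertwiner\<close>). Parseval's identity and the formula for Fourier coefficients identify the
  representation with \<open>T_plus_check\<close> on the spectral side and with \<open>g_plus\<close> on the side of sequences
  (\<open>represents_g_plus\<close>).
\<close>

section \<open>Pre-Hilbert spaces given by representatives\<close>

locale prehilbert =
  fixes S :: "'a hspace"
  assumes carr_nonempty: "carr S \<noteq> {}"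
    and add_closed [simp, intro]: "x \<in> carr S \<Longrightarrow> y \<in> carr S \<Longrightarrow> add S x y \<in> carr S"
    and smul_closed [simp, intro]: "x \<in> carr S \<Longrightarrow> smul S a x \<in> carr S"
    and ip_add_left: "x \<in> carr S \<Longrightarrow> y \<in> carr S \<Longrightarrow> z \<in> carr S \<Longrightarrow> ip S (add S x y) z = ip S x z + ip S y z"
    and ip_smul_left: "x \<in> carr S \<Longrightarrow> y \<in> carr S \<Longrightarrow> ip S (smul S a x) y = a * ip S x y"
    and ip_cnj: "x \<in> carr S \<Longrightarrow> y \<in> carr S \<Longrightarrow> ip S y x = cnj (ip S x y)"
    and ip_nonneg: "x \<in> carr S \<Longrightarrow> 0 \<le> Re (ip S x x)"

lemma hilbert_space_iff:
  "hilbert_space S \<longleftrightarrow>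
     prehilbert S \<and> (\<forall>X. (\<forall>n. X n \<in> carr S) \<and> hcauchy S X \<longrightarrow> (\<exists>x. hlimit S X x))"
  (is "?L \<longleftrightarrow> ?R")
proof
  assume L: ?L
  show ?R
    using L unfolding hilbert_space_def by (elim conjE, intro conjI, unfold_locales) (assumption | iprover dest: bspec spec)+
next
  assume R: ?R
  then interpret prehilbert S by simp
  show ?L
    unfolding hilbert_space_def
    by (intro conjI ballI allI carr_nonempty add_closed smul_closed ip_add_left ip_smul_left
          ip_nonneg ip_cnj conjunct2[OF R]) assumption+
qed

lemma hilbert_spaceD: "hilbert_space S \<Longrightarrow> prehilbert S"
  by (simp add: hilbert_space_iff)

lemma hilbert_space_complete:
  "hilbert_space S \<Longrightarrow> (\<And>n. X n \<in> carr S) \<Longrightarrow> hcauchy S X \<Longrightarrow> \<exists>x. hlimit S X x"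
  by (simp add: hilbert_space_iff)

context prehilbert
begin

abbreviation df :: "'a \<Rightarrow> 'a \<Rightarrow> 'a" where "df x y \<equiv> add S x (smul S (-1) y)"

lemma ip_add_right:
  assumes "x \<in> carr S" "y \<in> carr S" "z \<in> carr S"
  shows "ip S z (add S x y) = ip S z x + ip S z y"
  using assms by (metis add_closed complex_cnj_add ip_add_left ip_cnj)

lemma ip_smul_right:
  assumes "x \<in> carr S" "y \<in> carr S"
  shows "ip S y (smul S a x) = cnj a * ip S y x"
  using assms by (metis smul_closed complex_cnj_mult ip_smul_left ip_cnj)

lemmas ip_expand = ip_add_left ip_add_right ip_smul_left ip_smul_right

lemma ip_self: "x \<in> carr S \<Longrightarrow> ip S x x = complex_of_real ((hnorm S x)\<^sup>2)"
proof -
  assume x: "x \<in> carr S"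
  have "Im (ip S x x) = 0" using ip_cnj[OF x x] by (metis complex_cnj_cancel_iff cnj.simps(2) neg_equal_zero)
  then show ?thesis using ip_nonneg[OF x] by (simp add: hnorm_def complex_eq_iff)
qed

lemma hnorm_sq: "x \<in> carr S \<Longrightarrow> (hnorm S x)\<^sup>2 = Re (ip S x x)"
  using ip_nonneg by (simp add: hnorm_def)

lemma hnorm_nonneg [simp]: "x \<in> carr S \<Longrightarrow> 0 \<le> hnorm S x"
  using ip_nonneg by (simp add: hnorm_def)

lemma hdist_nonneg [simp]: "x \<in> carr S \<Longrightarrow> y \<in> carr S \<Longrightarrow> 0 \<le> hdist S x y"
  by (simp add: hdist_def)

lemma Re_ip_commute: "x \<in> carr S \<Longrightarrow> y \<in> carr S \<Longrightarrow> Re (ip S y x) = Re (ip S x y)"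
  using ip_cnj by (metis cnj.simps(1))

lemma hdist_sq:
  assumes "x \<in> carr S" "y \<in> carr S"
  shows "(hdist S x y)\<^sup>2 = (hnorm S x)\<^sup>2 - 2 * Re (ip S x y) + (hnorm S y)\<^sup>2"
  using assms Re_ip_commute[OF assms] by (simp add: hdist_def hnorm_sq ip_expand)

lemma hnorm_add_sq:
  assumes "x \<in> carr S" "y \<in> carr S"
  shows "(hnorm S (add S x y))\<^sup>2 = (hnorm S x)\<^sup>2 + 2 * Re (ip S x y) + (hnorm S y)\<^sup>2"
  using assms Re_ip_commute[OF assms] by (simp add: hnorm_sq ip_expand)

lemma hnorm_smul:
  assumes "x \<in> carr S" shows "hnorm S (smul S a x) = cmod a * hnorm S x"
proof -
  have "ip S (smul S a x) (smul S a x) = (a * cnj a) * ip S x x"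
    using assms by (simp add: ip_expand)
  then have "ip S (smul S a x) (smul S a x) = complex_of_real ((cmod a * hnorm S x)\<^sup>2)"
    using ip_self[OF assms] by (simp add: complex_norm_square power_mult_distrib flip: of_real_power)
  then have "(hnorm S (smul S a x))\<^sup>2 = (cmod a * hnorm S x)\<^sup>2"
    using assms by (simp add: hnorm_sq)
  then show ?thesis using assms by (simp add: power2_eq_iff_nonneg)
qed

lemma Cauchy_Schwarz:
  assumes x: "x \<in> carr S" and y: "y \<in> carr S"
  shows "cmod (ip S x y) \<le> hnorm S x * hnorm S y"
proof (cases "ip S x y = 0")
  case True then show ?thesis using x y by simp
next
  case False
  define b where "b = cnj (sgn (ip S x y))"
  have b1: "cmod b = 1" using False by (simp add: b_def norm_sgn)
  have "b * ip S x y = complex_of_real (cmod (ip S x y))"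
    using False complex_norm_square[of "ip S x y"]
    by (simp add: b_def sgn_eq power2_eq_square mult.commute[of "cnj _"] flip: complex_norm_square)
  then have br: "ip S (smul S b x) y = complex_of_real (cmod (ip S x y))"
    using x y by (simp add: ip_smul_left)
  have quad: "0 \<le> (hnorm S x)\<^sup>2 * t\<^sup>2 - 2 * (cmod (ip S x y) * t) + (hnorm S y)\<^sup>2" for t :: real
  proof -
    have "0 \<le> (hdist S (smul S (of_real t * b) x) y)\<^sup>2" by simp
    also have "\<dots> = (hnorm S x)\<^sup>2 * t\<^sup>2 - 2 * (cmod (ip S x y) * t) + (hnorm S y)\<^sup>2"
    proof -
      have "ip S (smul S (of_real t * b) x) y = of_real t * ip S (smul S b x) y"
        using x y by (simp add: ip_smul_left)
      then show ?thesis using x y b1 br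
        by (simp add: hdist_sq hnorm_smul norm_mult power_mult_distrib)
    qed
    finally show ?thesis .
  qed
  have "(cmod (ip S x y))\<^sup>2 \<le> (hnorm S x)\<^sup>2 * (hnorm S y)\<^sup>2"
  proof (cases "hnorm S x = 0")
    case True
    \<comment> \<open>for a null vector the quadratic polynomial is linear and bounded below, so its slope is zero\<close>
    have "2 * (cmod (ip S x y) * (((hnorm S y)\<^sup>2 + 1) / (2 * cmod (ip S x y)))) \<le> (hnorm S y)\<^sup>2"
      using quad[of "((hnorm S y)\<^sup>2 + 1) / (2 * cmod (ip S x y))"] True by simp
    then show ?thesis using False by simp
  next
    case nz: False
    then have p: "(hnorm S x)\<^sup>2 > 0" by simp
    have "0 \<le> (hnorm S x)\<^sup>2 * (cmod (ip S x y) / (hnorm S x)\<^sup>2)\<^sup>2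
          - 2 * (cmod (ip S x y) * (cmod (ip S x y) / (hnorm S x)\<^sup>2)) + (hnorm S y)\<^sup>2"
      by (rule quad)
    also have "\<dots> = (hnorm S y)\<^sup>2 - (cmod (ip S x y))\<^sup>2 / (hnorm S x)\<^sup>2"
      using nz by (simp add: field_simps power2_eq_square)
    finally show ?thesis using p by (simp add: field_simps)
  qed
  then show ?thesis
    using x y by (metis power_mult_distrib power2_le_imp_le hnorm_nonneg mult_nonneg_nonneg)
qed

lemma hnorm_triangle:
  assumes x: "x \<in> carr S" and y: "y \<in> carr S"
  shows "hnorm S (add S x y) \<le> hnorm S x + hnorm S y"
proof (rule power2_le_imp_le)
  have "Re (ip S x y) \<le> hnorm S x * hnorm S y"
    using Cauchy_Schwarz[OF x y] complex_Re_le_cmod order_trans by blast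
  then show "(hnorm S (add S x y))\<^sup>2 \<le> (hnorm S x + hnorm S y)\<^sup>2"
    using x y by (simp add: hnorm_add_sq power2_sum)
qed (use x y in simp)

lemma hdist_self: "x \<in> carr S \<Longrightarrow> hdist S x x = 0"
  using hdist_sq[of x x] by (simp add: hnorm_sq)

lemma hdist_commute:
  assumes "x \<in> carr S" "y \<in> carr S" shows "hdist S x y = hdist S y x"
proof -
  have "(hdist S x y)\<^sup>2 = (hdist S y x)\<^sup>2"
    using assms Re_ip_commute[OF assms] by (simp add: hdist_sq)
  then show ?thesis using assms by (simp add: power2_eq_iff_nonneg)
qed

lemma hdist_triangle:
  assumes x: "x \<in> carr S" and y: "y \<in> carr S" and z: "z \<in> carr S"
  shows "hdist S x z \<le> hdist S x y + hdist S y z"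
proof -
  have "(hdist S x z)\<^sup>2 = (hnorm S (add S (df x y) (df y z)))\<^sup>2"
    using x y z Re_ip_commute by (simp add: hdist_sq hnorm_sq ip_expand)
  then have "hdist S x z = hnorm S (add S (df x y) (df y z))"
    using x y z by (simp add: power2_eq_iff_nonneg)
  then show ?thesis using hnorm_triangle[of "df x y" "df y z"] x y z by (simp add: hdist_def)
qed

lemma hdist_add:
  assumes "x \<in> carr S" "y \<in> carr S" "x' \<in> carr S" "y' \<in> carr S"
  shows "hdist S (add S x y) (add S x' y') \<le> hdist S x x' + hdist S y y'"
proof -
  have "(hdist S (add S x y) (add S x' y'))\<^sup>2 = (hnorm S (add S (df x x') (df y y')))\<^sup>2"
    using assms Re_ip_commute by (simp add: hdist_sq hnorm_sq ip_expand)
  then have "hdist S (add S x y) (add S x' y') = hnorm S (add S (df x x') (df y y'))"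
    using assms by (simp add: power2_eq_iff_nonneg)
  then show ?thesis using hnorm_triangle[of "df x x'" "df y y'"] assms by (simp add: hdist_def)
qed

lemma hdist_smul:
  assumes "x \<in> carr S" "y \<in> carr S"
  shows "hdist S (smul S a x) (smul S a y) = cmod a * hdist S x y"
proof -
  have "(hdist S (smul S a x) (smul S a y))\<^sup>2 = (hnorm S (smul S a (df x y)))\<^sup>2"
    unfolding hdist_def using assms by (simp add: hnorm_sq ip_expand algebra_simps)
  then have "hdist S (smul S a x) (smul S a y) = hnorm S (smul S a (df x y))"
    using assms by (simp add: power2_eq_iff_nonneg)
  then show ?thesis using assms by (simp add: hnorm_smul hdist_def)
qed

lemma hnorm_diff_le_hdist:
  assumes x: "x \<in> carr S" and y: "y \<in> carr S"
  shows "\<bar>hnorm S x - hnorm S y\<bar> \<le> hdist S x y"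
proof (rule power2_le_imp_le)
  have "Re (ip S x y) \<le> hnorm S x * hnorm S y"
    using Cauchy_Schwarz[OF x y] complex_Re_le_cmod order_trans by blast
  then show "\<bar>hnorm S x - hnorm S y\<bar>\<^sup>2 \<le> (hdist S x y)\<^sup>2"
    using x y by (simp add: hdist_sq power2_diff)
qed (use x y in simp)

lemma ip_diff_le:
  assumes "x \<in> carr S" "y \<in> carr S" "x' \<in> carr S" "y' \<in> carr S"
  shows "cmod (ip S x y - ip S x' y') \<le> hdist S x x' * hnorm S y + hnorm S x' * hdist S y y'"
proof -
  have "ip S x y - ip S x' y' = ip S (df x x') y + ip S x' (df y y')"
    using assms by (simp add: ip_expand)
  also have "cmod \<dots> \<le> cmod (ip S (df x x') y) + cmod (ip S x' (df y y'))"
    by (rule norm_triangle_ineq)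
  also have "\<dots> \<le> hdist S x x' * hnorm S y + hnorm S x' * hdist S y y'"
    unfolding hdist_def using assms by (intro add_mono Cauchy_Schwarz) auto
  finally show ?thesis .
qed

lemma heqI: "hdist S x y \<le> 0 \<Longrightarrow> x \<in> carr S \<Longrightarrow> y \<in> carr S \<Longrightarrow> heq S x y"
  using hdist_nonneg[of x y] unfolding heq_def by linarith

lemma heq_refl [simp]: "x \<in> carr S \<Longrightarrow> heq S x x"
  by (simp add: heq_def hdist_self)

lemma heq_sym: "heq S x y \<Longrightarrow> x \<in> carr S \<Longrightarrow> y \<in> carr S \<Longrightarrow> heq S y x"
  by (simp add: heq_def hdist_commute)

lemma heq_trans:
  assumes "heq S x y" "heq S y z" "x \<in> carr S" "y \<in> carr S" "z \<in> carr S"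
  shows "heq S x z"
  using assms hdist_triangle[of x y z] by (intro heqI) (simp_all add: heq_def)

lemma heq_ip:
  assumes "heq S x x'" "heq S y y'" "x \<in> carr S" "y \<in> carr S" "x' \<in> carr S" "y' \<in> carr S"
  shows "ip S x y = ip S x' y'"
  using ip_diff_le[of x y x' y'] assms by (simp add: heq_def)

lemma heq_hnorm:
  assumes "heq S x y" "x \<in> carr S" "y \<in> carr S"
  shows "hnorm S x = hnorm S y"
  using hnorm_diff_le_hdist[of x y] assms by (simp add: heq_def)

lemma heq_hdist:
  assumes "heq S x x'" "heq S y y'" "x \<in> carr S" "y \<in> carr S" "x' \<in> carr S" "y' \<in> carr S"
  shows "hdist S x y = hdist S x' y'"
  using hdist_triangle[of x x' y] hdist_triangle[of x' y' y] hdist_triangle[of x' x y']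
    hdist_triangle[of x y y'] assms
  by (simp add: heq_def hdist_commute)

lemma heq_add:
  assumes "heq S x x'" "heq S y y'" "x \<in> carr S" "y \<in> carr S" "x' \<in> carr S" "y' \<in> carr S"
  shows "heq S (add S x y) (add S x' y')"
  using hdist_add[of x y x' y'] assms by (intro heqI) (simp_all add: heq_def)

lemma hlimit_unique:
  assumes "hlimit S X x" "hlimit S X y" "\<And>n. X n \<in> carr S"
  shows "heq S x y"
proof -
  have xy: "x \<in> carr S" "y \<in> carr S" using assms by (simp_all add: hlimit_def)
  have "(\<lambda>n. hdist S (X n) x + hdist S (X n) y) \<longlonglongrightarrow> 0 + 0"
    using assms by (intro tendsto_add) (simp_all add: hlimit_def)
  moreover have "hdist S x y \<le> hdist S (X n) x + hdist S (X n) y" for n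
    using hdist_triangle[of x "X n" y] assms(3) xy by (simp add: hdist_commute)
  ultimately have "hdist S x y \<le> 0"
    by (intro LIMSEQ_le_const[where X = "\<lambda>n. hdist S (X n) x + hdist S (X n) y"]) auto
  then show ?thesis using xy by (intro heqI)
qed

lemma hlimit_heq:
  assumes "hlimit S X x" "heq S x y" "y \<in> carr S" "\<And>n. X n \<in> carr S"
  shows "hlimit S X y"
proof -
  have "hdist S (X n) y = hdist S (X n) x" for n
    using assms by (intro heq_hdist) (auto simp: hlimit_def intro: heq_sym)
  then show ?thesis using assms by (simp add: hlimit_def)
qed

lemma hlimit_ip:
  assumes "hlimit S X x" "hlimit S Y y" "\<And>n. X n \<in> carr S" "\<And>n. Y n \<in> carr S"
  shows "(\<lambda>n. ip S (X n) (Y n)) \<longlonglongrightarrow> ip S x y"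
proof -
  have xy: "x \<in> carr S" "y \<in> carr S" using assms by (simp_all add: hlimit_def)
  have dx: "(\<lambda>n. hdist S (X n) x) \<longlonglongrightarrow> 0" and dy: "(\<lambda>n. hdist S (Y n) y) \<longlonglongrightarrow> 0"
    using assms by (simp_all add: hlimit_def)
  have bnd: "cmod (ip S (X n) (Y n) - ip S x y)
     \<le> hdist S (X n) x * (hnorm S y + hdist S (Y n) y) + hnorm S x * hdist S (Y n) y" for n
  proof -
    have "hnorm S (Y n) \<le> hnorm S y + hdist S (Y n) y"
      using hnorm_diff_le_hdist[of "Y n" y] assms(4)[of n] xy by linarith
    then have "hdist S (X n) x * hnorm S (Y n) \<le> hdist S (X n) x * (hnorm S y + hdist S (Y n) y)"
      using assms(3) xy by (intro mult_left_mono) auto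
    then show ?thesis using ip_diff_le[of "X n" "Y n" x y] assms(3,4) xy by (meson add_right_mono order_trans)
  qed
  have "(\<lambda>n. hdist S (X n) x * (hnorm S y + hdist S (Y n) y) + hnorm S x * hdist S (Y n) y)
      \<longlonglongrightarrow> 0 * (hnorm S y + 0) + hnorm S x * 0"
    by (intro tendsto_intros dx dy)
  then have "(\<lambda>n. hdist S (X n) x * (hnorm S y + hdist S (Y n) y) + hnorm S x * hdist S (Y n) y) \<longlonglongrightarrow> 0"
    by simp
  then have "(\<lambda>n. ip S (X n) (Y n) - ip S x y) \<longlonglongrightarrow> 0"
    by (rule Lim_null_comparison[OF always_eventually, rule_format, OF bnd])
  then show ?thesis by (simp add: LIM_zero_iff)
qed

lemma hlimit_const: "x \<in> carr S \<Longrightarrow> hlimit S (\<lambda>n. x) x"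
  by (simp add: hlimit_def hdist_self)

end

subsection \<open>Maps preserving inner products\<close>

lemma ip_preserving_hdist:
  assumes "prehilbert S" "prehilbert S'"
    and "\<And>x. x \<in> carr S \<Longrightarrow> U x \<in> carr S'"
    and "\<And>x y. x \<in> carr S \<Longrightarrow> y \<in> carr S \<Longrightarrow> ip S' (U x) (U y) = ip S x y"
    and "x \<in> carr S" "y \<in> carr S"
  shows "hdist S' (U x) (U y) = hdist S x y"
proof -
  interpret S: prehilbert S by fact
  interpret S': prehilbert S' by fact
  have "(hdist S' (U x) (U y))\<^sup>2 = (hdist S x y)\<^sup>2"
    using assms(3-) by (simp add: S.hdist_sq S'.hdist_sq S.hnorm_sq S'.hnorm_sq)
  then show ?thesis using assms(3-) by (simp add: power2_eq_iff_nonneg)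
qed

text \<open>Linearity up to null vectors is automatic: the squared norm of \<open>U (x + y) - U x - U y\<close> is a combination
  of inner products, all of which \<open>U\<close> preserves.\<close>

lemma hilbert_isoI:
  assumes S: "hilbert_space S" and S': "hilbert_space S'"
    and cl: "\<And>x. x \<in> carr S \<Longrightarrow> U x \<in> carr S'"
    and ip: "\<And>x y. x \<in> carr S \<Longrightarrow> y \<in> carr S \<Longrightarrow> ip S' (U x) (U y) = ip S x y"
    and onto: "\<And>z. z \<in> carr S' \<Longrightarrow> \<exists>x\<in>carr S. heq S' (U x) z"
  shows "hilbert_iso S S' U"
proof -
  interpret S: prehilbert S using S by (rule hilbert_spaceD)
  interpret S': prehilbert S' using S' by (rule hilbert_spaceD)
  have "heq S' (U (add S x y)) (add S' (U x) (U y))" if "x \<in> carr S" "y \<in> carr S" for x y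
  proof -
    have "(hdist S' (U (add S x y)) (add S' (U x) (U y)))\<^sup>2 = (hdist S (add S x y) (add S x y))\<^sup>2"
      using that cl by (simp add: S.hdist_sq S'.hdist_sq S.hnorm_sq S'.hnorm_sq S.ip_expand S'.ip_expand ip)
    then show ?thesis using that by (simp add: heq_def S.hdist_self)
  qed
  moreover have "heq S' (U (smul S a x)) (smul S' a (U x))" if "x \<in> carr S" for a x
  proof -
    have "(hdist S' (U (smul S a x)) (smul S' a (U x)))\<^sup>2 = (hdist S (smul S a x) (smul S a x))\<^sup>2"
      using that cl by (simp add: S.hdist_sq S'.hdist_sq S.hnorm_sq S'.hnorm_sq S.ip_expand S'.ip_expand ip)
    then show ?thesis using that by (simp add: heq_def S.hdist_self)
  qed
  ultimately show ?thesis using assms by (auto simp: hilbert_iso_def)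
qed

lemma (in prehilbert) minimal_imp_orthogonal:
  assumes r: "r \<in> carr S" and u: "u \<in> carr S"
    and min: "\<And>a. hnorm S r \<le> hdist S r (smul S a u)"
  shows "ip S r u = 0"
proof -
  have "2 * t * (cmod (ip S r u))\<^sup>2 \<le> t\<^sup>2 * (cmod (ip S r u))\<^sup>2 * (hnorm S u)\<^sup>2" for t :: real
  proof -
    \<comment> \<open>for small \<open>t\<close> the first order term of \<open>\<parallel>r - a u\<parallel>\<^sup>2\<close> dominates\<close>
    define a where "a = of_real t * ip S r u"
    have "(hnorm S r)\<^sup>2 \<le> (hdist S r (smul S a u))\<^sup>2"
      using min r by (intro power_mono) auto
    then have "2 * Re (ip S r (smul S a u)) \<le> (hnorm S (smul S a u))\<^sup>2"
      using r u by (simp add: hdist_sq)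
    moreover have "ip S r (smul S a u) = complex_of_real (t * (cmod (ip S r u))\<^sup>2)"
      unfolding of_real_mult complex_norm_square using r u by (simp add: ip_expand a_def)
    ultimately show ?thesis using r u
      by (simp add: hnorm_smul a_def norm_mult power_mult_distrib)
  qed
  note q = this
  show ?thesis
  proof (rule ccontr)
    assume "ip S r u \<noteq> 0"
    then have p: "(cmod (ip S r u))\<^sup>2 > 0" by simp
    define t where "t = 1 / ((hnorm S u)\<^sup>2 + 1)"
    have den: "(hnorm S u)\<^sup>2 + 1 > 0" by (smt (verit) zero_le_power2)
    then have tp: "t > 0" by (simp add: t_def)
    have "2 * t \<le> t\<^sup>2 * (hnorm S u)\<^sup>2"
      using q[of t] p by (simp add: mult.commute mult.left_commute)
    then have "2 \<le> t * (hnorm S u)\<^sup>2" using tp by (simp add: power2_eq_square)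
    moreover have "t * (hnorm S u)\<^sup>2 \<le> 1" using den by (simp add: t_def field_simps)
    ultimately show False by simp
  qed
qed

text \<open>The image is complete, so a vector outside of it has a nearest point in the image; the
  difference is orthogonal to the image.\<close>

lemma ip_preserving_onto:
  assumes S: "hilbert_space S" and S': "prehilbert S'"
    and cl: "\<And>x. x \<in> carr S \<Longrightarrow> U x \<in> carr S'"
    and ip: "\<And>x y. x \<in> carr S \<Longrightarrow> y \<in> carr S \<Longrightarrow> ip S' (U x) (U y) = ip S x y"
    and orth: "\<And>z. z \<in> carr S' \<Longrightarrow> (\<And>x. x \<in> carr S \<Longrightarrow> ip S' z (U x) = 0) \<Longrightarrow> hnorm S' z = 0"
    and z: "z \<in> carr S'"
  shows "\<exists>x\<in>carr S. heq S' (U x) z"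
proof -
  interpret S: prehilbert S using S by (rule hilbert_spaceD)
  interpret S': prehilbert S' by fact
  define A where "A = (\<lambda>x. hdist S' (U x) z) ` carr S"
  define d where "d = Inf A"
  have bdd: "bdd_below A" unfolding A_def using cl z by (intro bdd_belowI2[of _ 0]) auto
  have ne: "A \<noteq> {}" using S.carr_nonempty by (simp add: A_def)
  have dle: "d \<le> hdist S' (U x) z" if "x \<in> carr S" for x
    unfolding d_def using bdd that by (intro cInf_lower) (auto simp: A_def)
  have d0: "d \<ge> 0" unfolding d_def using ne cl z by (intro cInf_greatest) (auto simp: A_def)
  have "\<exists>x\<in>carr S. hdist S' (U x) z < d + 1 / (real n + 1)" for n
    using cInf_lessD[OF ne, of "d + 1 / (real n + 1)"] by (auto simp: d_def A_def)
  then obtain X where X: "\<And>n. X n \<in> carr S" "\<And>n. hdist S' (U (X n)) z < d + 1 / (real n + 1)"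
    by metis
  \<comment> \<open>the parallelogram identity for \<open>U x - z\<close> and \<open>U y - z\<close>, whose midpoint is again in the image\<close>
  have par: "(hdist S x y)\<^sup>2 \<le> 2 * (hdist S' (U x) z)\<^sup>2 + 2 * (hdist S' (U y) z)\<^sup>2 - 4 * d\<^sup>2"
    if x: "x \<in> carr S" and y: "y \<in> carr S" for x y
  proof -
    define w where "w = smul S (1/2) (add S x y)"
    have w: "w \<in> carr S" using x y by (simp add: w_def)
    have ipw: "ip S' (U w) z = (ip S' (U x) z + ip S' (U y) z) / 2"
    proof -
      let ?d = "S'.df (U w) (smul S' (1/2) (add S' (U x) (U y)))"
      have "(hnorm S' ?d)\<^sup>2 = 0"
        using x y w cl by (simp add: S'.hnorm_sq S'.ip_expand ip)
          (simp add: w_def S.ip_expand field_simps)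
      then have "heq S' (U w) (smul S' (1/2) (add S' (U x) (U y)))" by (simp add: heq_def hdist_def)
      then have "ip S' (U w) z = ip S' (smul S' (1/2) (add S' (U x) (U y))) z"
        using x y w cl z by (intro S'.heq_ip) auto
      then show ?thesis using x y cl z by (simp add: S'.ip_expand)
    qed
    have "4 * d\<^sup>2 \<le> 4 * (hdist S' (U w) z)\<^sup>2"
      using dle[OF w] d0 by (simp add: power_mono)
    also have "\<dots> = 2 * (hdist S' (U x) z)\<^sup>2 + 2 * (hdist S' (U y) z)\<^sup>2 - (hdist S x y)\<^sup>2"
    proof -
      have nw: "4 * (hnorm S w)\<^sup>2 = (hnorm S x)\<^sup>2 + 2 * Re (ip S x y) + (hnorm S y)\<^sup>2"
        using x y by (simp add: w_def S.hnorm_smul S.hnorm_add_sq power_mult_distrib power_divide)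
      have nU: "(hnorm S' (U v))\<^sup>2 = (hnorm S v)\<^sup>2" if "v \<in> carr S" for v
        using that cl ip by (simp add: S.hnorm_sq S'.hnorm_sq)
      have rw: "2 * Re (ip S' (U w) z) = Re (ip S' (U x) z) + Re (ip S' (U y) z)"
        by (simp add: ipw)
      have "4 * (hdist S' (U w) z)\<^sup>2 = 4 * (hnorm S w)\<^sup>2 - 4 * (2 * Re (ip S' (U w) z)) + 4 * (hnorm S' z)\<^sup>2"
        using w cl z by (simp add: S'.hdist_sq nU)
      also have "\<dots> = 2 * (hdist S' (U x) z)\<^sup>2 + 2 * (hdist S' (U y) z)\<^sup>2 - (hdist S x y)\<^sup>2"
        unfolding rw nw using x y cl z by (simp add: S'.hdist_sq S.hdist_sq nU)
      finally show ?thesis .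
    qed
    finally show ?thesis by linarith
  qed
  define \<epsilon> where "\<epsilon> n = 1 / (real n + 1)" for n
  have eps: "\<epsilon> \<longlonglongrightarrow> 0" unfolding \<epsilon>_def
    using LIMSEQ_inverse_real_of_nat by (simp add: inverse_eq_divide add.commute)
  have "hcauchy S X"
    unfolding hcauchy_def
  proof (intro allI impI)
    fix e :: real assume e: "e > 0"
    have "(\<lambda>n. 4 * (d + \<epsilon> n)\<^sup>2 - 4 * d\<^sup>2) \<longlonglongrightarrow> 4 * (d + 0)\<^sup>2 - 4 * d\<^sup>2"
      by (intro tendsto_intros eps)
    then have "\<forall>\<^sub>F n in sequentially. 4 * (d + \<epsilon> n)\<^sup>2 - 4 * d\<^sup>2 < e\<^sup>2"
      using e by (intro order_tendstoD) auto
    then obtain N where N: "4 * (d + \<epsilon> N)\<^sup>2 - 4 * d\<^sup>2 < e\<^sup>2"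
      by (auto simp: eventually_sequentially)
    have bd: "(hdist S' (U (X m)) z)\<^sup>2 \<le> (d + \<epsilon> N)\<^sup>2" if "m \<ge> N" for m
    proof -
      have "\<epsilon> m \<le> \<epsilon> N" using that by (simp add: \<epsilon>_def frac_le)
      then have "hdist S' (U (X m)) z \<le> d + \<epsilon> N" using X(2)[of m] by (simp add: \<epsilon>_def)
      then show ?thesis using cl X(1) z by (intro power_mono) auto
    qed
    have "hdist S (X m) (X n) < e" if "m \<ge> N" "n \<ge> N" for m n
    proof -
      have "(hdist S (X m) (X n))\<^sup>2 < e\<^sup>2"
        using par[OF X(1)[of m] X(1)[of n]] bd[OF that(1)] bd[OF that(2)] N by linarith
      then show ?thesis using e by (meson power2_less_imp_less less_imp_le)
    qed
    then show "\<exists>N. \<forall>m\<ge>N. \<forall>n\<ge>N. hdist S (X m) (X n) < e" by blast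
  qed
  then obtain x where x: "hlimit S X x" using hilbert_space_complete[OF S] X(1) by blast
  have xc: "x \<in> carr S" using x by (simp add: hlimit_def)
  have "hdist S' (U x) z \<le> d"
  proof (rule LIMSEQ_le_const[where X = "\<lambda>n. hdist S (X n) x + (d + \<epsilon> n)"])
    have "(\<lambda>n. hdist S (X n) x + (d + \<epsilon> n)) \<longlonglongrightarrow> 0 + (d + 0)"
      using x by (intro tendsto_intros eps) (simp add: hlimit_def)
    then show "(\<lambda>n. hdist S (X n) x + (d + \<epsilon> n)) \<longlonglongrightarrow> d" by simp
    have "hdist S' (U x) z \<le> hdist S (X n) x + (d + \<epsilon> n)" for n
    proof -
      have "hdist S' (U x) (U (X n)) = hdist S (X n) x"
        using ip_preserving_hdist[of S S' U x "X n"] S.prehilbert_axioms S' cl ip xc X(1)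
        by (simp add: S.hdist_commute)
      then show ?thesis
        using S'.hdist_triangle[of "U x" "U (X n)" z] X cl z xc by (smt (verit) \<epsilon>_def)
    qed
    then show "\<exists>N. \<forall>n\<ge>N. hdist S' (U x) z \<le> hdist S (X n) x + (d + \<epsilon> n)" by blast
  qed
  then have dx: "hdist S' (U x) z \<le> d" .
  define r where "r = S'.df z (U x)"
  have r: "r \<in> carr S'" using z cl xc by (simp add: r_def)
  have "hnorm S' r = 0"
  proof (rule orth[OF r])
    fix y assume y: "y \<in> carr S"
    show "ip S' r (U y) = 0"
    proof (rule S'.minimal_imp_orthogonal[OF r cl[OF y]])
      fix a
      define v where "v = add S x (smul S a y)"
      have v: "v \<in> carr S" using xc y by (simp add: v_def)
      have nv: "(hdist S' (U v) (add S' (U x) (smul S' a (U y))))\<^sup>2 = 0"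
        using v xc y cl by (simp add: hdist_def S'.hnorm_sq S'.ip_expand ip)
          (simp add: v_def S.ip_expand algebra_simps)
      have hq: "heq S' (U v) (add S' (U x) (smul S' a (U y)))" using nv by (simp add: heq_def)
      have "hnorm S' r = hdist S' (U x) z"
        using S'.hdist_commute[of "U x" z] cl xc z by (simp add: r_def hdist_def)
      also have "\<dots> \<le> hdist S' (U v) z" using dx dle[OF v] by linarith
      also have "\<dots> = hdist S' (add S' (U x) (smul S' a (U y))) z"
        using S'.heq_hdist[OF hq S'.heq_refl[OF z]] v xc y cl z by simp
      also have "\<dots> = hdist S' r (smul S' a (U y))"
      proof -
        have "(hdist S' (add S' (U x) (smul S' a (U y))) z)\<^sup>2 = (hdist S' r (smul S' a (U y)))\<^sup>2"
          using xc y cl z by (simp add: hdist_def r_def S'.hnorm_sq S'.ip_expand algebra_simps)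
        then show ?thesis using xc y cl z r by (simp add: power2_eq_iff_nonneg)
      qed
      finally show "hnorm S' r \<le> hdist S' r (smul S' a (U y))" .
    qed
  qed
  then have "heq S' z (U x)" by (simp add: heq_def hdist_def r_def)
  then show ?thesis using S'.heq_sym xc cl z by blast
qed

subsection \<open>Completion\<close>

context prehilbert
begin

lemma hcauchy_hnorm_bound:
  assumes X: "\<And>n. X n \<in> carr S" "hcauchy S X"
  obtains B where "B > 0" "\<And>n. hnorm S (X n) \<le> B"
proof -
  have "Cauchy (\<lambda>n. hnorm S (X n))"
  proof (rule metric_CauchyI)
    fix e :: real assume "e > 0"
    then obtain N where N: "\<And>m n. m \<ge> N \<Longrightarrow> n \<ge> N \<Longrightarrow> hdist S (X m) (X n) < e"
      using X(2) unfolding hcauchy_def by blast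
    have "dist (hnorm S (X m)) (hnorm S (X n)) < e" if "m \<ge> N" "n \<ge> N" for m n
      using hnorm_diff_le_hdist[of "X m" "X n"] N[OF that] X(1) by (simp add: dist_real_def)
    then show "\<exists>M. \<forall>m\<ge>M. \<forall>n\<ge>M. dist (hnorm S (X m)) (hnorm S (X n)) < e" by blast
  qed
  then have "Bseq (\<lambda>n. hnorm S (X n))" by (rule Cauchy_Bseq)
  then obtain B where "B > 0" "\<And>n. norm (hnorm S (X n)) \<le> B" unfolding Bseq_def by blast
  then show ?thesis using that X(1) by force
qed

lemma ip_Cauchy_tendsto:
  assumes X: "\<And>n. X n \<in> carr S" "hcauchy S X" and Y: "\<And>n. Y n \<in> carr S" "hcauchy S Y"
  shows "(\<lambda>n. ip S (X n) (Y n)) \<longlonglongrightarrow> ip (completion S) X Y"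
proof -
  obtain B where B: "B > 0" "\<And>n. hnorm S (X n) \<le> B" using hcauchy_hnorm_bound[OF X] by blast
  obtain C where C: "C > 0" "\<And>n. hnorm S (Y n) \<le> C" using hcauchy_hnorm_bound[OF Y] by blast
  have "Cauchy (\<lambda>n. ip S (X n) (Y n))"
  proof (rule metric_CauchyI)
    fix e :: real assume e: "e > 0"
    obtain N where N: "\<And>m n. m \<ge> N \<Longrightarrow> n \<ge> N \<Longrightarrow> hdist S (X m) (X n) < e / (2 * C)"
      using X(2) e C unfolding hcauchy_def by (meson divide_pos_pos mult_pos_pos zero_less_numeral)
    obtain M where M: "\<And>m n. m \<ge> M \<Longrightarrow> n \<ge> M \<Longrightarrow> hdist S (Y m) (Y n) < e / (2 * B)"
      using Y(2) e B unfolding hcauchy_def by (meson divide_pos_pos mult_pos_pos zero_less_numeral)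
    have "dist (ip S (X m) (Y m)) (ip S (X n) (Y n)) < e" if mn: "m \<ge> max N M" "n \<ge> max N M" for m n
    proof -
      have "dist (ip S (X m) (Y m)) (ip S (X n) (Y n))
          \<le> hdist S (X m) (X n) * hnorm S (Y m) + hnorm S (X n) * hdist S (Y m) (Y n)"
        unfolding dist_norm by (rule ip_diff_le) (use X Y in auto)
      also have "\<dots> \<le> hdist S (X m) (X n) * C + B * hdist S (Y m) (Y n)"
        using X Y B C by (intro add_mono mult_left_mono mult_right_mono) auto
      also have "\<dots> < e / (2 * C) * C + B * (e / (2 * B))"
        using N M mn B C by (intro add_strict_mono mult_strict_left_mono mult_strict_right_mono) auto
      also have "\<dots> = e" using B C by simp
      finally show ?thesis .
    qed
    then show "\<exists>K. \<forall>m\<ge>K. \<forall>n\<ge>K. dist (ip S (X m) (Y m)) (ip S (X n) (Y n)) < e" by blast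
  qed
  then show ?thesis
    by (simp add: completion_def Cauchy_convergent_iff convergent_LIMSEQ_iff)
qed

lemma hcauchy_add:
  assumes X: "\<And>n. X n \<in> carr S" "hcauchy S X" and Y: "\<And>n. Y n \<in> carr S" "hcauchy S Y"
  shows "hcauchy S (\<lambda>n. add S (X n) (Y n))"
  unfolding hcauchy_def
proof (intro allI impI)
  fix e :: real assume "e > 0"
  then have e: "e / 2 > 0" by simp
  obtain N where N: "\<And>m n. m \<ge> N \<Longrightarrow> n \<ge> N \<Longrightarrow> hdist S (X m) (X n) < e / 2"
    using X(2) e unfolding hcauchy_def by blast
  obtain M where M: "\<And>m n. m \<ge> M \<Longrightarrow> n \<ge> M \<Longrightarrow> hdist S (Y m) (Y n) < e / 2"
    using Y(2) e unfolding hcauchy_def by blast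
  have "hdist S (add S (X m) (Y m)) (add S (X n) (Y n)) < e" if "m \<ge> max N M" "n \<ge> max N M" for m n
    using hdist_add[of "X m" "Y m" "X n" "Y n"] N[of m n] M[of m n] X Y that by simp
  then show "\<exists>N. \<forall>m\<ge>N. \<forall>n\<ge>N. hdist S (add S (X m) (Y m)) (add S (X n) (Y n)) < e" by blast
qed

lemma hcauchy_smul:
  assumes X: "\<And>n. X n \<in> carr S" "hcauchy S X"
  shows "hcauchy S (\<lambda>n. smul S a (X n))"
  unfolding hcauchy_def
proof (intro allI impI)
  fix e :: real assume e: "e > 0"
  have p: "cmod a + 1 > 0" by (smt (verit) norm_ge_zero)
  then have "e / (cmod a + 1) > 0" using e by simp
  then obtain N where N: "\<And>m n. m \<ge> N \<Longrightarrow> n \<ge> N \<Longrightarrow> hdist S (X m) (X n) < e / (cmod a + 1)"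
    using X(2) unfolding hcauchy_def by blast
  have "hdist S (smul S a (X m)) (smul S a (X n)) < e" if "m \<ge> N" "n \<ge> N" for m n
  proof -
    have "(cmod a + 1) * hdist S (X m) (X n) < e"
      using N[OF that] p by (simp add: pos_less_divide_eq mult.commute)
    moreover have "hdist S (X m) (X n) \<ge> 0" using X by simp
    ultimately have "cmod a * hdist S (X m) (X n) < e" unfolding distrib_right by linarith
    then show ?thesis using X by (simp add: hdist_smul)
  qed
  then show "\<exists>N. \<forall>m\<ge>N. \<forall>n\<ge>N. hdist S (smul S a (X m)) (smul S a (X n)) < e" by blast
qed

lemma carr_completion_iff:
  "X \<in> carr (completion S) \<longleftrightarrow> (\<forall>n. X n \<in> carr S) \<and> hcauchy S X"
  by (simp add: completion_def)

lemma prehilbert_completion: "prehilbert (completion S)"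
proof
  obtain x where x: "x \<in> carr S" using carr_nonempty by blast
  then have "(\<lambda>n. x) \<in> carr (completion S)"
    by (auto simp: carr_completion_iff hcauchy_def hdist_self)
  then show "carr (completion S) \<noteq> {}" by blast
next
  fix X Y assume XY: "X \<in> carr (completion S)" "Y \<in> carr (completion S)"
  then show cl: "add (completion S) X Y \<in> carr (completion S)"
    by (auto simp: completion_def intro: hcauchy_add)
  show "ip (completion S) Y X = cnj (ip (completion S) X Y)"
  proof (rule LIMSEQ_unique)
    show "(\<lambda>n. ip S (Y n) (X n)) \<longlonglongrightarrow> ip (completion S) Y X"
      using XY by (intro ip_Cauchy_tendsto) (auto simp: carr_completion_iff)
    have "(\<lambda>n. cnj (ip S (X n) (Y n))) \<longlonglongrightarrow> cnj (ip (completion S) X Y)"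
      using XY by (intro tendsto_cnj ip_Cauchy_tendsto) (auto simp: carr_completion_iff)
    moreover have "cnj (ip S (X n) (Y n)) = ip S (Y n) (X n)" for n
      using XY ip_cnj[of "X n" "Y n"] by (simp add: carr_completion_iff)
    ultimately show "(\<lambda>n. ip S (Y n) (X n)) \<longlonglongrightarrow> cnj (ip (completion S) X Y)" by simp
  qed
  fix Z assume Z: "Z \<in> carr (completion S)"
  show "ip (completion S) (add (completion S) X Y) Z = ip (completion S) X Z + ip (completion S) Y Z"
  proof (rule LIMSEQ_unique)
    show "(\<lambda>n. ip S (add (completion S) X Y n) (Z n)) \<longlonglongrightarrow> ip (completion S) (add (completion S) X Y) Z"
      using cl Z by (intro ip_Cauchy_tendsto) (auto simp: carr_completion_iff)
    have "(\<lambda>n. ip S (X n) (Z n) + ip S (Y n) (Z n)) \<longlonglongrightarrow> ip (completion S) X Z + ip (completion S) Y Z"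
      using XY Z by (intro tendsto_add ip_Cauchy_tendsto) (auto simp: carr_completion_iff)
    moreover have "ip S (X n) (Z n) + ip S (Y n) (Z n) = ip S (add (completion S) X Y n) (Z n)" for n
      using XY Z by (simp add: completion_def ip_add_left)
    ultimately show "(\<lambda>n. ip S (add (completion S) X Y n) (Z n)) \<longlonglongrightarrow> ip (completion S) X Z + ip (completion S) Y Z"
      by simp
  qed
next
  fix X a assume X: "X \<in> carr (completion S)"
  then show cl: "smul (completion S) a X \<in> carr (completion S)"
    by (auto simp: completion_def intro: hcauchy_smul)
  have "(\<lambda>n. Re (ip S (X n) (X n))) \<longlonglongrightarrow> Re (ip (completion S) X X)"
    using X by (intro tendsto_Re ip_Cauchy_tendsto) (auto simp: carr_completion_iff)
  then show "0 \<le> Re (ip (completion S) X X)"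
    by (rule LIMSEQ_le_const) (use X ip_nonneg in \<open>auto simp: carr_completion_iff\<close>)
  fix Y assume Y: "Y \<in> carr (completion S)"
  show "ip (completion S) (smul (completion S) a X) Y = a * ip (completion S) X Y"
  proof (rule LIMSEQ_unique)
    show "(\<lambda>n. ip S (smul (completion S) a X n) (Y n)) \<longlonglongrightarrow> ip (completion S) (smul (completion S) a X) Y"
      using cl Y by (intro ip_Cauchy_tendsto) (auto simp: carr_completion_iff)
    have "(\<lambda>n. a * ip S (X n) (Y n)) \<longlonglongrightarrow> a * ip (completion S) X Y"
      using X Y by (intro tendsto_mult tendsto_const ip_Cauchy_tendsto) (auto simp: carr_completion_iff)
    moreover have "a * ip S (X n) (Y n) = ip S (smul (completion S) a X n) (Y n)" for n
      using X Y by (simp add: completion_def ip_smul_left)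
    ultimately show "(\<lambda>n. ip S (smul (completion S) a X n) (Y n)) \<longlonglongrightarrow> a * ip (completion S) X Y"
      by simp
  qed
qed

lemma hdist_completion_tendsto:
  assumes X: "X \<in> carr (completion S)" and Y: "Y \<in> carr (completion S)"
  shows "(\<lambda>n. hdist S (X n) (Y n)) \<longlonglongrightarrow> hdist (completion S) X Y"
proof -
  interpret C: prehilbert "completion S" by (rule prehilbert_completion)
  let ?D = "add (completion S) X (smul (completion S) (-1) Y)"
  have D: "?D \<in> carr (completion S)" using X Y by simp
  have "(\<lambda>n. sqrt (Re (ip S (?D n) (?D n)))) \<longlonglongrightarrow> sqrt (Re (ip (completion S) ?D ?D))"
    using D by (intro tendsto_real_sqrt tendsto_Re ip_Cauchy_tendsto) (auto simp: carr_completion_iff)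
  then show ?thesis by (simp add: hdist_def hnorm_def completion_def)
qed

text \<open>A Cauchy sequence of Cauchy sequences is represented by a diagonal sequence.\<close>

lemma hilbert_space_completion: "hilbert_space (completion S)"
  unfolding hilbert_space_iff
proof (intro conjI allI impI)
  show "prehilbert (completion S)" by (rule prehilbert_completion)
  then interpret C: prehilbert "completion S" .
  fix F assume "(\<forall>k. F k \<in> carr (completion S)) \<and> hcauchy (completion S) F"
  then have F: "\<And>k. F k \<in> carr (completion S)" and cF: "hcauchy (completion S) F" by auto
  have Fc: "F k n \<in> carr S" for k n using F[of k] by (simp add: carr_completion_iff)
  have "\<exists>N. \<forall>m\<ge>N. \<forall>n\<ge>N. hdist S (F k m) (F k n) < 1 / (real k + 1)" for k
  proof -
    have "hcauchy S (F k)" using F[of k] by (simp add: carr_completion_iff)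
    moreover have "1 / (real k + 1) > 0" by simp
    ultimately show ?thesis unfolding hcauchy_def by blast
  qed
  then obtain N where N: "\<And>k m n. m \<ge> N k \<Longrightarrow> n \<ge> N k \<Longrightarrow> hdist S (F k m) (F k n) < 1 / (real k + 1)"
    by metis
  define Y where "Y k = F k (N k)" for k
  have Yc: "Y k \<in> carr S" for k by (simp add: Y_def Fc)
  have near: "hdist S (F k n) (Y k) \<le> 1 / (real k + 1)" if "n \<ge> N k" for k n
    using N[of k n "N k"] that by (simp add: Y_def)
  have tends: "(\<lambda>n. hdist S (F k n) (F l n)) \<longlonglongrightarrow> hdist (completion S) (F k) (F l)" for k l
    by (intro hdist_completion_tendsto F)
  have small: "\<exists>K. \<forall>k\<ge>K. 1 / (real k + 1) < e" if "e > 0" for e :: real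
  proof -
    obtain K where "inverse (real (Suc K)) < e" using reals_Archimedean[OF \<open>e > 0\<close>] by auto
    moreover have "1 / (real k + 1) \<le> inverse (real (Suc K))" if "k \<ge> K" for k
      using that by (simp add: inverse_eq_divide frac_le)
    ultimately show ?thesis by (meson le_less_trans)
  qed
  have Ydist: "hdist S (Y k) (Y l) \<le> 1 / (real k + 1) + hdist (completion S) (F k) (F l) + 1 / (real l + 1)" for k l
  proof (rule LIMSEQ_le_const[where X = "\<lambda>n. 1 / (real k + 1) + hdist S (F k n) (F l n) + 1 / (real l + 1)"])
    show "(\<lambda>n. 1 / (real k + 1) + hdist S (F k n) (F l n) + 1 / (real l + 1))
        \<longlonglongrightarrow> 1 / (real k + 1) + hdist (completion S) (F k) (F l) + 1 / (real l + 1)"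
      by (intro tendsto_intros tends)
    have "hdist S (Y k) (Y l) \<le> 1 / (real k + 1) + hdist S (F k n) (F l n) + 1 / (real l + 1)"
      if "n \<ge> max (N k) (N l)" for n
      using hdist_triangle[of "Y k" "F k n" "Y l"] hdist_triangle[of "F k n" "F l n" "Y l"]
        near[of k n] near[of l n] that Yc Fc by (simp add: hdist_commute)
    then show "\<exists>n0. \<forall>n\<ge>n0. hdist S (Y k) (Y l) \<le> 1 / (real k + 1) + hdist S (F k n) (F l n) + 1 / (real l + 1)"
      by blast
  qed
  have cY: "hcauchy S Y"
    unfolding hcauchy_def
  proof (intro allI impI)
    fix e :: real assume "e > 0"
    then have e: "e / 3 > 0" by simp
    obtain K where K: "\<And>k. k \<ge> K \<Longrightarrow> 1 / (real k + 1) < e / 3" using small[OF e] by blast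
    obtain L where L: "\<And>k l. k \<ge> L \<Longrightarrow> l \<ge> L \<Longrightarrow> hdist (completion S) (F k) (F l) < e / 3"
      using cF e unfolding hcauchy_def by blast
    have "hdist S (Y k) (Y l) < e" if "k \<ge> max K L" "l \<ge> max K L" for k l
      using Ydist[of k l] K[of k] K[of l] L[of k l] that by simp
    then show "\<exists>N. \<forall>m\<ge>N. \<forall>n\<ge>N. hdist S (Y m) (Y n) < e" by blast
  qed
  have Y: "Y \<in> carr (completion S)" using Yc cY by (simp add: carr_completion_iff)
  have "hlimit (completion S) F Y"
    unfolding hlimit_def
  proof (intro conjI Y LIMSEQ_I)
    fix e :: real assume "e > 0"
    then have e: "e / 3 > 0" by simp
    obtain K where K: "\<And>k. k \<ge> K \<Longrightarrow> 1 / (real k + 1) < e / 3" using small[OF e] by blast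
    obtain L where L: "\<And>k l. k \<ge> L \<Longrightarrow> l \<ge> L \<Longrightarrow> hdist S (Y k) (Y l) < e / 3"
      using cY e unfolding hcauchy_def by blast
    have "norm (hdist (completion S) (F k) Y - 0) < e" if k: "k \<ge> max K L" for k
    proof -
      have "hdist (completion S) (F k) Y \<le> 2 * (e / 3)"
      proof (rule LIMSEQ_le_const2[OF hdist_completion_tendsto[OF F Y]])
        have "hdist S (F k n) (Y n) \<le> 2 * (e / 3)" if "n \<ge> max (N k) L" for n
          using hdist_triangle[of "F k n" "Y k" "Y n"] near[of k n] K[of k] L[of k n] that k Yc Fc by simp
        then show "\<exists>n0. \<forall>n\<ge>n0. hdist S (F k n) (Y n) \<le> 2 * (e / 3)" by blast
      qed
      then show ?thesis using F Y \<open>e > 0\<close> by simp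
    qed
    then show "\<exists>no. \<forall>k\<ge>no. norm (hdist (completion S) (F k) Y - 0) < e" by blast
  qed
  then show "\<exists>x. hlimit (completion S) F x" by blast
qed

end

lemma completion_extension_ip:
  assumes P: "prehilbert P" and K: "prehilbert K"
    and cl: "\<And>f. f \<in> carr P \<Longrightarrow> U f \<in> carr K"
    and ip: "\<And>f g. f \<in> carr P \<Longrightarrow> g \<in> carr P \<Longrightarrow> ip K (U f) (U g) = ip P f g"
    and lim: "\<And>X. X \<in> carr (completion P) \<Longrightarrow> hlimit K (\<lambda>n. U (X n)) (W X)"
    and X: "X \<in> carr (completion P)" and Y: "Y \<in> carr (completion P)"
  shows "ip K (W X) (W Y) = ip (completion P) X Y"
proof -
  interpret P: prehilbert P by fact
  interpret K: prehilbert K by fact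
  have c: "X n \<in> carr P" "Y n \<in> carr P" for n using X Y by (auto simp: P.carr_completion_iff)
  have "(\<lambda>n. ip K (U (X n)) (U (Y n))) \<longlonglongrightarrow> ip K (W X) (W Y)"
    using X Y c cl by (intro K.hlimit_ip lim) auto
  moreover have "(\<lambda>n. ip P (X n) (Y n)) \<longlonglongrightarrow> ip (completion P) X Y"
    using X Y by (intro P.ip_Cauchy_tendsto) (auto simp: P.carr_completion_iff)
  ultimately show ?thesis using c by (simp add: ip LIMSEQ_unique)
qed

subsection \<open>Square summable sequences\<close>

lemma sq_add_le: "(a + b)\<^sup>2 \<le> 2 * a\<^sup>2 + 2 * (b::real)\<^sup>2"
  using zero_le_power2[of "a - b"] by (simp add: power2_sum power2_diff)

lemma mult_le_sq: "a * b \<le> a\<^sup>2 + (b::real)\<^sup>2"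
proof -
  have "2 * a * b \<le> a\<^sup>2 + b\<^sup>2" using zero_le_power2[of "a - b"] by (simp add: power2_diff)
  moreover have "0 \<le> a\<^sup>2" "0 \<le> b\<^sup>2" by simp_all
  ultimately show ?thesis by linarith
qed

context prehilbert
begin

lemma carr_ell2_iff:
  "h \<in> carr (ell2 S) \<longleftrightarrow> (\<forall>n. h n \<in> carr S) \<and> (\<lambda>n. (hnorm S (h n))\<^sup>2) summable_on UNIV"
  by (simp add: ell2_def)

lemma ell2_ip_summable:
  assumes g: "g \<in> carr (ell2 S)" and h: "h \<in> carr (ell2 S)"
  shows "(\<lambda>n. ip S (g n) (h n)) summable_on UNIV"
proof (rule abs_summable_summable, rule summable_on_comparison_test)
  show "(\<lambda>n. (hnorm S (g n))\<^sup>2 + (hnorm S (h n))\<^sup>2) summable_on UNIV"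
    using g h by (intro summable_on_add) (auto simp: carr_ell2_iff)
  show "norm (ip S (g n) (h n)) \<le> (hnorm S (g n))\<^sup>2 + (hnorm S (h n))\<^sup>2" for n
    using Cauchy_Schwarz[of "g n" "h n"] mult_le_sq[of "hnorm S (g n)" "hnorm S (h n)"] g h
    by (simp add: carr_ell2_iff)
qed auto

lemma ell2_ip_has_sum:
  assumes "g \<in> carr (ell2 S)" "h \<in> carr (ell2 S)"
  shows "((\<lambda>n. ip S (g n) (h n)) has_sum ip (ell2 S) g h) UNIV"
  using ell2_ip_summable[OF assms] by (simp add: ell2_def)

lemma ell2_add_closed:
  assumes g: "g \<in> carr (ell2 S)" and h: "h \<in> carr (ell2 S)"
  shows "(\<lambda>n. add S (g n) (h n)) \<in> carr (ell2 S)"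
proof -
  have c: "g n \<in> carr S" "h n \<in> carr S" for n using g h by (auto simp: carr_ell2_iff)
  have "(\<lambda>n. (hnorm S (add S (g n) (h n)))\<^sup>2) summable_on UNIV"
  proof (rule summable_on_comparison_test)
    show "(\<lambda>n. 2 * (hnorm S (g n))\<^sup>2 + 2 * (hnorm S (h n))\<^sup>2) summable_on UNIV"
      using g h by (intro summable_on_add summable_on_cmult_right) (auto simp: carr_ell2_iff)
    show "(hnorm S (add S (g n) (h n)))\<^sup>2 \<le> 2 * (hnorm S (g n))\<^sup>2 + 2 * (hnorm S (h n))\<^sup>2" for n
    proof -
      have "(hnorm S (add S (g n) (h n)))\<^sup>2 \<le> (hnorm S (g n) + hnorm S (h n))\<^sup>2"
        using c by (intro power_mono hnorm_triangle) auto
      then show ?thesis using sq_add_le order_trans by blast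
    qed
  qed auto
  then show ?thesis using c by (simp add: carr_ell2_iff)
qed

lemma prehilbert_ell2: "prehilbert (ell2 S)"
proof
  obtain x where x: "x \<in> carr S" using carr_nonempty by blast
  then have "(\<lambda>n. smul S 0 x) \<in> carr (ell2 S)" by (simp add: carr_ell2_iff hnorm_smul)
  then show "carr (ell2 S) \<noteq> {}" by blast
next
  fix g h assume g: "g \<in> carr (ell2 S)" and h: "h \<in> carr (ell2 S)"
  have c: "g n \<in> carr S" "h n \<in> carr S" for n using g h by (auto simp: carr_ell2_iff)
  show "add (ell2 S) g h \<in> carr (ell2 S)"
    using ell2_add_closed[OF g h] by (simp add: ell2_def)
  have "ip S (h n) (g n) = cnj (ip S (g n) (h n))" for n using c by (rule ip_cnj)
  then show "ip (ell2 S) h g = cnj (ip (ell2 S) g h)" by (simp add: ell2_def)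
  fix k assume k: "k \<in> carr (ell2 S)"
  have "(\<Sum>\<^sub>\<infinity>n. ip S (add S (g n) (h n)) (k n)) = (\<Sum>\<^sub>\<infinity>n. ip S (g n) (k n) + ip S (h n) (k n))"
    using c k by (intro infsum_cong ip_add_left) (auto simp: carr_ell2_iff)
  also have "\<dots> = (\<Sum>\<^sub>\<infinity>n. ip S (g n) (k n)) + (\<Sum>\<^sub>\<infinity>n. ip S (h n) (k n))"
    using g h k by (intro infsum_add ell2_ip_summable)
  finally show "ip (ell2 S) (add (ell2 S) g h) k = ip (ell2 S) g k + ip (ell2 S) h k"
    by (simp add: ell2_def)
next
  fix g a assume g: "g \<in> carr (ell2 S)"
  then have c: "g n \<in> carr S" for n by (auto simp: carr_ell2_iff)
  have "(\<lambda>n. (cmod a)\<^sup>2 * (hnorm S (g n))\<^sup>2) summable_on UNIV"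
    using g by (intro summable_on_cmult_right) (auto simp: carr_ell2_iff)
  then show "smul (ell2 S) a g \<in> carr (ell2 S)"
    using c by (simp add: ell2_def hnorm_smul power_mult_distrib)
  have "Re (ip (ell2 S) g g) = (\<Sum>\<^sub>\<infinity>n. Re (ip S (g n) (g n)))"
    using infsum_Re[OF ell2_ip_summable[OF g g]] by (simp add: ell2_def)
  also have "\<dots> \<ge> 0" by (intro infsum_nonneg) (simp add: ip_nonneg c)
  finally show "0 \<le> Re (ip (ell2 S) g g)" .
  fix h assume h: "h \<in> carr (ell2 S)"
  have "(\<Sum>\<^sub>\<infinity>n. ip S (smul S a (g n)) (h n)) = (\<Sum>\<^sub>\<infinity>n. a * ip S (g n) (h n))"
    using c h by (intro infsum_cong ip_smul_left) (auto simp: carr_ell2_iff)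
  also have "\<dots> = a * (\<Sum>\<^sub>\<infinity>n. ip S (g n) (h n))" by (rule infsum_cmult_right')
  finally show "ip (ell2 S) (smul (ell2 S) a g) h = a * ip (ell2 S) g h" by (simp add: ell2_def)
qed

lemma ell2_hnorm_has_sum:
  assumes g: "g \<in> carr (ell2 S)"
  shows "((\<lambda>n. (hnorm S (g n))\<^sup>2) has_sum (hnorm (ell2 S) g)\<^sup>2) UNIV"
proof -
  interpret E: prehilbert "ell2 S" by (rule prehilbert_ell2)
  have c: "g n \<in> carr S" for n using g by (auto simp: carr_ell2_iff)
  show ?thesis using has_sum_Re[OF ell2_ip_has_sum[OF g g]] g c by (simp add: hnorm_sq E.hnorm_sq)
qed

lemma ell2_hdist_has_sum:
  assumes g: "g \<in> carr (ell2 S)" and h: "h \<in> carr (ell2 S)"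
  shows "((\<lambda>n. (hdist S (g n) (h n))\<^sup>2) has_sum (hdist (ell2 S) g h)\<^sup>2) UNIV"
proof -
  interpret E: prehilbert "ell2 S" by (rule prehilbert_ell2)
  have "add (ell2 S) g (smul (ell2 S) (-1) h) \<in> carr (ell2 S)" using g h by simp
  from ell2_hnorm_has_sum[OF this] show ?thesis by (simp add: hdist_def ell2_def)
qed

lemma ell2_coord_hnorm_le:
  assumes g: "g \<in> carr (ell2 S)"
  shows "hnorm S (g n) \<le> hnorm (ell2 S) g"
proof -
  interpret E: prehilbert "ell2 S" by (rule prehilbert_ell2)
  have "sum (\<lambda>n. (hnorm S (g n))\<^sup>2) {n} \<le> (hnorm (ell2 S) g)\<^sup>2"
    by (rule finite_sum_le_has_sum[OF ell2_hnorm_has_sum[OF g]]) auto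
  then have "(hnorm S (g n))\<^sup>2 \<le> (hnorm (ell2 S) g)\<^sup>2" by simp
  then show ?thesis by (rule power2_le_imp_le) (rule E.hnorm_nonneg[OF g])
qed

lemma ell2_coord_hdist_le:
  assumes g: "g \<in> carr (ell2 S)" and h: "h \<in> carr (ell2 S)"
  shows "hdist S (g n) (h n) \<le> hdist (ell2 S) g h"
proof -
  interpret E: prehilbert "ell2 S" by (rule prehilbert_ell2)
  have "add (ell2 S) g (smul (ell2 S) (-1) h) \<in> carr (ell2 S)" using g h by simp
  from ell2_coord_hnorm_le[OF this, of n] show ?thesis by (simp add: hdist_def ell2_def)
qed

lemma ell2_hnorm_0_iff:
  assumes g: "g \<in> carr (ell2 S)"
  shows "hnorm (ell2 S) g = 0 \<longleftrightarrow> (\<forall>n. hnorm S (g n) = 0)"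
proof
  assume "hnorm (ell2 S) g = 0"
  then have "hnorm S (g n) \<le> 0" for n using ell2_coord_hnorm_le[OF g, of n] by simp
  then show "\<forall>n. hnorm S (g n) = 0" using g by (metis carr_ell2_iff hnorm_nonneg order_antisym)
next
  assume "\<forall>n. hnorm S (g n) = 0"
  then have "((\<lambda>n. (hnorm S (g n))\<^sup>2) has_sum 0) UNIV" by simp
  from has_sum_unique[OF this ell2_hnorm_has_sum[OF g]] show "hnorm (ell2 S) g = 0" by simp
qed

lemma ell2_heq_iff:
  assumes g: "g \<in> carr (ell2 S)" and h: "h \<in> carr (ell2 S)"
  shows "heq (ell2 S) g h \<longleftrightarrow> (\<forall>n. heq S (g n) (h n))"
proof -
  interpret E: prehilbert "ell2 S" by (rule prehilbert_ell2)
  have "add (ell2 S) g (smul (ell2 S) (-1) h) \<in> carr (ell2 S)" using g h by simp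
  from ell2_hnorm_0_iff[OF this] show ?thesis by (simp add: heq_def hdist_def ell2_def)
qed

lemma ell2_shift:
  assumes g: "g \<in> carr (ell2 S)" shows "(\<lambda>n. g (n + k)) \<in> carr (ell2 S)"
proof -
  have b: "bij_betw (\<lambda>n. n + k) UNIV (UNIV :: int set)"
    by (rule bij_betwI[where g = "\<lambda>n. n - k"]) auto
  show ?thesis
    using g summable_on_reindex_bij_betw[OF b, of "\<lambda>n. (hnorm S (g n))\<^sup>2"] by (simp add: carr_ell2_iff)
qed

lemma ell2_shift_ip: "ip (ell2 S) (\<lambda>n. g (n + k)) (\<lambda>n. h (n + k)) = ip (ell2 S) g h"
proof -
  have b: "bij_betw (\<lambda>n. n + k) UNIV (UNIV :: int set)"
    by (rule bij_betwI[where g = "\<lambda>n. n - k"]) auto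
  show ?thesis
    using infsum_reindex_bij_betw[OF b, of "\<lambda>n. ip S (g n) (h n)"] by (simp add: ell2_def)
qed

end

text \<open>Coordinates of a Cauchy sequence converge, and every bound on finite partial sums of the squared
  distances survives in the limit.\<close>

lemma hilbert_space_ell2:
  assumes N: "hilbert_space N" shows "hilbert_space (ell2 N)"
  unfolding hilbert_space_iff
proof (intro conjI allI impI)
  interpret N: prehilbert N using N by (rule hilbert_spaceD)
  show "prehilbert (ell2 N)" by (rule N.prehilbert_ell2)
  then interpret E: prehilbert "ell2 N" .
  fix X assume "(\<forall>i. X i \<in> carr (ell2 N)) \<and> hcauchy (ell2 N) X"
  then have X: "\<And>i. X i \<in> carr (ell2 N)" and cX: "hcauchy (ell2 N) X" by auto
  have Xc: "X i n \<in> carr N" for i n using X[of i] by (simp add: N.carr_ell2_iff)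
  have "\<exists>y. hlimit N (\<lambda>i. X i n) y" for n
  proof (rule hilbert_space_complete[OF N Xc])
    show "hcauchy N (\<lambda>i. X i n)"
      using cX N.ell2_coord_hdist_le[OF X X] unfolding hcauchy_def by (meson le_less_trans)
  qed
  then obtain Y where Y: "\<And>n. hlimit N (\<lambda>i. X i n) (Y n)" by metis
  have Yc: "Y n \<in> carr N" for n using Y[of n] by (simp add: hlimit_def)
  have fin: "(\<Sum>n\<in>F. (hdist N (X i n) (Y n))\<^sup>2) \<le> e\<^sup>2"
    if F: "finite F" and i: "\<And>j. j \<ge> i \<Longrightarrow> hdist (ell2 N) (X i) (X j) \<le> e" and e: "e > 0" for F i e
  proof (rule LIMSEQ_le_const2)
    have "(\<lambda>j. hdist N (X i n) (X j n)) \<longlonglongrightarrow> hdist N (X i n) (Y n)" for n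
    proof -
      have "\<bar>hdist N (X i n) (X j n) - hdist N (X i n) (Y n)\<bar> \<le> hdist N (X j n) (Y n)" for j
        using N.hdist_triangle[of "X i n" "X j n" "Y n"] N.hdist_triangle[of "X i n" "Y n" "X j n"]
          N.hdist_commute[of "Y n" "X j n"] Xc Yc by (simp add: abs_le_iff)
      then have "\<forall>j. norm (hdist N (X i n) (X j n) - hdist N (X i n) (Y n)) \<le> hdist N (X j n) (Y n)"
        by simp
      moreover have "(\<lambda>j. hdist N (X j n) (Y n)) \<longlonglongrightarrow> 0" using Y[of n] by (simp add: hlimit_def)
      ultimately have "(\<lambda>j. hdist N (X i n) (X j n) - hdist N (X i n) (Y n)) \<longlonglongrightarrow> 0"
        by (rule Lim_null_comparison[OF always_eventually])
      then show ?thesis by (simp add: LIM_zero_iff)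
    qed
    then show "(\<lambda>j. \<Sum>n\<in>F. (hdist N (X i n) (X j n))\<^sup>2) \<longlonglongrightarrow> (\<Sum>n\<in>F. (hdist N (X i n) (Y n))\<^sup>2)"
      by (intro tendsto_sum tendsto_power)
    have "(\<Sum>n\<in>F. (hdist N (X i n) (X j n))\<^sup>2) \<le> e\<^sup>2" if "j \<ge> i" for j
    proof -
      have "(\<Sum>n\<in>F. (hdist N (X i n) (X j n))\<^sup>2) \<le> (hdist (ell2 N) (X i) (X j))\<^sup>2"
        by (rule finite_sum_le_has_sum[OF N.ell2_hdist_has_sum[OF X X]]) (use F in auto)
      also have "\<dots> \<le> e\<^sup>2" using i[OF that] X by (intro power_mono) auto
      finally show ?thesis .
    qed
    then show "\<exists>M. \<forall>j\<ge>M. (\<Sum>n\<in>F. (hdist N (X i n) (X j n))\<^sup>2) \<le> e\<^sup>2" by blast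
  qed
  have ex: "\<exists>M. \<forall>i\<ge>M. \<forall>j\<ge>i. hdist (ell2 N) (X i) (X j) \<le> e" if "e > 0" for e
    using cX that unfolding hcauchy_def by (meson less_imp_le order_trans)
  have summ: "(\<lambda>n. (hdist N (X i n) (Y n))\<^sup>2) summable_on UNIV"
    if i: "\<And>j. j \<ge> i \<Longrightarrow> hdist (ell2 N) (X i) (X j) \<le> e" and e: "e > 0" for i e
    by (rule nonneg_bdd_above_summable_on) (use fin[OF _ i e] in \<open>auto intro!: bdd_aboveI2\<close>)
  obtain M where M: "\<And>j. j \<ge> M \<Longrightarrow> hdist (ell2 N) (X M) (X j) \<le> 1" using ex[of 1] by auto
  have "(\<lambda>n. (hnorm N (Y n))\<^sup>2) summable_on UNIV"
  proof (rule summable_on_comparison_test)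
    show "(\<lambda>n. 2 * (hnorm N (X M n))\<^sup>2 + 2 * (hdist N (X M n) (Y n))\<^sup>2) summable_on UNIV"
      using X[of M] by (intro summable_on_add summable_on_cmult_right summ[OF M]) (auto simp: N.carr_ell2_iff)
    show "(hnorm N (Y n))\<^sup>2 \<le> 2 * (hnorm N (X M n))\<^sup>2 + 2 * (hdist N (X M n) (Y n))\<^sup>2" for n
    proof -
      have "hnorm N (Y n) \<le> hnorm N (X M n) + hdist N (X M n) (Y n)"
        using N.hnorm_diff_le_hdist[of "X M n" "Y n"] Xc Yc by (simp add: abs_le_iff)
      then have "(hnorm N (Y n))\<^sup>2 \<le> (hnorm N (X M n) + hdist N (X M n) (Y n))\<^sup>2"
        using Yc by (intro power_mono) auto
      then show ?thesis using sq_add_le order_trans by blast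
    qed
  qed auto
  then have Yl: "Y \<in> carr (ell2 N)" using Yc by (simp add: N.carr_ell2_iff)
  have "hlimit (ell2 N) X Y"
    unfolding hlimit_def
  proof (intro conjI Yl LIMSEQ_I)
    fix e :: real assume "e > 0"
    then have e: "e / 2 > 0" by simp
    obtain M where M: "\<And>i j. i \<ge> M \<Longrightarrow> j \<ge> i \<Longrightarrow> hdist (ell2 N) (X i) (X j) \<le> e / 2"
      using ex[OF e] by blast
    have "norm (hdist (ell2 N) (X i) Y - 0) < e" if i: "i \<ge> M" for i
    proof -
      have "(hdist (ell2 N) (X i) Y)\<^sup>2 \<le> (e / 2)\<^sup>2"
        by (rule has_sum_le_finite_sums[OF N.ell2_hdist_has_sum[OF X Yl]]) (rule fin[OF _ M[OF i] e])
      then have "hdist (ell2 N) (X i) Y \<le> e / 2" using e by (meson power2_le_imp_le less_imp_le)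
      then show ?thesis using X Yl \<open>e > 0\<close> by simp
    qed
    then show "\<exists>no. \<forall>i\<ge>no. norm (hdist (ell2 N) (X i) Y - 0) < e" by blast
  qed
  then show "\<exists>x. hlimit (ell2 N) X x" by blast
qed

subsection \<open>Rescaled inner products\<close>

lemma rescale_simps [simp]:
  "carr (rescale c S) = carr S" "add (rescale c S) = add S" "smul (rescale c S) = smul S"
  "ip (rescale c S) x y = complex_of_real c * ip S x y"
  by (simp_all add: rescale_def)

lemma hnorm_rescale: "c \<ge> 0 \<Longrightarrow> hnorm (rescale c S) x = sqrt c * hnorm S x"
  by (simp add: hnorm_def real_sqrt_mult)

lemma hdist_rescale: "c \<ge> 0 \<Longrightarrow> hdist (rescale c S) x y = sqrt c * hdist S x y"
  by (simp add: hdist_def hnorm_rescale)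

lemma heq_rescale: "c > 0 \<Longrightarrow> heq (rescale c S) x y \<longleftrightarrow> heq S x y"
  by (simp add: heq_def hdist_rescale)

lemma hilbert_space_rescale:
  assumes S: "hilbert_space S" and c: "c > 0" shows "hilbert_space (rescale c S)"
  unfolding hilbert_space_iff
proof (intro conjI allI impI)
  interpret S: prehilbert S using S by (rule hilbert_spaceD)
  show "prehilbert (rescale c S)"
  proof
    show "carr (rescale c S) \<noteq> {}" using S.carr_nonempty by simp
    show "ip (rescale c S) y x = cnj (ip (rescale c S) x y)"
      if "x \<in> carr (rescale c S)" "y \<in> carr (rescale c S)" for x y
      using S.ip_cnj[of x y] that by simp
  qed (use c S.ip_nonneg in \<open>simp_all add: S.ip_expand distrib_left\<close>)
  fix X assume X: "(\<forall>n. X n \<in> carr (rescale c S)) \<and> hcauchy (rescale c S) X"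
  have sc: "sqrt c > 0" using c by simp
  have "hcauchy S X"
    unfolding hcauchy_def
  proof (intro allI impI)
    fix e :: real assume "e > 0"
    then have "sqrt c * e > 0" using sc by simp
    then obtain N where "\<forall>m\<ge>N. \<forall>n\<ge>N. hdist (rescale c S) (X m) (X n) < sqrt c * e"
      using X unfolding hcauchy_def by blast
    then show "\<exists>N. \<forall>m\<ge>N. \<forall>n\<ge>N. hdist S (X m) (X n) < e" using sc c by (auto simp: hdist_rescale)
  qed
  then obtain x where x: "hlimit S X x" using hilbert_space_complete[OF S, of X] X by auto
  then have "(\<lambda>n. sqrt c * hdist S (X n) x) \<longlonglongrightarrow> sqrt c * 0"
    by (intro tendsto_mult tendsto_const) (simp add: hlimit_def)
  then have "hlimit (rescale c S) X x" using x c by (simp add: hlimit_def hdist_rescale)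
  then show "\<exists>x. hlimit (rescale c S) X x" by blast
qed

subsection \<open>Outgoing subspaces from translation representations\<close>

lemma right_shift_eq: "right_shift h = (\<lambda>n. h (n + (-1)))"
  by (simp add: right_shift_def fun_eq_iff)

text \<open>\<open>W\<close> identifies \<open>S\<close> with sequences, \<open>V\<close> with the right shift, and \<open>D\<close> with the sequences that vanish at
  negative times; the axioms of an outgoing subspace are then read off from the sequences.\<close>

locale shift_intertwiner =
  fixes S :: "'a hspace" and N :: "'b hspace" and V :: "'a \<Rightarrow> 'a" and W :: "'a \<Rightarrow> int \<Rightarrow> 'b"
    and D :: "'a set"
  assumes S: "hilbert_space S" and N: "hilbert_space N"
    and Vcl: "\<And>x. x \<in> carr S \<Longrightarrow> V x \<in> carr S"
    and Wcl: "\<And>x. x \<in> carr S \<Longrightarrow> W x \<in> carr (ell2 N)"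
    and Wip: "\<And>x y. x \<in> carr S \<Longrightarrow> y \<in> carr S \<Longrightarrow> ip (ell2 N) (W x) (W y) = ip S x y"
    and Wonto: "\<And>h. h \<in> carr (ell2 N) \<Longrightarrow> \<exists>x\<in>carr S. heq (ell2 N) (W x) h"
    and WV: "\<And>x. x \<in> carr S \<Longrightarrow> heq (ell2 N) (W (V x)) (right_shift (W x))"
    and D: "D = {x \<in> carr S. W x \<in> ell2_nonneg N}"
begin

sublocale S: prehilbert S using S by (rule hilbert_spaceD)
sublocale N: prehilbert N using N by (rule hilbert_spaceD)
sublocale E: prehilbert "ell2 N" by (rule N.prehilbert_ell2)

lemma Wc: "x \<in> carr S \<Longrightarrow> W x n \<in> carr N"
  using Wcl by (simp add: N.carr_ell2_iff)

lemma Whdist: "x \<in> carr S \<Longrightarrow> y \<in> carr S \<Longrightarrow> hdist (ell2 N) (W x) (W y) = hdist S x y"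
  using Wip Wcl by (intro ip_preserving_hdist S.prehilbert_axioms E.prehilbert_axioms)

lemma Wheq: "x \<in> carr S \<Longrightarrow> y \<in> carr S \<Longrightarrow> heq S x y \<longleftrightarrow> (\<forall>n. heq N (W x n) (W y n))"
  using N.ell2_heq_iff[OF Wcl Wcl] by (simp add: heq_def Whdist)

lemma Whnorm: "x \<in> carr S \<Longrightarrow> hnorm (ell2 N) (W x) = hnorm S x"
  using Wip by (simp add: hnorm_def)

lemma shift_closed: "h \<in> carr (ell2 N) \<Longrightarrow> right_shift h \<in> carr (ell2 N)"
  unfolding right_shift_eq by (rule N.ell2_shift)

lemma WVn: "x \<in> carr S \<Longrightarrow> heq N (W (V x) n) (W x (n - 1))"
  using WV[of x] N.ell2_heq_iff[OF Wcl[OF Vcl] shift_closed[OF Wcl]] by (auto simp: right_shift_def)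

lemma Vpow: "x \<in> carr S \<Longrightarrow> (V ^^ k) x \<in> carr S \<and> (\<forall>n. heq N (W ((V ^^ k) x) n) (W x (n - int k)))"
proof (induction k)
  case 0 then show ?case using Wc by simp
next
  case (Suc k)
  then have c: "(V ^^ k) x \<in> carr S" and h: "\<And>n. heq N (W ((V ^^ k) x) n) (W x (n - int k))" by auto
  have "heq N (W (V ((V ^^ k) x)) n) (W x (n - int (Suc k)))" for n
    using N.heq_trans[OF WVn[OF c] h[of "n - 1"]] Wc Vcl c Suc.prems by (simp add: algebra_simps)
  then show ?case using Vcl[OF c] by simp
qed

lemma in_D_iff: "x \<in> D \<longleftrightarrow> x \<in> carr S \<and> (\<forall>n<0. hnorm N (W x n) = 0)"
  unfolding D ell2_nonneg_def using Wcl by auto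

lemma V_ip: "x \<in> carr S \<Longrightarrow> y \<in> carr S \<Longrightarrow> ip S (V x) (V y) = ip S x y"
proof -
  assume x: "x \<in> carr S" and y: "y \<in> carr S"
  have "ip S (V x) (V y) = ip (ell2 N) (W (V x)) (W (V y))" using x y by (simp add: Wip Vcl)
  also have "\<dots> = ip (ell2 N) (right_shift (W x)) (right_shift (W y))"
    using x y by (intro E.heq_ip WV Wcl Vcl shift_closed)
  also have "\<dots> = ip S x y" unfolding right_shift_eq N.ell2_shift_ip using x y by (rule Wip)
  finally show ?thesis .
qed

lemma preimage_of_shift:
  assumes x: "x \<in> carr S"
  shows "\<exists>y\<in>carr S. \<forall>n. heq N (W y n) (W x (n + k))"
proof -
  have c: "(\<lambda>n. W x (n + k)) \<in> carr (ell2 N)" using Wcl[OF x] by (rule N.ell2_shift)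
  from Wonto[OF c] obtain y where "y \<in> carr S" "heq (ell2 N) (W y) (\<lambda>n. W x (n + k))" by blast
  then show ?thesis using N.ell2_heq_iff[OF Wcl c] by blast
qed

lemma V_onto: "x \<in> carr S \<Longrightarrow> \<exists>y\<in>carr S. heq S (V y) x"
proof -
  assume x: "x \<in> carr S"
  obtain y where y: "y \<in> carr S" "\<And>n. heq N (W y n) (W x (n + 1))"
    using preimage_of_shift[OF x] by blast
  have "heq N (W (V y) n) (W x n)" for n
    using N.heq_trans[OF WVn[OF y(1)] y(2)[of "n - 1"]] Wc Vcl x y by simp
  then show ?thesis using y Wheq Vcl x by blast
qed

lemma V_iso: "hilbert_iso S S V"
  by (intro hilbert_isoI S Vcl V_ip V_onto)

lemma W_iso: "hilbert_iso S (ell2 N) W"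
  by (intro hilbert_isoI S hilbert_space_ell2 N Wcl Wip Wonto)

lemma pow_image_iff: "pow_image S V D k = {y \<in> carr S. \<forall>n<k. hnorm N (W y n) = 0}"
proof (cases "0 \<le> k")
  case True
  show ?thesis
  proof (intro set_eqI iffI)
    fix y assume "y \<in> pow_image S V D k"
    then obtain x where y: "y \<in> carr S" and x: "x \<in> D" and h: "heq S y ((V ^^ nat k) x)"
      using True by (auto simp: pow_image_def)
    have xc: "x \<in> carr S" using x by (simp add: in_D_iff)
    have p: "(V ^^ nat k) x \<in> carr S" "\<And>n. heq N (W ((V ^^ nat k) x) n) (W x (n - k))"
      using Vpow[OF xc, of "nat k"] True by auto
    have "hnorm N (W y n) = 0" if "n < k" for n
    proof -
      have "heq N (W y n) (W ((V ^^ nat k) x) n)" using h Wheq[OF y p(1)] by blast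
      then have "hnorm N (W y n) = hnorm N (W x (n - k))"
        using p y xc Wc N.heq_hnorm by metis
      then show ?thesis using x that by (simp add: in_D_iff)
    qed
    then show "y \<in> {y \<in> carr S. \<forall>n<k. hnorm N (W y n) = 0}" using y by simp
  next
    fix y assume "y \<in> {y \<in> carr S. \<forall>n<k. hnorm N (W y n) = 0}"
    then have y: "y \<in> carr S" and z: "\<And>n. n < k \<Longrightarrow> hnorm N (W y n) = 0" by auto
    obtain x where x: "x \<in> carr S" "\<And>n. heq N (W x n) (W y (n + k))"
      using preimage_of_shift[OF y] by blast
    have "hnorm N (W x n) = 0" if "n < 0" for n
      using N.heq_hnorm[OF x(2)[of n]] Wc x y z[of "n + k"] that by simp
    then have xD: "x \<in> D" using x by (simp add: in_D_iff)
    have p: "(V ^^ nat k) x \<in> carr S" "\<And>n. heq N (W ((V ^^ nat k) x) n) (W x (n - k))"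
      using Vpow[OF x(1), of "nat k"] True by auto
    have "heq N (W ((V ^^ nat k) x) n) (W y n)" for n
      using N.heq_trans[OF p(2)[of n] x(2)[of "n - k"]] Wc p x y by simp
    then have "heq S ((V ^^ nat k) x) y" using Wheq[OF p(1) y] by blast
    then have "heq S y ((V ^^ nat k) x)" using S.heq_sym p y by blast
    then show "y \<in> pow_image S V D k" using True y xD by (auto simp: pow_image_def)
  qed
next
  case False
  have "(V ^^ nat (- k)) y \<in> D \<longleftrightarrow> (\<forall>n<k. hnorm N (W y n) = 0)" if y: "y \<in> carr S" for y
  proof -
    have p: "(V ^^ nat (- k)) y \<in> carr S" "\<And>n. heq N (W ((V ^^ nat (- k)) y) n) (W y (n + k))"
      using Vpow[OF y, of "nat (- k)"] False by auto
    have e: "hnorm N (W ((V ^^ nat (- k)) y) n) = hnorm N (W y (n + k))" for n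
      using N.heq_hnorm[OF p(2)] Wc p y by simp
    have "(\<forall>n<0. hnorm N (W y (n + k)) = 0) \<longleftrightarrow> (\<forall>n<k. hnorm N (W y n) = 0)"
    proof safe
      fix n assume "\<forall>n<0. hnorm N (W y (n + k)) = 0" "n < k"
      then show "hnorm N (W y n) = 0" by (elim allE[of _ "n - k"]) simp
    qed simp
    then show ?thesis using p by (simp add: in_D_iff e)
  qed
  then show ?thesis using False by (auto simp: pow_image_def)
qed

text \<open>Cutting a sequence off at a time in the remote past changes it little.\<close>

lemma union_dense:
  assumes x: "x \<in> carr S" and e: "e > 0"
  shows "\<exists>y\<in>(\<Union>k. pow_image S V D k). hdist S x y < e"
proof -
  have sm: "(\<lambda>n. (hnorm N (W x n))\<^sup>2) summable_on UNIV" using Wcl[OF x] by (simp add: N.carr_ell2_iff)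
  let ?s = "infsum (\<lambda>n. (hnorm N (W x n))\<^sup>2) UNIV"
  have "e\<^sup>2 / 2 > 0" using e by simp
  then obtain F where F: "finite F" "dist (\<Sum>n\<in>F. (hnorm N (W x n))\<^sup>2) ?s \<le> e\<^sup>2 / 2"
    using infsum_finite_approximation[OF sm] by blast
  define k where "k = Min (insert 0 F)"
  have k: "n \<ge> k" if "n \<in> F" for n using that F unfolding k_def by (intro Min_le) auto
  define h where "h n = (if n < k then smul N 0 (W x n) else W x n)" for n
  have hc: "h n \<in> carr N" for n using x Wc by (simp add: h_def)
  have "(\<lambda>n. (hnorm N (h n))\<^sup>2) summable_on UNIV"
    by (rule summable_on_comparison_test[OF sm]) (use x Wc in \<open>auto simp: h_def N.hnorm_smul\<close>)
  then have h: "h \<in> carr (ell2 N)" using hc by (simp add: N.carr_ell2_iff)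
  obtain y where y: "y \<in> carr S" "heq (ell2 N) (W y) h" using Wonto[OF h] by blast
  have "hnorm N (W y n) = 0" if "n < k" for n
  proof -
    have "heq N (W y n) (h n)" using y N.ell2_heq_iff[OF Wcl[OF y(1)] h] by blast
    then have "hnorm N (W y n) = hnorm N (h n)" using y hc Wc by (intro N.heq_hnorm)
    then show ?thesis using that x Wc by (simp add: h_def N.hnorm_smul)
  qed
  then have yU: "y \<in> pow_image S V D k" using y by (simp add: pow_image_iff)
  have "hdist S x y = hdist (ell2 N) (W x) h"
    using Whdist[OF x y(1)] E.heq_hdist[OF E.heq_refl y(2)] x y h Wcl by metis
  moreover have "hdist (ell2 N) (W x) h < e"
  proof -
    have pt: "(hdist N (W x n) (h n))\<^sup>2 = (if n < k then (hnorm N (W x n))\<^sup>2 else 0)" for n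
      using x Wc N.hdist_sq[of "W x n" "smul N 0 (W x n)"]
      by (simp add: h_def N.hdist_self N.hnorm_smul N.ip_expand)
    have "(hdist (ell2 N) (W x) h)\<^sup>2 \<le> e\<^sup>2 / 2"
    proof (rule has_sum_le_finite_sums[OF N.ell2_hdist_has_sum[OF Wcl[OF x] h]])
      fix G :: "int set" assume G: "finite G"
      have "(\<Sum>n\<in>G. (hdist N (W x n) (h n))\<^sup>2) \<le> (\<Sum>n\<in>G - F. (hnorm N (W x n))\<^sup>2)"
      proof -
        have "(\<Sum>n\<in>G. (hdist N (W x n) (h n))\<^sup>2) = (\<Sum>n\<in>G - F. (hdist N (W x n) (h n))\<^sup>2)"
          using G k by (intro sum.mono_neutral_right) (auto simp: pt, force)
        also have "\<dots> \<le> (\<Sum>n\<in>G - F. (hnorm N (W x n))\<^sup>2)" by (intro sum_mono) (simp add: pt)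
        finally show ?thesis .
      qed
      also have "\<dots> = (\<Sum>n\<in>G \<union> F. (hnorm N (W x n))\<^sup>2) - (\<Sum>n\<in>F. (hnorm N (W x n))\<^sup>2)"
        using sum.union_disjoint[of "G - F" F "\<lambda>n. (hnorm N (W x n))\<^sup>2"] G F(1)
        by (simp add: Int_Diff Diff_Int_distrib2 Diff_Int)
      also have "\<dots> \<le> ?s - (\<Sum>n\<in>F. (hnorm N (W x n))\<^sup>2)"
        using finite_sum_le_infsum[OF sm, of "G \<union> F"] G F(1) by simp
      also have "\<dots> \<le> e\<^sup>2 / 2" using F(2) unfolding dist_real_def by linarith
      finally show "(\<Sum>n\<in>G. (hdist N (W x n) (h n))\<^sup>2) \<le> e\<^sup>2 / 2" .
    qed
    also have "\<dots> < e\<^sup>2" using e by simp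
    finally show ?thesis using e by (meson power2_less_imp_less less_imp_le)
  qed
  ultimately have "hdist S x y < e" by simp
  then show ?thesis using yU by blast
qed

lemma D_subspace: "hsubspace S D"
  unfolding hsubspace_def
proof (intro conjI ballI allI impI)
  show "D \<subseteq> carr S" by (auto simp: in_D_iff)
  obtain x where x: "x \<in> carr S" using S.carr_nonempty by blast
  have W0: "heq N (W (smul S a x) n) (smul N a (W x n))" if "x \<in> carr S" for a x n
  proof -
    have "heq (ell2 N) (W (smul S a x)) (smul (ell2 N) a (W x))"
      using W_iso that by (simp add: hilbert_iso_def)
    moreover have "smul (ell2 N) a (W x) = (\<lambda>n. smul N a (W x n))" by (simp add: ell2_def)
    ultimately show ?thesis
      using N.ell2_heq_iff[of "W (smul S a x)" "smul (ell2 N) a (W x)"] that Wcl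
        E.smul_closed[OF Wcl[OF that], of a] by auto
  qed
  have W0n: "hnorm N (W (smul S a x) n) = cmod a * hnorm N (W x n)" if "x \<in> carr S" for a x n
    using N.heq_hnorm[OF W0[OF that]] that Wc by (simp add: N.hnorm_smul)
  have "smul S 0 x \<in> D" using x by (simp add: in_D_iff W0n)
  then show "D \<noteq> {}" by blast
  show "smul S a y \<in> D" if "y \<in> D" for a y using that by (simp add: in_D_iff W0n)
  show "add S y z \<in> D" if "y \<in> D" "z \<in> D" for y z
  proof -
    have yz: "y \<in> carr S" "z \<in> carr S" using that by (auto simp: in_D_iff)
    have "heq (ell2 N) (W (add S y z)) (add (ell2 N) (W y) (W z))"
      using W_iso yz by (simp add: hilbert_iso_def)
    moreover have "add (ell2 N) (W y) (W z) = (\<lambda>n. add N (W y n) (W z n))" by (simp add: ell2_def)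
    ultimately have "heq N (W (add S y z) n) (add N (W y n) (W z n))" for n
      using N.ell2_heq_iff[of "W (add S y z)" "add (ell2 N) (W y) (W z)"] yz Wcl
        E.add_closed[OF Wcl[OF yz(1)] Wcl[OF yz(2)]] by auto
    then have "hnorm N (W (add S y z) n) \<le> hnorm N (W y n) + hnorm N (W z n)" for n
      using N.heq_hnorm N.hnorm_triangle[of "W y n" "W z n"] yz Wc by (metis N.add_closed S.add_closed)
    then have "hnorm N (W (add S y z) n) = 0" if "n < 0" for n
      using \<open>y \<in> D\<close> \<open>z \<in> D\<close> that N.hnorm_nonneg[OF Wc[OF S.add_closed[OF yz]], of n]
      by (metis add_0 in_D_iff order_antisym)
    then show ?thesis using yz by (simp add: in_D_iff)
  qed
  show "z \<in> D" if "y \<in> D" "z \<in> carr S" "heq S y z" for y z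
  proof -
    have "y \<in> carr S" using that by (simp add: in_D_iff)
    then have "hnorm N (W z n) = hnorm N (W y n)" for n
      using Wheq[of y z] that N.heq_hnorm Wc by metis
    then show ?thesis using that by (simp add: in_D_iff)
  qed
qed

theorem outgoing: "outgoing S V D"
  unfolding outgoing_def
proof (intro conjI V_iso D_subspace)
  show "V ` D \<subseteq> D"
  proof
    fix y assume "y \<in> V ` D"
    then obtain x where x: "x \<in> D" "y = V x" by blast
    then have xc: "x \<in> carr S" by (simp add: in_D_iff)
    have "hnorm N (W (V x) n) = hnorm N (W x (n - 1))" for n
      using N.heq_hnorm[OF WVn[OF xc]] Wc Vcl xc by simp
    then show "y \<in> D" using x Vcl[OF xc] by (simp add: in_D_iff)
  qed
  show "(\<Inter>k. pow_image S V D k) = {x \<in> carr S. hnorm S x = 0}"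
  proof (intro set_eqI iffI)
    fix x assume x: "x \<in> (\<Inter>k. pow_image S V D k)"
    then have "x \<in> pow_image S V D (n + 1)" for n by blast
    then have "x \<in> carr S" "\<And>n. hnorm N (W x n) = 0" by (auto simp: pow_image_iff)
    then show "x \<in> {x \<in> carr S. hnorm S x = 0}"
      using N.ell2_hnorm_0_iff[OF Wcl] by (simp add: Whnorm)
  next
    fix x assume "x \<in> {x \<in> carr S. hnorm S x = 0}"
    then have "x \<in> carr S" "\<And>n. hnorm N (W x n) = 0"
      using N.ell2_hnorm_0_iff[OF Wcl, of x] by (auto simp: Whnorm)
    then show "x \<in> (\<Inter>k. pow_image S V D k)" by (auto simp: pow_image_iff)
  qed
  show "\<forall>x\<in>carr S. \<forall>e>0. \<exists>y\<in>(\<Union>k. pow_image S V D k). hdist S x y < e"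
    using union_dense by blast
qed

theorem translation_rep: "translation_rep S V D N W"
  unfolding translation_rep_def
proof (intro conjI N W_iso ballI WV)
  show "W x \<in> ell2_nonneg N" if "x \<in> D" for x using that by (simp add: D)
  show "\<exists>x\<in>D. heq (ell2 N) (W x) h" if h: "h \<in> ell2_nonneg N" for h
  proof -
    have hc: "h \<in> carr (ell2 N)" and h0: "\<And>n. n < 0 \<Longrightarrow> hnorm N (h n) = 0"
      using h by (auto simp: ell2_nonneg_def)
    obtain x where x: "x \<in> carr S" "heq (ell2 N) (W x) h" using Wonto[OF hc] by blast
    then have "hnorm N (W x n) = hnorm N (h n)" for n
      using N.ell2_heq_iff[OF Wcl hc] N.heq_hnorm Wc hc by (metis N.carr_ell2_iff)
    then have "x \<in> D" using x h0 by (simp add: in_D_iff)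
    then show ?thesis using x by blast
  qed
qed

end

section \<open>The space of square integrable functions\<close>

lemma carr_L2_iff: "f \<in> carr (L2 M) \<longleftrightarrow> f \<in> borel_measurable M \<and> integrable M (\<lambda>x. (cmod (f x))\<^sup>2)"
  by (simp add: L2_def)

lemma L2_add: "add (L2 M) f g = (\<lambda>x. f x + g x)"
  and L2_smul: "smul (L2 M) a f = (\<lambda>x. a * f x)"
  and L2_ip: "ip (L2 M) f g = (\<integral>x. f x * cnj (g x) \<partial>M)"
  by (simp_all add: L2_def)

lemma L2_measurable: "f \<in> carr (L2 M) \<Longrightarrow> f \<in> borel_measurable M"
  by (simp add: carr_L2_iff)

lemma cnj_measurable [measurable (raw)]:
  "f \<in> borel_measurable M \<Longrightarrow> (\<lambda>x. cnj (f x)) \<in> borel_measurable M"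
  by (rule borel_measurable_continuous_on[where f = cnj]) (auto intro: continuous_intros)

lemma L2_ip_self: "ip (L2 M) f f = complex_of_real (\<integral>x. (cmod (f x))\<^sup>2 \<partial>M)"
  unfolding L2_ip complex_norm_square[symmetric] of_real_power[symmetric] by (rule integral_complex_of_real)

lemma L2_product_integrable:
  assumes f: "f \<in> carr (L2 M)" and g: "g \<in> carr (L2 M)"
  shows "integrable M (\<lambda>x. f x * cnj (g x))"
proof (rule Bochner_Integration.integrable_bound[where f = "\<lambda>x. (cmod (f x))\<^sup>2 + (cmod (g x))\<^sup>2"])
  have [measurable]: "f \<in> borel_measurable M" "g \<in> borel_measurable M"
    using f g by (auto simp: carr_L2_iff)
  show "integrable M (\<lambda>x. (cmod (f x))\<^sup>2 + (cmod (g x))\<^sup>2)" using f g by (simp add: carr_L2_iff)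
  show "(\<lambda>x. f x * cnj (g x)) \<in> borel_measurable M" by measurable
  show "AE x in M. norm (f x * cnj (g x)) \<le> norm ((cmod (f x))\<^sup>2 + (cmod (g x))\<^sup>2)"
    by (intro AE_I2) (simp add: norm_mult mult_le_sq)
qed

lemma prehilbert_L2: "prehilbert (L2 M)"
proof
  have "(\<lambda>x. 0) \<in> carr (L2 M)" by (simp add: carr_L2_iff)
  then show "carr (L2 M) \<noteq> {}" by blast
next
  fix f g assume f: "f \<in> carr (L2 M)" and g: "g \<in> carr (L2 M)"
  have [measurable]: "f \<in> borel_measurable M" "g \<in> borel_measurable M"
    using f g by (auto simp: carr_L2_iff)
  have "integrable M (\<lambda>x. (cmod (f x + g x))\<^sup>2)"
  proof (rule Bochner_Integration.integrable_bound[where f = "\<lambda>x. 2 * (cmod (f x))\<^sup>2 + 2 * (cmod (g x))\<^sup>2"])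
    show "integrable M (\<lambda>x. 2 * (cmod (f x))\<^sup>2 + 2 * (cmod (g x))\<^sup>2)" using f g by (simp add: carr_L2_iff)
    show "AE x in M. norm ((cmod (f x + g x))\<^sup>2) \<le> norm (2 * (cmod (f x))\<^sup>2 + 2 * (cmod (g x))\<^sup>2)"
    proof (intro AE_I2)
      fix x
      have "(cmod (f x + g x))\<^sup>2 \<le> (cmod (f x) + cmod (g x))\<^sup>2"
        by (intro power_mono norm_triangle_ineq) auto
      then show "norm ((cmod (f x + g x))\<^sup>2) \<le> norm (2 * (cmod (f x))\<^sup>2 + 2 * (cmod (g x))\<^sup>2)"
        using order_trans[OF _ sq_add_le[of "cmod (f x)" "cmod (g x)"]] by simp
    qed
  qed simp
  then show "add (L2 M) f g \<in> carr (L2 M)" by (simp add: carr_L2_iff L2_add)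
  have "cnj (\<integral>x. f x * cnj (g x) \<partial>M) = (\<integral>x. cnj (f x * cnj (g x)) \<partial>M)"
    by (rule Bochner_Integration.integral_cnj[symmetric])
  then show "ip (L2 M) g f = cnj (ip (L2 M) f g)" by (simp add: L2_ip mult.commute)
  fix h assume h: "h \<in> carr (L2 M)"
  show "ip (L2 M) (add (L2 M) f g) h = ip (L2 M) f h + ip (L2 M) g h"
    using L2_product_integrable[OF f h] L2_product_integrable[OF g h]
    by (simp add: L2_ip L2_add distrib_right)
next
  fix f a assume f: "f \<in> carr (L2 M)"
  then show "smul (L2 M) a f \<in> carr (L2 M)"
    by (auto simp: carr_L2_iff L2_smul norm_mult power_mult_distrib)
  show "0 \<le> Re (ip (L2 M) f f)"
    by (simp add: L2_ip_self)
  fix g assume "g \<in> carr (L2 M)"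
  show "ip (L2 M) (smul (L2 M) a f) g = a * ip (L2 M) f g"
    by (simp add: L2_ip L2_smul mult.assoc)
qed

interpretation L2: prehilbert "L2 M" for M by (rule prehilbert_L2)

lemma L2_hnorm_sq: "f \<in> carr (L2 M) \<Longrightarrow> (hnorm (L2 M) f)\<^sup>2 = (\<integral>x. (cmod (f x))\<^sup>2 \<partial>M)"
  by (simp add: L2.hnorm_sq L2_ip_self)

lemma L2_diff_closed: "f \<in> carr (L2 M) \<Longrightarrow> g \<in> carr (L2 M) \<Longrightarrow> (\<lambda>x. f x - g x) \<in> carr (L2 M)"
  using L2.add_closed[OF _ L2.smul_closed, of f M g "-1"] by (simp add: L2_add L2_smul)

lemma L2_hdist: "hdist (L2 M) f g = hnorm (L2 M) (\<lambda>x. f x - g x)"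
  by (simp add: hdist_def L2_add L2_smul)

lemma L2_hdist_sq:
  "f \<in> carr (L2 M) \<Longrightarrow> g \<in> carr (L2 M) \<Longrightarrow> (hdist (L2 M) f g)\<^sup>2 = (\<integral>x. (cmod (f x - g x))\<^sup>2 \<partial>M)"
  by (simp add: L2_hdist L2_hnorm_sq L2_diff_closed)

lemma L2_hnorm_0_iff:
  assumes f: "f \<in> carr (L2 M)"
  shows "hnorm (L2 M) f = 0 \<longleftrightarrow> (AE x in M. f x = 0)"
proof -
  have "hnorm (L2 M) f = 0 \<longleftrightarrow> (\<integral>x. (cmod (f x))\<^sup>2 \<partial>M) = 0"
    using L2_hnorm_sq[OF f] by (metis power_eq_0_iff zero_neq_numeral power2_eq_square mult_zero_left)
  also have "\<dots> \<longleftrightarrow> (AE x in M. f x = 0)"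
    using f by (subst integral_nonneg_eq_0_iff_AE) (auto simp: carr_L2_iff)
  finally show ?thesis .
qed

lemma L2_heq_iff:
  assumes f: "f \<in> carr (L2 M)" and g: "g \<in> carr (L2 M)"
  shows "heq (L2 M) f g \<longleftrightarrow> (AE x in M. f x = g x)"
  using L2_hnorm_0_iff[OF L2_diff_closed[OF f g]] by (simp add: heq_def L2_hdist)

lemma L2_AE_cong:
  assumes f: "f \<in> carr (L2 M)" and g: "g \<in> borel_measurable M" and e: "AE x in M. f x = g x"
  shows "g \<in> carr (L2 M)"
proof -
  have [measurable]: "f \<in> borel_measurable M" using f by (simp add: carr_L2_iff)
  note [measurable] = g
  have "integrable M (\<lambda>x. (cmod (f x))\<^sup>2) \<longleftrightarrow> integrable M (\<lambda>x. (cmod (g x))\<^sup>2)"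
    using e by (intro integrable_cong_AE) auto
  then show ?thesis using f g by (simp add: carr_L2_iff)
qed

lemma L2_nn_integral:
  assumes f: "f \<in> carr (L2 M)"
  shows "(\<integral>\<^sup>+x. ennreal ((cmod (f x))\<^sup>2) \<partial>M) = ennreal ((hnorm (L2 M) f)\<^sup>2)"
  using f by (simp add: L2_hnorm_sq nn_integral_eq_integral carr_L2_iff)

context finite_measure
begin

lemma L2_bounded:
  assumes f: "f \<in> borel_measurable M" and b: "\<And>x. x \<in> space M \<Longrightarrow> cmod (f x) \<le> B"
  shows "f \<in> carr (L2 M)"
proof -
  note [measurable] = f
  have "integrable M (\<lambda>x. (cmod (f x))\<^sup>2)"
  proof (rule integrable_const_bound)
    show "AE x in M. norm ((cmod (f x))\<^sup>2) \<le> B\<^sup>2"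
      using b by (intro AE_I2) (simp add: power_mono)
  qed simp
  then show ?thesis using f by (simp add: carr_L2_iff)
qed

lemma L2_L1:
  assumes f: "f \<in> carr (L2 M)"
  shows "integrable M f" "(\<integral>x. cmod (f x) \<partial>M) \<le> sqrt (measure M (space M)) * hnorm (L2 M) f"
proof -
  have [measurable]: "f \<in> borel_measurable M" using f by (simp add: carr_L2_iff)
  have one: "(\<lambda>x. 1) \<in> carr (L2 M)" by (rule L2_bounded[where B = 1]) auto
  have abs: "(\<lambda>x. complex_of_real (cmod (f x))) \<in> carr (L2 M)" using f by (simp add: carr_L2_iff)
  show "integrable M f" using L2_product_integrable[OF f one] by simp
  have n1: "hnorm (L2 M) (\<lambda>x. 1) = sqrt (measure M (space M))"
    using L2_hnorm_sq[OF one] L2.hnorm_nonneg[OF one] by (simp add: real_sqrt_unique)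
  have na: "hnorm (L2 M) (\<lambda>x. complex_of_real (cmod (f x))) = hnorm (L2 M) f"
  proof -
    have "(hnorm (L2 M) (\<lambda>x. complex_of_real (cmod (f x))))\<^sup>2 = (hnorm (L2 M) f)\<^sup>2"
      using abs f by (simp add: L2_hnorm_sq)
    then show ?thesis using L2.hnorm_nonneg[OF abs] L2.hnorm_nonneg[OF f] by (simp add: power2_eq_iff_nonneg)
  qed
  have "cmod (ip (L2 M) (\<lambda>x. complex_of_real (cmod (f x))) (\<lambda>x. 1)) \<le> hnorm (L2 M) f * sqrt (measure M (space M))"
    using L2.Cauchy_Schwarz[OF abs one] by (simp add: n1 na)
  then show "(\<integral>x. cmod (f x) \<partial>M) \<le> sqrt (measure M (space M)) * hnorm (L2 M) f"
    by (simp add: L2_ip mult.commute)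
qed

text \<open>Completeness (Riesz-Fischer): a subsequence with summable increments converges almost
  everywhere, and Fatou's lemma turns this into convergence in norm.\<close>

theorem hilbert_space_L2: "hilbert_space (L2 M)"
  unfolding hilbert_space_iff
proof (intro conjI allI impI prehilbert_L2)
  fix X assume "(\<forall>n. X n \<in> carr (L2 M)) \<and> hcauchy (L2 M) X"
  then have X: "\<And>n. X n \<in> carr (L2 M)" and cX: "hcauchy (L2 M) X" by auto
  have Xm [measurable]: "X n \<in> borel_measurable M" for n using X by (simp add: carr_L2_iff)
  have "\<exists>N. \<forall>m\<ge>N. \<forall>n\<ge>N. hdist (L2 M) (X m) (X n) < (1/2) ^ k" for k
    using cX unfolding hcauchy_def by simp
  then obtain N where N: "\<And>k m n. m \<ge> N k \<Longrightarrow> n \<ge> N k \<Longrightarrow> hdist (L2 M) (X m) (X n) < (1/2) ^ k"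
    by metis
  define r where "r k = (\<Sum>i\<le>k. N i) + k" for k
  have r: "r k \<ge> N k" for k unfolding r_def by (rule trans_le_add1, rule member_le_sum) auto
  have rmono: "r k \<le> r (Suc k)" for k by (simp add: r_def)
  define Y where "Y k = X (r k)" for k
  have Y: "Y k \<in> carr (L2 M)" for k by (simp add: Y_def X)
  have Ym [measurable]: "Y k \<in> borel_measurable M" for k by (simp add: Y_def)
  have inc: "hdist (L2 M) (Y (Suc k)) (Y k) \<le> (1/2) ^ k" for k
    unfolding Y_def using N[of k "r (Suc k)" "r k"] r[of k] rmono[of k] by simp
  let ?C = "sqrt (measure M (space M))"
  have "(\<integral>\<^sup>+x. (\<Sum>k. ennreal (cmod (Y (Suc k) x - Y k x))) \<partial>M) < \<infinity>"
  proof -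
    have "(\<integral>\<^sup>+x. ennreal (cmod (Y (Suc k) x - Y k x)) \<partial>M) \<le> ennreal (?C * (1/2) ^ k)" for k
    proof -
      note d = L2_diff_closed[OF Y[of "Suc k"] Y[of k]]
      have "(\<integral>\<^sup>+x. ennreal (cmod (Y (Suc k) x - Y k x)) \<partial>M) = ennreal (\<integral>x. cmod (Y (Suc k) x - Y k x) \<partial>M)"
        using L2_L1(1)[OF d] by (intro nn_integral_eq_integral) auto
      also have "\<dots> \<le> ennreal (?C * (1/2) ^ k)"
      proof (rule ennreal_leI)
        have "(\<integral>x. cmod (Y (Suc k) x - Y k x) \<partial>M) \<le> ?C * hnorm (L2 M) (\<lambda>x. Y (Suc k) x - Y k x)"
          by (rule L2_L1(2)[OF d])
        also have "\<dots> \<le> ?C * (1/2) ^ k"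
          using inc[of k] by (intro mult_left_mono) (auto simp: L2_hdist)
        finally show "(\<integral>x. cmod (Y (Suc k) x - Y k x) \<partial>M) \<le> ?C * (1/2) ^ k" .
      qed
      finally show ?thesis .
    qed
    then have "(\<Sum>k. \<integral>\<^sup>+x. ennreal (cmod (Y (Suc k) x - Y k x)) \<partial>M) \<le> (\<Sum>k. ennreal (?C * (1/2) ^ k))"
      by (intro suminf_le) auto
    also have "\<dots> = ennreal (\<Sum>k. ?C * (1/2) ^ k)"
      by (intro suminf_ennreal2 summable_mult) auto
    also have "\<dots> < \<infinity>" by simp
    finally show ?thesis by (subst nn_integral_suminf) auto
  qed
  then have "AE x in M. (\<Sum>k. ennreal (cmod (Y (Suc k) x - Y k x))) \<noteq> \<infinity>"
    by (intro nn_integral_PInf_AE) auto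
  then have ae: "AE x in M. convergent (\<lambda>k. Y k x)"
  proof eventually_elim
    case (elim x)
    then have "summable (\<lambda>k. cmod (Y (Suc k) x - Y k x))"
      by (intro summable_suminf_not_top) (auto simp: top_ennreal_def infinity_ennreal_def)
    then have "summable (\<lambda>k. Y (Suc k) x - Y k x)" by (rule summable_norm_cancel)
    then have "convergent (\<lambda>n. Y n x - Y 0 x)"
      unfolding summable_iff_convergent sum_lessThan_telescope[of "\<lambda>i. Y i x"] .
    then show ?case by (simp add: convergent_diff_const_right_iff)
  qed
  define f where "f x = lim (\<lambda>k. Y k x)" for x
  have fm [measurable]: "f \<in> borel_measurable M" unfolding f_def by measurable
  have lim: "AE x in M. (\<lambda>k. Y k x) \<longlonglongrightarrow> f x"
    using ae by eventually_elim (simp add: f_def convergent_LIMSEQ_iff)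
  have fatou: "(\<integral>\<^sup>+x. ennreal ((cmod (X n x - f x))\<^sup>2) \<partial>M) \<le> ennreal (e\<^sup>2)"
    if n: "\<And>m. m \<ge> n \<Longrightarrow> hdist (L2 M) (X n) (X m) \<le> e" and e: "e \<ge> 0" for n e
  proof -
    have "(\<integral>\<^sup>+x. ennreal ((cmod (X n x - f x))\<^sup>2) \<partial>M)
        = (\<integral>\<^sup>+x. liminf (\<lambda>k. ennreal ((cmod (X n x - Y k x))\<^sup>2)) \<partial>M)"
    proof (rule nn_integral_cong_AE)
      show "AE x in M. ennreal ((cmod (X n x - f x))\<^sup>2) = liminf (\<lambda>k. ennreal ((cmod (X n x - Y k x))\<^sup>2))"
        using lim
      proof eventually_elim
        case (elim x)
        then have "(\<lambda>k. ennreal ((cmod (X n x - Y k x))\<^sup>2)) \<longlonglongrightarrow> ennreal ((cmod (X n x - f x))\<^sup>2)"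
          by (intro tendsto_ennrealI tendsto_intros)
        then show ?case by (rule lim_imp_Liminf[OF trivial_limit_sequentially, symmetric])
      qed
    qed
    also have "\<dots> \<le> liminf (\<lambda>k. \<integral>\<^sup>+x. ennreal ((cmod (X n x - Y k x))\<^sup>2) \<partial>M)"
      by (rule nn_integral_liminf) measurable
    also have "\<dots> \<le> limsup (\<lambda>k. \<integral>\<^sup>+x. ennreal ((cmod (X n x - Y k x))\<^sup>2) \<partial>M)"
      by (rule Liminf_le_Limsup) simp
    also have "\<dots> \<le> ennreal (e\<^sup>2)"
    proof (rule Limsup_bounded)
      show "\<forall>\<^sub>F k in sequentially. (\<integral>\<^sup>+x. ennreal ((cmod (X n x - Y k x))\<^sup>2) \<partial>M) \<le> ennreal (e\<^sup>2)"
      proof (intro eventually_sequentiallyI[of n])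
        fix k assume "n \<le> k"
        then have "n \<le> r k" by (simp add: r_def)
        then have "(hdist (L2 M) (X n) (Y k))\<^sup>2 \<le> e\<^sup>2"
          unfolding Y_def by (intro power_mono n L2.hdist_nonneg X)
        then show "(\<integral>\<^sup>+x. ennreal ((cmod (X n x - Y k x))\<^sup>2) \<partial>M) \<le> ennreal (e\<^sup>2)"
          by (subst L2_nn_integral[OF L2_diff_closed[OF X Y]]) (simp add: L2_hdist ennreal_leI)
      qed
    qed
    finally show ?thesis .
  qed
  have ex: "\<exists>K. \<forall>n\<ge>K. \<forall>m\<ge>n. hdist (L2 M) (X n) (X m) \<le> e" if "e > 0" for e
    using cX that unfolding hcauchy_def by (meson less_imp_le order_trans)
  have diff: "(\<lambda>x. X n x - f x) \<in> carr (L2 M)"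
    if n: "\<And>m. m \<ge> n \<Longrightarrow> hdist (L2 M) (X n) (X m) \<le> e" and e: "e \<ge> 0" for n e
  proof -
    have "(\<integral>\<^sup>+x. ennreal ((cmod (X n x - f x))\<^sup>2) \<partial>M) \<le> ennreal (e\<^sup>2)"
      by (rule fatou) (use n e in auto)
    then have "(\<integral>\<^sup>+x. ennreal ((cmod (X n x - f x))\<^sup>2) \<partial>M) < \<infinity>"
      by (metis ennreal_less_top infinity_ennreal_def le_less_trans)
    then have "integrable M (\<lambda>x. (cmod (X n x - f x))\<^sup>2)"
      by (intro integrableI_nonneg) auto
    then show ?thesis by (simp add: carr_L2_iff)
  qed
  obtain K where K: "\<And>m. m \<ge> K \<Longrightarrow> hdist (L2 M) (X K) (X m) \<le> 1" using ex[of 1] by auto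
  have "(\<lambda>x. X K x - (X K x - f x)) \<in> carr (L2 M)"
    by (rule L2_diff_closed[OF X diff[OF K]]) auto
  then have f: "f \<in> carr (L2 M)" by simp
  have "hlimit (L2 M) X f"
    unfolding hlimit_def
  proof (intro conjI f LIMSEQ_I)
    fix e :: real assume "e > 0"
    then have e: "e / 2 > 0" by simp
    obtain K where K: "\<And>n m. n \<ge> K \<Longrightarrow> m \<ge> n \<Longrightarrow> hdist (L2 M) (X n) (X m) \<le> e / 2"
      using ex[OF e] by blast
    have "norm (hdist (L2 M) (X n) f - 0) < e" if n: "n \<ge> K" for n
    proof -
      have "ennreal ((hdist (L2 M) (X n) f)\<^sup>2) \<le> ennreal ((e / 2)\<^sup>2)"
        using fatou[OF K[OF n]] e L2_nn_integral[OF L2_diff_closed[OF X f]] by (simp add: L2_hdist)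
      then have "(hdist (L2 M) (X n) f)\<^sup>2 \<le> (e / 2)\<^sup>2" by simp
      then have "hdist (L2 M) (X n) f \<le> e / 2" using e by (meson power2_le_imp_le less_imp_le)
      then show ?thesis using X f \<open>e > 0\<close> by simp
    qed
    then show "\<exists>no. \<forall>n\<ge>no. norm (hdist (L2 M) (X n) f - 0) < e" by blast
  qed
  then show "\<exists>f. hlimit (L2 M) X f" by blast
qed

end

section \<open>The circle\<close>

lemma space_circle [simp]: "space circle = sphere 0 1"
  and sets_circle [measurable_cong]: "sets circle = sets (restrict_space borel (sphere 0 1))"
  by (simp_all add: circle_def space_restrict_space)

lemma cis_measurable_circle: "cis \<in> lborel \<rightarrow>\<^sub>M restrict_space borel (sphere 0 1)"
proof (rule measurable_restrict_space2)
  have "cis \<in> borel_measurable borel"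
    by (rule borel_measurable_continuous_onI) (auto simp: cis_conv_exp intro!: continuous_intros)
  then show "cis \<in> borel_measurable lborel" by simp
qed simp

lemma cis_measurable_restrict:
  "cis \<in> restrict_space lborel {0..<2 * pi} \<rightarrow>\<^sub>M restrict_space borel (sphere 0 1)"
  by (rule measurable_restrict_space1[OF cis_measurable_circle])

lemma nn_integral_circle:
  assumes f: "f \<in> borel_measurable circle"
  shows "(\<integral>\<^sup>+\<xi>. f \<xi> \<partial>circle) = (\<integral>\<^sup>+t. f (cis t) * indicator {0..<2 * pi} t \<partial>lborel)"
proof -
  have f': "f \<in> borel_measurable (restrict_space borel (sphere 0 1))"
    using f by (simp cong: measurable_cong_sets add: sets_circle)
  have "(\<integral>\<^sup>+\<xi>. f \<xi> \<partial>circle) = (\<integral>\<^sup>+t. f (cis t) \<partial>restrict_space lborel {0..<2 * pi})"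
    unfolding circle_def by (rule nn_integral_distr[OF cis_measurable_restrict]) (use f' in simp)
  also have "\<dots> = (\<integral>\<^sup>+t. f (cis t) * indicator {0..<2 * pi} t \<partial>lborel)"
    by (subst nn_integral_restrict_space) auto
  finally show ?thesis .
qed

lemma integral_circle:
  fixes f :: "complex \<Rightarrow> complex"
  assumes f: "f \<in> borel_measurable circle"
  shows "(\<integral>\<xi>. f \<xi> \<partial>circle) = (\<integral>t. indicator {0..<2 * pi} t *\<^sub>R f (cis t) \<partial>lborel)"
proof -
  have f': "f \<in> borel_measurable (restrict_space borel (sphere 0 1))"
    using f by (simp cong: measurable_cong_sets add: sets_circle)
  have "(\<integral>\<xi>. f \<xi> \<partial>circle) = (\<integral>t. f (cis t) \<partial>restrict_space lborel {0..<2 * pi})"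
    unfolding circle_def by (rule integral_distr[OF cis_measurable_restrict f'])
  also have "\<dots> = (\<integral>t. indicator {0..<2 * pi} t *\<^sub>R f (cis t) \<partial>lborel)"
    by (subst integral_restrict_space) auto
  finally show ?thesis .
qed

lemma emeasure_circle: "emeasure circle (space circle) = ennreal (2 * pi)"
  using nn_integral_circle[of "\<lambda>_. 1"] by simp

interpretation circle: finite_measure circle
  by (rule finite_measureI) (use emeasure_circle in simp)

lemma measure_circle: "measure circle (sphere 0 1) = 2 * pi"
  using emeasure_circle by (simp add: measure_def)

lemma powi_measurable [measurable]: "(\<lambda>\<xi>. \<xi> powi k) \<in> borel_measurable circle"
proof -
  have "continuous_on (sphere 0 1) (\<lambda>\<xi>::complex. \<xi> powi k)"
    by (intro continuous_intros) auto
  then have "(\<lambda>\<xi>::complex. \<xi> powi k) \<in> borel_measurable (restrict_space borel (sphere 0 1))"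
    by (rule borel_measurable_continuous_on_restrict)
  then show ?thesis by (simp cong: measurable_cong_sets add: sets_circle)
qed

lemma norm_powi_circle: "\<xi> \<in> sphere 0 1 \<Longrightarrow> cmod (\<xi> powi k) = 1"
  by (simp add: norm_power_int)

lemma integral_circle_powi: "(\<integral>\<xi>. \<xi> powi k \<partial>circle) = (if k = 0 then complex_of_real (2 * pi) else 0)"
proof (cases "k = 0")
  case True
  then show ?thesis using measure_circle by (simp add: scaleR_conv_of_real)
next
  case False
  have "(\<integral>\<xi>. \<xi> powi k \<partial>circle) = (\<integral>t. indicator {0..<2 * pi} t *\<^sub>R cis (of_int k * t) \<partial>lborel)"
    by (subst integral_circle) (simp_all add: cis_power_int)
  also have "\<dots> = (\<integral>t. indicator {0..2 * pi} t *\<^sub>R cis (of_int k * t) \<partial>lborel)"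
  proof (rule integral_cong_AE)
    have [measurable]: "cis \<in> borel_measurable borel"
      by (rule borel_measurable_continuous_onI) (auto simp: cis_conv_exp intro!: continuous_intros)
    show "(\<lambda>t. indicator {0..<2 * pi} t *\<^sub>R cis (of_int k * t)) \<in> borel_measurable lborel" by measurable
    show "(\<lambda>t. indicator {0..2 * pi} t *\<^sub>R cis (of_int k * t)) \<in> borel_measurable lborel" by measurable
    have "AE t in lborel. t \<noteq> 2 * pi" by (rule AE_lborel_singleton)
    then show "AE t in lborel. indicator {0..<2 * pi} t *\<^sub>R cis (of_int k * t)
        = indicator {0..2 * pi} t *\<^sub>R cis (of_int k * t)"
      by eventually_elim (auto simp: indicator_def)
  qed
  also have "\<dots> = cis (of_int k * (2 * pi)) / (\<i> * of_int k) - cis (of_int k * 0) / (\<i> * of_int k)"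
  proof (rule integral_FTC_atLeastAtMost)
    show "((\<lambda>t. cis (of_int k * t) / (\<i> * of_int k)) has_vector_derivative cis (of_int k * x)) (at x within {0..2 * pi})"
      for x
    proof -
      have "((\<lambda>t. exp (\<i> * of_real (of_int k * t)) / (\<i> * of_int k)) has_vector_derivative
          (exp (\<i> * of_real (of_int k * x)) * (\<i> * of_int k)) / (\<i> * of_int k)) (at x within {0..2 * pi})"
        by (intro derivative_eq_intros has_vector_derivative_real_field | simp)+
          (use False in \<open>auto intro!: derivative_eq_intros simp: has_vector_derivative_def scaleR_conv_of_real mult.commute[of _ \<i>]\<close>)
      then show ?thesis using False by (simp add: cis_conv_exp)
    qed
    show "continuous_on {0..2 * pi} (\<lambda>t. cis (of_int k * t))"
      by (auto simp: cis_conv_exp intro!: continuous_intros)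
  qed simp
  also have "cis (of_int k * (2 * pi)) = 1"
    using cis_multiple_2pi[of "of_int k"] by (simp add: mult.commute)
  finally show ?thesis using False by simp
qed

lemma inverse_measurable_circle [measurable]: "inverse \<in> circle \<rightarrow>\<^sub>M circle"
proof -
  have "inverse \<in> restrict_space borel (sphere (0::complex) 1) \<rightarrow>\<^sub>M restrict_space borel (sphere 0 1)"
  proof (rule measurable_restrict_space2)
    have "continuous_on (sphere 0 1) (inverse :: complex \<Rightarrow> complex)" by (intro continuous_intros) auto
    then show "inverse \<in> borel_measurable (restrict_space borel (sphere (0::complex) 1))"
      by (rule borel_measurable_continuous_on_restrict)
  qed (auto simp: space_restrict_space norm_inverse)
  then show ?thesis by (simp cong: measurable_cong_sets add: sets_circle)
qed

text \<open>In terms of the angle, inversion is \<open>t \<mapsto> 2\<pi> - t\<close>, which preserves Lebesgue measure and the interval of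
  angles up to its end points.\<close>

lemma distr_circle_inverse: "distr circle circle inverse = circle"
proof (rule measure_eqI)
  fix A assume "A \<in> sets (distr circle circle inverse)"
  then have A: "A \<in> sets circle" by simp
  let ?f = "\<lambda>\<xi>. indicator A \<xi> :: ennreal"
  have f [measurable]: "?f \<in> borel_measurable circle" using A by simp
  have fi: "(\<lambda>\<xi>. ?f (inverse \<xi>)) \<in> borel_measurable circle" by measurable
  have f': "?f \<in> borel_measurable (restrict_space borel (sphere 0 1))"
    using f by (simp cong: measurable_cong_sets add: sets_circle)
  have fcis [measurable]: "(\<lambda>t. ?f (cis t)) \<in> borel_measurable borel"
    using measurable_compose[OF cis_measurable_circle f'] by simp
  have "emeasure (distr circle circle inverse) A = (\<integral>\<^sup>+\<xi>. ?f \<xi> \<partial>distr circle circle inverse)"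
    using A by simp
  also have "\<dots> = (\<integral>\<^sup>+\<xi>. ?f (inverse \<xi>) \<partial>circle)" by (rule nn_integral_distr) measurable
  also have "\<dots> = (\<integral>\<^sup>+t. ?f (inverse (cis t)) * indicator {0..<2 * pi} t \<partial>lborel)"
    by (rule nn_integral_circle[OF fi])
  also have "\<dots> = (\<integral>\<^sup>+t. ?f (cis (2 * pi + (-1) * t)) * indicator {0..<2 * pi} (2 * pi + (-1) * t) \<partial>lborel)"
  proof (rule nn_integral_cong_AE)
    have c: "cis (2 * pi - t) = inverse (cis t)" for t
      by (simp add: cis_inverse complex_eq_iff cos_diff sin_diff)
    have "AE t in lborel. t \<noteq> (0::real)" "AE t in lborel. t \<noteq> 2 * pi"
      by (rule AE_lborel_singleton)+
    then show "AE t in lborel. ?f (inverse (cis t)) * indicator {0..<2 * pi} t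
        = ?f (cis (2 * pi + (-1) * t)) * indicator {0..<2 * pi} (2 * pi + (-1) * t)"
      by eventually_elim (auto simp: indicator_def c)
  qed
  also have "\<dots> = (\<integral>\<^sup>+t. ?f (cis t) * indicator {0..<2 * pi} t \<partial>lborel)"
    using nn_integral_real_affine[of "\<lambda>t. ?f (cis t) * indicator {0..<2 * pi} t" "-1" "2 * pi"] by simp
  also have "\<dots> = (\<integral>\<^sup>+\<xi>. ?f \<xi> \<partial>circle)" by (rule nn_integral_circle[OF f, symmetric])
  also have "\<dots> = emeasure circle A" using A by simp
  finally show "emeasure (distr circle circle inverse) A = emeasure circle A" .
qed simp

section \<open>Fourier series with square integrable coefficients\<close>

lemma (in prehilbert) hlimit_tendsto_const_iff:
  "(\<And>n. X n \<in> carr S) \<Longrightarrow> hlimit S X x \<longleftrightarrow> x \<in> carr S \<and> (\<lambda>n. (hdist S (X n) x)\<^sup>2) \<longlonglongrightarrow> 0"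
proof -
  assume X: "\<And>n. X n \<in> carr S"
  have "(\<lambda>n. hdist S (X n) x) \<longlonglongrightarrow> 0" if x: "x \<in> carr S" and l: "(\<lambda>n. (hdist S (X n) x)\<^sup>2) \<longlonglongrightarrow> 0"
  proof -
    have "(\<lambda>n. sqrt ((hdist S (X n) x)\<^sup>2)) \<longlonglongrightarrow> sqrt 0" by (intro tendsto_real_sqrt l)
    then show ?thesis using X x by simp
  qed
  moreover have "(\<lambda>n. (hdist S (X n) x)\<^sup>2) \<longlonglongrightarrow> 0" if "(\<lambda>n. hdist S (X n) x) \<longlonglongrightarrow> 0"
    using tendsto_power[OF that, of 2] by simp
  ultimately show ?thesis by (auto simp: hlimit_def)
qed

lemma filterlim_symmetric_intervals:
  "filterlim (\<lambda>K. {- int K..int K}) (finite_subsets_at_top UNIV) sequentially"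
  unfolding filterlim_finite_subsets_at_top
proof (intro allI impI, elim conjE)
  fix F :: "int set" assume F: "finite F"
  define k where "k = nat (Max (insert 0 (abs ` F)))"
  show "\<forall>\<^sub>F K in sequentially. finite {- int K..int K} \<and> F \<subseteq> {- int K..int K} \<and> {- int K..int K} \<subseteq> UNIV"
  proof (intro eventually_sequentiallyI[of k])
    fix K assume "k \<le> K"
    moreover have "\<bar>n\<bar> \<le> Max (insert 0 (abs ` F))" if "n \<in> F" for n
      using F that by (intro Max_ge) auto
    ultimately show "finite {- int K..int K} \<and> F \<subseteq> {- int K..int K} \<and> {- int K..int K} \<subseteq> UNIV"
      by (fastforce simp: k_def)
  qed
qed

lemma has_sum_symmetric_limit:
  "(f has_sum s) UNIV \<Longrightarrow> (\<lambda>K. \<Sum>n = - int K..int K. f n) \<longlonglongrightarrow> s"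
  unfolding has_sum_def by (rule filterlim_compose[OF _ filterlim_symmetric_intervals])

lemma circle_cnj_powi: "\<xi> \<in> sphere 0 1 \<Longrightarrow> cnj (\<xi> powi m) = \<xi> powi (- m)"
proof -
  assume x: "\<xi> \<in> sphere 0 1"
  then have "\<xi> * cnj \<xi> = 1" by (simp flip: complex_norm_square)
  then have "cnj \<xi> = inverse \<xi>" by (metis inverse_unique)
  then show ?thesis by (cases "m \<ge> 0") (auto simp: power_int_def power_inverse)
qed

definition mode :: "('y \<Rightarrow> complex) \<Rightarrow> int \<Rightarrow> complex \<times> 'y \<Rightarrow> complex" where
  "mode f n = (\<lambda>(\<xi>, y). f y * \<xi> powi n)"

definition fsum :: "(int \<Rightarrow> 'y \<Rightarrow> complex) \<Rightarrow> int set \<Rightarrow> complex \<times> 'y \<Rightarrow> complex" where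
  "fsum h F = (\<lambda>(\<xi>, y). \<Sum>n\<in>F. h n y * \<xi> powi n)"

lemma fsum_empty: "fsum h {} = (\<lambda>_. 0)"
  by (simp add: fsum_def fun_eq_iff)

lemma fsum_insert: "finite F \<Longrightarrow> n \<notin> F \<Longrightarrow> fsum h (insert n F) = add (L2 M) (mode (h n) n) (fsum h F)"
  by (auto simp: fsum_def mode_def L2_add fun_eq_iff)

locale fourier = finite_measure M for M :: "'a measure"
begin

sublocale circ: pair_sigma_finite circle M ..

abbreviation P :: "(complex \<times> 'a) measure" where "P \<equiv> circle \<Otimes>\<^sub>M M"

lemma finite_measure_P: "finite_measure P"
  by (rule finite_measure_pair_measure) unfold_locales

sublocale P: finite_measure P by (rule finite_measure_P)

lemma space_P: "space P = sphere 0 1 \<times> space M"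
  by (simp add: space_pair_measure)

lemma mode_measurable:
  assumes [measurable]: "f \<in> borel_measurable M" shows "mode f n \<in> borel_measurable P"
  unfolding mode_def by measurable

lemma mode_L2:
  assumes f: "f \<in> carr (L2 M)" shows "mode f n \<in> carr (L2 P)"
proof -
  have fm [measurable]: "f \<in> borel_measurable M" using f by (simp add: carr_L2_iff)
  have [measurable]: "mode f n \<in> borel_measurable P" by (rule mode_measurable) measurable
  have i: "integrable M (\<lambda>y. (cmod (f y))\<^sup>2)" using f by (simp add: carr_L2_iff)
  have "integrable P (\<lambda>p. (cmod (mode f n p))\<^sup>2)"
  proof (rule circ.Fubini_integrable)
    have e: "(\<integral>y. norm ((cmod (mode f n (\<xi>, y)))\<^sup>2) \<partial>M) = (\<integral>y. (cmod (f y))\<^sup>2 \<partial>M)"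
      if "\<xi> \<in> space circle" for \<xi>
      using that by (simp add: mode_def norm_mult norm_power_int)
    have "integrable circle (\<lambda>\<xi>. (\<integral>y. norm ((cmod (mode f n (\<xi>, y)))\<^sup>2) \<partial>M))
        \<longleftrightarrow> integrable circle (\<lambda>\<xi>. (\<integral>y. (cmod (f y))\<^sup>2 \<partial>M))"
      using e by (intro Bochner_Integration.integrable_cong) auto
    then show "integrable circle (\<lambda>\<xi>. (\<integral>y. norm ((cmod (mode f n (\<xi>, y)))\<^sup>2) \<partial>M))" by simp
    show "AE \<xi> in circle. integrable M (\<lambda>y. (cmod (mode f n (\<xi>, y)))\<^sup>2)"
      by (intro AE_I2) (use i in \<open>simp add: mode_def norm_mult norm_power_int\<close>)
  qed measurable
  then show ?thesis by (simp add: carr_L2_iff)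
qed

lemma mode_ip:
  assumes f: "f \<in> carr (L2 M)" and g: "g \<in> carr (L2 M)"
  shows "ip (L2 P) (mode f n) (mode g m) = (if n = m then complex_of_real (2 * pi) * ip (L2 M) f g else 0)"
proof -
  have "ip (L2 P) (mode f n) (mode g m)
      = (\<integral>\<xi>. (\<integral>y. mode f n (\<xi>, y) * cnj (mode g m (\<xi>, y)) \<partial>M) \<partial>circle)"
    unfolding L2_ip by (rule circ.integral_fst'[symmetric]) (intro L2_product_integrable mode_L2 f g)
  also have "\<dots> = (\<integral>\<xi>. \<xi> powi (n - m) * ip (L2 M) f g \<partial>circle)"
  proof (rule Bochner_Integration.integral_cong)
    fix \<xi> assume "\<xi> \<in> space circle"
    then have x: "\<xi> \<in> sphere 0 1" "\<xi> \<noteq> 0" by auto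
    have "mode f n (\<xi>, y) * cnj (mode g m (\<xi>, y)) = \<xi> powi (n - m) * (f y * cnj (g y))" for y
      using x circle_cnj_powi[OF x(1), of m]
      by (simp add: mode_def power_int_diff power_int_minus field_simps)
    then show "(\<integral>y. mode f n (\<xi>, y) * cnj (mode g m (\<xi>, y)) \<partial>M) = \<xi> powi (n - m) * ip (L2 M) f g"
      by (simp add: L2_ip)
  qed simp
  also have "\<dots> = (\<integral>\<xi>. \<xi> powi (n - m) \<partial>circle) * ip (L2 M) f g" by simp
  finally show ?thesis by (simp add: integral_circle_powi)
qed

lemma fsum_L2:
  assumes h: "\<And>n. h n \<in> carr (L2 M)" and F: "finite F" shows "fsum h F \<in> carr (L2 P)"
  using F
proof induction
  case empty then show ?case by (simp add: fsum_empty carr_L2_iff)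
next
  case (insert n F)
  then show ?case by (subst fsum_insert[where M = P]) (auto intro: mode_L2 h)
qed

lemma mode_fsum_ip:
  assumes f: "f \<in> carr (L2 M)" and h: "\<And>n. h n \<in> carr (L2 M)" and F: "finite F"
  shows "ip (L2 P) (mode f n) (fsum h F) = (if n \<in> F then complex_of_real (2 * pi) * ip (L2 M) f (h n) else 0)"
  using F
proof induction
  case empty then show ?case by (simp add: fsum_empty L2_ip)
next
  case (insert m F)
  have "ip (L2 P) (mode f n) (fsum h (insert m F))
      = ip (L2 P) (mode f n) (mode (h m) m) + ip (L2 P) (mode f n) (fsum h F)"
    unfolding fsum_insert[OF insert.hyps, where M = P]
    by (intro L2.ip_add_right mode_L2 fsum_L2 f h insert.hyps)
  then show ?case using insert by (auto simp: mode_ip[OF f h])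
qed

lemma fsum_ip:
  assumes g: "\<And>n. g n \<in> carr (L2 M)" and h: "\<And>n. h n \<in> carr (L2 M)" and F: "finite F" and G: "finite G" "F \<subseteq> G"
  shows "ip (L2 P) (fsum g F) (fsum h G) = complex_of_real (2 * pi) * (\<Sum>n\<in>F. ip (L2 M) (g n) (h n))"
  using F G(2)
proof induction
  case empty then show ?case by (simp add: fsum_empty L2_ip)
next
  case (insert m F)
  have "ip (L2 P) (fsum g (insert m F)) (fsum h G)
      = ip (L2 P) (mode (g m) m) (fsum h G) + ip (L2 P) (fsum g F) (fsum h G)"
    unfolding fsum_insert[OF insert.hyps, where M = P]
    by (intro L2.ip_add_left mode_L2 fsum_L2 g h insert.hyps G)
  then show ?case using insert by (simp add: mode_fsum_ip[OF g h G(1)] distrib_left)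
qed

lemma fsum_hdist:
  assumes h: "\<And>n. h n \<in> carr (L2 M)" and FG: "finite G" "F \<subseteq> G"
  shows "(hdist (L2 P) (fsum h F) (fsum h G))\<^sup>2
    = 2 * pi * ((\<Sum>n\<in>G. (hnorm (L2 M) (h n))\<^sup>2) - (\<Sum>n\<in>F. (hnorm (L2 M) (h n))\<^sup>2))"
proof -
  have F: "finite F" using FG finite_subset by blast
  have s: "Re (ip (L2 P) (fsum h A) (fsum h B)) = 2 * pi * (\<Sum>n\<in>A. (hnorm (L2 M) (h n))\<^sup>2)"
    if "finite B" "A \<subseteq> B" for A B
  proof -
    have "finite A" using that finite_subset by blast
    then have "ip (L2 P) (fsum h A) (fsum h B) = complex_of_real (2 * pi) * (\<Sum>n\<in>A. ip (L2 M) (h n) (h n))"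
      using that h by (intro fsum_ip)
    also have "\<dots> = complex_of_real (2 * pi * (\<Sum>n\<in>A. (hnorm (L2 M) (h n))\<^sup>2))"
      by (simp add: L2.ip_self h)
    finally show ?thesis by simp
  qed
  show ?thesis
    unfolding L2.hdist_sq[OF fsum_L2[OF h F] fsum_L2[OF h FG(1)]]
    using s[OF FG] s[OF F order_refl] s[OF FG(1) order_refl]
    by (simp add: L2.hnorm_sq[OF fsum_L2[OF h F]] L2.hnorm_sq[OF fsum_L2[OF h FG(1)]] algebra_simps)
qed

lemma fourier_transform_fsum:
  "fourier_transform M h \<phi> \<longleftrightarrow> hlimit (L2 P) (\<lambda>K. fsum h {- int K..int K}) \<phi>"
  by (simp add: fourier_transform_def fsum_def)

lemma ell2_coord: "h \<in> carr (ell2 (L2 M)) \<Longrightarrow> h n \<in> carr (L2 M)"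
  by (simp add: L2.carr_ell2_iff)

lemma fourier_transform_exists:
  assumes h: "h \<in> carr (ell2 (L2 M))"
  shows "\<exists>\<phi>. fourier_transform M h \<phi>"
  unfolding fourier_transform_fsum
proof (rule hilbert_space_complete[OF P.hilbert_space_L2])
  note hc = ell2_coord[OF h]
  show "fsum h {- int K..int K} \<in> carr (L2 P)" for K using hc by (intro fsum_L2) auto
  define s where "s K = (\<Sum>n = - int K..int K. (hnorm (L2 M) (h n))\<^sup>2)" for K
  have "s \<longlonglongrightarrow> (hnorm (ell2 (L2 M)) h)\<^sup>2"
    unfolding s_def by (rule has_sum_symmetric_limit[OF L2.ell2_hnorm_has_sum[OF h]])
  then have cs: "Cauchy s" by (rule LIMSEQ_imp_Cauchy)
  show "hcauchy (L2 P) (\<lambda>K. fsum h {- int K..int K})"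
    unfolding hcauchy_def
  proof (intro allI impI)
    fix e :: real assume e: "e > 0"
    then have "e\<^sup>2 / (2 * pi) > 0" by simp
    then obtain K0 where K0: "\<And>K L. K \<ge> K0 \<Longrightarrow> L \<ge> K0 \<Longrightarrow> \<bar>s K - s L\<bar> < e\<^sup>2 / (2 * pi)"
      using cs unfolding Cauchy_def dist_real_def by blast
    have le: "hdist (L2 P) (fsum h {- int K..int K}) (fsum h {- int L..int L}) < e" if "K \<ge> K0" "L \<ge> K" for K L
    proof -
      have "(hdist (L2 P) (fsum h {- int K..int K}) (fsum h {- int L..int L}))\<^sup>2 = 2 * pi * (s L - s K)"
        unfolding s_def using that hc by (intro fsum_hdist) auto
      also have "\<dots> \<le> 2 * pi * \<bar>s L - s K\<bar>" by (intro mult_left_mono) auto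
      also have "\<dots> < 2 * pi * (e\<^sup>2 / (2 * pi))"
        using K0[of L K] that by (intro mult_strict_left_mono) auto
      also have "\<dots> = e\<^sup>2" by simp
      finally show ?thesis using e by (meson power2_less_imp_less less_imp_le)
    qed
    have "hdist (L2 P) (fsum h {- int K..int K}) (fsum h {- int L..int L}) < e" if "K \<ge> K0" "L \<ge> K0" for K L
    proof (cases "K \<le> L")
      case True then show ?thesis using le that by simp
    next
      case False
      then have "hdist (L2 P) (fsum h {- int L..int L}) (fsum h {- int K..int K}) < e" using le that by simp
      then show ?thesis
        using hc by (subst L2.hdist_commute) (auto intro!: fsum_L2)
    qed
    then show "\<exists>N. \<forall>m\<ge>N. \<forall>n\<ge>N. hdist (L2 P) (fsum h {- int m..int m}) (fsum h {- int n..int n}) < e"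
      by blast
  qed
qed

lemma fourier_transform_carr: "fourier_transform M h \<phi> \<Longrightarrow> \<phi> \<in> carr (L2 P)"
  by (simp add: fourier_transform_def hlimit_def)

text \<open>Parseval's identity, which follows from the orthogonality of the modes by continuity of inner products.\<close>

lemma fourier_transform_ip:
  assumes h: "h \<in> carr (ell2 (L2 M))" and g: "g \<in> carr (ell2 (L2 M))"
    and \<phi>: "fourier_transform M h \<phi>" and \<psi>: "fourier_transform M g \<psi>"
  shows "ip (L2 P) \<phi> \<psi> = complex_of_real (2 * pi) * ip (ell2 (L2 M)) h g"
proof (rule LIMSEQ_unique)
  show "(\<lambda>K. ip (L2 P) (fsum h {- int K..int K}) (fsum g {- int K..int K})) \<longlonglongrightarrow> ip (L2 P) \<phi> \<psi>"
    using \<phi> \<psi> unfolding fourier_transform_fsum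
    by (rule L2.hlimit_ip) (auto intro!: fsum_L2 ell2_coord h g)
  have "(\<lambda>K. complex_of_real (2 * pi) * (\<Sum>n = - int K..int K. ip (L2 M) (h n) (g n)))
      \<longlonglongrightarrow> complex_of_real (2 * pi) * ip (ell2 (L2 M)) h g"
    by (intro tendsto_mult tendsto_const has_sum_symmetric_limit[OF L2.ell2_ip_has_sum[OF h g]])
  then show "(\<lambda>K. ip (L2 P) (fsum h {- int K..int K}) (fsum g {- int K..int K}))
      \<longlonglongrightarrow> complex_of_real (2 * pi) * ip (ell2 (L2 M)) h g"
    by (subst fsum_ip) (auto intro!: ell2_coord h g)
qed

interpretation E: prehilbert "ell2 (L2 M)" by (rule L2.prehilbert_ell2)

lemma fourier_transform_hdist:
  assumes h: "h \<in> carr (ell2 (L2 M))" and g: "g \<in> carr (ell2 (L2 M))"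
    and \<phi>: "fourier_transform M h \<phi>" and \<psi>: "fourier_transform M g \<psi>"
  shows "(hdist (L2 P) \<phi> \<psi>)\<^sup>2 = 2 * pi * (hdist (ell2 (L2 M)) h g)\<^sup>2"
  using h g fourier_transform_carr[OF \<phi>] fourier_transform_carr[OF \<psi>]
  by (simp add: L2.hdist_sq E.hdist_sq L2.hnorm_sq E.hnorm_sq fourier_transform_ip[OF h h \<phi> \<phi>]
      fourier_transform_ip[OF g g \<psi> \<psi>] fourier_transform_ip[OF h g \<phi> \<psi>] algebra_simps)

lemma fourier_transform_cong:
  assumes \<phi>: "fourier_transform M h \<phi>" and h: "\<And>n. h n \<in> carr (L2 M)" and g: "\<And>n. g n \<in> carr (L2 M)"
    and hg: "\<And>n. heq (L2 M) (h n) (g n)" and \<psi>: "\<psi> \<in> carr (L2 P)" "heq (L2 P) \<phi> \<psi>"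
  shows "fourier_transform M g \<psi>"
proof -
  have e: "heq (L2 P) (fsum h F) (fsum g F)" if F: "finite F" for F
    using F
  proof induction
    case empty then show ?case by (simp add: fsum_empty carr_L2_iff)
  next
    case (insert n F)
    have m: "heq (L2 P) (mode (h n) n) (mode (g n) n)"
    proof -
      define d where "d = (\<lambda>y. h n y - g n y)"
      have d: "d \<in> carr (L2 M)" unfolding d_def by (rule L2_diff_closed[OF h g])
      have "hnorm (L2 M) d = 0" using hg[of n] by (simp add: heq_def L2_hdist d_def)
      then have "(hnorm (L2 P) (mode d n))\<^sup>2 = 0"
        unfolding L2.hnorm_sq[OF mode_L2[OF d]] mode_ip[OF d d] by (simp add: L2.ip_self[OF d])
      moreover have "(\<lambda>p. mode (h n) n p - mode (g n) n p) = mode d n"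
        by (auto simp: mode_def d_def fun_eq_iff algebra_simps)
      ultimately show ?thesis by (simp add: heq_def L2_hdist)
    qed
    have "heq (L2 P) (add (L2 P) (mode (h n) n) (fsum h F)) (add (L2 P) (mode (g n) n) (fsum g F))"
      using insert by (intro L2.heq_add m mode_L2 fsum_L2 h g) auto
    then show ?case using insert by (simp add: fsum_insert[where M = P])
  qed
  have "hlimit (L2 P) (\<lambda>K. fsum h {- int K..int K}) \<psi>"
    using \<phi> \<psi> unfolding fourier_transform_fsum by (elim L2.hlimit_heq) (auto intro!: fsum_L2 h)
  moreover have "hdist (L2 P) (fsum g {- int K..int K}) \<psi> = hdist (L2 P) (fsum h {- int K..int K}) \<psi>" for K
    using h g \<psi> by (intro L2.heq_hdist L2.heq_sym[OF e] L2.heq_refl) (auto intro!: fsum_L2)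
  ultimately show ?thesis by (simp add: fourier_transform_fsum hlimit_def)
qed

lemma powi_times_L2:
  assumes \<phi>: "\<phi> \<in> carr (L2 P)" shows "(\<lambda>p. \<phi> p * fst p powi k) \<in> carr (L2 P)"
proof -
  have [measurable]: "\<phi> \<in> borel_measurable P" using \<phi> by (simp add: carr_L2_iff)
  have "integrable P (\<lambda>p. (cmod (\<phi> p * fst p powi k))\<^sup>2) \<longleftrightarrow> integrable P (\<lambda>p. (cmod (\<phi> p))\<^sup>2)"
    by (intro Bochner_Integration.integrable_cong) (auto simp: space_P norm_mult norm_power_int)
  then show ?thesis using \<phi> by (simp add: carr_L2_iff)
qed

text \<open>Taking the \<open>n\<close>-th coefficient is continuous from \<open>L\<^sup>2\<close> of the product to \<open>L\<^sup>1\<close>, and it is constant along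
  the partial sums from the \<open>n\<close>-th on. This makes sense for almost every \<open>y\<close> only, since sections of an
  element of \<open>L\<^sup>2\<close> are integrable almost surely.\<close>

lemma fourier_coefficient:
  assumes h: "h \<in> carr (ell2 (L2 M))" and \<phi>: "fourier_transform M h \<phi>"
  shows "AE y in M. h n y = 1 / complex_of_real (2 * pi) * (\<integral>\<xi>. \<phi> (\<xi>, y) * \<xi> powi (- n) \<partial>circle)"
proof -
  note hc = ell2_coord[OF h]
  note \<phi>c = fourier_transform_carr[OF \<phi>]
  let ?S = "\<lambda>K. fsum h {- int K..int K}"
  have Sc: "?S K \<in> carr (L2 P)" for K by (intro fsum_L2 hc) auto
  define c where "c \<psi> y = (\<integral>\<xi>. \<psi> (\<xi>, y) * \<xi> powi (- n) \<partial>circle)" for \<psi> :: "complex \<times> 'a \<Rightarrow> complex" and y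
  have int: "integrable P (\<lambda>(\<xi>, y). \<psi> (\<xi>, y) * \<xi> powi (- n))" if "\<psi> \<in> carr (L2 P)" for \<psi>
    using P.L2_L1(1)[OF powi_times_L2[OF that]] by (simp add: case_prod_unfold)
  have ae: "AE y in M. integrable circle (\<lambda>\<xi>. \<psi> (\<xi>, y) * \<xi> powi (- n))" if "\<psi> \<in> carr (L2 P)" for \<psi>
    using circ.AE_integrable_snd[OF int[OF that]] by simp
  have cint: "integrable M (c \<psi>)" if "\<psi> \<in> carr (L2 P)" for \<psi>
    using circ.integrable_snd[OF int[OF that]] unfolding c_def .
  have cb: "(\<integral>y. cmod (c \<psi> y) \<partial>M) \<le> sqrt (measure P (space P)) * hnorm (L2 P) \<psi>" if \<psi>: "\<psi> \<in> carr (L2 P)" for \<psi>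
  proof -
    have i1: "integrable P (\<lambda>(\<xi>, y). cmod (\<psi> (\<xi>, y)))"
      using P.L2_L1(1)[OF \<psi>] by (simp add: case_prod_unfold)
    have "(\<integral>y. cmod (c \<psi> y) \<partial>M) \<le> (\<integral>y. (\<integral>\<xi>. cmod (\<psi> (\<xi>, y)) \<partial>circle) \<partial>M)"
    proof (rule integral_mono_AE)
      show "integrable M (\<lambda>y. cmod (c \<psi> y))" using cint[OF \<psi>] by simp
      show "integrable M (\<lambda>y. \<integral>\<xi>. cmod (\<psi> (\<xi>, y)) \<partial>circle)" by (rule circ.integrable_snd[OF i1])
      show "AE y in M. cmod (c \<psi> y) \<le> (\<integral>\<xi>. cmod (\<psi> (\<xi>, y)) \<partial>circle)"
      proof (intro AE_I2)
        fix y
        have "cmod (c \<psi> y) \<le> (\<integral>\<xi>. cmod (\<psi> (\<xi>, y) * \<xi> powi (- n)) \<partial>circle)"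
          unfolding c_def by (rule integral_norm_bound)
        also have "\<dots> = (\<integral>\<xi>. cmod (\<psi> (\<xi>, y)) \<partial>circle)"
          by (intro Bochner_Integration.integral_cong) (auto simp: norm_mult norm_power_int)
        finally show "cmod (c \<psi> y) \<le> (\<integral>\<xi>. cmod (\<psi> (\<xi>, y)) \<partial>circle)" .
      qed
    qed
    also have "\<dots> = (\<integral>p. cmod (\<psi> p) \<partial>P)" using circ.integral_snd[OF i1] by (simp add: case_prod_unfold)
    also have "\<dots> \<le> sqrt (measure P (space P)) * hnorm (L2 P) \<psi>" by (rule P.L2_L1(2)[OF \<psi>])
    finally show ?thesis .
  qed
  have cS: "c (?S K) y = complex_of_real (2 * pi) * h n y" if "K \<ge> nat \<bar>n\<bar>" for K y
  proof -
    have "c (?S K) y = (\<integral>\<xi>. (\<Sum>m = - int K..int K. h m y * \<xi> powi (m - n)) \<partial>circle)"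
      unfolding c_def fsum_def
    proof (rule Bochner_Integration.integral_cong)
      fix \<xi> assume "\<xi> \<in> space circle"
      then have "\<xi> \<noteq> 0" by auto
      then show "(case (\<xi>, y) of (\<xi>, y) \<Rightarrow> \<Sum>m = - int K..int K. h m y * \<xi> powi m) * \<xi> powi (- n)
          = (\<Sum>m = - int K..int K. h m y * \<xi> powi (m - n))"
        unfolding prod.case sum_distrib_right
        by (intro sum.cong) (simp_all add: power_int_diff power_int_minus divide_inverse)
    qed simp
    also have "\<dots> = (\<Sum>m = - int K..int K. h m y * (\<integral>\<xi>. \<xi> powi (m - n) \<partial>circle))"
    proof (subst Bochner_Integration.integral_sum)
      show "integrable circle (\<lambda>\<xi>. h m y * \<xi> powi (m - n))" for m
        by (intro integrable_mult_right circle.integrable_const_bound[where B = 1]) (auto simp: norm_power_int)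
    qed simp
    also have "\<dots> = (\<Sum>m = - int K..int K. if m = n then complex_of_real (2 * pi) * h n y else 0)"
      by (intro sum.cong) (auto simp: integral_circle_powi)
    also have "\<dots> = complex_of_real (2 * pi) * h n y"
    proof -
      have "n \<in> {- int K..int K}" using that by auto
      then show ?thesis by (simp only: sum.delta finite_atLeastAtMost_int if_True)
    qed
    finally show ?thesis .
  qed
  have bound: "(\<integral>y. cmod (c \<phi> y - complex_of_real (2 * pi) * h n y) \<partial>M)
      \<le> sqrt (measure P (space P)) * hdist (L2 P) (?S K) \<phi>" if K: "K \<ge> nat \<bar>n\<bar>" for K
  proof -
    have d: "(\<lambda>p. \<phi> p - ?S K p) \<in> carr (L2 P)" by (rule L2_diff_closed[OF \<phi>c Sc])
    have "AE y in M. c (\<lambda>p. \<phi> p - ?S K p) y = c \<phi> y - complex_of_real (2 * pi) * h n y"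
      using ae[OF \<phi>c] ae[OF Sc[of K]]
    proof eventually_elim
      case (elim y)
      have "c (\<lambda>p. \<phi> p - ?S K p) y = c \<phi> y - c (?S K) y"
        unfolding c_def using elim by (simp add: left_diff_distrib)
      then show ?case using cS[OF K] by simp
    qed
    then have "(\<integral>y. cmod (c \<phi> y - complex_of_real (2 * pi) * h n y) \<partial>M) = (\<integral>y. cmod (c (\<lambda>p. \<phi> p - ?S K p) y) \<partial>M)"
      using cint[OF d] cint[OF \<phi>c] hc[of n]
      by (intro integral_cong_AE) (auto dest!: borel_measurable_integrable L2_measurable)
    also have "\<dots> \<le> sqrt (measure P (space P)) * hnorm (L2 P) (\<lambda>p. \<phi> p - ?S K p)" by (rule cb[OF d])
    also have "hnorm (L2 P) (\<lambda>p. \<phi> p - ?S K p) = hdist (L2 P) (?S K) \<phi>"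
      using L2.hdist_commute[OF \<phi>c Sc[of K]] by (simp add: L2_hdist)
    finally show ?thesis .
  qed
  have "(\<lambda>K. sqrt (measure P (space P)) * hdist (L2 P) (?S K) \<phi>) \<longlonglongrightarrow> sqrt (measure P (space P)) * 0"
    using \<phi> unfolding fourier_transform_fsum by (intro tendsto_mult tendsto_const) (simp add: hlimit_def)
  then have "(\<integral>y. cmod (c \<phi> y - complex_of_real (2 * pi) * h n y) \<partial>M) \<le> 0"
    by (intro LIMSEQ_le_const[where X = "\<lambda>K. sqrt (measure P (space P)) * hdist (L2 P) (?S K) \<phi>"])
      (use bound in auto)
  moreover have i: "integrable M (\<lambda>y. c \<phi> y - complex_of_real (2 * pi) * h n y)"
    using cint[OF \<phi>c] L2_L1(1)[OF hc[of n]] by simp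
  ultimately have "(\<integral>y. cmod (c \<phi> y - complex_of_real (2 * pi) * h n y) \<partial>M) = 0"
    by (intro antisym) (auto intro: integral_nonneg_AE)
  then have "AE y in M. cmod (c \<phi> y - complex_of_real (2 * pi) * h n y) = 0"
    using i by (subst (asm) integral_nonneg_eq_0_iff_AE) auto
  then show ?thesis by eventually_elim (simp add: c_def field_simps)
qed

text \<open>For finitely supported data the transform is known by a formula at every point; dominated convergence
  turns pointwise summation into summation in \<open>L\<^sup>2\<close>.\<close>

lemma fourier_transform_pointwise:
  assumes hm: "\<And>n. h n \<in> borel_measurable M" and b: "b summable_on UNIV"
    and hb: "\<And>n y. y \<in> space M \<Longrightarrow> cmod (h n y) \<le> b n"
    and hs: "\<And>\<xi> y. \<xi> \<in> sphere 0 1 \<Longrightarrow> y \<in> space M \<Longrightarrow> ((\<lambda>n. h n y * \<xi> powi n) has_sum \<phi> (\<xi>, y)) UNIV"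
  shows "fourier_transform M h \<phi>"
proof -
  have hc: "h n \<in> carr (L2 M)" for n using hm hb by (rule L2_bounded)
  have Sc: "fsum h {- int K..int K} \<in> carr (L2 P)" for K by (intro fsum_L2 hc) auto
  have [measurable]: "fsum h {- int K..int K} \<in> borel_measurable P" for K by (rule L2_measurable[OF Sc])
  define B where "B = infsum b UNIV"
  have tb: "cmod (h n y * \<xi> powi n) \<le> b n" if "\<xi> \<in> sphere 0 1" "y \<in> space M" for \<xi> y n
    using hb[OF that(2)] that(1) by (simp add: norm_mult norm_power_int)
  have Sb: "cmod (fsum h {- int K..int K} (\<xi>, y)) \<le> B" if p: "\<xi> \<in> sphere 0 1" "y \<in> space M" for K \<xi> y
  proof -
    have nn: "0 \<le> b n" for n using tb[OF p, of n] norm_ge_zero order_trans by blast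
    have "cmod (fsum h {- int K..int K} (\<xi>, y)) \<le> (\<Sum>n = - int K..int K. b n)"
      unfolding fsum_def using tb[OF p] by (auto intro: sum_norm_le)
    also have "\<dots> \<le> B" unfolding B_def using nn by (intro finite_sum_le_infsum b) auto
    finally show ?thesis .
  qed
  have lim: "(\<lambda>K. fsum h {- int K..int K} (\<xi>, y)) \<longlonglongrightarrow> \<phi> (\<xi>, y)" if p: "\<xi> \<in> sphere 0 1" "y \<in> space M" for \<xi> y
    using has_sum_symmetric_limit[OF hs[OF p]] by (simp add: fsum_def)
  have \<phi>m [measurable]: "\<phi> \<in> borel_measurable P"
  proof (rule borel_measurable_LIMSEQ_metric)
    show "fsum h {- int K..int K} \<in> borel_measurable P" for K by measurable
    show "(\<lambda>K. fsum h {- int K..int K} p) \<longlonglongrightarrow> \<phi> p" if "p \<in> space P" for p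
      using that lim by (cases p) (simp add: space_P)
  qed
  have \<phi>b: "cmod (\<phi> (\<xi>, y)) \<le> B" if p: "\<xi> \<in> sphere 0 1" "y \<in> space M" for \<xi> y
    by (rule LIMSEQ_le_const2[OF tendsto_norm[OF lim[OF p]]]) (use Sb[OF p] in auto)
  have \<phi>c: "\<phi> \<in> carr (L2 P)"
    by (rule P.L2_bounded[OF \<phi>m, where B = B]) (use \<phi>b in \<open>auto simp: space_P\<close>)
  have "(\<lambda>K. (\<integral>p. (cmod (fsum h {- int K..int K} p - \<phi> p))\<^sup>2 \<partial>P)) \<longlonglongrightarrow> (\<integral>p. 0 \<partial>P)"
  proof (rule integral_dominated_convergence[where w = "\<lambda>_. (2 * B)\<^sup>2"])
    show "AE p in P. (\<lambda>K. (cmod (fsum h {- int K..int K} p - \<phi> p))\<^sup>2) \<longlonglongrightarrow> 0"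
    proof (intro AE_I2)
      fix p assume "p \<in> space P"
      then obtain \<xi> y where p: "p = (\<xi>, y)" "\<xi> \<in> sphere 0 1" "y \<in> space M" by (auto simp: space_P)
      have "(\<lambda>K. (cmod (fsum h {- int K..int K} p - \<phi> p))\<^sup>2) \<longlonglongrightarrow> (cmod (\<phi> p - \<phi> p))\<^sup>2"
        unfolding p(1) by (intro tendsto_intros lim p)
      then show "(\<lambda>K. (cmod (fsum h {- int K..int K} p - \<phi> p))\<^sup>2) \<longlonglongrightarrow> 0" by simp
    qed
    show "AE p in P. norm ((cmod (fsum h {- int K..int K} p - \<phi> p))\<^sup>2) \<le> (2 * B)\<^sup>2" for K
    proof (intro AE_I2)
      fix p assume "p \<in> space P"
      then obtain \<xi> y where p: "p = (\<xi>, y)" "\<xi> \<in> sphere 0 1" "y \<in> space M" by (auto simp: space_P)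
      have "cmod (fsum h {- int K..int K} p - \<phi> p) \<le> B + B"
        unfolding p(1) by (rule order_trans[OF norm_triangle_ineq4]) (intro add_mono Sb \<phi>b p)
      then have "(cmod (fsum h {- int K..int K} p - \<phi> p))\<^sup>2 \<le> (B + B)\<^sup>2" by (intro power_mono) auto
      then show "norm ((cmod (fsum h {- int K..int K} p - \<phi> p))\<^sup>2) \<le> (2 * B)\<^sup>2" by simp
    qed
  qed (auto)
  then have "(\<lambda>K. (hdist (L2 P) (fsum h {- int K..int K}) \<phi>)\<^sup>2) \<longlonglongrightarrow> 0"
    by (simp add: L2_hdist_sq[OF Sc \<phi>c])
  then show ?thesis
    unfolding fourier_transform_fsum
    using L2.hlimit_tendsto_const_iff[of "\<lambda>K. fsum h {- int K..int K}" P \<phi>] Sc \<phi>c by blast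
qed

definition reflect :: "(complex \<times> 'a \<Rightarrow> complex) \<Rightarrow> complex \<times> 'a \<Rightarrow> complex" where
  "reflect \<phi> = (\<lambda>(\<xi>, y). \<phi> (inverse \<xi>, y))"

lemma reflect_reflect: "reflect (reflect \<phi>) = \<phi>"
  by (simp add: reflect_def fun_eq_iff)

lemma distr_reflect: "distr P P (\<lambda>(\<xi>, y). (inverse \<xi>, y)) = P"
proof -
  have "distr circle circle inverse \<Otimes>\<^sub>M distr M M (\<lambda>y. y) = distr P P (\<lambda>(\<xi>, y). (inverse \<xi>, y))"
    by (rule pair_measure_distr) (auto simp: distr_id intro: sigma_finite_measure_axioms)
  then show ?thesis by (simp add: distr_circle_inverse distr_id)
qed

lemma reflect_L2:
  assumes \<phi>: "\<phi> \<in> carr (L2 P)"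
  shows "reflect \<phi> \<in> carr (L2 P)" "hnorm (L2 P) (reflect \<phi>) = hnorm (L2 P) \<phi>"
proof -
  have m [measurable]: "\<phi> \<in> borel_measurable P" by (rule L2_measurable[OF \<phi>])
  have r [measurable]: "(\<lambda>(\<xi>, y). (inverse \<xi>, y)) \<in> P \<rightarrow>\<^sub>M P" by measurable
  have "(\<lambda>p. \<phi> (case p of (\<xi>, y) \<Rightarrow> (inverse \<xi>, y))) \<in> borel_measurable P"
    by (rule measurable_compose[OF r m])
  then have rm: "reflect \<phi> \<in> borel_measurable P" by (simp add: reflect_def case_prod_unfold)
  have "integrable (distr P P (\<lambda>(\<xi>, y). (inverse \<xi>, y))) (\<lambda>p. (cmod (\<phi> p))\<^sup>2)"
    using \<phi> by (simp add: distr_reflect carr_L2_iff)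
  from integrable_distr[OF r this]
  show c: "reflect \<phi> \<in> carr (L2 P)" using rm by (simp add: carr_L2_iff reflect_def case_prod_unfold)
  have "(\<integral>p. (cmod (\<phi> p))\<^sup>2 \<partial>P) = (\<integral>p. (cmod (\<phi> p))\<^sup>2 \<partial>distr P P (\<lambda>(\<xi>, y). (inverse \<xi>, y)))"
    by (simp add: distr_reflect)
  also have "\<dots> = (\<integral>p. (cmod (reflect \<phi> p))\<^sup>2 \<partial>P)"
    by (subst integral_distr[OF r]) (auto simp: reflect_def case_prod_unfold)
  finally have "(hnorm (L2 P) (reflect \<phi>))\<^sup>2 = (hnorm (L2 P) \<phi>)\<^sup>2" by (simp add: L2_hnorm_sq c \<phi>)
  then show "hnorm (L2 P) (reflect \<phi>) = hnorm (L2 P) \<phi>"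
    using L2.hnorm_nonneg[OF c] L2.hnorm_nonneg[OF \<phi>] by (simp add: power2_eq_iff_nonneg)
qed

lemma reflect_hdist:
  assumes "\<phi> \<in> carr (L2 P)" "\<psi> \<in> carr (L2 P)"
  shows "hdist (L2 P) (reflect \<phi>) (reflect \<psi>) = hdist (L2 P) \<phi> \<psi>"
proof -
  have "(\<lambda>p. reflect \<phi> p - reflect \<psi> p) = reflect (\<lambda>p. \<phi> p - \<psi> p)"
    by (simp add: reflect_def fun_eq_iff)
  then show ?thesis using reflect_L2(2)[OF L2_diff_closed[OF assms]] by (simp add: L2_hdist)
qed

end

section \<open>Distances in a regular tree\<close>

text \<open>When a step returns to a vertex of the path, the loop is cut off.\<close>

lemma rtranclp_distinct_path:
  assumes "r\<^sup>*\<^sup>* x y"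
  shows "\<exists>xs. xs \<noteq> [] \<and> hd xs = x \<and> last xs = y \<and> distinct xs \<and> successively r xs"
  using assms
proof induction
  case base
  then show ?case by (intro exI[of _ "[x]"]) simp
next
  case (step y z)
  then obtain xs where xs: "xs \<noteq> []" "hd xs = x" "last xs = y" "distinct xs" "successively r xs" by blast
  show ?case
  proof (cases "z \<in> set xs")
    case True
    then obtain as bs where "xs = as @ z # bs" by (meson split_list)
    then show ?thesis using xs
      by (intro exI[of _ "as @ [z]"]) (auto simp: successively_append_iff hd_append)
  next
    case False
    then show ?thesis using xs step.hyps
      by (intro exI[of _ "xs @ [z]"]) (auto simp: successively_append_iff)
  qed
qed

locale reg_tree =
  fixes q :: nat and adj :: "'v \<Rightarrow> 'v \<Rightarrow> bool"
  assumes tree: "regular_tree q adj"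
begin

abbreviation d :: "'v \<Rightarrow> 'v \<Rightarrow> nat" where "d \<equiv> tdist adj"

lemma adj_sym: "adj v w \<Longrightarrow> adj w v"
  and adj_irrefl: "\<not> adj v v"
  and connected: "adj\<^sup>*\<^sup>* v w"
  and acyclic: "\<not> (\<exists>xs. length xs \<ge> 3 \<and> distinct xs \<and> successively adj xs \<and> adj (last xs) (hd xs))"
  and finite_nbrs [simp]: "finite {w. adj v w}"
  and card_nbrs: "card {w. adj v w} = q + 1"
  using tree unfolding regular_tree_def by blast+

lemma relpow_tdist: "(adj ^^ d v w) v w"
  unfolding tdist_def by (rule LeastI_ex) (use connected in \<open>auto dest: rtranclp_imp_relpowp\<close>)

lemma tdist_le: "(adj ^^ n) v w \<Longrightarrow> d v w \<le> n"
  unfolding tdist_def by (rule Least_le)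

lemma d_refl [simp]: "d v v = 0"
  using tdist_le[of 0 v v] by simp

lemma d_eq_0_iff [simp]: "d v w = 0 \<longleftrightarrow> v = w"
  using relpow_tdist[of v w] by (auto intro: ccontr)

lemma relpow_sym: "(adj ^^ n) v w \<Longrightarrow> (adj ^^ n) w v"
proof (induction n arbitrary: w)
  case (Suc n)
  then obtain u where "(adj ^^ n) v u" "adj u w" by auto
  then show ?case using Suc.IH adj_sym by (meson relpowp_Suc_I2)
qed simp

lemma d_sym: "d v w = d w v"
  by (rule antisym) (rule tdist_le, rule relpow_sym, rule relpow_tdist)+

lemma d_triangle: "d u w \<le> d u v + d v w"
proof (rule tdist_le)
  have "((adj ^^ d u v) OO (adj ^^ d v w)) u w" using relpow_tdist by blast
  then show "(adj ^^ (d u v + d v w)) u w" by (simp add: relpowp_add)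
qed

lemma d_adj: "adj v w \<Longrightarrow> d v w = 1"
proof -
  assume a: "adj v w"
  then have "(adj ^^ Suc 0) v w" by (simp add: eq_OO)
  then have "d v w \<le> 1" using tdist_le[of "Suc 0" v w] by simp
  moreover have "v \<noteq> w" using a adj_irrefl by blast
  ultimately show ?thesis using d_eq_0_iff[of v w] by linarith
qed

lemma d_adj_le: "adj v w \<Longrightarrow> d x w \<le> d x v + 1"
  using d_triangle[of x w v] d_adj[of v w] by simp

lemma closer_nbr:
  assumes "v \<noteq> x"
  obtains w where "adj v w" "d x v = d x w + 1"
proof -
  obtain n where n: "d x v = Suc n" using assms d_eq_0_iff[of x v] by (metis not0_implies_Suc)
  then have "(adj ^^ Suc n) x v" using relpow_tdist[of x v] by simp
  then obtain w where w: "(adj ^^ n) x w" "adj w v" by auto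
  have "d x w \<le> n" using w by (intro tdist_le)
  moreover have "d x v \<le> d x w + 1" using d_adj_le[OF w(2)] .
  ultimately have "d x v = d x w + 1" using n by linarith
  then show ?thesis using that w(2) adj_sym by blast
qed

text \<open>Otherwise a path from \<open>w1\<close> to \<open>w2\<close> that avoids \<open>v\<close> would close up to a cycle through \<open>v\<close>.\<close>

lemma nbrs_separated:
  assumes v: "adj v w1" "adj v w2" "w1 \<noteq> w2"
  shows "\<not> (\<lambda>a b. adj a b \<and> a \<noteq> v \<and> b \<noteq> v)\<^sup>*\<^sup>* w1 w2"
proof
  let ?R = "\<lambda>a b. adj a b \<and> a \<noteq> v \<and> b \<noteq> v"
  assume "?R\<^sup>*\<^sup>* w1 w2"
  then obtain xs where xs: "xs \<noteq> []" "hd xs = w1" "last xs = w2" "distinct xs" "successively ?R xs"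
    using rtranclp_distinct_path[of ?R] by blast
  have w1v: "w1 \<noteq> v" using v adj_irrefl by blast
  have nv: "v \<notin> set xs"
  proof -
    have "successively ?R ys \<Longrightarrow> ys \<noteq> [] \<Longrightarrow> hd ys \<noteq> v \<Longrightarrow> v \<notin> set ys" for ys
      by (induction ys rule: induct_list012) auto
    then show ?thesis using xs w1v by blast
  qed
  have sa: "successively adj xs" using xs(5) by (rule successively_mono) auto
  have "length xs \<ge> 2" using xs v(3) by (cases xs rule: remdups_adj.cases) auto
  then have "length (xs @ [v]) \<ge> 3" by simp
  moreover have "distinct (xs @ [v])" using xs nv by simp
  moreover have "successively adj (xs @ [v])" using sa xs v adj_sym by (auto simp: successively_append_iff)
  moreover have "adj (last (xs @ [v])) (hd (xs @ [v]))" using xs v by simp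
  ultimately show False using acyclic by blast
qed

lemma descend_avoiding:
  assumes "d x w \<le> d x v" "w \<noteq> v"
  shows "(\<lambda>a b. adj a b \<and> a \<noteq> v \<and> b \<noteq> v)\<^sup>*\<^sup>* w x \<or> v = x"
  using assms
proof (induction "d x w" arbitrary: w)
  case 0 then show ?case by auto
next
  case (Suc n)
  then have "w \<noteq> x" by auto
  then obtain u where u: "adj w u" "d x w = d x u + 1" by (rule closer_nbr)
  then have "u \<noteq> v" "d x u \<le> d x v" "n = d x u" using Suc by auto
  then have "(\<lambda>a b. adj a b \<and> a \<noteq> v \<and> b \<noteq> v)\<^sup>*\<^sup>* u x \<or> v = x" using Suc.hyps(1) by blast
  then show ?case using u \<open>u \<noteq> v\<close> Suc.prems by (auto intro: converse_rtranclp_into_rtranclp)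
qed

text \<open>Two such neighbours are joined to \<open>x\<close>, hence to each other, by descending paths that avoid \<open>v\<close>. The
  weak inequality also excludes neighbours at the same distance, so the tree is bipartite.\<close>

lemma closer_unique:
  assumes w: "adj v w1" "d x w1 \<le> d x v" "adj v w2" "d x w2 \<le> d x v"
  shows "w1 = w2"
proof (rule ccontr)
  assume ne: "w1 \<noteq> w2"
  let ?R = "\<lambda>a b. adj a b \<and> a \<noteq> v \<and> b \<noteq> v"
  have nv: "w1 \<noteq> v" "w2 \<noteq> v" using w adj_irrefl by blast+
  have "v \<noteq> x" using w nv by auto
  then have 1: "?R\<^sup>*\<^sup>* w1 x" and 2: "?R\<^sup>*\<^sup>* w2 x" using descend_avoiding w nv by blast+
  have "symp ?R" using adj_sym by (auto intro: sympI)
  from sympD[OF symp_rtranclp[OF this] 2] have "?R\<^sup>*\<^sup>* x w2" .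
  then show False using 1 nbrs_separated[OF w(1,3) ne] by (meson rtranclp_trans)
qed

lemma farther:
  assumes "adj v w" "adj v u" "d x u \<le> d x v" "w \<noteq> u"
  shows "d x w = d x v + 1"
  using closer_unique[of v w x u] d_adj_le[of v w x] assms by force

lemma adj_levels: "adj v w \<Longrightarrow> d x w = d x v + 1 \<or> d x v = d x w + 1"
proof -
  assume a: "adj v w"
  show ?thesis
  proof (cases "v = x")
    case True then show ?thesis using d_adj[OF a] by simp
  next
    case False
    then obtain u where u: "adj v u" "d x v = d x u + 1" by (rule closer_nbr)
    then show ?thesis using farther[OF a u(1)] by (cases "w = u") auto
  qed
qed

section \<open>Non-backtracking paths\<close>

lemma nb_adj: "\<gamma> \<in> nb_paths adj \<Longrightarrow> adj (\<gamma> n) (\<gamma> (Suc n))"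
  by (simp add: nb_paths_def)

lemma nb_ne: "\<gamma> \<in> nb_paths adj \<Longrightarrow> \<gamma> (Suc (Suc n)) \<noteq> \<gamma> n"
  by (simp add: nb_paths_def)

text \<open>Once the path has moved away from \<open>x\<close>, the vertex just left is the only neighbour closer to \<open>x\<close>, and
  the path may not return to it.\<close>

lemma nb_increasing:
  assumes g: "\<gamma> \<in> nb_paths adj" and i: "d x (\<gamma> (Suc n)) = d x (\<gamma> n) + 1"
  shows "d x (\<gamma> (n + k)) = d x (\<gamma> n) + k"
proof -
  have "d x (\<gamma> (n + k)) = d x (\<gamma> n) + k \<and> d x (\<gamma> (Suc (n + k))) = d x (\<gamma> n) + k + 1"
  proof (induction k)
    case 0 then show ?case using i by simp
  next
    case (Suc k)
    have "d x (\<gamma> (Suc (Suc (n + k)))) = d x (\<gamma> (Suc (n + k))) + 1"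
    proof (rule farther[of _ _ "\<gamma> (n + k)"])
      show "adj (\<gamma> (Suc (n + k))) (\<gamma> (Suc (Suc (n + k))))" by (rule nb_adj[OF g])
      show "adj (\<gamma> (Suc (n + k))) (\<gamma> (n + k))" by (rule adj_sym, rule nb_adj[OF g])
    qed (use Suc nb_ne[OF g] in auto)
    then show ?case using Suc by simp
  qed
  then show ?thesis by blast
qed

lemma nb_dist: "\<gamma> \<in> nb_paths adj \<Longrightarrow> d (\<gamma> n) (\<gamma> (n + k)) = k"
  using nb_increasing[of \<gamma> "\<gamma> n" n k] d_adj[OF nb_adj[of \<gamma> n]] by simp

lemma nb_eventually_increasing:
  assumes g: "\<gamma> \<in> nb_paths adj"
  shows "\<exists>n. d x (\<gamma> (Suc n)) = d x (\<gamma> n) + 1"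
proof -
  obtain n where n: "\<And>m. d x (\<gamma> n) \<le> d x (\<gamma> m)"
    using ex_has_least_nat[of "\<lambda>_. True" 0 "\<lambda>n. d x (\<gamma> n)"] by blast
  have "d x (\<gamma> (Suc n)) = d x (\<gamma> n) + 1"
    using adj_levels[OF nb_adj[OF g, of n], of x] n[of "Suc n"] by linarith
  then show ?thesis by blast
qed

lemma nb_start_dist: "\<gamma> \<in> nb_paths adj \<Longrightarrow> d (\<gamma> 0) (\<gamma> n) = n"
  using nb_dist[of \<gamma> 0 n] by simp

text \<open>The levels of \<open>\<gamma> n\<close> and \<open>\<gamma> (n + 2)\<close> differ.\<close>

lemma level_path_nb:
  assumes "\<And>n. adj (\<gamma> n) (\<gamma> (Suc n))" "\<And>n. d x (\<gamma> n) = n"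
  shows "\<gamma> \<in> nb_paths adj"
proof -
  have "\<gamma> (n + 2) \<noteq> \<gamma> n" for n
  proof
    assume e: "\<gamma> (n + 2) = \<gamma> n"
    have "n + 2 = d x (\<gamma> (n + 2))" by (simp only: assms(2))
    also have "\<dots> = n" by (simp only: e assms(2))
    finally show False by simp
  qed
  then show ?thesis using assms(1) by (simp add: nb_paths_def)
qed

end

locale rooted_tree = reg_tree q adj for q :: nat and adj :: "'v \<Rightarrow> 'v \<Rightarrow> bool" +
  fixes x0 :: 'v
begin

abbreviation lev :: "'v \<Rightarrow> nat" where "lev v \<equiv> d x0 v"

definition par :: "'v \<Rightarrow> 'v" where "par v = (if v = x0 then x0 else SOME w. adj v w \<and> lev v = lev w + 1)"

lemma par: "v \<noteq> x0 \<Longrightarrow> adj v (par v) \<and> lev v = lev (par v) + 1"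
proof -
  assume v: "v \<noteq> x0"
  then obtain w where "adj v w" "lev v = lev w + 1" by (rule closer_nbr)
  then have "adj v w \<and> lev v = lev w + 1" ..
  then show ?thesis unfolding par_def if_not_P[OF v] by (rule someI)
qed

lemma par_unique: "adj v w \<Longrightarrow> lev v = lev w + 1 \<Longrightarrow> par v = w"
proof -
  assume w: "adj v w" "lev v = lev w + 1"
  then have "v \<noteq> x0" by auto
  then have "adj v (par v)" "lev (par v) \<le> lev v" using par[of v] by linarith+
  then show ?thesis using w by (intro closer_unique[of v "par v" x0 w]) linarith+
qed

lemma lev_par: "lev (par v) = lev v - 1"
  using par[of v] by (cases "v = x0") (auto simp: par_def)

definition anc :: "'v \<Rightarrow> nat \<Rightarrow> 'v" where "anc v j = (par ^^ (lev v - j)) v"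

lemma lev_par_pow: "lev ((par ^^ i) v) = lev v - i"
  by (induction i) (simp_all add: lev_par)

lemma lev_anc: "j \<le> lev v \<Longrightarrow> lev (anc v j) = j"
  by (simp add: anc_def lev_par_pow)

lemma anc_self [simp]: "anc v (lev v) = v"
  by (simp add: anc_def)

lemma par_anc: "Suc j \<le> lev v \<Longrightarrow> par (anc v (Suc j)) = anc v j"
proof -
  assume "Suc j \<le> lev v"
  then have "lev v - j = Suc (lev v - Suc j)" by simp
  then show ?thesis by (simp add: anc_def)
qed

lemma anc_adj: "Suc j \<le> lev v \<Longrightarrow> adj (anc v j) (anc v (Suc j))"
proof -
  assume j: "Suc j \<le> lev v"
  then have "anc v (Suc j) \<noteq> x0" using lev_anc[OF j] by auto
  then show ?thesis using par[of "anc v (Suc j)"] par_anc[OF j] adj_sym by simp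
qed

lemma anc_0: "anc v 0 = x0"
  using lev_anc[of 0 v] by (metis d_eq_0_iff le0)

lemma d_anc: "j \<le> lev v \<Longrightarrow> d v (anc v j) = lev v - j"
proof -
  assume j: "j \<le> lev v"
  have "d v ((par ^^ i) v) \<le> i" if "i \<le> lev v" for i
    using that
  proof (induction i)
    case (Suc i)
    have "(par ^^ i) v \<noteq> x0" using lev_par_pow[of i v] Suc.prems by auto
    then have "d v (par ((par ^^ i) v)) \<le> d v ((par ^^ i) v) + 1" using par d_adj_le by blast
    then show ?case using Suc by simp
  qed simp
  from this[of "lev v - j"] have "d v (anc v j) \<le> lev v - j" by (simp add: anc_def)
  moreover have "lev v \<le> lev (anc v j) + d (anc v j) v" by (rule d_triangle)
  ultimately show ?thesis using lev_anc[OF j] d_sym[of v "anc v j"] by simp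
qed

lemma anc_eq_down:
  assumes "anc v k = anc w k" "j \<le> k" "k \<le> lev v" "k \<le> lev w"
  shows "anc v j = anc w j"
  using assms(2)
proof (induction rule: inc_induct)
  case (step n) then show ?case using par_anc[of n v] par_anc[of n w] assms by simp
qed (rule assms)

lemma path_anc:
  assumes g: "\<gamma> \<in> nb_paths adj" "\<gamma> 0 = x0" and e: "\<gamma> k = anc v k" and j: "j \<le> k" and k: "k \<le> lev v"
  shows "\<gamma> j = anc v j"
  using j
proof (induction rule: inc_induct)
  case base then show ?case by (rule e)
next
  case (step n)
  have "par (\<gamma> (Suc n)) = \<gamma> n"
    using nb_adj[OF g(1), of n] nb_start_dist[OF g(1)] g(2) adj_sym by (intro par_unique) auto
  then show ?case using step par_anc[of n v] k by simp
qed

text \<open>The path from \<open>v\<close> to its ancestor at level \<open>j\<close>, continued along \<open>\<gamma>\<close>, does not backtrack.\<close>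

lemma path_dist:
  assumes g: "\<gamma> \<in> nb_paths adj" "\<gamma> 0 = x0" and j: "j \<le> lev v" and e: "\<gamma> j = anc v j"
    and ne: "j < lev v \<Longrightarrow> \<gamma> (Suc j) \<noteq> anc v (Suc j)"
  shows "d v (\<gamma> (j + k)) = lev v - j + k"
proof -
  have "d v (\<gamma> (Suc j)) = d v (\<gamma> j) + 1"
  proof (cases "j < lev v")
    case False
    then have "\<gamma> j = v" using j e anc_self[of v] by (metis le_neq_implies_less)
    then show ?thesis using d_adj[OF nb_adj[OF g(1), of j]] by simp
  next
    case True
    show ?thesis
    proof (rule farther[of _ _ "anc v (Suc j)"])
      show "adj (\<gamma> j) (\<gamma> (Suc j))" by (rule nb_adj[OF g(1)])
      show "adj (\<gamma> j) (anc v (Suc j))" using anc_adj[of j v] True e by simp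
      show "d v (anc v (Suc j)) \<le> d v (\<gamma> j)" using d_anc[of "Suc j" v] d_anc[of j v] True e by simp
      show "\<gamma> (Suc j) \<noteq> anc v (Suc j)" by (rule ne[OF True])
    qed
  qed
  from nb_increasing[OF g(1) this, of k] show ?thesis using d_anc[OF j] e by simp
qed

subsection \<open>Representatives of boundary points starting at the base vertex\<close>

text \<open>After the two paths part, their distance grows by two in each step.\<close>

lemma boundary_path_unique:
  assumes g: "\<gamma>1 \<in> nb_paths adj" "\<gamma>1 0 = x0" and h: "\<gamma>2 \<in> nb_paths adj" "\<gamma>2 0 = x0"
    and b: "\<And>n. d (\<gamma>1 n) (\<gamma>2 n) \<le> B"
  shows "\<gamma>1 = \<gamma>2"
proof (rule ccontr)
  assume "\<gamma>1 \<noteq> \<gamma>2"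
  then obtain i0 where "\<gamma>1 i0 \<noteq> \<gamma>2 i0" by (auto simp: fun_eq_iff)
  define i where "i = (LEAST i. \<gamma>1 i \<noteq> \<gamma>2 i)"
  have i: "\<gamma>1 i \<noteq> \<gamma>2 i" unfolding i_def by (rule LeastI[where P = "\<lambda>i. \<gamma>1 i \<noteq> \<gamma>2 i"]) fact
  have below: "\<gamma>1 j = \<gamma>2 j" if "j < i" for j using not_less_Least[of j "\<lambda>i. \<gamma>1 i \<noteq> \<gamma>2 i"] that i_def by blast
  obtain j where j: "i = Suc j" using i g h by (cases i) auto
  define v where "v = \<gamma>1 (j + Suc B)"
  have lv: "lev v = j + Suc B" using nb_start_dist[OF g(1)] g(2) by (simp add: v_def)
  have top: "\<gamma>1 (j + Suc B) = anc v (j + Suc B)"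
    using anc_self[of v] unfolding lv by (simp only: v_def[symmetric])
  have a: "\<gamma>1 k = anc v k" if "k \<le> j + Suc B" for k
    by (rule path_anc[OF g top that]) (simp only: lv order_refl)
  have "d v (\<gamma>2 (j + Suc B)) = lev v - j + Suc B"
  proof (rule path_dist[OF h])
    show "\<gamma>2 j = anc v j" using a[of j] below[of j] j by simp
    show "\<gamma>2 (Suc j) \<noteq> anc v (Suc j)" using a[of "Suc j"] i j by simp
  qed (simp add: lv)
  then show False using b[of "j + Suc B"] lv by (simp add: v_def)
qed

lemma convergent_nat_bounded:
  assumes "convergent (\<lambda>n. real (f n :: nat))" shows "\<exists>B. \<forall>n. f n \<le> B"
proof -
  have "Bseq (\<lambda>n. real (f n))" using assms convergent_imp_Bseq by blast
  then obtain B where "\<And>n. norm (real (f n)) \<le> B" unfolding Bseq_def by blast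
  then have "f n \<le> nat \<lceil>B\<rceil>" for n by (metis le_nat_iff norm_of_nat of_nat_ceiling of_nat_le_iff order_trans real_nat_ceiling_ge)
  then show ?thesis by blast
qed

text \<open>Follow \<open>\<gamma>\<close> from the point where it starts to move away from the base vertex, and reach that point
  directly; the two parametrisations then differ by a constant shift.\<close>

lemma boundary_path_exists:
  assumes g: "\<gamma> \<in> nb_paths adj"
  shows "\<exists>\<gamma>'. \<gamma>' \<in> nb_paths adj \<and> \<gamma>' 0 = x0 \<and> convergent (\<lambda>n. real (d (\<gamma> n) (\<gamma>' n)))"
proof -
  obtain m where m: "lev (\<gamma> (Suc m)) = lev (\<gamma> m) + 1" using nb_eventually_increasing[OF g] by blast
  have lev: "lev (\<gamma> (m + k)) = lev (\<gamma> m) + k" for k by (rule nb_increasing[OF g m])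
  define D where "D = lev (\<gamma> m)"
  define \<gamma>' where "\<gamma>' i = (if i \<le> D then anc (\<gamma> m) i else \<gamma> (m + (i - D)))" for i
  have eq: "\<gamma>' i = \<gamma> (m + (i - D))" if "i \<ge> D" for i
    using that by (auto simp: \<gamma>'_def D_def)
  have "\<gamma>' \<in> nb_paths adj"
  proof (rule level_path_nb)
    show "lev (\<gamma>' n) = n" for n using lev[of "n - D"] by (auto simp: \<gamma>'_def lev_anc D_def)
    show "adj (\<gamma>' n) (\<gamma>' (Suc n))" for n
    proof (cases "Suc n \<le> D")
      case True then show ?thesis by (simp add: \<gamma>'_def anc_adj D_def)
    next
      case False
      then have "\<gamma>' n = \<gamma> (m + (n - D))" "\<gamma>' (Suc n) = \<gamma> (Suc (m + (n - D)))"
        using eq[of n] eq[of "Suc n"] by (auto simp: Suc_diff_le)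
      then show ?thesis using nb_adj[OF g] by simp
    qed
  qed
  moreover have "\<gamma>' 0 = x0" by (simp add: \<gamma>'_def anc_0)
  moreover have "convergent (\<lambda>n. real (d (\<gamma> n) (\<gamma>' n)))"
  proof -
    have "d (\<gamma> n) (\<gamma>' n) = (if m \<ge> D then m - D else D - m)" if n: "n \<ge> D + m" for n
    proof (cases "m \<ge> D")
      case True
      have "\<gamma>' n = \<gamma> (n + (m - D))" using eq[of n] n True by (simp add: algebra_simps)
      then show ?thesis using nb_dist[OF g, of n "m - D"] True by simp
    next
      case False
      define k where "k = m + (n - D)"
      have "\<gamma>' n = \<gamma> k" "n = k + (D - m)" using eq[of n] n False by (auto simp: k_def)
      then show ?thesis using nb_dist[OF g, of k "D - m"] False d_sym by simp
    qed
    then have "\<forall>\<^sub>F n in sequentially. real (d (\<gamma> n) (\<gamma>' n)) = real (if m \<ge> D then m - D else D - m)"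
      by (intro eventually_sequentiallyI[of "D + m"]) simp
    then have "(\<lambda>n. real (d (\<gamma> n) (\<gamma>' n))) \<longlonglongrightarrow> real (if m \<ge> D then m - D else D - m)"
      by (rule tendsto_eventually)
    then show ?thesis by (rule convergentI)
  qed
  ultimately show ?thesis by blast
qed

lemma geod:
  assumes "\<omega> \<in> boundary adj"
  shows "geod x0 \<omega> \<in> nb_paths adj" "geod x0 \<omega> 0 = x0"
proof -
  obtain \<gamma> where g: "\<gamma> \<in> nb_paths adj" and w: "\<omega> = path_equiv adj `` {\<gamma>}"
    using assms unfolding boundary_def quotient_def by blast
  have mem: "\<gamma>' \<in> \<omega> \<longleftrightarrow> \<gamma>' \<in> nb_paths adj \<and> convergent (\<lambda>n. real (d (\<gamma> n) (\<gamma>' n)))" for \<gamma>'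
    using g by (auto simp: w path_equiv_def)
  have "\<exists>!\<gamma>'. \<gamma>' \<in> \<omega> \<and> \<gamma>' 0 = x0"
  proof (rule ex_ex1I)
    show "\<exists>\<gamma>'. \<gamma>' \<in> \<omega> \<and> \<gamma>' 0 = x0" using boundary_path_exists[OF g] mem by blast
    fix \<gamma>1 \<gamma>2 assume 1: "\<gamma>1 \<in> \<omega> \<and> \<gamma>1 0 = x0" and 2: "\<gamma>2 \<in> \<omega> \<and> \<gamma>2 0 = x0"
    have "convergent (\<lambda>n. real (d (\<gamma> n) (\<gamma>1 n)))" using 1 mem by blast
    from convergent_nat_bounded[OF this] obtain B1 where B1: "\<And>n. d (\<gamma> n) (\<gamma>1 n) \<le> B1" by blast
    have "convergent (\<lambda>n. real (d (\<gamma> n) (\<gamma>2 n)))" using 2 mem by blast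
    from convergent_nat_bounded[OF this] obtain B2 where B2: "\<And>n. d (\<gamma> n) (\<gamma>2 n) \<le> B2" by blast
    have "d (\<gamma>1 n) (\<gamma>2 n) \<le> B1 + B2" for n
      using d_triangle[of "\<gamma>1 n" "\<gamma>2 n" "\<gamma> n"] B1[of n] B2[of n] d_sym[of "\<gamma> n" "\<gamma>1 n"] by linarith
    then show "\<gamma>1 = \<gamma>2" using 1 2 mem by (intro boundary_path_unique) auto
  qed
  then have "geod x0 \<omega> \<in> \<omega> \<and> geod x0 \<omega> 0 = x0" unfolding geod_def by (rule theI')
  then show "geod x0 \<omega> \<in> nb_paths adj" "geod x0 \<omega> 0 = x0" using mem by auto
qed

lemma lev_geod: "\<omega> \<in> boundary adj \<Longrightarrow> lev (geod x0 \<omega> n) = n"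
  using nb_start_dist geod by metis

subsection \<open>Cylinders and horocycles\<close>

lemma cylinder_iff: "\<omega> \<in> cylinder adj x0 v \<longleftrightarrow> \<omega> \<in> boundary adj \<and> geod x0 \<omega> (lev v) = v"
  unfolding cylinder_def using lev_geod by fastforce

lemma cylinder_base: "cylinder adj x0 x0 = boundary adj"
  using cylinder_iff[of _ x0] geod(2) by auto

text \<open>Here \<open>j\<close> is the level at which the ray towards \<open>\<omega>\<close> leaves the path to \<open>v\<close>.\<close>

lemma horo_limit:
  assumes w: "\<omega> \<in> boundary adj"
  obtains j where "j \<le> lev v" "\<And>i. i \<le> lev v \<Longrightarrow> geod x0 \<omega> i = anc v i \<longleftrightarrow> i \<le> j"
    "horo adj x0 \<omega> v = 2 * int j - int (lev v)"
    "\<And>n. n \<ge> j \<Longrightarrow> int n - int (d (geod x0 \<omega> n) v) = 2 * int j - int (lev v)"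
proof -
  let ?\<gamma> = "geod x0 \<omega>"
  note g = geod[OF w]
  define j where "j = Max {i. i \<le> lev v \<and> ?\<gamma> i = anc v i}"
  have fin: "finite {i. i \<le> lev v \<and> ?\<gamma> i = anc v i}" by simp
  have "0 \<in> {i. i \<le> lev v \<and> ?\<gamma> i = anc v i}" using g by (simp add: anc_0)
  then have jin: "j \<in> {i. i \<le> lev v \<and> ?\<gamma> i = anc v i}" unfolding j_def using fin Max_in by blast
  have jmax: "i \<le> j" if "i \<le> lev v" "?\<gamma> i = anc v i" for i
    unfolding j_def using fin that by (intro Max_ge) auto
  have iff: "?\<gamma> i = anc v i \<longleftrightarrow> i \<le> j" if "i \<le> lev v" for i
    using jmax[OF that] path_anc[OF g, of j v i] jin by auto
  have dist: "d v (?\<gamma> (j + k)) = lev v - j + k" for k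
    by (rule path_dist[OF g]) (use jin iff[of "Suc j"] in auto)
  have val: "int n - int (d (?\<gamma> n) v) = 2 * int j - int (lev v)" if "n \<ge> j" for n
    using dist[of "n - j"] that jin by (simp add: d_sym[of v])
  have "(\<lambda>n. int n - int (d (?\<gamma> n) v)) \<longlonglongrightarrow> 2 * int j - int (lev v)"
    by (intro tendsto_eventually eventually_sequentiallyI[of j] val)
  then have "horo adj x0 \<omega> v = 2 * int j - int (lev v)" unfolding horo_def by (rule limI)
  then show ?thesis using that[of j] jin iff val by simp
qed

lemma horo_parity: "\<omega> \<in> boundary adj \<Longrightarrow> even (horo adj x0 \<omega> v - int (lev v))"
  by (rule horo_limit[of \<omega> v]) auto

lemma horo_le: "\<omega> \<in> boundary adj \<Longrightarrow> horo adj x0 \<omega> v \<le> int (lev v)"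
  by (rule horo_limit[of \<omega> v]) auto

lemma horo_ge: "\<omega> \<in> boundary adj \<Longrightarrow> - int (lev v) \<le> horo adj x0 \<omega> v"
  by (rule horo_limit[of \<omega> v]) auto

lemma horo_ge_iff:
  assumes w: "\<omega> \<in> boundary adj" and j: "j \<le> lev v"
  shows "2 * int j - int (lev v) \<le> horo adj x0 \<omega> v \<longleftrightarrow> \<omega> \<in> cylinder adj x0 (anc v j)"
proof -
  obtain i where i: "\<And>i'. i' \<le> lev v \<Longrightarrow> geod x0 \<omega> i' = anc v i' \<longleftrightarrow> i' \<le> i"
    "horo adj x0 \<omega> v = 2 * int i - int (lev v)" using horo_limit[OF w, of v] by metis
  show ?thesis using i(1)[OF j] i(2) w j by (simp add: cylinder_iff lev_anc)
qed

text \<open>For large \<open>n\<close>, heights near \<open>v\<close> are given by distances to the \<open>n\<close>-th vertex of the ray, and exactly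
  one neighbour of \<open>v\<close> is closer to that vertex.\<close>

lemma horo_nbrs:
  assumes w: "\<omega> \<in> boundary adj"
  obtains p where "adj v p" "horo adj x0 \<omega> p = horo adj x0 \<omega> v + 1"
    "\<And>u. adj v u \<Longrightarrow> u \<noteq> p \<Longrightarrow> horo adj x0 \<omega> u = horo adj x0 \<omega> v - 1"
proof -
  have "\<exists>N. \<forall>n\<ge>N. int n - int (d (geod x0 \<omega> n) u) = horo adj x0 \<omega> u" for u
    by (rule horo_limit[OF w, of u]) metis
  then obtain N where N: "\<And>u n. n \<ge> N u \<Longrightarrow> int n - int (d (geod x0 \<omega> n) u) = horo adj x0 \<omega> u" by metis
  define n where "n = Max (N ` insert v {u. adj v u}) + lev v + 1"
  have nN: "n \<ge> N u" if "u \<in> insert v {u. adj v u}" for u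
  proof -
    have "N u \<le> Max (N ` insert v {u. adj v u})" using that by (intro Max_ge) auto
    then show ?thesis by (simp add: n_def)
  qed
  let ?x = "geod x0 \<omega> n"
  have "v \<noteq> ?x" using lev_geod[OF w, of n] by (auto simp: n_def)
  then obtain p where p: "adj v p" "d ?x v = d ?x p + 1" by (rule closer_nbr)
  have hv: "horo adj x0 \<omega> u = int n - int (d ?x u)" if "u = v \<or> adj v u" for u
    using N[OF nN[of u]] that by auto
  have "horo adj x0 \<omega> u = horo adj x0 \<omega> v - 1" if "adj v u" "u \<noteq> p" for u
    using farther[OF that(1) p(1) _ that(2), of ?x] p hv[of u] hv[of v] that by simp
  moreover have "horo adj x0 \<omega> p = horo adj x0 \<omega> v + 1" using p hv[of p] hv[of v] by simp
  ultimately show ?thesis using that p by blast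
qed

end

section \<open>Sums over levels\<close>

lemma has_sum_int_atMostI:
  fixes f :: "int \<Rightarrow> real"
  assumes "((\<lambda>i. f (k - int i)) has_sum s) UNIV"
  shows "(f has_sum s) {..k}"
proof -
  have "bij_betw (\<lambda>i. k - int i) UNIV {..k}"
    by (rule bij_betwI[where g = "\<lambda>j. nat (k - j)"]) auto
  then show ?thesis using has_sum_reindex_bij_betw assms by blast
qed

lemma has_sum_geometric_int:
  fixes x :: real assumes x: "x > 1"
  shows "((\<lambda>j. x powi j) has_sum x powi (k + 1) / (x - 1)) {..k}"
proof (rule has_sum_int_atMostI)
  have "(\<lambda>i. (1 / x) ^ i) sums (1 / (1 - 1 / x))" using x by (intro geometric_sums) simp
  then have "((\<lambda>i. (1 / x) ^ i) has_sum (1 / (1 - 1 / x))) UNIV"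
    using x by (intro sums_nonneg_imp_has_sum) auto
  then have "((\<lambda>i. x powi k * (1 / x) ^ i) has_sum (x powi k * (1 / (1 - 1 / x)))) UNIV"
    by (rule has_sum_cmult_right)
  moreover have "x powi k * (1 / x) ^ i = x powi (k - int i)" for i
    using x by (simp add: power_int_diff power_one_over)
  moreover have "x powi k * (1 / (1 - 1 / x)) = x powi (k + 1) / (x - 1)"
    using x by (simp add: power_int_add field_simps)
  ultimately show "((\<lambda>i. x powi (k - int i)) has_sum x powi (k + 1) / (x - 1)) UNIV" by simp
qed

lemma has_sum_insert_real:
  fixes f :: "'b \<Rightarrow> real"
  assumes "(f has_sum s) A" "x \<notin> A"
  shows "(f has_sum (f x + s)) (insert x A)"
proof -
  have "(f has_sum f x) {x}" by (rule has_sum_finiteI) auto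
  from has_sum_Un_disjoint[OF this assms(1)] show ?thesis using assms(2) by simp
qed

locale level_sum =
  fixes q :: real
  assumes q: "q > 1"
begin

text \<open>The measure of a cylinder at level \<open>i\<close>. Negative levels occur as well and stand for the whole
  boundary.\<close>

definition mu :: "int \<Rightarrow> real" where "mu i = (if i \<le> 0 then 1 else q powi (1 - i) / (q + 1))"

text \<open>The measure of the set of ends agreeing up to level \<open>j\<close> with a vertex at level \<open>m\<close> and up to
  level \<open>l\<close> with a vertex at level \<open>m'\<close>, if the paths from the base vertex to these two vertices part
  at level \<open>p\<close>.\<close>

definition meet :: "int \<Rightarrow> int \<Rightarrow> int \<Rightarrow> int \<Rightarrow> int \<Rightarrow> real" where
  "meet m m' p j l = (if j \<le> m \<and> l \<le> m' \<and> min j l \<le> p then mu (max j l) else 0)"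

text \<open>Up to a common factor, the contribution of level \<open>j\<close> to \<open>\<langle>S\<^sup>k a\<^sub>x, w\<^sub>v\<rangle>\<close>: at the corresponding time \<open>a\<^sub>x\<close>
  is a multiple of \<open>q\<close> times the indicator of level \<open>j + 1\<close> minus the indicator of level \<open>j\<close>, and \<open>w\<^sub>v\<close> is a
  multiple of the indicator of level \<open>j + s\<close>, where \<open>s\<close> depends on \<open>k\<close> and on the levels of the vertices.\<close>

definition level_term :: "int \<Rightarrow> int \<Rightarrow> int \<Rightarrow> int \<Rightarrow> int \<Rightarrow> real" where
  "level_term m m' p s j = q powi (2 * j) * (q * meet m m' p (j + 1) (j + s) - meet m m' p j (j + s))"

lemma q_powi_sq: "q powi (2 * j) = (q\<^sup>2) powi j"
  unfolding power_int_mult power_int_def[of q 2] by simp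

lemma q_pos: "q > 0" "q + 1 > 0" "q - 1 > 0" "q\<^sup>2 > 1" "q\<^sup>2 - 1 = (q - 1) * (q + 1)"
proof -
  show "q > 0" "q + 1 > 0" "q - 1 > 0" using q by auto
  show "q\<^sup>2 > 1" using q by (simp add: one_less_power)
  show "q\<^sup>2 - 1 = (q - 1) * (q + 1)" by (simp add: power2_eq_square algebra_simps)
qed

lemma geometric_q:
  "((\<lambda>j. q powi (2 * j) * (q - 1)) has_sum q powi (2 * k + 2) / (q + 1)) {..k}"
proof -
  have "((\<lambda>j. (q\<^sup>2) powi j * (q - 1)) has_sum ((q\<^sup>2) powi (k + 1) / (q\<^sup>2 - 1) * (q - 1))) {..k}"
    by (intro has_sum_cmult_left has_sum_geometric_int q_pos)
  moreover have "(q\<^sup>2) powi (k + 1) / (q\<^sup>2 - 1) * (q - 1) = q powi (2 * k + 2) / (q + 1)"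
  proof -
    have "2 * (k + 1) = 2 * k + 2" by simp
    then have "(q\<^sup>2) powi (k + 1) = q powi (2 * k + 2)" unfolding q_powi_sq[symmetric] by (simp only:)
    then show ?thesis unfolding q_pos(5) using q_pos(1-3) by simp
  qed
  ultimately show ?thesis by (simp add: q_powi_sq)
qed

lemma mu_step: "j \<ge> 1 \<Longrightarrow> q * mu (j + 1) = mu j"
  using q_pos by (simp add: mu_def power_int_diff power_int_minus field_simps)

lemma mu_0_1: "q * mu 1 - mu 0 = - 1 / (q + 1)"
  using q_pos by (simp add: mu_def field_simps)

text \<open>The terms with \<open>j \<ge> 1\<close> vanish because a cylinder is the union of \<open>q\<close> cylinders of equal measure on the
  next level. The base vertex has \<open>q + 1\<close> neighbours, so the term with \<open>j = 0\<close> is negative; it cancels the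
  geometric series over negative levels, where both sets are the whole boundary.\<close>

lemma level_sum_below:
  assumes s: "s \<le> 0" "m + s > p" and p: "0 \<le> p" "p \<le> m" "p \<le> m'"
  shows "(level_term m m' p s has_sum 0) UNIV"
proof -
  have m1: "m \<ge> 1" using s p by linarith
  have pos: "level_term m m' p s j = 0" if "j \<ge> 1" for j
  proof -
    have "q * meet m m' p (j + 1) (j + s) = meet m m' p j (j + s)"
    proof (cases "j + s \<le> p")
      case True
      then have "j < m" using s by linarith
      then have "meet m m' p (j + 1) (j + s) = mu (j + 1)" "meet m m' p j (j + s) = mu j"
        using True s p by (auto simp: meet_def max_def)
      then show ?thesis using mu_step[OF that] by simp
    next
      case False
      then have "\<not> min (j + 1) (j + s) \<le> p" "\<not> min j (j + s) \<le> p" using s by auto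
      then show ?thesis by (simp add: meet_def)
    qed
    then show ?thesis by (simp add: level_term_def)
  qed
  have zero: "level_term m m' p s 0 = - 1 / (q + 1)"
  proof -
    have "meet m m' p (0 + 1) (0 + s) = mu 1" "meet m m' p 0 (0 + s) = mu 0"
      using s p m1 by (auto simp: meet_def max_def)
    then show ?thesis using mu_0_1 by (simp add: level_term_def)
  qed
  have neg: "level_term m m' p s j = q powi (2 * j) * (q - 1)" if "j \<le> - 1" for j
  proof -
    have "meet m m' p (j + 1) (j + s) = 1" "meet m m' p j (j + s) = 1"
      using s p m1 that by (auto simp: meet_def max_def mu_def)
    then show ?thesis by (simp add: level_term_def)
  qed
  have "(level_term m m' p s has_sum q powi (2 * (-1) + 2) / (q + 1)) {..-1}"
    using geometric_q[of "-1"] neg by (subst has_sum_cong) auto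
  then have "(level_term m m' p s has_sum (level_term m m' p s 0 + q powi (2 * (-1) + 2) / (q + 1))) (insert 0 {..-1})"
    by (rule has_sum_insert_real) simp
  then have "(level_term m m' p s has_sum 0) (insert 0 {..-1})" using zero by simp
  then show ?thesis by (rule has_sum_cong_neutral[THEN iffD1, rotated -1]) (use pos in auto)
qed

lemma mu_partial_sum:
  assumes "j + s \<ge> 0"
  shows "((\<lambda>j. q powi (2 * j) * (q - 1) * mu (j + s)) has_sum q powi (j + 2 - s) / (q + 1)) {..j}"
  using assms
proof (induction "nat (j + s)" arbitrary: j)
  case 0
  then have j: "j = - s" by simp
  have "((\<lambda>i. q powi (2 * i) * (q - 1) * mu (i + s)) has_sum q powi (2 * j + 2) / (q + 1)) {..j}"
    using geometric_q[of j] by (subst has_sum_cong[where g = "\<lambda>i. q powi (2 * i) * (q - 1)"]) (auto simp: mu_def j)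
  then show ?case by (simp add: j)
next
  case (Suc n)
  have "((\<lambda>j. q powi (2 * j) * (q - 1) * mu (j + s)) has_sum q powi (j - 1 + 2 - s) / (q + 1)) {..j - 1}"
    using Suc.hyps(2) by (intro Suc.hyps(1)) auto
  then have "((\<lambda>j. q powi (2 * j) * (q - 1) * mu (j + s)) has_sum
     (q powi (2 * j) * (q - 1) * mu (j + s) + q powi (j - 1 + 2 - s) / (q + 1))) (insert j {..j - 1})"
    by (rule has_sum_insert_real) simp
  moreover have "insert j {..j - 1} = {..j}" by auto
  moreover have "q powi (2 * j) * (q - 1) * mu (j + s) + q powi (j - 1 + 2 - s) / (q + 1) = q powi (j + 2 - s) / (q + 1)"
  proof -
    have "q powi (2 * j) * mu (j + s) = q powi (j + 1 - s) / (q + 1)"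
    proof -
      have "2 * j + (1 - (j + s)) = j + 1 - s" by simp
      then have "q powi (2 * j) * q powi (1 - (j + s)) = q powi (j + 1 - s)"
        using q_pos by (metis power_int_add less_irrefl)
      moreover have "j + s > 0" using Suc.hyps(2) by linarith
      ultimately show ?thesis by (simp add: mu_def)
    qed
    moreover have "q powi (j + 2 - s) = q powi (j + 1 - s) * q"
      using q_pos power_int_add[of q "j + 1 - s" 1] by (simp add: algebra_simps)
    moreover have "j - 1 + 2 - s = j + 1 - s" by simp
    ultimately show ?thesis using q_pos by (simp add: field_simps)
  qed
  ultimately show ?case by simp
qed

text \<open>Now the set at level \<open>j + s\<close> is the smaller one in both intersections. The terms with \<open>j < p\<close> add up to a
  power of \<open>q\<close>, which the term with \<open>j = p\<close> cancels, unless the level \<open>p + s\<close> exceeds \<open>m'\<close> and this term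
  vanishes.\<close>

lemma level_sum_above:
  assumes s: "s \<ge> 1" "p + s \<le> m' + 1" and p: "0 \<le> p" "p \<le> m" "p \<le> m'"
  shows "(level_term m m' p s has_sum (if p + s \<le> m' then 0 else q powi (p + 1 - s) / (q + 1))) UNIV"
proof -
  have neg: "level_term m m' p s j = q powi (2 * j) * (q - 1) * mu (j + s)" if "j \<le> p - 1" for j
  proof -
    have "meet m m' p (j + 1) (j + s) = mu (j + s)" "meet m m' p j (j + s) = mu (j + s)"
      using s p that by (auto simp: meet_def max_def)
    then show ?thesis by (simp add: level_term_def algebra_simps)
  qed
  have pos: "level_term m m' p s j = 0" if "j > p" for j
    using that s by (simp add: level_term_def meet_def)
  have eq: "level_term m m' p s p = (if p + s \<le> m' then - (q powi (p + 1 - s) / (q + 1)) else 0)"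
  proof -
    have "meet m m' p (p + 1) (p + s) = 0" using s by (auto simp: meet_def)
    moreover have "meet m m' p p (p + s) = (if p + s \<le> m' then mu (p + s) else 0)"
      using s p by (auto simp: meet_def max_def)
    moreover have "q powi (2 * p) * mu (p + s) = q powi (p + 1 - s) / (q + 1)"
    proof -
      have "2 * p + (1 - (p + s)) = p + 1 - s" by simp
      then have "q powi (2 * p) * q powi (1 - (p + s)) = q powi (p + 1 - s)"
        using q_pos by (metis power_int_add less_irrefl)
      then show ?thesis using s p by (simp add: mu_def)
    qed
    ultimately show ?thesis by (simp add: level_term_def)
  qed
  have "((\<lambda>j. q powi (2 * j) * (q - 1) * mu (j + s)) has_sum q powi (p - 1 + 2 - s) / (q + 1)) {..p - 1}"
    using s p by (intro mu_partial_sum) auto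
  then have "(level_term m m' p s has_sum q powi (p - 1 + 2 - s) / (q + 1)) {..p - 1}"
    using neg by (subst has_sum_cong) auto
  then have "(level_term m m' p s has_sum (level_term m m' p s p + q powi (p - 1 + 2 - s) / (q + 1))) (insert p {..p - 1})"
    by (rule has_sum_insert_real) simp
  moreover have e: "p - 1 + 2 - s = p + 1 - s" by simp
  ultimately have "(level_term m m' p s has_sum (if p + s \<le> m' then 0 else q powi (p + 1 - s) / (q + 1))) (insert p {..p - 1})"
    unfolding eq e by (cases "p + s \<le> m'") simp_all
  then show ?thesis by (rule has_sum_cong_neutral[THEN iffD1, rotated -1]) (use pos in auto)
qed

end

section \<open>Outgoing waves\<close>

locale boundary_tree = rooted_tree q adj x0 for q :: nat and adj :: "'v \<Rightarrow> 'v \<Rightarrow> bool" and x0 :: 'v +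
  fixes \<nu> :: "(nat \<Rightarrow> 'v) set measure"
  assumes q2: "q \<ge> 2" and bm: "boundary_measure q adj x0 \<nu>"
begin

lemma prob: "prob_space \<nu>"
  using bm by (simp add: boundary_measure_def)

sublocale prob_space \<nu> by (rule prob)
sublocale fourier \<nu> ..
sublocale LS: level_sum "real q" by unfold_locales (use q2 in simp)

lemma space_nu: "space \<nu> = boundary adj"
  using bm by (simp add: boundary_measure_def)

lemma cylinder_sets: "cylinder adj x0 v \<in> sets \<nu>"
  using bm by (auto simp: boundary_measure_def)

lemma measure_cylinder:
  assumes "v \<noteq> x0" shows "measure \<nu> (cylinder adj x0 v) = LS.mu (int (lev v))"
proof -
  have l: "lev v \<ge> 1" using assms by (metis d_eq_0_iff less_one not_le)
  have "measure \<nu> (cylinder adj x0 v) = 1 / ((real q + 1) * real q ^ (lev v - 1))"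
    using bm assms by (simp add: boundary_measure_def)
  also have "real q ^ (lev v - 1) = real q powi (int (lev v) - 1)"
    using l by (simp add: of_nat_diff flip: power_int_of_nat)
  also have "1 / ((real q + 1) * real q powi (int (lev v) - 1)) = real q powi (1 - int (lev v)) / (real q + 1)"
    using power_int_minus[of "real q" "int (lev v) - 1"] by (simp add: field_simps)
  finally show ?thesis using l assms by (simp add: LS.mu_def)
qed

subsection \<open>Ends agreeing with a vertex up to a level\<close>

text \<open>Levels below zero impose no condition and levels above that of \<open>v\<close> cannot be reached; with these
  conventions every height is described by one level (\<open>Cyl_horo\<close>).\<close>

definition Cyl :: "'v \<Rightarrow> int \<Rightarrow> (nat \<Rightarrow> 'v) set set" where
  "Cyl v j = (if j \<le> 0 then boundary adj
     else if j \<le> int (lev v) then cylinder adj x0 (anc v (nat j)) else {})"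

lemma Cyl_sets [measurable]: "Cyl v j \<in> sets \<nu>"
  using cylinder_sets sets.top[of \<nu>] by (simp add: Cyl_def space_nu)

lemma Cyl_subset: "Cyl v j \<subseteq> boundary adj"
  by (auto simp: Cyl_def cylinder_iff)

lemma Cyl_horo:
  assumes w: "\<omega> \<in> boundary adj"
  shows "\<omega> \<in> Cyl v j \<longleftrightarrow> 2 * j - int (lev v) \<le> horo adj x0 \<omega> v"
proof -
  consider "j \<le> 0" | "j > int (lev v)" | "j > 0" "j \<le> int (lev v)" by linarith
  then show ?thesis
  proof cases
    case 1 then show ?thesis using w horo_ge[OF w, of v] by (simp add: Cyl_def)
  next
    case 2 then show ?thesis using horo_le[OF w, of v] by (simp add: Cyl_def)
  next
    case 3 then show ?thesis using horo_ge_iff[OF w, of "nat j" v] by (simp add: Cyl_def)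
  qed
qed

lemma measure_Cyl: "measure \<nu> (Cyl v j) = (if j \<le> int (lev v) then LS.mu j else 0)"
proof -
  consider "j \<le> 0" | "j > int (lev v)" | "j > 0" "j \<le> int (lev v)" by linarith
  then show ?thesis
  proof cases
    case 1 then show ?thesis using prob_space by (simp add: Cyl_def LS.mu_def space_nu)
  next
    case 2 then show ?thesis by (simp add: Cyl_def)
  next
    case 3
    then have l: "lev (anc v (nat j)) = nat j" by (intro lev_anc) auto
    then have "anc v (nat j) \<noteq> x0" using 3 by auto
    from measure_cylinder[OF this] show ?thesis using 3 l by (simp add: Cyl_def)
  qed
qed

definition confluence :: "'v \<Rightarrow> 'v \<Rightarrow> nat" where
  "confluence x v = Max {j. j \<le> lev x \<and> j \<le> lev v \<and> anc x j = anc v j}"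

lemma confluence_in: "confluence x v \<le> lev x" "confluence x v \<le> lev v" "anc x (confluence x v) = anc v (confluence x v)"
proof -
  have "finite {j. j \<le> lev x \<and> j \<le> lev v \<and> anc x j = anc v j}" by simp
  moreover have "0 \<in> {j. j \<le> lev x \<and> j \<le> lev v \<and> anc x j = anc v j}" by (simp add: anc_0)
  ultimately have "confluence x v \<in> {j. j \<le> lev x \<and> j \<le> lev v \<and> anc x j = anc v j}"
    unfolding confluence_def using Max_in by blast
  then show "confluence x v \<le> lev x" "confluence x v \<le> lev v" "anc x (confluence x v) = anc v (confluence x v)" by auto
qed

lemma confluence_iff: "j \<le> lev x \<Longrightarrow> j \<le> lev v \<Longrightarrow> anc x j = anc v j \<longleftrightarrow> j \<le> confluence x v"
proof
  assume "j \<le> lev x" "j \<le> lev v" "anc x j = anc v j"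
  then show "j \<le> confluence x v" unfolding confluence_def by (intro Max_ge) auto
next
  assume "j \<le> confluence x v"
  then show "anc x j = anc v j" by (intro anc_eq_down[OF confluence_in(3)] confluence_in)
qed

lemma confluence_commute: "confluence x v = confluence v x"
  unfolding confluence_def by (rule arg_cong[where f = Max]) auto

lemma confluence_self [simp]: "confluence x x = lev x"
  using confluence_iff[of "lev x" x x] confluence_in(1)[of x x] by simp

lemma confluence_eq: "confluence x v = lev x \<Longrightarrow> confluence x v = lev v \<Longrightarrow> x = v"
  using confluence_in(3)[of x v] anc_self by metis

abbreviation meetv :: "'v \<Rightarrow> 'v \<Rightarrow> int \<Rightarrow> int \<Rightarrow> real" where
  "meetv x v \<equiv> LS.meet (int (lev x)) (int (lev v)) (int (confluence x v))"

lemma Cyl_inter: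
  assumes jl: "j \<le> l" and j: "j \<le> int (lev x)" and l: "l \<le> int (lev v)"
  shows "Cyl x j \<inter> Cyl v l = (if j \<le> int (confluence x v) then Cyl v l else {})"
proof (cases "j \<le> 0")
  case True
  then show ?thesis using Cyl_subset[of v l] by (auto simp: Cyl_def[of x])
next
  case False
  have c: "nat j \<le> nat l" "nat l \<le> lev v" "nat j \<le> lev x" using jl j l False by auto
  have sub: "\<omega> \<in> Cyl v l \<Longrightarrow> geod x0 \<omega> (nat j) = anc v (nat j)" for \<omega>
    using False jl l c path_anc[of "geod x0 \<omega>" "nat l" v "nat j"] geod[of \<omega>]
    by (auto simp: Cyl_def cylinder_iff lev_anc)
  have x: "\<omega> \<in> Cyl x j \<longleftrightarrow> \<omega> \<in> boundary adj \<and> geod x0 \<omega> (nat j) = anc x (nat j)" for \<omega>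
    using False j c by (auto simp: Cyl_def cylinder_iff lev_anc)
  have "anc x (nat j) = anc v (nat j) \<longleftrightarrow> j \<le> int (confluence x v)"
    using confluence_iff[of "nat j" x v] c False by auto
  then show ?thesis using sub x Cyl_subset[of v l] by auto
qed

lemma measure_meet: "measure \<nu> (Cyl x j \<inter> Cyl v l) = meetv x v j l"
proof (cases "j \<le> int (lev x) \<and> l \<le> int (lev v)")
  case False
  then have "Cyl x j \<inter> Cyl v l = {}" by (auto simp: Cyl_def)
  then show ?thesis using False by (auto simp: LS.meet_def)
next
  case True
  show ?thesis
  proof (cases "j \<le> l")
    case jl: True
    then show ?thesis using True
      by (subst Cyl_inter) (auto simp: LS.meet_def measure_Cyl min_def max_def)
  next
    case False
    then have "l \<le> j" by simp
    then have "measure \<nu> (Cyl v l \<inter> Cyl x j) = meetv x v j l" using True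
      by (subst Cyl_inter) (auto simp: LS.meet_def measure_Cyl min_def max_def confluence_commute[of v x])
    then show ?thesis by (simp add: Int_commute)
  qed
qed

subsection \<open>The space of translation representations\<close>

definition cc :: real where "cc = rep_const q"

lemma cc_pos: "cc > 0"
  by (simp add: cc_def rep_const_def add_pos_nonneg)

lemma cc_eq: "cc * (2 * real q / (real q + 1)) = 1"
proof -
  have q: "real q > 0" "real q + 1 > 0" using q2 by auto
  then have "1 + inverse (real q) = (real q + 1) / real q" by (simp add: field_simps)
  then show ?thesis using q by (simp add: cc_def rep_const_def)
qed

abbreviation "N \<equiv> rescale cc (L2 \<nu>)"
abbreviation "K \<equiv> ell2 N"

lemma hilbert_N: "hilbert_space N"
  by (intro hilbert_space_rescale hilbert_space_L2 cc_pos)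

lemma hilbert_K: "hilbert_space K"
  by (intro hilbert_space_ell2 hilbert_N)

sublocale N: prehilbert N by (rule hilbert_spaceD[OF hilbert_N])
sublocale K: prehilbert K by (rule hilbert_spaceD[OF hilbert_K])

lemma K_add: "add K g h = (\<lambda>n \<omega>. g n \<omega> + h n \<omega>)"
  and K_smul: "smul K a g = (\<lambda>n \<omega>. a * g n \<omega>)"
  by (simp_all add: ell2_def L2_def rescale_def)

lemma K_carr_L2: "g \<in> carr K \<Longrightarrow> g n \<in> carr (L2 \<nu>)"
  by (simp add: N.carr_ell2_iff)

lemma K_ip_has_sum:
  assumes "g \<in> carr K" "h \<in> carr K"
  shows "((\<lambda>n. complex_of_real cc * ip (L2 \<nu>) (g n) (h n)) has_sum ip K g h) UNIV"
  using N.ell2_ip_has_sum[OF assms] by simp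

definition tshift :: "int \<Rightarrow> (int \<Rightarrow> (nat \<Rightarrow> 'v) set \<Rightarrow> complex) \<Rightarrow> int \<Rightarrow> (nat \<Rightarrow> 'v) set \<Rightarrow> complex" where
  "tshift k g = (\<lambda>n. g (n - k))"

lemma tshift_closed [simp, intro]: "g \<in> carr K \<Longrightarrow> tshift k g \<in> carr K"
  using N.ell2_shift[of g "- k"] by (simp add: tshift_def)

lemma tshift_ip: "ip K (tshift k g) (tshift k h) = ip K g h"
  using N.ell2_shift_ip[of g "- k" h] by (simp add: tshift_def)

lemma tshift_tshift [simp]: "tshift a (tshift b g) = tshift (a + b) g"
  by (simp add: tshift_def algebra_simps)

lemma tshift_0 [simp]: "tshift 0 g = g"
  by (simp add: tshift_def)

lemma tshift_ip_left: "ip K (tshift k g) h = ip K g (tshift (- k) h)"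
  using tshift_ip[of k g "tshift (- k) h"] by simp

definition rt :: real where "rt = sqrt (real q)"

lemma rt: "rt > 0" "rt\<^sup>2 = real q" "rt \<noteq> 0"
  using q2 by (auto simp: rt_def)

lemma rt_powi_even: "rt powi (2 * j) = real q powi j"
  unfolding power_int_mult power_int_def[of rt 2] using rt by simp

lemma rt_add: "rt powi a * rt powi b = rt powi (a + b)"
  using rt by (simp add: power_int_add)

text \<open>The wave \<open>w\<^sub>v\<close>: the inner product with it evaluates the first component of the data at \<open>v\<close>.\<close>

definition eval_wave :: "'v \<Rightarrow> int \<Rightarrow> (nat \<Rightarrow> 'v) set \<Rightarrow> complex" where
  "eval_wave v n \<omega> = (if even (n + 1 - int (lev v))
     then complex_of_real (2 * rt powi (n + 1)) * indicator (Cyl v ((n + 1 + int (lev v)) div 2)) \<omega> else 0)"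

lemma eval_wave_level: "eval_wave v (2 * l - int (lev v) - 1) = (\<lambda>\<omega>. complex_of_real (2 * rt powi (2 * l - int (lev v))) * indicator (Cyl v l) \<omega>)"
  by (auto simp: eval_wave_def fun_eq_iff)

lemma eval_wave_horo:
  assumes w: "\<omega> \<in> boundary adj"
  shows "eval_wave v n \<omega> = (if even (n + 1 - int (lev v)) \<and> n + 1 \<le> horo adj x0 \<omega> v then complex_of_real (2 * rt powi (n + 1)) else 0)"
proof (cases "even (n + 1 - int (lev v))")
  case False then show ?thesis by (simp add: eval_wave_def)
next
  case True
  then have e: "2 * ((n + 1 + int (lev v)) div 2) - int (lev v) = n + 1" by presburger
  show ?thesis using True Cyl_horo[OF w, of v "(n + 1 + int (lev v)) div 2"]
    unfolding e by (simp add: eval_wave_def indicator_def)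
qed

lemma eval_wave_outside: "\<omega> \<notin> boundary adj \<Longrightarrow> eval_wave v n \<omega> = 0"
  using Cyl_subset by (auto simp: eval_wave_def indicator_def)

lemma eval_wave_measurable: "eval_wave v n \<in> borel_measurable \<nu>"
  unfolding eval_wave_def by measurable

lemma eval_wave_above: "n \<ge> int (lev v) \<Longrightarrow> eval_wave v n \<omega> = 0"
proof -
  assume "n \<ge> int (lev v)"
  then have "(n + 1 + int (lev v)) div 2 > int (lev v) \<or> odd (n + 1 - int (lev v))" by presburger
  then show ?thesis by (auto simp: eval_wave_def Cyl_def)
qed

lemma eval_wave_bound: "cmod (eval_wave v n \<omega>) \<le> (if n + 1 \<le> int (lev v) then 2 * rt powi (n + 1) else 0)"
proof (cases "n + 1 \<le> int (lev v)")
  case True then show ?thesis using rt by (auto simp: eval_wave_def indicator_def norm_mult norm_power_int)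
next
  case False then show ?thesis using eval_wave_above[of v n \<omega>] by simp
qed

lemma eval_wave_L2: "eval_wave v n \<in> carr (L2 \<nu>)"
  using eval_wave_measurable eval_wave_bound by (rule L2_bounded)

lemma eval_wave_bound_summable:
  "x > 1 \<Longrightarrow> (\<lambda>n. if n + 1 \<le> m then C * x powi (n + 1) else 0) summable_on (UNIV :: int set)" for x C :: real and m :: int
proof -
  assume x: "x > 1"
  have "((\<lambda>n. C * x * x powi n) has_sum (C * x * (x powi (m - 1 + 1) / (x - 1)))) {..m - 1}"
    by (intro has_sum_cmult_right has_sum_geometric_int x)
  then have "(\<lambda>n. C * x * x powi n) summable_on {..m - 1}" by (rule has_sum_imp_summable)
  then show ?thesis
    by (rule summable_on_cong_neutral[THEN iffD1, rotated -1]) (use x in \<open>auto simp: power_int_add\<close>)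
qed

lemma eval_wave_K [simp]: "eval_wave v \<in> carr K"
proof -
  have "(\<lambda>n. (hnorm N (eval_wave v n))\<^sup>2) summable_on UNIV"
  proof (rule summable_on_comparison_test)
    show "(\<lambda>n. if n + 1 \<le> int (lev v) then (cc * 4) * real q powi (n + 1) else 0) summable_on UNIV"
      by (rule eval_wave_bound_summable) (use q2 in simp)
    show "(hnorm N (eval_wave v n))\<^sup>2 \<le> (if n + 1 \<le> int (lev v) then (cc * 4) * real q powi (n + 1) else 0)" for n
    proof -
      define b where "b = (if n + 1 \<le> int (lev v) then 2 * rt powi (n + 1) else 0)"
      have pt: "(cmod (eval_wave v n \<omega>))\<^sup>2 \<le> b\<^sup>2" for \<omega>
        unfolding b_def by (intro power_mono eval_wave_bound) auto
      have "(hnorm N (eval_wave v n))\<^sup>2 = cc * (\<integral>\<omega>. (cmod (eval_wave v n \<omega>))\<^sup>2 \<partial>\<nu>)"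
        using cc_pos by (simp add: hnorm_rescale power_mult_distrib L2_hnorm_sq[OF eval_wave_L2])
      also have "(\<integral>\<omega>. (cmod (eval_wave v n \<omega>))\<^sup>2 \<partial>\<nu>) \<le> (\<integral>\<omega>. b\<^sup>2 \<partial>\<nu>)"
        by (rule integral_mono[OF _ _ pt]) (use eval_wave_L2[of v n] in \<open>auto simp: carr_L2_iff\<close>)
      also have "(\<integral>\<omega>. b\<^sup>2 \<partial>\<nu>) = b\<^sup>2" using prob_space by simp
      also have "b\<^sup>2 = (if n + 1 \<le> int (lev v) then 4 * real q powi (n + 1) else 0)"
        unfolding b_def rt_powi_even[of "n + 1", symmetric]
        by (simp add: power_mult_distrib power_int_power' mult.commute)
      finally show ?thesis using cc_pos by (auto split: if_splits)
    qed
  qed auto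
  then show ?thesis using eval_wave_L2 by (simp add: N.carr_ell2_iff)
qed

text \<open>The representation \<open>a\<^sub>v\<close> of the data \<open>(0, \<delta>\<^sub>v)\<close>.\<close>

definition vel_wave :: "'v \<Rightarrow> int \<Rightarrow> (nat \<Rightarrow> 'v) set \<Rightarrow> complex" where
  "vel_wave v = smul K (-1/2) (add K (tshift 1 (eval_wave v)) (smul K (-1) (tshift (-1) (eval_wave v))))"

text \<open>The representation \<open>b\<^sub>v\<close> of the data \<open>(\<delta>\<^sub>v, 0)\<close>.\<close>

definition pos_wave :: "'v \<Rightarrow> int \<Rightarrow> (nat \<Rightarrow> 'v) set \<Rightarrow> complex" where
  "pos_wave v = smul K (1/2) (add K (tshift 1 (vel_wave v)) (smul K (-1) (tshift (-1) (vel_wave v))))"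

lemma vel_wave_K [simp]: "vel_wave v \<in> carr K" and pos_wave_K [simp]: "pos_wave v \<in> carr K"
  by (simp_all add: vel_wave_def pos_wave_def)

lemma vel_wave_eq: "vel_wave v n \<omega> = (eval_wave v (n + 1) \<omega> - eval_wave v (n - 1) \<omega>) / 2"
  by (simp add: vel_wave_def K_add K_smul tshift_def field_simps)

lemma pos_wave_eq: "pos_wave v n \<omega> = (vel_wave v (n - 1) \<omega> - vel_wave v (n + 1) \<omega>) / 2"
  by (simp add: pos_wave_def K_add K_smul tshift_def field_simps)

text \<open>One neighbour of \<open>v\<close> is higher by one and the other \<open>q\<close> are lower by one, so at time \<open>n\<close> the sum over the
  neighbours counts once the condition \<open>n \<le> h\<close> and \<open>q\<close> times the condition \<open>n + 2 \<le> h\<close>.\<close>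

lemma eval_wave_recursion: "eval_wave v (n - 1) \<omega> + eval_wave v (n + 1) \<omega> = (\<Sum>u | adj v u. eval_wave u n \<omega>) / complex_of_real rt"
proof (cases "\<omega> \<in> boundary adj")
  case False then show ?thesis by (simp add: eval_wave_outside)
next
  case w: True
  obtain p where p: "adj v p" "horo adj x0 \<omega> p = horo adj x0 \<omega> v + 1"
    "\<And>u. adj v u \<Longrightarrow> u \<noteq> p \<Longrightarrow> horo adj x0 \<omega> u = horo adj x0 \<omega> v - 1"
    using horo_nbrs[OF w, of v] by metis
  let ?h = "horo adj x0 \<omega> v"
  have par: "even (n + 1 - int (lev u)) \<longleftrightarrow> even (n - int (lev v))" if "adj v u" for u
    using adj_levels[OF that, of x0] by auto
  have card: "card ({u. adj v u} - {p}) = q" using card_nbrs[of v] p(1) by simp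
  have "(\<Sum>u | adj v u. eval_wave u n \<omega>) = eval_wave p n \<omega> + (\<Sum>u \<in> {u. adj v u} - {p}. eval_wave u n \<omega>)"
    using p(1) by (subst sum.remove[of _ p]) auto
  also have "(\<Sum>u \<in> {u. adj v u} - {p}. eval_wave u n \<omega>) = (\<Sum>u \<in> {u. adj v u} - {p}.
      (if even (n - int (lev v)) \<and> n + 2 \<le> ?h then complex_of_real (2 * rt powi (n + 1)) else 0))"
  proof (rule sum.cong)
    fix u assume u: "u \<in> {u. adj v u} - {p}"
    then have "horo adj x0 \<omega> u = ?h - 1" "even (n + 1 - int (lev u)) \<longleftrightarrow> even (n - int (lev v))"
      using p(3) par by auto
    then show "eval_wave u n \<omega> = (if even (n - int (lev v)) \<and> n + 2 \<le> ?h then complex_of_real (2 * rt powi (n + 1)) else 0)"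
      unfolding eval_wave_horo[OF w] by auto
  qed simp
  also have "\<dots> = of_nat q * (if even (n - int (lev v)) \<and> n + 2 \<le> ?h then complex_of_real (2 * rt powi (n + 1)) else 0)"
    using card by simp
  also have "eval_wave p n \<omega> = (if even (n - int (lev v)) \<and> n \<le> ?h then complex_of_real (2 * rt powi (n + 1)) else 0)"
    unfolding eval_wave_horo[OF w] using p par[OF p(1)] by auto
  finally have sum: "(\<Sum>u | adj v u. eval_wave u n \<omega>) =
      (if even (n - int (lev v)) \<and> n \<le> ?h then complex_of_real (2 * rt powi (n + 1)) else 0)
      + of_nat q * (if even (n - int (lev v)) \<and> n + 2 \<le> ?h then complex_of_real (2 * rt powi (n + 1)) else 0)" .
  have 1: "eval_wave v (n - 1) \<omega> = (if even (n - int (lev v)) \<and> n \<le> ?h then complex_of_real (2 * rt powi n) else 0)"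
    unfolding eval_wave_horo[OF w] by simp
  have 2: "eval_wave v (n + 1) \<omega> = (if even (n - int (lev v)) \<and> n + 2 \<le> ?h then complex_of_real (2 * rt powi (n + 2)) else 0)"
    unfolding eval_wave_horo[OF w] by (auto simp: algebra_simps)
  have a: "complex_of_real (2 * rt powi (n + 1)) / complex_of_real rt = complex_of_real (2 * rt powi n)"
    using rt by (simp add: power_int_add)
  have "rt * rt powi (n + 2) = rt\<^sup>2 * rt powi (n + 1)"
    using rt by (simp add: power_int_add power2_eq_square)
  then have "real q * (2 * rt powi (n + 1)) / rt = 2 * rt powi (n + 2)"
    using rt by (simp add: divide_eq_eq mult.commute mult.left_commute)
  from arg_cong[OF this, of complex_of_real]
  have b: "of_nat q * complex_of_real (2 * rt powi (n + 1)) / complex_of_real rt = complex_of_real (2 * rt powi (n + 2))"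
    by simp
  show ?thesis unfolding sum 1 2 add_divide_distrib using a b by (auto split: if_splits)
qed

lemma vel_wave_recursion: "vel_wave v (n - 1) \<omega> + vel_wave v (n + 1) \<omega> = (\<Sum>u | adj v u. vel_wave u n \<omega>) / complex_of_real rt"
proof -
  have "vel_wave v (n - 1) \<omega> + vel_wave v (n + 1) \<omega>
     = ((eval_wave v (n + 1 - 1) \<omega> + eval_wave v (n + 1 + 1) \<omega>) - (eval_wave v (n - 1 - 1) \<omega> + eval_wave v (n - 1 + 1) \<omega>)) / 2"
    by (simp add: vel_wave_eq field_simps)
  then show ?thesis
    unfolding eval_wave_recursion by (simp add: vel_wave_eq sum_subtractf sum_divide_distrib diff_divide_distrib mult.commute)
qed

lemma pos_wave_recursion: "pos_wave v (n - 1) \<omega> + pos_wave v (n + 1) \<omega> = (\<Sum>u | adj v u. pos_wave u n \<omega>) / complex_of_real rt"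
proof -
  have "pos_wave v (n - 1) \<omega> + pos_wave v (n + 1) \<omega>
     = ((vel_wave v (n - 1 - 1) \<omega> + vel_wave v (n - 1 + 1) \<omega>) - (vel_wave v (n + 1 - 1) \<omega> + vel_wave v (n + 1 + 1) \<omega>)) / 2"
    by (simp add: pos_wave_eq field_simps)
  then show ?thesis
    unfolding vel_wave_recursion by (simp add: pos_wave_eq sum_subtractf sum_divide_distrib diff_divide_distrib mult.commute)
qed

subsection \<open>Inner products of outgoing waves\<close>

lemma indicator_ip: "A \<in> sets \<nu> \<Longrightarrow> B \<in> sets \<nu> \<Longrightarrow>
   ip (L2 \<nu>) (\<lambda>\<omega>. complex_of_real a * indicator A \<omega>) (\<lambda>\<omega>. complex_of_real b * indicator B \<omega>)
     = complex_of_real (a * b * measure \<nu> (A \<inter> B))"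
proof -
  assume [measurable]: "A \<in> sets \<nu>" "B \<in> sets \<nu>"
  have "complex_of_real a * indicator A \<omega> * cnj (complex_of_real b * indicator B \<omega>)
      = complex_of_real (a * b * indicator (A \<inter> B) \<omega>)" for \<omega>
    by (auto simp: indicator_def)
  then show ?thesis by (simp add: L2_ip integral_complex_of_real del: of_real_mult)
qed

lemma eval_wave_ip:
  "ip (L2 \<nu>) (eval_wave x (2 * j - int (lev x) - 1)) (eval_wave v (2 * l - int (lev v) - 1))
    = complex_of_real (4 * rt powi (2 * j - int (lev x)) * rt powi (2 * l - int (lev v)) * meetv x v j l)"
  unfolding eval_wave_level by (subst indicator_ip) (simp_all add: measure_meet)

lemma eval_wave_parity: "odd (n + 1 - int (lev v)) \<Longrightarrow> eval_wave v n = (\<lambda>_. 0)"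
  by (simp add: eval_wave_def fun_eq_iff)

lemma vel_wave_parity: "odd (n - int (lev v)) \<Longrightarrow> vel_wave v n = (\<lambda>_. 0)"
  by (simp add: vel_wave_eq fun_eq_iff eval_wave_parity)

lemma vel_wave_ip:
  "ip (L2 \<nu>) (vel_wave x n) f = (ip (L2 \<nu>) (eval_wave x (n + 1)) f - ip (L2 \<nu>) (eval_wave x (n - 1)) f) / 2" if "f \<in> carr (L2 \<nu>)"
proof -
  have "vel_wave x n = smul (L2 \<nu>) (1/2) (add (L2 \<nu>) (eval_wave x (n + 1)) (smul (L2 \<nu>) (-1) (eval_wave x (n - 1))))"
    by (simp add: vel_wave_eq fun_eq_iff L2_add L2_smul)
  then show ?thesis using eval_wave_L2 that by (simp add: L2.ip_expand)
qed

lemma vel_wave_eval_wave_term: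
  assumes s: "2 * s = int (lev v) - int (lev x) + k + 1"
  shows "ip (L2 \<nu>) (vel_wave x (2 * j - int (lev x))) (eval_wave v (2 * j - int (lev x) + k))
    = complex_of_real (2 * rt powi (k + 1 - 2 * int (lev x))
        * LS.level_term (int (lev x)) (int (lev v)) (int (confluence x v)) s j)"
proof -
  let ?m = "int (lev x)" and ?n = "int (lev v)"
  have e: "2 * j - ?m + k = 2 * (j + s) - ?n - 1" using s by simp
  have e1: "2 * j - ?m + 1 = 2 * (j + 1) - ?m - 1" by simp
  have e2: "2 * (j + s) - ?n = 2 * j - ?m + k + 1" using s by simp
  have p1: "rt powi (2 * (j + 1) - ?m) * rt powi (2 * j - ?m + k + 1)
      = rt powi (k + 1 - 2 * ?m) * (real q powi (2 * j) * real q)"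
  proof -
    have "2 * (j + 1) - ?m + (2 * j - ?m + k + 1) = k + 1 - 2 * ?m + 2 * (2 * j + 1)" by simp
    then have "rt powi (2 * (j + 1) - ?m) * rt powi (2 * j - ?m + k + 1)
        = rt powi (k + 1 - 2 * ?m) * rt powi (2 * (2 * j + 1))"
      by (simp only: rt_add)
    also have "rt powi (2 * (2 * j + 1)) = real q powi (2 * j) * real q"
      unfolding rt_powi_even using q2 by (simp add: power_int_add)
    finally show ?thesis .
  qed
  have p2: "rt powi (2 * j - ?m) * rt powi (2 * j - ?m + k + 1) = rt powi (k + 1 - 2 * ?m) * real q powi (2 * j)"
  proof -
    have "2 * j - ?m + (2 * j - ?m + k + 1) = k + 1 - 2 * ?m + 2 * (2 * j)" by simp
    then have "rt powi (2 * j - ?m) * rt powi (2 * j - ?m + k + 1)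
        = rt powi (k + 1 - 2 * ?m) * rt powi (2 * (2 * j))"
      by (simp only: rt_add)
    then show ?thesis unfolding rt_powi_even .
  qed
  have "ip (L2 \<nu>) (vel_wave x (2 * j - ?m)) (eval_wave v (2 * j - ?m + k))
      = complex_of_real ((4 * (rt powi (2 * (j + 1) - ?m) * rt powi (2 * j - ?m + k + 1)) * meetv x v (j + 1) (j + s)
         - 4 * (rt powi (2 * j - ?m) * rt powi (2 * j - ?m + k + 1)) * meetv x v j (j + s)) / 2)"
  proof -
    have A: "ip (L2 \<nu>) (eval_wave x (2 * j - ?m + 1)) (eval_wave v (2 * j - ?m + k))
        = complex_of_real (4 * rt powi (2 * (j + 1) - ?m) * rt powi (2 * (j + s) - ?n) * meetv x v (j + 1) (j + s))"
      unfolding e e1 by (rule eval_wave_ip)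
    have B: "ip (L2 \<nu>) (eval_wave x (2 * j - ?m - 1)) (eval_wave v (2 * j - ?m + k))
        = complex_of_real (4 * rt powi (2 * j - ?m) * rt powi (2 * (j + s) - ?n) * meetv x v j (j + s))"
      unfolding e by (rule eval_wave_ip)
    show ?thesis unfolding vel_wave_ip[OF eval_wave_L2] A B unfolding e2 by (simp add: mult.assoc)
  qed
  also have "\<dots> = complex_of_real (2 * rt powi (k + 1 - 2 * ?m)
        * LS.level_term ?m ?n (int (confluence x v)) s j)"
    unfolding p1 p2 LS.level_term_def by (rule arg_cong[where f = complex_of_real]) (simp add: field_simps)
  finally show ?thesis .
qed

text \<open>The solution of the wave equation with initial data \<open>(0, \<delta>\<^sub>x)\<close>, at the times \<open>0\<close> and \<open>1\<close>. Only times of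
  the right parity contribute, and they correspond to levels \<open>j\<close>. Which of the two vertices is closer to the
  base vertex decides whether \<open>s \<le> 0\<close> or \<open>s \<ge> 1\<close>, hence which evaluation of the level sum applies.\<close>

lemma vel_wave_eval_wave_ip:
  assumes k: "k = 0 \<or> k = 1"
  shows "ip K (tshift k (vel_wave x)) (eval_wave v) = (if k = 1 \<and> x = v then 1 else 0)"
proof -
  let ?m = "int (lev x)" and ?n = "int (lev v)" and ?p = "int (confluence x v)"
  let ?T = "\<lambda>n. complex_of_real cc * ip (L2 \<nu>) (tshift k (vel_wave x) n) (eval_wave v n)"
  have hs: "(?T has_sum ip K (tshift k (vel_wave x)) (eval_wave v)) UNIV" by (rule K_ip_has_sum) auto
  have "(?T has_sum (if k = 1 \<and> x = v then 1 else 0)) UNIV"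
  proof (cases "even (?n - ?m + k + 1)")
    case False
    then have xv: "\<not> (k = 1 \<and> x = v)" by auto
    have "?T n = 0" for n
    proof -
      have "odd (n - k - ?m) \<or> odd (n + 1 - ?n)" using False by presburger
      then have "tshift k (vel_wave x) n = (\<lambda>_. 0) \<or> eval_wave v n = (\<lambda>_. 0)"
        unfolding tshift_def using vel_wave_parity[of "n - k" x] eval_wave_parity[of n v] by blast
      then show ?thesis by (elim disjE) (simp_all add: L2_ip)
    qed
    then have "?T = (\<lambda>_. 0)" by (intro ext)
    then show ?thesis unfolding if_not_P[OF xv] by (simp only: has_sum_0_simp)
  next
    case True
    define s where "s = (?n - ?m + k + 1) div 2"
    have s: "2 * s = ?n - ?m + k + 1" unfolding s_def by (rule even_two_times_div_two[OF True])
    \<comment> \<open>the time at which level \<open>j\<close> contributes\<close>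
    define f where "f j = 2 * j - ?m + k" for j
    have inj: "inj f" by (auto simp: f_def inj_on_def)
    have z: "?T n = 0" if "n \<notin> range f" for n
    proof -
      have "odd (n - k - ?m)"
      proof
        assume "even (n - k - ?m)"
        then obtain i where "n - k - ?m = 2 * i" by (rule evenE)
        then have "n = f (i + ?m)" by (simp add: f_def)
        then show False using that by blast
      qed
      then show ?thesis using vel_wave_parity[of "n - k" x] by (simp add: tshift_def L2_ip)
    qed
    have Tf: "?T (f j) = complex_of_real (cc * (2 * rt powi (k + 1 - 2 * ?m)) * LS.level_term ?m ?n ?p s j)" for j
      unfolding f_def tshift_def using vel_wave_eval_wave_term[OF s, of j] by (simp add: algebra_simps)
    have cp: "0 \<le> ?p" "?p \<le> ?m" "?p \<le> ?n" using confluence_in by auto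
    have "(LS.level_term ?m ?n ?p s has_sum (if k = 1 \<and> x = v then real q powi ?m / (real q + 1) else 0)) UNIV"
    proof (cases "s \<le> 0")
      case True
      have nx: "\<not> (k = 1 \<and> x = v)" using s True by auto
      have "?m + s > ?p" using s cp k by linarith
      from LS.level_sum_below[OF True this cp] show ?thesis unfolding if_not_P[OF nx] .
    next
      case False
      then have s1: "s \<ge> 1" by simp
      show ?thesis
      proof (cases "k = 1 \<and> x = v")
        case True
        then have eqs: "s = 1" "?p = ?m" "?n = ?m" using s by auto
        have X: "(LS.level_term ?m ?n ?p 1 has_sum (if ?p + 1 \<le> ?n then 0 else real q powi (?p + 1 - 1) / (real q + 1))) UNIV"
          by (rule LS.level_sum_above) (use eqs cp in linarith)+
        have "\<not> ?p + 1 \<le> ?n" using eqs by linarith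
        then have nle: "(?p + 1 \<le> ?n) = False" by blast
        have e: "?p + 1 - 1 = ?m" using eqs by linarith
        show ?thesis using X unfolding nle e if_False if_P[OF True] eqs(1) .
      next
        case False
        have "?p + s \<le> ?n"
        proof (rule ccontr)
          assume "\<not> ?p + s \<le> ?n"
          then have "k = 1 \<and> ?p = ?m \<and> ?p = ?n" using s cp k by (intro conjI) linarith+
          then show False using confluence_eq[of x v] False by auto
        qed
        then have "(LS.level_term ?m ?n ?p s has_sum 0) UNIV"
          using LS.level_sum_above[of s ?p ?n ?m] cp s1 by simp
        then show ?thesis using False by (simp only: if_False)
      qed
    qed
    then have X: "((\<lambda>j. complex_of_real (cc * (2 * rt powi (k + 1 - 2 * ?m)) * LS.level_term ?m ?n ?p s j)) has_sum
      complex_of_real (cc * (2 * rt powi (k + 1 - 2 * ?m)) * (if k = 1 \<and> x = v then real q powi ?m / (real q + 1) else 0))) UNIV"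
      by (intro has_sum_of_real has_sum_cmult_right)
    have Y: "cc * (2 * rt powi (k + 1 - 2 * ?m)) * (if k = 1 \<and> x = v then real q powi ?m / (real q + 1) else 0)
        = (if k = 1 \<and> x = v then 1 else 0)"
    proof (cases "k = 1 \<and> x = v")
      case True
      have e: "k + 1 - 2 * ?m = 2 * (1 - ?m)" using True by simp
      have R: "rt powi (k + 1 - 2 * ?m) = real q powi (1 - ?m)" unfolding e by (rule rt_powi_even)
      have M: "real q powi (1 - ?m) * real q powi ?m = real q"
        using q2 power_int_add[of "real q" "1 - ?m" ?m] by simp
      have "cc * (2 * rt powi (k + 1 - 2 * ?m)) * (real q powi ?m / (real q + 1))
          = cc * (2 * (real q powi (1 - ?m) * real q powi ?m) / (real q + 1))"
        unfolding R by simp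
      also have "\<dots> = 1" unfolding M by (rule cc_eq)
      finally show ?thesis unfolding if_P[OF True] .
    qed auto
    have Z: "complex_of_real (if k = 1 \<and> x = v then 1 else 0) = (if k = 1 \<and> x = v then 1 else 0)" by simp
    have "((?T \<circ> f) has_sum (if k = 1 \<and> x = v then 1 else 0)) UNIV"
      using X unfolding comp_def Tf Y Z .
    then have "(?T has_sum (if k = 1 \<and> x = v then 1 else 0)) (range f)"
      using has_sum_reindex[OF inj] by blast
    then show ?thesis by (rule has_sum_cong_neutral[THEN iffD1, rotated -1]) (use z in auto)
  qed
  then show ?thesis using hs has_sum_unique by blast
qed

end

section \<open>The translation representation of finitely supported data\<close>

definition lincomb :: "('v \<Rightarrow> complex) \<Rightarrow> ('v \<Rightarrow> complex) \<Rightarrow> complex" where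
  "lincomb f e = (\<Sum>v | f v \<noteq> 0. f v * e v)"

lemma lincomb_superset: "finite A \<Longrightarrow> {v. f v \<noteq> 0} \<subseteq> A \<Longrightarrow> lincomb f e = (\<Sum>v\<in>A. f v * e v)"
  unfolding lincomb_def by (rule sum.mono_neutral_left) auto

lemma lincomb_add_left: "finsupp f \<Longrightarrow> finsupp g \<Longrightarrow> lincomb (\<lambda>v. f v + g v) e = lincomb f e + lincomb g e"
proof -
  assume "finsupp f" "finsupp g"
  then have fin: "finite ({v. f v \<noteq> 0} \<union> {v. g v \<noteq> 0})" by (simp add: finsupp_def)
  have "lincomb (\<lambda>v. f v + g v) e = (\<Sum>v\<in>{v. f v \<noteq> 0} \<union> {v. g v \<noteq> 0}. (f v + g v) * e v)"
    by (rule lincomb_superset[OF fin]) auto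
  also have "\<dots> = lincomb f e + lincomb g e"
    by (simp add: lincomb_superset[OF fin, of f] lincomb_superset[OF fin, of g] distrib_right sum.distrib)
  finally show ?thesis .
qed

lemma lincomb_smul_left: "lincomb (\<lambda>v. a * f v) e = a * lincomb f e"
  by (cases "a = 0") (simp_all add: lincomb_def sum_distrib_left mult.assoc)

lemma lincomb_add_right: "lincomb f (\<lambda>v. e v + e' v) = lincomb f e + lincomb f e'"
  by (simp add: lincomb_def distrib_left sum.distrib)

lemma lincomb_smul_right: "lincomb f (\<lambda>v. a * e v) = a * lincomb f e"
  by (simp add: lincomb_def sum_distrib_left mult.left_commute)

lemma lincomb_delta: "finsupp f \<Longrightarrow> lincomb f (\<lambda>x. if x = v then 1 else 0) = f v"
proof -
  assume "finsupp f"
  then have "finite (insert v {v. f v \<noteq> 0})" by (simp add: finsupp_def)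
  then have "lincomb f (\<lambda>x. if x = v then 1 else 0) = (\<Sum>x\<in>insert v {v. f v \<noteq> 0}. f x * (if x = v then 1 else 0))"
    by (rule lincomb_superset) auto
  also have "\<dots> = (\<Sum>x\<in>insert v {v. f v \<noteq> 0}. if x = v then f x else 0)" by (intro sum.cong) auto
  also have "\<dots> = f v" using \<open>finite (insert v _)\<close> by (simp add: sum.delta)
  finally show ?thesis .
qed

lemma finsupp_add: "finsupp f \<Longrightarrow> finsupp g \<Longrightarrow> finsupp (\<lambda>v. f v + g v)"
  unfolding finsupp_def by (rule finite_subset[of _ "{v. f v \<noteq> 0} \<union> {v. g v \<noteq> 0}"]) auto

lemma finsupp_smul: "finsupp f \<Longrightarrow> finsupp (\<lambda>v. a * f v)"
  unfolding finsupp_def by (rule finite_subset[of _ "{v. f v \<noteq> 0}"]) auto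

context boundary_tree
begin

lemma finsupp_adj_op: "finsupp f \<Longrightarrow> finsupp (adj_op adj f)"
proof -
  assume "finsupp f"
  then have "finite (\<Union>u\<in>{v. f v \<noteq> 0}. {w. adj u w})" by (simp add: finsupp_def)
  moreover have "{v. adj_op adj f v \<noteq> 0} \<subseteq> (\<Union>u\<in>{v. f v \<noteq> 0}. {w. adj u w})"
  proof
    fix v assume "v \<in> {v. adj_op adj f v \<noteq> 0}"
    then obtain u where "adj v u" "f u \<noteq> 0" unfolding adj_op_def by (auto elim: sum.not_neutral_contains_not_neutral)
    then show "v \<in> (\<Union>u\<in>{v. f v \<noteq> 0}. {w. adj u w})" using adj_sym by auto
  qed
  ultimately show ?thesis unfolding finsupp_def by (rule finite_subset[rotated])
qed

text \<open>The adjacency operator is symmetric.\<close>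

lemma lincomb_adj_op:
  assumes f: "finsupp f"
  shows "lincomb (adj_op adj f) e = lincomb f (\<lambda>v. \<Sum>u | adj v u. e u)"
proof -
  let ?S = "{v. f v \<noteq> 0}"
  define T where "T = ?S \<union> (\<Union>u\<in>?S. {w. adj u w})"
  have fin: "finite T" using f by (simp add: T_def finsupp_def)
  have "{v. adj_op adj f v \<noteq> 0} \<subseteq> T"
  proof
    fix v assume "v \<in> {v. adj_op adj f v \<noteq> 0}"
    then obtain u where "adj v u" "f u \<noteq> 0" unfolding adj_op_def by (auto elim: sum.not_neutral_contains_not_neutral)
    then show "v \<in> T" using adj_sym by (auto simp: T_def)
  qed
  then have "lincomb (adj_op adj f) e = (\<Sum>v\<in>T. (\<Sum>u | adj v u. f u) * e v)"
    unfolding adj_op_def[symmetric] by (rule lincomb_superset[OF fin])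
  also have "\<dots> = (\<Sum>v\<in>T. \<Sum>u\<in>T. if adj v u then f u * e v else 0)"
  proof (rule sum.cong)
    fix v assume "v \<in> T"
    have "(\<Sum>u | adj v u. f u) = (\<Sum>u\<in>{u. adj v u} \<inter> T. f u)"
      by (rule sum.mono_neutral_right) (auto simp: T_def)
    also have "\<dots> = (\<Sum>u\<in>T. if adj v u then f u else 0)"
      using fin by (simp add: sum.inter_restrict[symmetric] Int_commute flip: sum.inter_filter)
        (auto intro: sum.cong)
    finally show "(\<Sum>u | adj v u. f u) * e v = (\<Sum>u\<in>T. if adj v u then f u * e v else 0)"
      by (simp add: sum_distrib_right if_distrib[of "\<lambda>x. x * _"] cong: if_cong)
  qed simp
  also have "\<dots> = (\<Sum>u\<in>T. \<Sum>v\<in>T. if adj v u then f u * e v else 0)" by (rule sum.swap)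
  also have "\<dots> = (\<Sum>u\<in>T. f u * (\<Sum>v | adj u v. e v))"
  proof (rule sum.cong)
    fix u assume "u \<in> T"
    show "(\<Sum>v\<in>T. if adj v u then f u * e v else 0) = f u * (\<Sum>v | adj u v. e v)"
    proof (cases "f u = 0")
      case False
      then have sub: "{v. adj u v} \<subseteq> T" by (auto simp: T_def)
      have "(\<Sum>v\<in>T. if adj v u then f u * e v else 0) = (\<Sum>v | adj u v. f u * e v)"
        by (rule sum.mono_neutral_cong_right[OF fin sub]) (use adj_sym in auto)
      then show ?thesis by (simp add: sum_distrib_left)
    qed (simp cong: if_cong)
  qed simp
  also have "\<dots> = lincomb f (\<lambda>v. \<Sum>u | adj v u. e u)"
    by (rule lincomb_superset[OF fin, symmetric]) (auto simp: T_def)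
  finally show ?thesis .
qed

definition W0 :: "'v data \<Rightarrow> int \<Rightarrow> (nat \<Rightarrow> 'v) set \<Rightarrow> complex" where
  "W0 f n \<omega> = lincomb (fst f) (\<lambda>v. pos_wave v n \<omega>) + lincomb (snd f) (\<lambda>v. vel_wave v n \<omega>)"

abbreviation "FD \<equiv> fin_data q adj"

lemma carr_FD: "f \<in> carr FD \<longleftrightarrow> finsupp (fst f) \<and> finsupp (snd f)"
  by (simp add: fin_data_def)

lemma FD_add: "add FD f g = (\<lambda>v. fst f v + fst g v, \<lambda>v. snd f v + snd g v)"
  and FD_smul: "smul FD a f = (\<lambda>v. a * fst f v, \<lambda>v. a * snd f v)"
  by (simp_all add: fin_data_def)

lemma W0_add: "f \<in> carr FD \<Longrightarrow> g \<in> carr FD \<Longrightarrow> W0 (add FD f g) = add K (W0 f) (W0 g)"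
  by (simp add: fun_eq_iff W0_def carr_FD FD_add K_add lincomb_add_left)

lemma W0_smul: "W0 (smul FD a f) = smul K a (W0 f)"
  by (simp add: fun_eq_iff W0_def FD_smul K_smul lincomb_smul_left distrib_left)

lemma K_zero: "(\<lambda>n \<omega>. 0) \<in> carr K"
  using K.smul_closed[OF eval_wave_K, of 0 x0] by (simp add: K_smul)

lemma K_sum:
  assumes A: "finite A" and e: "\<And>v. e v \<in> carr K" and h: "h \<in> carr K"
  shows "(\<lambda>n \<omega>. \<Sum>v\<in>A. g v * e v n \<omega>) \<in> carr K
    \<and> ip K (\<lambda>n \<omega>. \<Sum>v\<in>A. g v * e v n \<omega>) h = (\<Sum>v\<in>A. g v * ip K (e v) h)"
  using A
proof induction
  case empty
  have "ip K (smul K 0 h) h = 0" using h by (simp add: K.ip_smul_left)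
  then show ?case using K_zero by (simp add: K_smul)
next
  case (insert v A)
  have "(\<lambda>n \<omega>. \<Sum>v\<in>insert v A. g v * e v n \<omega>) = add K (smul K (g v) (e v)) (\<lambda>n \<omega>. \<Sum>v\<in>A. g v * e v n \<omega>)"
    using insert by (simp add: K_add K_smul fun_eq_iff)
  then show ?case using insert e h by (simp add: K.ip_expand)
qed

lemma K_lincomb:
  assumes g: "finsupp g" and e: "\<And>v. e v \<in> carr K"
  shows K_lincomb_closed: "(\<lambda>n \<omega>. lincomb g (\<lambda>v. e v n \<omega>)) \<in> carr K"
    and K_lincomb_ip: "\<And>h. h \<in> carr K \<Longrightarrow> ip K (\<lambda>n \<omega>. lincomb g (\<lambda>v. e v n \<omega>)) h = lincomb g (\<lambda>v. ip K (e v) h)"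
  using K_sum[of "{v. g v \<noteq> 0}" e _ g] g e K_zero by (auto simp: lincomb_def finsupp_def)

lemma K_nbrs:
  assumes e: "\<And>v. e v \<in> carr K"
  shows K_nbrs_closed: "(\<lambda>n \<omega>. \<Sum>u | adj v u. e u n \<omega>) \<in> carr K"
    and K_nbrs_ip: "\<And>h. h \<in> carr K \<Longrightarrow> ip K (\<lambda>n \<omega>. \<Sum>u | adj v u. e u n \<omega>) h = (\<Sum>u | adj v u. ip K (e u) h)"
    and K_nbrs_ip': "\<And>h. h \<in> carr K \<Longrightarrow> ip K h (\<lambda>n \<omega>. \<Sum>u | adj v u. e u n \<omega>) = (\<Sum>u | adj v u. ip K h (e u))"
proof -
  show c: "(\<lambda>n \<omega>. \<Sum>u | adj v u. e u n \<omega>) \<in> carr K"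
    using K_sum[of "{u. adj v u}" e _ "\<lambda>_. 1"] e K_zero by auto
  show i: "ip K (\<lambda>n \<omega>. \<Sum>u | adj v u. e u n \<omega>) h = (\<Sum>u | adj v u. ip K (e u) h)" if "h \<in> carr K" for h
    using K_sum[of "{u. adj v u}" e h "\<lambda>_. 1"] e that by simp
  show "ip K h (\<lambda>n \<omega>. \<Sum>u | adj v u. e u n \<omega>) = (\<Sum>u | adj v u. ip K h (e u))" if h: "h \<in> carr K" for h
  proof -
    have "ip K h (\<lambda>n \<omega>. \<Sum>u | adj v u. e u n \<omega>) = cnj (\<Sum>u | adj v u. ip K (e u) h)"
      using K.ip_cnj[OF c h] i[OF h] by simp
    also have "\<dots> = (\<Sum>u | adj v u. cnj (ip K (e u) h))" by simp
    also have "\<dots> = (\<Sum>u | adj v u. ip K h (e u))"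
      by (intro sum.cong refl K.ip_cnj[OF e h, symmetric])
    finally show ?thesis .
  qed
qed

lemma W0_K [simp]: "f \<in> carr FD \<Longrightarrow> W0 f \<in> carr K"
proof -
  assume f: "f \<in> carr FD"
  have "W0 f = add K (\<lambda>n \<omega>. lincomb (fst f) (\<lambda>v. pos_wave v n \<omega>)) (\<lambda>n \<omega>. lincomb (snd f) (\<lambda>v. vel_wave v n \<omega>))"
    by (simp add: W0_def K_add fun_eq_iff)
  then show ?thesis using f by (simp add: carr_FD K_lincomb_closed)
qed

lemma W0_ip:
  assumes f: "f \<in> carr FD" and h: "h \<in> carr K"
  shows "ip K (W0 f) h = lincomb (fst f) (\<lambda>v. ip K (pos_wave v) h) + lincomb (snd f) (\<lambda>v. ip K (vel_wave v) h)"
proof -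
  have "W0 f = add K (\<lambda>n \<omega>. lincomb (fst f) (\<lambda>v. pos_wave v n \<omega>)) (\<lambda>n \<omega>. lincomb (snd f) (\<lambda>v. vel_wave v n \<omega>))"
    by (simp add: W0_def K_add fun_eq_iff)
  then show ?thesis using f h by (simp add: carr_FD K_lincomb_closed K_lincomb_ip K.ip_add_left)
qed

lemma rt_complex: "complex_of_real (sqrt (real q)) = complex_of_real rt" "complex_of_real rt * complex_of_real rt = of_nat q"
  "complex_of_real rt \<noteq> 0"
proof -
  show "complex_of_real (sqrt (real q)) = complex_of_real rt" by (simp add: rt_def)
  have "complex_of_real (rt * rt) = complex_of_real (real q)" using rt by (simp add: power2_eq_square)
  then show "complex_of_real rt * complex_of_real rt = of_nat q" by simp
  show "complex_of_real rt \<noteq> 0" using rt by simp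
qed

lemma prop_closed: "f \<in> carr FD \<Longrightarrow> prop_fin q adj f \<in> carr FD"
proof -
  assume f: "f \<in> carr FD"
  have d: "finsupp g \<Longrightarrow> finsupp (\<lambda>v. g v / c)" for g :: "'v \<Rightarrow> complex" and c
    using finsupp_smul[of g "1 / c"] by simp
  have m: "finsupp g \<Longrightarrow> finsupp h \<Longrightarrow> finsupp (\<lambda>v. g v - h v)" for g h :: "'v \<Rightarrow> complex"
    using finsupp_add[OF _ finsupp_smul, of g h "-1"] by simp
  show ?thesis using f unfolding carr_FD prop_fin_def fst_conv snd_conv
    by (intro conjI finsupp_add d m finsupp_adj_op) auto
qed

text \<open>With \<open>A / (2 \<surd>q)\<close> acting on the waves as \<open>(S + S\<^sup>-\<^sup>1) / 2\<close>, the coefficient of \<open>f\<^sub>2\<close> becomes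
  \<open>b\<^sub>v + (S + S\<^sup>-\<^sup>1) a\<^sub>v / 2 = S a\<^sub>v\<close>, and that of \<open>f\<^sub>1\<close> becomes \<open>(S + S\<^sup>-\<^sup>1) b\<^sub>v / 2 + (S - S\<^sup>-\<^sup>1)\<^sup>2 a\<^sub>v / 4 = S b\<^sub>v\<close>.\<close>

lemma W0_prop:
  assumes f: "f \<in> carr FD" shows "W0 (prop_fin q adj f) = tshift 1 (W0 f)"
proof (intro ext)
  fix n \<omega>
  let ?r = "complex_of_real rt"
  let ?a = "\<lambda>n v. vel_wave v n \<omega>" and ?b = "\<lambda>n v. pos_wave v n \<omega>"
  have f12: "finsupp (fst f)" "finsupp (snd f)" using f by (auto simp: carr_FD)
  have na: "(\<lambda>v. \<Sum>u | adj v u. vel_wave u m \<omega>) = (\<lambda>v. ?r * (vel_wave v (m - 1) \<omega> + vel_wave v (m + 1) \<omega>))" for m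
    using vel_wave_recursion rt_complex by (simp add: fun_eq_iff)
  have nb: "(\<lambda>v. \<Sum>u | adj v u. pos_wave u m \<omega>) = (\<lambda>v. ?r * (pos_wave v (m - 1) \<omega> + pos_wave v (m + 1) \<omega>))" for m
    using pos_wave_recursion rt_complex by (simp add: fun_eq_iff)
  have naa: "lincomb (adj_op adj (adj_op adj (fst f))) (?a n)
      = of_nat q * (lincomb (fst f) (?a (n - 2)) + 2 * lincomb (fst f) (?a n) + lincomb (fst f) (?a (n + 2)))"
  proof -
    have "lincomb (adj_op adj (adj_op adj (fst f))) (?a n)
        = ?r * lincomb (adj_op adj (fst f)) (\<lambda>v. vel_wave v (n - 1) \<omega> + vel_wave v (n + 1) \<omega>)"
      unfolding lincomb_adj_op[OF finsupp_adj_op[OF f12(1)]] na lincomb_smul_right ..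
    also have "\<dots> = ?r * (lincomb (fst f) (\<lambda>v. ?r * (vel_wave v (n - 1 - 1) \<omega> + vel_wave v (n - 1 + 1) \<omega>))
        + lincomb (fst f) (\<lambda>v. ?r * (vel_wave v (n + 1 - 1) \<omega> + vel_wave v (n + 1 + 1) \<omega>)))"
      unfolding lincomb_add_right lincomb_adj_op[OF f12(1)] na ..
    also have "\<dots> = (?r * ?r) * (lincomb (fst f) (?a (n - 2)) + 2 * lincomb (fst f) (?a n) + lincomb (fst f) (?a (n + 2)))"
      unfolding lincomb_smul_right lincomb_add_right by (simp add: algebra_simps)
    finally show ?thesis unfolding rt_complex .
  qed
  define g1 where "g1 = (\<lambda>v. (1 / (2 * ?r)) * adj_op adj (fst f) v)"
  define g2 where "g2 = (\<lambda>v. (1 / (4 * of_nat q)) * adj_op adj (adj_op adj (fst f)) v)"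
  define g3 where "g3 = (\<lambda>v. (-1) * fst f v)"
  define g4 where "g4 = (\<lambda>v. (1 / (2 * ?r)) * adj_op adj (snd f) v)"
  have fs: "finsupp g1" "finsupp g2" "finsupp g3" "finsupp g4"
    unfolding g1_def g2_def g3_def g4_def using f12 by (intro finsupp_smul finsupp_adj_op; simp)+
  have p: "prop_fin q adj f = (\<lambda>v. g1 v + snd f v, \<lambda>v. (g2 v + g3 v) + g4 v)"
    by (simp add: prop_fin_def g1_def g2_def g3_def g4_def rt_complex(1))
  have b: "lincomb g (?b m) = (lincomb g (?a (m - 1)) - lincomb g (?a (m + 1))) / 2" for m g
  proof -
    have "?b m = (\<lambda>v. (1/2) * (?a (m - 1) v + (-1) * ?a (m + 1) v))"
      by (simp add: pos_wave_eq fun_eq_iff)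
    then show ?thesis by (simp only: lincomb_smul_right lincomb_add_right) simp
  qed
  have R: "tshift 1 (W0 f) n \<omega> = lincomb (fst f) (?b (n - 1)) + lincomb (snd f) (?a (n - 1))"
    by (simp add: tshift_def W0_def)
  have "W0 (prop_fin q adj f) n \<omega> = lincomb g1 (?b n) + lincomb (snd f) (?b n) + (lincomb g2 (?a n) + lincomb g3 (?a n) + lincomb g4 (?a n))"
    unfolding W0_def p fst_conv snd_conv
    by (simp add: lincomb_add_left fs f12 finsupp_add)
  also have "lincomb g1 (?b n) = (lincomb (fst f) (?b (n - 1)) + lincomb (fst f) (?b (n + 1))) / 2"
    unfolding g1_def lincomb_smul_left lincomb_adj_op[OF f12(1)] nb lincomb_smul_right lincomb_add_right
    using rt_complex by simp
  also have "lincomb g2 (?a n) = (lincomb (fst f) (?a (n - 2)) + 2 * lincomb (fst f) (?a n) + lincomb (fst f) (?a (n + 2))) / 4"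
    unfolding g2_def lincomb_smul_left naa using q2 by simp
  also have "lincomb g3 (?a n) = - lincomb (fst f) (?a n)" unfolding g3_def lincomb_smul_left by simp
  also have "lincomb g4 (?a n) = (lincomb (snd f) (?a (n - 1)) + lincomb (snd f) (?a (n + 1))) / 2"
    unfolding g4_def lincomb_smul_left lincomb_adj_op[OF f12(2)] na lincomb_smul_right lincomb_add_right
    using rt_complex by simp
  also have "(lincomb (fst f) (?b (n - 1)) + lincomb (fst f) (?b (n + 1))) / 2 + lincomb (snd f) (?b n)
      + ((lincomb (fst f) (?a (n - 2)) + 2 * lincomb (fst f) (?a n) + lincomb (fst f) (?a (n + 2))) / 4 + - lincomb (fst f) (?a n)
        + (lincomb (snd f) (?a (n - 1)) + lincomb (snd f) (?a (n + 1))) / 2) = tshift 1 (W0 f) n \<omega>"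
    unfolding R b by (simp add: field_simps)
  finally show "W0 (prop_fin q adj f) n \<omega> = tshift 1 (W0 f) n \<omega>" .
qed

subsection \<open>Recovering the data from its representation\<close>

text \<open>The wave equation at time \<open>0\<close>, where the solution vanishes.\<close>

lemma tshift_minus_vel_wave_eval_wave: "ip K (tshift (-1) (vel_wave x)) (eval_wave v) = - ip K (tshift 1 (vel_wave x)) (eval_wave v)"
proof -
  have e: "add K (tshift 1 (vel_wave x)) (tshift (-1) (vel_wave x)) = smul K (1 / complex_of_real rt) (\<lambda>n \<omega>. \<Sum>u | adj x u. vel_wave u n \<omega>)"
    using vel_wave_recursion by (simp add: K_add K_smul tshift_def fun_eq_iff)
  have "ip K (tshift 1 (vel_wave x)) (eval_wave v) + ip K (tshift (-1) (vel_wave x)) (eval_wave v)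
      = ip K (add K (tshift 1 (vel_wave x)) (tshift (-1) (vel_wave x))) (eval_wave v)" by (simp add: K.ip_add_left)
  also have "\<dots> = 1 / complex_of_real rt * (\<Sum>u | adj x u. ip K (vel_wave u) (eval_wave v))"
    unfolding e by (simp add: K.ip_smul_left K_nbrs_closed K_nbrs_ip)
  also have "\<dots> = 0" using vel_wave_eval_wave_ip[of 0 _ v] by simp
  finally show ?thesis by (simp add: add_eq_0_iff)
qed

lemma W0_eval_wave: "f \<in> carr FD \<Longrightarrow> ip K (W0 f) (eval_wave v) = fst f v"
proof -
  assume f: "f \<in> carr FD"
  have a: "ip K (vel_wave x) (eval_wave v) = 0" for x using vel_wave_eval_wave_ip[of 0 x v] by simp
  have b: "ip K (pos_wave x) (eval_wave v) = (if x = v then 1 else 0)" for x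
    using vel_wave_eval_wave_ip[of 1 x v] by (simp add: pos_wave_def K.ip_expand tshift_minus_vel_wave_eval_wave)
  have "finsupp (fst f)" using f by (simp add: carr_FD)
  then show ?thesis using W0_ip[OF f eval_wave_K, of v] by (simp add: a b lincomb_delta) (simp add: lincomb_def)
qed

text \<open>The recursion for \<open>w\<^sub>v\<close> removes \<open>S w\<^sub>v\<close> from \<open>a\<^sub>v\<close>: \<open>a\<^sub>v = S\<^sup>-\<^sup>1 w\<^sub>v - q\<^bsup>-1/2\<^esup> \<Sum>\<^bsub>u \<sim> v\<^esub> w\<^sub>u / 2\<close>. For
  \<open>g = W0 f\<close> the vector \<open>S g\<close> represents the propagated data, so both terms are evaluations.\<close>

lemma ip_vel_wave:
  assumes g: "g \<in> carr K"
  shows "ip K g (vel_wave v) = ip K (tshift 1 g) (eval_wave v) - (\<Sum>u | adj v u. ip K g (eval_wave u)) / (2 * complex_of_real rt)"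
proof -
  have e: "vel_wave v = add K (tshift (-1) (eval_wave v)) (smul K (- 1 / complex_of_real (2 * rt)) (\<lambda>n \<omega>. \<Sum>u | adj v u. eval_wave u n \<omega>))"
  proof (intro ext)
    fix n \<omega>
    have "(\<Sum>u | adj v u. eval_wave u n \<omega>) = complex_of_real rt * (eval_wave v (n - 1) \<omega> + eval_wave v (n + 1) \<omega>)"
      using eval_wave_recursion[of v n \<omega>] rt_complex by simp
    then show "vel_wave v n \<omega> = add K (tshift (-1) (eval_wave v)) (smul K (- 1 / complex_of_real (2 * rt)) (\<lambda>n \<omega>. \<Sum>u | adj v u. eval_wave u n \<omega>)) n \<omega>"
      using rt_complex by (simp add: K_add K_smul tshift_def vel_wave_eq field_simps)
  qed
  show ?thesis
    unfolding e using g by (simp add: K.ip_expand K_nbrs_closed K_nbrs_ip' tshift_ip_left)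
qed

lemma ip_pos_wave:
  assumes g: "g \<in> carr K"
  shows "ip K g (pos_wave v) = (\<Sum>u | adj v u. ip K g (vel_wave u)) / (2 * complex_of_real rt) - ip K (tshift 1 g) (vel_wave v)"
proof -
  have e: "pos_wave v = add K (smul K (1 / complex_of_real (2 * rt)) (\<lambda>n \<omega>. \<Sum>u | adj v u. vel_wave u n \<omega>)) (smul K (-1) (tshift (-1) (vel_wave v)))"
  proof (intro ext)
    fix n \<omega>
    have "(\<Sum>u | adj v u. vel_wave u n \<omega>) = complex_of_real rt * (vel_wave v (n - 1) \<omega> + vel_wave v (n + 1) \<omega>)"
      using vel_wave_recursion[of v n \<omega>] rt_complex by simp
    then show "pos_wave v n \<omega> = add K (smul K (1 / complex_of_real (2 * rt)) (\<lambda>n \<omega>. \<Sum>u | adj v u. vel_wave u n \<omega>)) (smul K (-1) (tshift (-1) (vel_wave v))) n \<omega>"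
      using rt_complex by (simp add: K_add K_smul tshift_def pos_wave_eq field_simps)
  qed
  show ?thesis
    unfolding e using g by (simp add: K.ip_expand K_nbrs_closed K_nbrs_ip' tshift_ip_left)
qed

lemma W0_vel_wave: "f \<in> carr FD \<Longrightarrow> ip K (W0 f) (vel_wave v) = snd f v"
  by (simp add: ip_vel_wave W0_eval_wave prop_closed flip: W0_prop)
    (simp add: prop_fin_def adj_op_def rt_complex(1))

lemma W0_pos_wave: "f \<in> carr FD \<Longrightarrow> ip K (W0 f) (pos_wave v) = fst f v - adj_op adj (adj_op adj (fst f)) v / (4 * of_nat q)"
  by (simp add: ip_pos_wave W0_vel_wave prop_closed flip: W0_prop)
    (simp add: prop_fin_def adj_op_def[of adj "snd f"] rt_complex(1))

lemma fin_ip_eq: "finsupp f \<Longrightarrow> fin_ip g f = (\<Sum>v | f v \<noteq> 0. cnj (f v) * g v)"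
  unfolding fin_ip_def finsupp_def by (rule sum.mono_neutral_cong_left) auto

text \<open>Expanding the second argument reduces the claim to the inner products with \<open>b\<^sub>v\<close> and \<open>a\<^sub>v\<close>, which are the
  values at \<open>v\<close> of \<open>f\<^sub>1 - A\<^sup>2 f\<^sub>1 / 4q\<close> and \<open>f\<^sub>2\<close>.\<close>

lemma W0_isometry:
  assumes f: "f \<in> carr FD" and g: "g \<in> carr FD"
  shows "ip K (W0 f) (W0 g) = ip FD f g"
proof -
  have "ip K (W0 f) (W0 g) = cnj (lincomb (fst g) (\<lambda>v. ip K (pos_wave v) (W0 f)) + lincomb (snd g) (\<lambda>v. ip K (vel_wave v) (W0 f)))"
    using K.ip_cnj[of "W0 g" "W0 f"] W0_ip[OF g W0_K[OF f]] f g by simp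
  also have "\<dots> = (\<Sum>v | fst g v \<noteq> 0. cnj (fst g v) * cnj (ip K (pos_wave v) (W0 f)))
      + (\<Sum>v | snd g v \<noteq> 0. cnj (snd g v) * cnj (ip K (vel_wave v) (W0 f)))"
    by (simp add: lincomb_def)
  also have "\<dots> = (\<Sum>v | fst g v \<noteq> 0. cnj (fst g v) * ip K (W0 f) (pos_wave v))
      + (\<Sum>v | snd g v \<noteq> 0. cnj (snd g v) * ip K (W0 f) (vel_wave v))"
    using K.ip_cnj[OF pos_wave_K W0_K[OF f]] K.ip_cnj[OF vel_wave_K W0_K[OF f]] by simp
  also have "\<dots> = ip FD f g"
    using g by (simp add: W0_pos_wave[OF f] W0_vel_wave[OF f] fin_data_def energy_form_def fin_ip_eq)
  finally show ?thesis .
qed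

text \<open>Positivity of the energy form, that is \<open>\<parallel>A\<parallel> \<le> 2 \<surd>q\<close>, is inherited along the isometry.\<close>

lemma prehilbert_FD: "prehilbert FD"
proof
  have "(\<lambda>_. 0, \<lambda>_. 0) \<in> carr FD" by (simp add: carr_FD finsupp_def)
  then show "carr FD \<noteq> {}" by blast
next
  fix f g assume f: "f \<in> carr FD" and g: "g \<in> carr FD"
  show a: "add FD f g \<in> carr FD" using f g by (simp add: carr_FD FD_add finsupp_add)
  show "ip FD g f = cnj (ip FD f g)"
    using K.ip_cnj[of "W0 f" "W0 g"] f g by (simp add: W0_isometry)
  fix h assume h: "h \<in> carr FD"
  show "ip FD (add FD f g) h = ip FD f h + ip FD g h"
    using K.ip_add_left[of "W0 f" "W0 g" "W0 h"] f g h a by (simp add: W0_isometry flip: W0_add)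
next
  fix f a assume f: "f \<in> carr FD"
  show s: "smul FD a f \<in> carr FD" using f by (simp add: carr_FD FD_smul finsupp_smul)
  show "0 \<le> Re (ip FD f f)" using K.ip_nonneg[of "W0 f"] f by (simp add: W0_isometry)
  fix g assume g: "g \<in> carr FD"
  show "ip FD (smul FD a f) g = a * ip FD f g"
    using K.ip_smul_left[of "W0 f" "W0 g" a] f g s by (simp add: W0_isometry flip: W0_smul)
qed

end

section \<open>The energy space\<close>

context boundary_tree
begin

sublocale FD: prehilbert FD by (rule prehilbert_FD)

abbreviation "H \<equiv> energy_space q adj"

lemma H_eq: "H = completion FD"
  by (simp add: energy_space_def)

lemma hilbert_H: "hilbert_space H"
  unfolding H_eq by (rule FD.hilbert_space_completion)

lemma carr_H: "X \<in> carr H \<longleftrightarrow> (\<forall>n. X n \<in> carr FD) \<and> hcauchy FD X"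
  unfolding H_eq by (rule FD.carr_completion_iff)

lemma prop_ip: "f \<in> carr FD \<Longrightarrow> g \<in> carr FD \<Longrightarrow> ip FD (prop_fin q adj f) (prop_fin q adj g) = ip FD f g"
  by (simp add: prop_closed tshift_ip W0_prop flip: W0_isometry)

lemma propagator_closed: "X \<in> carr H \<Longrightarrow> propagator q adj X \<in> carr H"
proof -
  assume X: "X \<in> carr H"
  have "hdist FD (prop_fin q adj f) (prop_fin q adj g) = hdist FD f g" if "f \<in> carr FD" "g \<in> carr FD" for f g
    using that by (intro ip_preserving_hdist prehilbert_FD prop_closed prop_ip)
  then show ?thesis using X by (auto simp: carr_H propagator_def prop_closed hcauchy_def)
qed

lemma W0_hdist: "f \<in> carr FD \<Longrightarrow> g \<in> carr FD \<Longrightarrow> hdist K (W0 f) (W0 g) = hdist FD f g"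
  by (rule ip_preserving_hdist[OF prehilbert_FD K.prehilbert_axioms W0_K W0_isometry])

text \<open>The limit is determined up to null functions only, so being a representation is a relation.\<close>

definition represents :: "(nat \<Rightarrow> 'v data) \<Rightarrow> (int \<Rightarrow> (nat \<Rightarrow> 'v) set \<Rightarrow> complex) \<Rightarrow> bool" where
  "represents X g \<longleftrightarrow> hlimit K (\<lambda>n. W0 (X n)) g"

lemma represents_carr: "represents X g \<Longrightarrow> g \<in> carr K"
  by (simp add: represents_def hlimit_def)

lemma represents_exists: "X \<in> carr H \<Longrightarrow> \<exists>g. represents X g"
proof -
  assume X: "X \<in> carr H"
  then have "hcauchy K (\<lambda>n. W0 (X n))" by (auto simp: carr_H hcauchy_def W0_hdist)
  then show ?thesis unfolding represents_def
    using X by (intro hilbert_space_complete[OF hilbert_K]) (auto simp: carr_H)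
qed

lemma hlimit_tshift: "hlimit K G g \<Longrightarrow> (\<And>n. G n \<in> carr K) \<Longrightarrow> hlimit K (\<lambda>n. tshift k (G n)) (tshift k g)"
proof -
  assume l: "hlimit K G g" and G: "\<And>n. G n \<in> carr K"
  have g: "g \<in> carr K" using l by (simp add: hlimit_def)
  have "hdist K (tshift k a) (tshift k b) = hdist K a b" if "a \<in> carr K" "b \<in> carr K" for a b
    using that by (intro ip_preserving_hdist K.prehilbert_axioms tshift_closed tshift_ip)
  then show ?thesis using l G g by (simp add: hlimit_def)
qed

lemma represents_propagator:
  assumes X: "X \<in> carr H" and g: "represents X g" and g': "represents (propagator q adj X) g'"
  shows "heq K g' (tshift 1 g)"
proof (rule K.hlimit_unique)
  have Xc: "X n \<in> carr FD" for n using X by (simp add: carr_H)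
  show "hlimit K (\<lambda>n. W0 (prop_fin q adj (X n))) g'" using g' by (simp add: represents_def propagator_def)
  show "hlimit K (\<lambda>n. W0 (prop_fin q adj (X n))) (tshift 1 g)"
    using hlimit_tshift[of "\<lambda>n. W0 (X n)" g 1] g Xc by (simp add: represents_def W0_prop)
  show "W0 (prop_fin q adj (X n)) \<in> carr K" for n using Xc by (simp add: prop_closed)
qed

text \<open>Evaluations are inner products with waves, hence continuous for the energy norm; this is why the
  pointwise limits that define the components of an element of the completion exist.\<close>

lemma represents_data:
  assumes X: "X \<in> carr H" and g: "represents X g"
  shows "fst (data_fun X) v = ip K g (eval_wave v)" "snd (data_fun X) v = ip K g (vel_wave v)"
proof -
  have Xc: "X n \<in> carr FD" for n using X by (simp add: carr_H)
  have "(\<lambda>n. ip K (W0 (X n)) h) \<longlonglongrightarrow> ip K g h" if "h \<in> carr K" for h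
    using g that Xc by (intro K.hlimit_ip K.hlimit_const) (auto simp: represents_def)
  from this[OF eval_wave_K[of v]] this[OF vel_wave_K[of v]]
  have "(\<lambda>n. fst (X n) v) \<longlonglongrightarrow> ip K g (eval_wave v)" "(\<lambda>n. snd (X n) v) \<longlonglongrightarrow> ip K g (vel_wave v)"
    using Xc by (simp_all add: W0_eval_wave W0_vel_wave)
  then show "fst (data_fun X) v = ip K g (eval_wave v)" "snd (data_fun X) v = ip K g (vel_wave v)"
    by (simp_all add: data_fun_def limI)
qed

subsection \<open>Solutions of the wave equation\<close>

lemma wave_equation_unique:
  assumes u: "wave_equation q adj u" and w: "wave_equation q adj w"
    and init0: "\<And>v. u v 0 = w v 0" and init1: "\<And>v. (u v 1 - u v (-1)) / 2 = (w v 1 - w v (-1)) / 2"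
  shows "u = w"
proof -
  let ?A = "\<lambda>f v. adj_op adj f v / (2 * complex_of_real (sqrt (real q)))"
  have eu: "u v (t + 1) + u v (t - 1) = 2 * ?A (\<lambda>x. u x t) v" for v t
    using u by (simp add: wave_equation_def field_simps)
  have ew: "w v (t + 1) + w v (t - 1) = 2 * ?A (\<lambda>x. w x t) v" for v t
    using w by (simp add: wave_equation_def field_simps)
  have step: "u v (t + 1) - w v (t + 1) = - (u v (t - 1) - w v (t - 1))" if "\<And>x. u x t = w x t" for v t
  proof -
    have "?A (\<lambda>x. u x t) v = ?A (\<lambda>x. w x t) v" using that by (simp add: adj_op_def)
    then have "u v (t + 1) + u v (t - 1) = w v (t + 1) + w v (t - 1)" by (simp only: eu ew)
    then show ?thesis by (simp add: algebra_simps)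
  qed
  have one: "u v 1 = w v 1" "u v (-1) = w v (-1)" for v
  proof -
    have a: "u v 1 + u v (-1) = w v 1 + w v (-1)" using step[of 0 v] init0 by (simp add: algebra_simps)
    have b: "u v 1 - u v (-1) = w v 1 - w v (-1)" using init1[of v] unfolding divide_cancel_right by simp
    have "(u v 1 + u v (-1)) + (u v 1 - u v (-1)) = (w v 1 + w v (-1)) + (w v 1 - w v (-1))"
      by (simp only: a b)
    then show "u v 1 = w v 1" by simp
    then show "u v (-1) = w v (-1)" using a by simp
  qed
  define P where "P k \<longleftrightarrow> (\<forall>v. u v k = w v k)" for k
  have up: "P (k + 1)" if "P k" "P (k - 1)" for k using step[of k] that by (simp add: P_def)
  have down: "P (k - 1)" if "P k" "P (k + 1)" for k using step[of k] that by (simp add: P_def)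
  have "P (int n) \<and> P (int n + 1) \<and> P (- int n) \<and> P (- int n - 1)" for n
  proof (induction n)
    case 0 show ?case using init0 one by (simp add: P_def)
  next
    case (Suc n)
    have e: "int (Suc n) = int n + 1" "int (Suc n) + 1 = int n + 1 + 1"
      "- int (Suc n) = - int n - 1" "- int (Suc n) - 1 = - int n - 1 - 1" by simp_all
    have "P (int n + 1 + 1)" using up[of "int n + 1"] Suc by simp
    moreover have "P (- int n - 1 - 1)" using down[of "- int n - 1"] Suc by simp
    ultimately show ?case using Suc e by metis
  qed
  then have "P t" for t by (cases t rule: int_cases2) auto
  then have "u v t = w v t" for v t by (simp add: P_def)
  then show ?thesis by (simp add: fun_eq_iff)
qed

lemma ip_nbrs_eval_wave:
  assumes g: "g \<in> carr K"
  shows "(\<Sum>u | adj v u. ip K g (eval_wave u)) = complex_of_real rt * (ip K (tshift 1 g) (eval_wave v) + ip K (tshift (-1) g) (eval_wave v))"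
proof -
  have "(\<lambda>n \<omega>. \<Sum>u | adj v u. eval_wave u n \<omega>) = smul K (complex_of_real rt) (add K (tshift 1 (eval_wave v)) (tshift (-1) (eval_wave v)))"
    using eval_wave_recursion rt_complex by (simp add: K_add K_smul tshift_def fun_eq_iff)
  then have "(\<Sum>u | adj v u. ip K g (eval_wave u)) = ip K g (smul K (complex_of_real rt) (add K (tshift 1 (eval_wave v)) (tshift (-1) (eval_wave v))))"
    using K_nbrs_ip'[where e = eval_wave and v = v, OF eval_wave_K g] by simp
  then show ?thesis using g by (simp add: K.ip_expand tshift_ip_left)
qed

lemma ip_vel_wave_diff: "h \<in> carr K \<Longrightarrow> ip K h (vel_wave v) = (ip K (tshift 1 h) (eval_wave v) - ip K (tshift (-1) h) (eval_wave v)) / 2"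
  unfolding vel_wave_def by (simp add: K.ip_expand tshift_ip_left field_simps)

lemma represents_wave_solution:
  assumes X: "X \<in> carr H" and g: "represents X g"
  shows "wave_solution q adj (data_fun X) v t = ip K (tshift t g) (eval_wave v)"
proof -
  have gc: "g \<in> carr K" using g by (rule represents_carr)
  let ?u = "\<lambda>v t. ip K (tshift t g) (eval_wave v)"
  have "wave_solution q adj (data_fun X) = ?u"
    unfolding wave_solution_def
  proof (rule the_equality)
    have we: "wave_equation q adj ?u"
      unfolding wave_equation_def adj_op_def rt_complex(1)
      using ip_nbrs_eval_wave[OF tshift_closed[OF gc]] rt_complex(3) by (simp add: add.commute)
    have i0: "?u v 0 = fst (data_fun X) v" for v by (simp add: represents_data[OF X g])
    have i1: "(?u v 1 - ?u v (-1)) / 2 = snd (data_fun X) v" for v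
      by (simp add: represents_data(2)[OF X g] ip_vel_wave_diff[OF gc])
    show "wave_equation q adj ?u \<and> (\<forall>v. ?u v 0 = fst (data_fun X) v) \<and> (\<forall>v. (?u v 1 - ?u v (-1)) / 2 = snd (data_fun X) v)"
      using we i0 i1 by blast
    fix u assume "wave_equation q adj u \<and> (\<forall>v. u v 0 = fst (data_fun X) v) \<and> (\<forall>v. (u v 1 - u v (-1)) / 2 = snd (data_fun X) v)"
    then show "u = ?u" using we i0 i1 by (intro wave_equation_unique) auto
  qed
  then show ?thesis by simp
qed

subsection \<open>Vanishing of cylinder integrals\<close>

lemma has_sum_single: "(\<And>n. n \<noteq> a \<Longrightarrow> f n = 0) \<Longrightarrow> (f has_sum f a) UNIV" for f :: "int \<Rightarrow> complex"
  by (rule has_sum_cong_neutral[THEN iffD1, of UNIV "{a}" f]) (auto intro: has_sum_finiteI)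

lemma L2_indicator_ip:
  assumes A: "A \<in> sets \<nu>"
  shows "ip (L2 \<nu>) f (\<lambda>\<omega>. complex_of_real b * indicator A \<omega>) = complex_of_real b * (\<integral>\<omega>. f \<omega> * indicator A \<omega> \<partial>\<nu>)"
proof -
  have e: "f \<omega> * cnj (complex_of_real b * indicator A \<omega>) = complex_of_real b * (f \<omega> * indicator A \<omega>)" for \<omega>
    by (simp add: indicator_def)
  show ?thesis unfolding L2_ip e by simp
qed

lemma cylinder_Int_stable: "Int_stable (insert {} (range (cylinder adj x0)))"
proof (rule Int_stableI)
  have c: "cylinder adj x0 u \<inter> cylinder adj x0 v \<in> insert {} (range (cylinder adj x0))" if "lev u \<le> lev v" for u v
  proof (cases "anc v (lev u) = u")
    case True
    have "cylinder adj x0 v \<subseteq> cylinder adj x0 u"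
    proof
      fix \<omega> assume "\<omega> \<in> cylinder adj x0 v"
      then have w: "\<omega> \<in> boundary adj" "geod x0 \<omega> (lev v) = anc v (lev v)" by (auto simp: cylinder_iff)
      have "geod x0 \<omega> (lev u) = anc v (lev u)"
        by (rule path_anc[OF geod(1)[OF w(1)] geod(2)[OF w(1)] w(2) that order_refl])
      then show "\<omega> \<in> cylinder adj x0 u" using w True by (simp add: cylinder_iff)
    qed
    then have "cylinder adj x0 u \<inter> cylinder adj x0 v = cylinder adj x0 v" by blast
    then show ?thesis by simp
  next
    case False
    have "\<omega> \<notin> cylinder adj x0 u" if v: "\<omega> \<in> cylinder adj x0 v" for \<omega>
    proof -
      have w: "\<omega> \<in> boundary adj" "geod x0 \<omega> (lev v) = anc v (lev v)" using v by (auto simp: cylinder_iff)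
      have "geod x0 \<omega> (lev u) = anc v (lev u)"
        by (rule path_anc[OF geod(1)[OF w(1)] geod(2)[OF w(1)] w(2) \<open>lev u \<le> lev v\<close> order_refl])
      then show ?thesis using False by (simp add: cylinder_iff)
    qed
    then have "cylinder adj x0 u \<inter> cylinder adj x0 v = {}" by blast
    then show ?thesis by simp
  qed
  fix a b assume "a \<in> insert {} (range (cylinder adj x0))" "b \<in> insert {} (range (cylinder adj x0))"
  then consider "a = {}" | "b = {}" | u v where "a = cylinder adj x0 u" "b = cylinder adj x0 v" by blast
  then show "a \<inter> b \<in> insert {} (range (cylinder adj x0))"
  proof cases
    case 3
    then show ?thesis using c[of u v] c[of v u] by (cases "lev u \<le> lev v") (auto simp: Int_commute)
  qed auto
qed

text \<open>The cylinders form, with the empty set, a generator stable under intersections, so the integrals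
  over all measurable sets vanish.\<close>

lemma cylinder_integrals_zero:
  assumes f: "f \<in> carr (L2 \<nu>)" and z: "\<And>v. (\<integral>\<omega>. f \<omega> * indicator (cylinder adj x0 v) \<omega> \<partial>\<nu>) = 0"
  shows "hnorm (L2 \<nu>) f = 0"
proof -
  let ?G = "insert {} (range (cylinder adj x0))"
  have fi: "integrable \<nu> f" by (rule L2_L1(1)[OF f])
  have ind: "integrable \<nu> (\<lambda>\<omega>. f \<omega> * indicator A \<omega>)" if "A \<in> sets \<nu>" for A
  proof -
    have "(\<lambda>\<omega>. f \<omega> * indicator A \<omega>) = (\<lambda>\<omega>. indicator A \<omega> *\<^sub>R f \<omega>)" by (auto simp: indicator_def fun_eq_iff)
    then show ?thesis using integrable_mult_indicator[OF that fi] by simp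
  qed
  have cs: "cylinder adj x0 v \<subseteq> boundary adj" for v by (auto simp: cylinder_iff)
  have sets: "sets \<nu> = sigma_sets (boundary adj) ?G"
  proof -
    have "sigma_sets (boundary adj) (range (cylinder adj x0)) = sigma_sets (boundary adj) ?G"
      by (rule sigma_sets_eqI) (auto intro: sigma_sets.Empty sigma_sets.Basic)
    then show ?thesis using bm by (simp add: boundary_measure_def)
  qed
  have "(\<integral>\<omega>. f \<omega> * indicator A \<omega> \<partial>\<nu>) = 0" if A: "A \<in> sets \<nu>" for A
  proof -
    have A': "A \<in> sigma_sets (boundary adj) ?G" using A sets by simp
    have G: "?G \<subseteq> Pow (boundary adj)" using cs by auto
    from cylinder_Int_stable G A' show ?thesis
    proof (induction A rule: sigma_sets_induct_disjoint)
      case (basic A) then show ?case using z by auto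
    next
      case empty show ?case by simp
    next
      case (compl A)
      have "(\<integral>\<omega>. f \<omega> * indicator (boundary adj - A) \<omega> \<partial>\<nu>) = (\<integral>\<omega>. f \<omega> - f \<omega> * indicator A \<omega> \<partial>\<nu>)"
        by (intro Bochner_Integration.integral_cong) (auto simp: indicator_def space_nu)
      also have "\<dots> = (\<integral>\<omega>. f \<omega> \<partial>\<nu>) - (\<integral>\<omega>. f \<omega> * indicator A \<omega> \<partial>\<nu>)"
        using fi ind compl sets by (intro Bochner_Integration.integral_diff) auto
      also have "(\<integral>\<omega>. f \<omega> \<partial>\<nu>) = (\<integral>\<omega>. f \<omega> * indicator (cylinder adj x0 x0) \<omega> \<partial>\<nu>)"
        by (intro Bochner_Integration.integral_cong) (auto simp: cylinder_base space_nu)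
      finally show ?case using z compl by simp
    next
      case (union A)
      have As: "A i \<in> sets \<nu>" for i using union(2) sets by auto
      have m: "indicator B \<omega> *\<^sub>R f \<omega> = f \<omega> * indicator B \<omega>" for B and \<omega> :: "(nat \<Rightarrow> 'v) set"
        by (simp add: indicator_def)
      have si: "set_integrable \<nu> (\<Union>i. A i) f" unfolding set_integrable_def m using As by (intro ind) auto
      have "set_lebesgue_integral \<nu> (\<Union>i. A i) f = (\<Sum>i. set_lebesgue_integral \<nu> (A i) f)"
        by (rule lebesgue_integral_countable_add[OF As _ si]) (use union(1) in \<open>auto simp: disjoint_family_on_def\<close>)
      then show ?case
        unfolding set_lebesgue_integral_def m using union(3) by simp
    qed
  qed
  moreover have "indicator A \<omega> *\<^sub>R f \<omega> = f \<omega> * indicator A \<omega>" for A and \<omega> :: "(nat \<Rightarrow> 'v) set"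
    by (simp add: indicator_def)
  ultimately have "set_lebesgue_integral \<nu> A f = 0" if "A \<in> sets \<nu>" for A
    using that unfolding set_lebesgue_integral_def by simp
  then have "AE \<omega> in \<nu>. f \<omega> = 0" using fi by (intro density_zero)
  then show ?thesis using L2_hnorm_0_iff[OF f] by simp
qed

lemma eval_wave_cylinder: "eval_wave v (int (lev v) - 1) = (\<lambda>\<omega>. complex_of_real (2 * rt powi int (lev v)) * indicator (cylinder adj x0 v) \<omega>)"
proof -
  have "Cyl v (int (lev v)) = cylinder adj x0 v"
  proof (cases "lev v = 0")
    case True
    then have "v = x0" using d_eq_0_iff by metis
    then show ?thesis using cylinder_base by (simp add: Cyl_def)
  qed (simp add: Cyl_def)
  then show ?thesis using eval_wave_level[of v "int (lev v)"] by simp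
qed

text \<open>Induction on the level \<open>m\<close> of \<open>v\<close>. The inner product is a sum of integrals of \<open>g\<close>, at negative times, over
  the sets of ends that agree with \<open>v\<close> up to the levels \<open>j \<le> m\<close>. For \<open>m > 0\<close> and \<open>j < m\<close> these are
  cylinders of lower level, so only \<open>j = m\<close> remains. At the base vertex all levels give the whole boundary,
  and the waves \<open>w\<close> and \<open>q\<^sup>-\<^sup>1 S\<^sup>-\<^sup>2 w\<close> differ by a function living at a single time.\<close>

lemma cylinder_integrals_of_orthogonal:
  assumes g: "g \<in> carr K" and z: "\<And>v t. int (lev v) \<le> t \<Longrightarrow> ip K (tshift t g) (eval_wave v) = 0" and n: "n < 0"
  shows "(\<integral>\<omega>. g n \<omega> * indicator (cylinder adj x0 v) \<omega> \<partial>\<nu>) = 0"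
  using n
proof (induction "lev v" arbitrary: v n rule: less_induct)
  case less
  let ?m = "int (lev v)"
  define t where "t = ?m - 1 - n"
  have t: "?m \<le> t" using less.prems by (simp add: t_def)
  have tn: "?m - 1 - t = n" by (simp add: t_def)
  have r0: "rt powi k \<noteq> 0" for k using rt by simp
  show ?case
  proof (cases "lev v = 0")
    case True
    then have v: "v = x0" using d_eq_0_iff by metis
    define E where "E = (\<lambda>k::int. \<lambda>\<omega>. if k = -1 then complex_of_real 2 * indicator (boundary adj) \<omega> else 0 :: complex)"
    have w: "add K (eval_wave x0) (smul K (- 1 / of_nat q) (tshift (-2) (eval_wave x0))) = E"
    proof (intro ext)
      fix k \<omega>
      have C: "Cyl x0 j = (if j \<le> 0 then boundary adj else {})" for j by (simp add: Cyl_def)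
      show "add K (eval_wave x0) (smul K (- 1 / of_nat q) (tshift (-2) (eval_wave x0))) k \<omega> = E k \<omega>"
      proof (cases "odd k \<and> k \<le> -1 \<and> \<omega> \<in> boundary adj")
        case False
        then have "eval_wave x0 k \<omega> = 0" "eval_wave x0 (k + 2) \<omega> = 0" by (auto simp: eval_wave_def C indicator_def)
        moreover have "E k \<omega> = 0" using False by (auto simp: E_def)
        ultimately show ?thesis by (simp add: K_add K_smul tshift_def)
      next
        case True
        then have a: "eval_wave x0 k \<omega> = complex_of_real (2 * rt powi (k + 1))" by (auto simp: eval_wave_def C indicator_def)
        show ?thesis
        proof (cases "k = -1")
          case True
          then have "eval_wave x0 (k + 2) \<omega> = 0" by (simp add: eval_wave_def C)
          then show ?thesis using a True \<open>odd k \<and> _\<close> by (simp add: K_add K_smul tshift_def E_def)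
        next
          case False
          moreover have "odd k" "k \<le> -1" using True by auto
          ultimately have k3: "k + 2 \<le> -1" by presburger
          then have b: "eval_wave x0 (k + 2) \<omega> = complex_of_real (2 * rt powi (k + 3))"
            using True by (auto simp: eval_wave_def C indicator_def add.commute)
          have "rt powi (k + 3) = rt powi (k + 1) * rt\<^sup>2"
            using rt_add[of "k + 1" 2] by (simp add: power_int_def[of rt 2] algebra_simps)
          then have "eval_wave x0 (k + 2) \<omega> = of_nat q * eval_wave x0 k \<omega>" unfolding a b rt(2) by simp
          then show ?thesis using False q2 by (simp add: K_add K_smul tshift_def E_def)
        qed
      qed
    qed
    have Ec: "E \<in> carr K" unfolding w[symmetric] by simp
    have "ip K (tshift t g) E = 0"
    proof -
      have "ip K (tshift t g) (tshift (-2) (eval_wave x0)) = ip K (tshift (t + 2) g) (eval_wave x0)" by (simp add: tshift_ip_left)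
      then show ?thesis
        unfolding w[symmetric] using z[of x0 t] z[of x0 "t + 2"] t v g by (simp add: K.ip_expand)
    qed
    moreover have "ip K (tshift t g) E = complex_of_real cc * ip (L2 \<nu>) (tshift t g (-1)) (E (-1))"
    proof (rule has_sum_unique[OF K_ip_has_sum])
      show "((\<lambda>k. complex_of_real cc * ip (L2 \<nu>) (tshift t g k) (E k)) has_sum
          complex_of_real cc * ip (L2 \<nu>) (tshift t g (-1)) (E (-1))) UNIV"
        by (rule has_sum_single) (simp add: E_def L2_ip)
    qed (use g Ec in auto)
    moreover have "E (-1) = (\<lambda>\<omega>. complex_of_real 2 * indicator (cylinder adj x0 x0) \<omega>)"
      by (simp add: E_def cylinder_base)
    moreover have "tshift t g (-1) = g n" using tn True by (simp add: tshift_def)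
    ultimately show ?thesis using cc_pos v by (simp add: L2_indicator_ip[OF cylinder_sets, of _ 2, simplified])
  next
    case False
    have x0l: "lev x0 < lev v" using False by (simp del: d_eq_0_iff)
    have zero: "ip (L2 \<nu>) (tshift t g k) (eval_wave v k) = 0" if k: "k \<noteq> ?m - 1" for k
    proof (cases "even (k + 1 - ?m)")
      case False then show ?thesis by (simp add: eval_wave_parity L2_ip)
    next
      case True
      then obtain i where i: "k + 1 - ?m = 2 * i" by (rule evenE)
      define l where "l = i + ?m"
      have kl: "k = 2 * l - ?m - 1" using i by (simp add: l_def)
      have lm: "l \<noteq> ?m" using k kl by auto
      show ?thesis
      proof (cases "l > ?m")
        case True
        then show ?thesis unfolding kl eval_wave_level by (simp add: Cyl_def L2_ip)
      next
        case False
        then have l: "l < ?m" using lm by simp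
        have neg: "k - t < 0" using kl l t by simp
        obtain u where u: "lev u < lev v" "Cyl v l = cylinder adj x0 u"
        proof (cases "l \<le> 0")
          case True then show ?thesis using that[of x0] x0l cylinder_base by (simp add: Cyl_def)
        next
          case False
          then show ?thesis using that[of "anc v (nat l)"] l lev_anc[of "nat l" v] by (simp add: Cyl_def)
        qed
        have "(\<integral>\<omega>. g (k - t) \<omega> * indicator (cylinder adj x0 u) \<omega> \<partial>\<nu>) = 0" by (rule less.hyps[OF u(1) neg])
        then show ?thesis
          unfolding tshift_def kl eval_wave_level u(2) L2_indicator_ip[OF cylinder_sets] by simp
      qed
    qed
    have "ip K (tshift t g) (eval_wave v) = complex_of_real cc * ip (L2 \<nu>) (tshift t g (?m - 1)) (eval_wave v (?m - 1))"
    proof (rule has_sum_unique[OF K_ip_has_sum])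
      show "((\<lambda>k. complex_of_real cc * ip (L2 \<nu>) (tshift t g k) (eval_wave v k)) has_sum
          complex_of_real cc * ip (L2 \<nu>) (tshift t g (?m - 1)) (eval_wave v (?m - 1))) UNIV"
        by (rule has_sum_single) (simp add: zero)
    qed (use g in auto)
    then have "ip (L2 \<nu>) (tshift t g (?m - 1)) (eval_wave v (?m - 1)) = 0" using z[OF t] cc_pos by simp
    then show ?thesis
      unfolding eval_wave_cylinder L2_indicator_ip[OF cylinder_sets] tshift_def tn using rt by simp
  qed
qed

lemma orthogonal_imp_nonneg:
  assumes g: "g \<in> carr K" and z: "\<And>v t. int (lev v) \<le> t \<Longrightarrow> ip K (tshift t g) (eval_wave v) = 0" and n: "n < 0"
  shows "hnorm N (g n) = 0"
  using cylinder_integrals_zero[OF K_carr_L2[OF g] cylinder_integrals_of_orthogonal[OF g z n]] cc_pos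
  by (simp add: hnorm_rescale)

lemma nonneg_imp_orthogonal:
  assumes g: "g \<in> carr K" and z: "\<And>n. n < 0 \<Longrightarrow> hnorm N (g n) = 0" and t: "int (lev v) \<le> t"
  shows "ip K (tshift t g) (eval_wave v) = 0"
proof (rule has_sum_unique[OF K_ip_has_sum])
  have "ip (L2 \<nu>) (tshift t g k) (eval_wave v k) = 0" for k
  proof (cases "k \<ge> int (lev v)")
    case True then show ?thesis by (simp add: eval_wave_above L2_ip)
  next
    case False
    then have "hnorm (L2 \<nu>) (g (k - t)) = 0" using z[of "k - t"] t cc_pos by (simp add: hnorm_rescale)
    then show ?thesis using L2.Cauchy_Schwarz[OF K_carr_L2[OF g] eval_wave_L2, of "k - t" v k] by (simp add: tshift_def)
  qed
  then show "((\<lambda>k. complex_of_real cc * ip (L2 \<nu>) (tshift t g k) (eval_wave v k)) has_sum 0) UNIV" by simp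
qed (use g in auto)

lemma D_plus_iff:
  assumes X: "X \<in> carr H" and g: "represents X g"
  shows "X \<in> D_plus q adj x0 \<longleftrightarrow> g \<in> ell2_nonneg N"
proof -
  have gc: "g \<in> carr K" using g by (rule represents_carr)
  have "X \<in> D_plus q adj x0 \<longleftrightarrow> (\<forall>v t. int (lev v) \<le> t \<longrightarrow> ip K (tshift t g) (eval_wave v) = 0)"
    using X by (auto simp: D_plus_def represents_wave_solution[OF X g])
  also have "\<dots> \<longleftrightarrow> g \<in> ell2_nonneg N"
    using orthogonal_imp_nonneg[OF gc] nonneg_imp_orthogonal[OF gc] gc by (auto simp: ell2_nonneg_def)
  finally show ?thesis .
qed

subsection \<open>Completeness of the outgoing waves\<close>

text \<open>Since \<open>w\<^sub>v\<close> vanishes at times beyond the level of \<open>v\<close>, a large shift lets it meet only the remote past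
  of \<open>g\<close>, where the norms of \<open>g(n)\<close> are small.\<close>

lemma ip_eval_wave_decay:
  assumes g: "g \<in> carr K"
  shows "(\<lambda>i. ip K (tshift (k + 2 * int i) g) (eval_wave v)) \<longlonglongrightarrow> 0"
proof -
  have sm: "(\<lambda>n. (hnorm N (g n))\<^sup>2) summable_on UNIV" using g by (simp add: N.carr_ell2_iff)
  have tail: "\<exists>M. \<forall>n<M. hnorm N (g n) < e" if e: "e > 0" for e
  proof -
    have "e\<^sup>2 / 2 > 0" using e by simp
    then obtain F where F: "finite F" "dist (\<Sum>n\<in>F. (hnorm N (g n))\<^sup>2) (infsum (\<lambda>n. (hnorm N (g n))\<^sup>2) UNIV) \<le> e\<^sup>2 / 2"
      using infsum_finite_approximation[OF sm] by blast
    have "hnorm N (g n) < e" if "n < Min (insert 0 F)" for n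
    proof -
      have nF: "n \<notin> F" using that F(1) by auto
      have "(hnorm N (g n))\<^sup>2 + (\<Sum>n\<in>F. (hnorm N (g n))\<^sup>2) = (\<Sum>n\<in>insert n F. (hnorm N (g n))\<^sup>2)"
        using nF F(1) by simp
      also have "\<dots> \<le> infsum (\<lambda>n. (hnorm N (g n))\<^sup>2) UNIV"
        using F(1) by (intro finite_sum_le_infsum sm) auto
      finally have "(hnorm N (g n))\<^sup>2 \<le> e\<^sup>2 / 2" using F(2) unfolding dist_real_def by linarith
      also have "\<dots> < e\<^sup>2" using e by simp
      finally show ?thesis using e by (meson power2_less_imp_less less_imp_le)
    qed
    then show ?thesis by blast
  qed
  define b where "b n = (if n + 1 \<le> int (lev v) then 2 * rt powi (n + 1) else 0)" for n
  have rt1: "rt > 1" using q2 by (simp add: rt_def)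
  have bs: "b summable_on UNIV" unfolding b_def by (rule eval_wave_bound_summable[OF rt1])
  have b0: "b n \<ge> 0" for n using rt by (simp add: b_def)
  define B where "B = infsum b UNIV"
  have B0: "B \<ge> 0" unfolding B_def by (rule infsum_nonneg) (rule b0)
  have wn: "hnorm (L2 \<nu>) (eval_wave v n) \<le> b n" for n
  proof (rule power2_le_imp_le)
    have "(\<integral>\<omega>. (cmod (eval_wave v n \<omega>))\<^sup>2 \<partial>\<nu>) \<le> (\<integral>\<omega>. (b n)\<^sup>2 \<partial>\<nu>)"
      using eval_wave_L2[of v n] eval_wave_bound[of v n]
      by (intro integral_mono) (auto simp: carr_L2_iff b_def[symmetric] intro!: power_mono)
    then show "(hnorm (L2 \<nu>) (eval_wave v n))\<^sup>2 \<le> (b n)\<^sup>2" using prob_space by (simp add: L2_hnorm_sq[OF eval_wave_L2])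
  qed (rule b0)
  show ?thesis
  proof (rule LIMSEQ_I)
    fix e :: real assume e: "e > 0"
    define d where "d = e / (cc * (B + 1))"
    have d: "d > 0" using e cc_pos B0 by (simp add: d_def)
    obtain M where M: "\<And>n. n < M \<Longrightarrow> hnorm N (g n) < d * sqrt cc" using tail[of "d * sqrt cc"] d cc_pos by auto
    have gM: "hnorm (L2 \<nu>) (g n) \<le> d" if "n < M" for n
      using M[OF that] cc_pos by (simp add: hnorm_rescale mult.commute[of "sqrt cc"])
    have "norm (ip K (tshift (k + 2 * int i) g) (eval_wave v) - 0) < e" if i: "i \<ge> nat (int (lev v) - k - M)" for i
    proof -
      let ?T = "\<lambda>n. complex_of_real cc * ip (L2 \<nu>) (tshift (k + 2 * int i) g n) (eval_wave v n)"
      have hs: "(?T has_sum ip K (tshift (k + 2 * int i) g) (eval_wave v)) UNIV" by (rule K_ip_has_sum) (use g in auto)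
      have pt: "norm (?T n) \<le> cc * d * b n" for n
      proof (cases "n < int (lev v)")
        case False then show ?thesis using b0 cc_pos d by (simp add: eval_wave_above L2_ip)
      next
        case True
        then have "n - (k + 2 * int i) < M" using i by linarith
        then have "hnorm (L2 \<nu>) (g (n - (k + 2 * int i))) \<le> d" by (rule gM)
        then have "hnorm (L2 \<nu>) (g (n - (k + 2 * int i))) * hnorm (L2 \<nu>) (eval_wave v n) \<le> d * b n"
          using wn L2.hnorm_nonneg[OF eval_wave_L2] d by (intro mult_mono) auto
        then have "norm (ip (L2 \<nu>) (tshift (k + 2 * int i) g n) (eval_wave v n)) \<le> d * b n"
          using L2.Cauchy_Schwarz[OF K_carr_L2[OF g] eval_wave_L2, of "n - (k + 2 * int i)" v n] by (simp add: tshift_def)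
        then show ?thesis using cc_pos by (simp add: norm_mult)
      qed
      have "((\<lambda>n. cc * d * b n) has_sum (cc * d * B)) UNIV"
        unfolding B_def by (intro has_sum_cmult_right has_sum_infsum bs)
      note bd = this
      have ns: "(\<lambda>n. norm (?T n)) summable_on UNIV"
        by (rule summable_on_comparison_test[OF has_sum_imp_summable[OF bd] pt]) simp
      have "norm (ip K (tshift (k + 2 * int i) g) (eval_wave v)) \<le> infsum (\<lambda>n. norm (?T n)) UNIV"
        by (rule norm_has_sum_bound[OF has_sum_infsum[OF ns] hs])
      also have "\<dots> \<le> cc * d * B" by (rule has_sum_mono[OF has_sum_infsum[OF ns] bd pt])
      finally have "norm (ip K (tshift (k + 2 * int i) g) (eval_wave v)) \<le> cc * d * B" .
      also have "\<dots> < cc * d * (B + 1)" using cc_pos d by simp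
      also have "\<dots> = e" using cc_pos B0 by (simp add: d_def)
      finally show ?thesis by simp
    qed
    then show "\<exists>no. \<forall>i\<ge>no. norm (ip K (tshift (k + 2 * int i) g) (eval_wave v) - 0) < e" by blast
  qed
qed

text \<open>Orthogonality to \<open>a\<^sub>v\<close> at all times says that \<open>k \<mapsto> \<langle>S\<^sup>k g, w\<^sub>v\<rangle>\<close> has period two; by decay it is zero,
  and then the argument for negative times applies to every shift of \<open>g\<close>.\<close>

lemma orthogonal_to_waves_null:
  assumes g: "g \<in> carr K" and z: "\<And>v k. ip K (tshift k g) (vel_wave v) = 0"
  shows "hnorm K g = 0"
proof -
  have per: "ip K (tshift (k + 2) g) (eval_wave v) = ip K (tshift k g) (eval_wave v)" for k v
  proof -
    have e: "1 + (k + 1) = k + 2" "-1 + (k + 1) = k" by simp_all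
    have "ip K (tshift (k + 1) g) (vel_wave v) = (ip K (tshift (k + 2) g) (eval_wave v) - ip K (tshift k g) (eval_wave v)) / 2"
      unfolding ip_vel_wave_diff[OF tshift_closed[OF g]] tshift_tshift e ..
    then show ?thesis using z by simp
  qed
  have "ip K (tshift (k + 2 * int i) g) (eval_wave v) = ip K (tshift k g) (eval_wave v)" for k v i
  proof (induction i)
    case (Suc i) then show ?case using per[of "k + 2 * int i" v] by (simp add: algebra_simps)
  qed simp
  then have "(\<lambda>i. ip K (tshift k g) (eval_wave v)) \<longlonglongrightarrow> 0" for k v using ip_eval_wave_decay[OF g, of k v] by simp
  then have zero: "ip K (tshift k g) (eval_wave v) = 0" for k v by (simp add: LIMSEQ_const_iff)
  have "hnorm N (g n) = 0" for n
  proof -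
    have "hnorm N (tshift (- n - 1) g (-1)) = 0"
      by (rule orthogonal_imp_nonneg) (use g zero in auto)
    then show ?thesis by (simp add: tshift_def)
  qed
  then show ?thesis using N.ell2_hnorm_0_iff[OF g] by simp
qed

end

section \<open>The Fourier side\<close>

context boundary_tree
begin

text \<open>The bound provides a dominating constant for the partial sums, so that the pointwise series also converges
  in \<open>L\<^sup>2\<close>.\<close>

definition series :: "(int \<Rightarrow> (nat \<Rightarrow> 'v) set \<Rightarrow> complex) \<Rightarrow> (complex \<Rightarrow> (nat \<Rightarrow> 'v) set \<Rightarrow> complex) \<Rightarrow> bool" where
  "series h \<phi> \<longleftrightarrow> (\<exists>b. b summable_on UNIV \<and> (\<forall>n \<omega>. cmod (h n \<omega>) \<le> b n))
     \<and> (\<forall>\<xi>\<in>sphere 0 1. \<forall>\<omega>\<in>boundary adj. ((\<lambda>n. h n \<omega> * \<xi> powi n) has_sum \<phi> \<xi> \<omega>) UNIV)"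

lemma series_zero: "series (\<lambda>n \<omega>. 0) (\<lambda>\<xi> \<omega>. 0)"
  unfolding series_def by (auto intro!: exI[of _ "\<lambda>_. 0"])

lemma series_add:
  assumes h: "series h \<phi>" and g: "series g \<psi>"
  shows "series (\<lambda>n \<omega>. h n \<omega> + g n \<omega>) (\<lambda>\<xi> \<omega>. \<phi> \<xi> \<omega> + \<psi> \<xi> \<omega>)"
proof -
  obtain b where b: "b summable_on UNIV" "\<And>n \<omega>. cmod (h n \<omega>) \<le> b n" using h unfolding series_def by blast
  obtain c where c: "c summable_on UNIV" "\<And>n \<omega>. cmod (g n \<omega>) \<le> c n" using g unfolding series_def by blast
  have "cmod (h n \<omega> + g n \<omega>) \<le> b n + c n" for n \<omega>
    using norm_triangle_ineq[of "h n \<omega>" "g n \<omega>"] b(2)[of n \<omega>] c(2)[of n \<omega>] by linarith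
  moreover have "(\<lambda>n. b n + c n) summable_on UNIV" by (intro summable_on_add b c)
  moreover have "((\<lambda>n. (h n \<omega> + g n \<omega>) * \<xi> powi n) has_sum \<phi> \<xi> \<omega> + \<psi> \<xi> \<omega>) UNIV"
    if "\<xi> \<in> sphere 0 1" "\<omega> \<in> boundary adj" for \<xi> \<omega>
    unfolding distrib_right using h g that by (intro has_sum_add) (auto simp: series_def)
  ultimately show ?thesis unfolding series_def by blast
qed

lemma series_smul:
  assumes h: "series h \<phi>"
  shows "series (\<lambda>n \<omega>. a * h n \<omega>) (\<lambda>\<xi> \<omega>. a * \<phi> \<xi> \<omega>)"
proof -
  obtain b where b: "b summable_on UNIV" "\<And>n \<omega>. cmod (h n \<omega>) \<le> b n" using h unfolding series_def by blast
  have "cmod (a * h n \<omega>) \<le> cmod a * b n" for n \<omega> using b(2) by (simp add: norm_mult mult_left_mono)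
  moreover have "(\<lambda>n. cmod a * b n) summable_on UNIV" by (intro summable_on_cmult_right b)
  moreover have "((\<lambda>n. a * h n \<omega> * \<xi> powi n) has_sum a * \<phi> \<xi> \<omega>) UNIV"
    if "\<xi> \<in> sphere 0 1" "\<omega> \<in> boundary adj" for \<xi> \<omega>
    unfolding mult.assoc using h that by (intro has_sum_cmult_right) (auto simp: series_def)
  ultimately show ?thesis unfolding series_def by blast
qed

lemma series_shift:
  assumes h: "series h \<phi>"
  shows "series (\<lambda>n. h (n + k)) (\<lambda>\<xi> \<omega>. \<xi> powi (- k) * \<phi> \<xi> \<omega>)"
proof -
  have bij: "bij_betw (\<lambda>n. n + k) UNIV (UNIV :: int set)"
    by (rule bij_betwI[where g = "\<lambda>n. n - k"]) auto
  obtain b where b: "b summable_on UNIV" "\<And>n \<omega>. cmod (h n \<omega>) \<le> b n" using h unfolding series_def by blast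
  have "(\<lambda>n. b (n + k)) summable_on UNIV" using summable_on_reindex_bij_betw[OF bij, of b] b(1) by simp
  moreover have "((\<lambda>n. h (n + k) \<omega> * \<xi> powi n) has_sum \<xi> powi (- k) * \<phi> \<xi> \<omega>) UNIV"
    if p: "\<xi> \<in> sphere 0 1" "\<omega> \<in> boundary adj" for \<xi> \<omega>
  proof -
    have x: "\<xi> \<noteq> 0" using p by auto
    have "((\<lambda>n. h n \<omega> * \<xi> powi n) has_sum \<phi> \<xi> \<omega>) UNIV" using h p by (simp add: series_def)
    then have "((\<lambda>n. h (n + k) \<omega> * \<xi> powi (n + k)) has_sum \<phi> \<xi> \<omega>) UNIV"
      using has_sum_reindex_bij_betw[OF bij, of "\<lambda>n. h n \<omega> * \<xi> powi n"] by simp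
    then have "((\<lambda>n. \<xi> powi (- k) * (h (n + k) \<omega> * \<xi> powi (n + k))) has_sum \<xi> powi (- k) * \<phi> \<xi> \<omega>) UNIV"
      by (rule has_sum_cmult_right)
    moreover have "\<xi> powi (- k) * (h (n + k) \<omega> * \<xi> powi (n + k)) = h (n + k) \<omega> * \<xi> powi n" for n
    proof -
      have "\<xi> powi (- k) * \<xi> powi (n + k) = \<xi> powi n" using x by (simp flip: power_int_add)
      then show ?thesis by (metis mult.left_commute)
    qed
    ultimately show ?thesis by simp
  qed
  ultimately show ?thesis unfolding series_def using b(2) by (intro conjI exI[of _ "\<lambda>n. b (n + k)"]) auto
qed

lemma series_sum:
  assumes "finite A" "\<And>v. series (h v) (\<phi> v)"
  shows "series (\<lambda>n \<omega>. \<Sum>v\<in>A. c v * h v n \<omega>) (\<lambda>\<xi> \<omega>. \<Sum>v\<in>A. c v * \<phi> v \<xi> \<omega>)"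
  using assms(1)
proof induction
  case empty then show ?case by (simp add: series_zero)
next
  case (insert v A)
  then show ?case using series_add[OF series_smul[OF assms(2), of "c v" v] insert.IH] by simp
qed

lemma series_cong: "series h \<phi> \<Longrightarrow> (\<And>\<xi> \<omega>. \<xi> \<in> sphere 0 1 \<Longrightarrow> \<omega> \<in> boundary adj \<Longrightarrow> \<phi> \<xi> \<omega> = \<psi> \<xi> \<omega>) \<Longrightarrow> series h \<psi>"
  by (simp add: series_def)

text \<open>The Helgason kernel \<open>q\<^bsup>(1/2 + is) h\<^esup>\<close>, with \<open>\<xi> = q\<^sup>i\<^sup>s\<close>.\<close>

definition plane :: "'v \<Rightarrow> complex \<Rightarrow> (nat \<Rightarrow> 'v) set \<Rightarrow> complex" where
  "plane v \<xi> \<omega> = complex_of_real (real q powr (real_of_int (horo adj x0 \<omega> v) / 2)) * \<xi> powi horo adj x0 \<omega> v"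

lemma rt_powr: "rt powi k = real q powr (real_of_int k / 2)"
proof -
  have "rt powi k = rt powr real_of_int k" using rt(1) by (simp add: powr_real_of_int')
  also have "\<dots> = (real q powr (1/2)) powr real_of_int k"
    using q2 by (simp only: rt_def powr_half_sqrt of_nat_0_le_iff)
  also have "\<dots> = real q powr (real_of_int k / 2)" unfolding powr_powr by simp
  finally show ?thesis .
qed

text \<open>The numerator of \<open>c(\<xi>)\<close>.\<close>

definition den :: "complex \<Rightarrow> complex" where "den \<xi> = \<xi> - inverse (of_nat q) * inverse \<xi>"

lemma den_nonzero: "\<xi> \<in> sphere 0 1 \<Longrightarrow> den \<xi> \<noteq> 0"
proof
  assume x: "\<xi> \<in> sphere 0 1" and "den \<xi> = 0"
  then have "cmod \<xi> = cmod (inverse (of_nat q) * inverse \<xi>)" by (simp add: den_def)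
  then have "1 = inverse (real q)" using x by (simp add: norm_mult norm_inverse)
  then show False using q2 by (simp add: field_simps)
qed

text \<open>A geometric series with ratio \<open>q\<^sup>-\<^sup>1 \<xi>\<^sup>-\<^sup>2\<close> that starts at the time \<open>h - 1\<close> and runs into the past.\<close>

lemma series_eval_wave: "series (eval_wave v) (\<lambda>\<xi> \<omega>. 2 * plane v \<xi> \<omega> / den \<xi>)"
proof -
  have rt1: "rt > 1" using q2 by (simp add: rt_def)
  have "(\<lambda>n. if n + 1 \<le> int (lev v) then 2 * rt powi (n + 1) else 0) summable_on UNIV"
    by (rule eval_wave_bound_summable[OF rt1])
  moreover have "((\<lambda>n. eval_wave v n \<omega> * \<xi> powi n) has_sum 2 * plane v \<xi> \<omega> / den \<xi>) UNIV"
    if p: "\<xi> \<in> sphere 0 1" "\<omega> \<in> boundary adj" for \<xi> \<omega>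
  proof -
    have x: "\<xi> \<noteq> 0" "cmod \<xi> = 1" using p by auto
    let ?h = "horo adj x0 \<omega> v"
    define z where "z = inverse (of_nat q) * inverse \<xi> * inverse \<xi>"
    have "cmod z = inverse (real q)" by (simp add: z_def norm_mult norm_inverse x)
    moreover have "inverse (real q) < 1" using q2 by (simp add: field_simps)
    ultimately have zn: "cmod z < 1" by linarith
    have "(\<lambda>i. z ^ i) sums (1 / (1 - z))" by (rule geometric_sums[OF zn])
    moreover have "summable (\<lambda>i. norm (z ^ i))" using zn by (simp add: norm_power summable_geometric)
    ultimately have "((\<lambda>i. z ^ i) has_sum (1 / (1 - z))) UNIV" by (intro norm_summable_imp_has_sum)
    then have "((\<lambda>i. (2 * plane v \<xi> \<omega> * inverse \<xi>) * z ^ i) has_sum (2 * plane v \<xi> \<omega> * inverse \<xi>) * (1 / (1 - z))) UNIV"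
      by (rule has_sum_cmult_right)
    moreover have "(2 * plane v \<xi> \<omega> * inverse \<xi>) * (1 / (1 - z)) = 2 * plane v \<xi> \<omega> / den \<xi>"
    proof -
      have "den \<xi> = \<xi> * (1 - z)" using x by (simp add: den_def z_def field_simps)
      then show ?thesis by (simp add: divide_inverse mult.assoc)
    qed
    moreover define f where "f i = ?h - 1 - 2 * int i" for i
    moreover have "(2 * plane v \<xi> \<omega> * inverse \<xi>) * z ^ i = eval_wave v (f i) \<omega> * \<xi> powi (f i)" for i
    proof -
      have par: "even (f i + 1 - int (lev v))" using horo_parity[OF p(2), of v] by (simp add: f_def)
      have 1: "eval_wave v (f i) \<omega> = complex_of_real (2 * rt powi (?h - 2 * int i))"
        unfolding eval_wave_horo[OF p(2)] using par by (simp add: f_def)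
      have 2: "rt powi (?h - 2 * int i) = rt powi ?h * inverse (real q) ^ i"
      proof -
        have "rt powi (?h - 2 * int i) = rt powi ?h * rt powi (2 * (- int i))" by (simp add: rt_add)
        then show ?thesis unfolding rt_powi_even by (simp add: power_int_minus power_inverse)
      qed
      have 3: "\<xi> powi (f i) = \<xi> powi ?h * inverse \<xi> * (inverse \<xi> * inverse \<xi>) ^ i"
      proof -
        have "f i = ?h + (- 1) + (- int (2 * i))" by (simp add: f_def)
        then have "\<xi> powi (f i) = \<xi> powi ?h * \<xi> powi (-1) * \<xi> powi (- int (2 * i))"
          using x by (simp only: power_int_add simp_thms)
        also have "\<xi> powi (- int (2 * i)) = (inverse \<xi> * inverse \<xi>) ^ i"
          unfolding power_int_minus power_int_of_nat power_mult power2_eq_square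
          by (simp add: power_mult_distrib power_inverse)
        finally show ?thesis by (simp add: power_int_minus)
      qed
      have 4: "plane v \<xi> \<omega> = complex_of_real (rt powi ?h) * \<xi> powi ?h" by (simp add: plane_def rt_powr)
      show ?thesis unfolding 1 3 4 z_def unfolding 2 by (simp add: power_mult_distrib mult_ac)
    qed
    ultimately have "(((\<lambda>n. eval_wave v n \<omega> * \<xi> powi n) \<circ> f) has_sum 2 * plane v \<xi> \<omega> / den \<xi>) UNIV"
      by (simp add: comp_def)
    moreover have "inj f" by (auto simp: f_def inj_on_def)
    ultimately have "((\<lambda>n. eval_wave v n \<omega> * \<xi> powi n) has_sum 2 * plane v \<xi> \<omega> / den \<xi>) (range f)"
      using has_sum_reindex by blast
    moreover have "eval_wave v n \<omega> = 0" if "n \<notin> range f" for n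
    proof (rule ccontr)
      assume "eval_wave v n \<omega> \<noteq> 0"
      then have n: "even (n + 1 - int (lev v))" "n + 1 \<le> ?h" unfolding eval_wave_horo[OF p(2)] by (auto split: if_splits)
      moreover have "even (?h - int (lev v))" by (rule horo_parity[OF p(2)])
      ultimately have "even (?h - 1 - n)" by presburger
      then obtain k where k: "?h - 1 - n = 2 * k" by (rule evenE)
      then have "n = f (nat k)" using n(2) by (simp add: f_def)
      then show False using that by blast
    qed
    ultimately show ?thesis by (subst (asm) has_sum_cong_neutral[of UNIV]) auto
  qed
  ultimately show ?thesis unfolding series_def using eval_wave_bound by blast
qed

lemma series_vel_wave: "series (vel_wave v) (\<lambda>\<xi> \<omega>. (inverse \<xi> - \<xi>) * plane v \<xi> \<omega> / den \<xi>)"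
proof -
  have "series (\<lambda>n \<omega>. (1/2) * (eval_wave v (n + 1) \<omega> + (-1) * eval_wave v (n + (-1)) \<omega>))
     (\<lambda>\<xi> \<omega>. (1/2) * (\<xi> powi (- 1) * (2 * plane v \<xi> \<omega> / den \<xi>) + (-1) * (\<xi> powi (- (-1)) * (2 * plane v \<xi> \<omega> / den \<xi>))))"
    by (intro series_smul series_add series_shift series_eval_wave)
  moreover have "vel_wave v = (\<lambda>n \<omega>. (1/2) * (eval_wave v (n + 1) \<omega> + (-1) * eval_wave v (n + (-1)) \<omega>))"
    by (simp add: vel_wave_eq fun_eq_iff)
  ultimately have S: "series (vel_wave v) (\<lambda>\<xi> \<omega>. (1/2) * (\<xi> powi (- 1) * (2 * plane v \<xi> \<omega> / den \<xi>)
      + (-1) * (\<xi> powi (- (-1)) * (2 * plane v \<xi> \<omega> / den \<xi>))))" by (simp only:)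
  show ?thesis
  proof (rule series_cong[OF S])
    fix \<xi> :: complex and \<omega>
    have alg: "(1/2) * (a * (2 * p / D) + (-1) * (b * (2 * p / D))) = (a - b) * p / D" for a b p D :: complex
      by (cases "D = 0") (simp_all add: field_simps)
    have p: "\<xi> powi (- 1) = inverse \<xi>" "\<xi> powi (- (-1)) = \<xi>" by (simp_all add: power_int_minus)
    show "(1/2) * (\<xi> powi (- 1) * (2 * plane v \<xi> \<omega> / den \<xi>) + (-1) * (\<xi> powi (- (-1)) * (2 * plane v \<xi> \<omega> / den \<xi>)))
        = (inverse \<xi> - \<xi>) * plane v \<xi> \<omega> / den \<xi>"
      unfolding p by (rule alg)
  qed
qed

lemma series_pos_wave: "series (pos_wave v) (\<lambda>\<xi> \<omega>. (\<xi> - inverse \<xi>) / 2 * ((inverse \<xi> - \<xi>) * plane v \<xi> \<omega> / den \<xi>))"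
proof -
  have "series (\<lambda>n \<omega>. (1/2) * (vel_wave v (n + (-1)) \<omega> + (-1) * vel_wave v (n + 1) \<omega>))
     (\<lambda>\<xi> \<omega>. (1/2) * (\<xi> powi (- (-1)) * ((inverse \<xi> - \<xi>) * plane v \<xi> \<omega> / den \<xi>) + (-1) * (\<xi> powi (- 1) * ((inverse \<xi> - \<xi>) * plane v \<xi> \<omega> / den \<xi>))))"
    by (intro series_smul series_add series_shift series_vel_wave)
  moreover have "pos_wave v = (\<lambda>n \<omega>. (1/2) * (vel_wave v (n + (-1)) \<omega> + (-1) * vel_wave v (n + 1) \<omega>))"
    by (simp add: pos_wave_eq fun_eq_iff)
  ultimately have S: "series (pos_wave v) (\<lambda>\<xi> \<omega>. (1/2) * (\<xi> powi (- (-1)) * ((inverse \<xi> - \<xi>) * plane v \<xi> \<omega> / den \<xi>)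
      + (-1) * (\<xi> powi (- 1) * ((inverse \<xi> - \<xi>) * plane v \<xi> \<omega> / den \<xi>))))" by (simp only:)
  show ?thesis
  proof (rule series_cong[OF S])
    fix \<xi> :: complex and \<omega>
    have alg: "(1/2) * (a * X + (-1) * (b * X)) = (a - b) / 2 * X" for a b X :: complex
      by (simp add: left_diff_distrib diff_divide_distrib)
    have p: "\<xi> powi (- 1) = inverse \<xi>" "\<xi> powi (- (-1)) = \<xi>" by (simp_all add: power_int_minus)
    show "(1/2) * (\<xi> powi (- (-1)) * ((inverse \<xi> - \<xi>) * plane v \<xi> \<omega> / den \<xi>)
        + (-1) * (\<xi> powi (- 1) * ((inverse \<xi> - \<xi>) * plane v \<xi> \<omega> / den \<xi>)))
        = (\<xi> - inverse \<xi>) / 2 * ((inverse \<xi> - \<xi>) * plane v \<xi> \<omega> / den \<xi>)"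
      unfolding p by (rule alg)
  qed
qed

lemma Hel_lincomb: "Hel q adj x0 f (\<xi>, \<omega>) = lincomb f (\<lambda>v. plane v \<xi> \<omega>)"
  by (simp add: Hel_def lincomb_def plane_def mult.assoc)

text \<open>The factor \<open>\<xi> - \<xi>\<^sup>-\<^sup>1\<close> of \<open>c(\<xi>)\<^sup>-\<^sup>1\<close> is the difference of shifts in \<open>a\<^sub>v\<close>, and its denominator is the
  geometric series of \<open>w\<^sub>v\<close>.\<close>

lemma fourier_W0:
  assumes f: "f \<in> carr FD"
  shows "fourier_transform \<nu> (W0 f) (reflect (T_fin q adj x0 f))"
proof -
  have fin: "finite {v. fst f v \<noteq> 0}" "finite {v. snd f v \<noteq> 0}" using f by (auto simp: carr_FD finsupp_def)
  have "series (W0 f) (\<lambda>\<xi> \<omega>. reflect (T_fin q adj x0 f) (\<xi>, \<omega>))"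
  proof (rule series_cong)
    show "series (W0 f) (\<lambda>\<xi> \<omega>. (\<Sum>v | fst f v \<noteq> 0. fst f v * ((\<xi> - inverse \<xi>) / 2 * ((inverse \<xi> - \<xi>) * plane v \<xi> \<omega> / den \<xi>)))
        + (\<Sum>v | snd f v \<noteq> 0. snd f v * ((inverse \<xi> - \<xi>) * plane v \<xi> \<omega> / den \<xi>)))"
      unfolding W0_def[abs_def] lincomb_def by (intro series_add series_sum fin series_vel_wave series_pos_wave)
    fix \<xi> :: complex and \<omega> assume x: "\<xi> \<in> sphere 0 1"
    have dn: "den \<xi> \<noteq> 0" by (rule den_nonzero[OF x])
    have c: "inverse (c_fun q \<xi>) = (\<xi> - inverse \<xi>) / den \<xi>" by (simp add: c_fun_def den_def)
    have 1: "(\<Sum>v | fst f v \<noteq> 0. fst f v * ((\<xi> - inverse \<xi>) / 2 * ((inverse \<xi> - \<xi>) * plane v \<xi> \<omega> / den \<xi>)))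
        = (\<xi> - inverse \<xi>) / den \<xi> * ((inverse \<xi> - \<xi>) / 2 * lincomb (fst f) (\<lambda>v. plane v \<xi> \<omega>))"
      unfolding lincomb_def sum_distrib_left by (intro sum.cong refl) (simp add: field_simps)
    have 2: "(\<Sum>v | snd f v \<noteq> 0. snd f v * ((inverse \<xi> - \<xi>) * plane v \<xi> \<omega> / den \<xi>))
        = - ((\<xi> - inverse \<xi>) / den \<xi> * lincomb (snd f) (\<lambda>v. plane v \<xi> \<omega>))"
      unfolding lincomb_def sum_distrib_left sum_negf[symmetric]
      by (intro sum.cong refl) (simp add: minus_divide_left[symmetric] divide_inverse algebra_simps)
    show "(\<Sum>v | fst f v \<noteq> 0. fst f v * ((\<xi> - inverse \<xi>) / 2 * ((inverse \<xi> - \<xi>) * plane v \<xi> \<omega> / den \<xi>)))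
        + (\<Sum>v | snd f v \<noteq> 0. snd f v * ((inverse \<xi> - \<xi>) * plane v \<xi> \<omega> / den \<xi>))
        = reflect (T_fin q adj x0 f) (\<xi>, \<omega>)"
      unfolding 1 2 by (simp add: reflect_def T_fin_def c Hel_lincomb right_diff_distrib)
  qed
  then obtain b where b: "b summable_on UNIV" "\<And>n \<omega>. cmod (W0 f n \<omega>) \<le> b n"
    and hs: "\<And>\<xi> \<omega>. \<xi> \<in> sphere 0 1 \<Longrightarrow> \<omega> \<in> boundary adj \<Longrightarrow>
      ((\<lambda>n. W0 f n \<omega> * \<xi> powi n) has_sum reflect (T_fin q adj x0 f) (\<xi>, \<omega>)) UNIV"
    unfolding series_def by blast
  show ?thesis
    by (rule fourier_transform_pointwise[OF _ b(1)])
      (use b(2) hs W0_K[OF f] in \<open>auto simp: space_nu intro: L2_measurable K_carr_L2\<close>)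
qed

subsection \<open>Passing to the completion\<close>

interpretation E: prehilbert "ell2 (L2 \<nu>)" by (rule L2.prehilbert_ell2)

lemma carr_K_iff: "h \<in> carr K \<longleftrightarrow> h \<in> carr (ell2 (L2 \<nu>))"
  using cc_pos by (simp add: N.carr_ell2_iff L2.carr_ell2_iff hnorm_rescale power_mult_distrib summable_on_cmult_right')

lemma hdist_K: "g \<in> carr K \<Longrightarrow> h \<in> carr K \<Longrightarrow> (hdist K g h)\<^sup>2 = cc * (hdist (ell2 (L2 \<nu>)) g h)\<^sup>2"
proof -
  assume g: "g \<in> carr K" and h: "h \<in> carr K"
  have "((\<lambda>n. cc * (hdist (L2 \<nu>) (g n) (h n))\<^sup>2) has_sum (hdist K g h)\<^sup>2) UNIV"
    using N.ell2_hdist_has_sum[OF g h] cc_pos by (simp add: hdist_rescale power_mult_distrib)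
  moreover have "((\<lambda>n. cc * (hdist (L2 \<nu>) (g n) (h n))\<^sup>2) has_sum cc * (hdist (ell2 (L2 \<nu>)) g h)\<^sup>2) UNIV"
    using g h by (intro has_sum_cmult_right L2.ell2_hdist_has_sum) (auto simp: carr_K_iff)
  ultimately show ?thesis by (rule has_sum_unique)
qed

lemma T_fin_L2: "f \<in> carr FD \<Longrightarrow> T_fin q adj x0 f \<in> carr (L2 P)"
  using reflect_L2(1)[OF fourier_transform_carr[OF fourier_W0]] by (simp add: reflect_reflect)

lemma T_plus_check_reflect: "T_plus_check q adj x0 \<nu> X = reflect (T_plus q adj x0 \<nu> X)"
  by (simp add: T_plus_check_def reflect_def)

text \<open>By Parseval's identity the transforms of finitely supported approximations converge to the Fourier
  series of \<open>g\<close>; so the limit chosen in the definition of \<open>T_plus\<close> exists, and it is this series, reflected,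
  up to a null set.\<close>

lemma T_plus_fourier:
  assumes X: "X \<in> carr H" and g: "represents X g"
  shows "fourier_transform \<nu> g (T_plus_check q adj x0 \<nu> X)" "T_plus q adj x0 \<nu> X \<in> carr (L2 P)"
proof -
  have Xc: "X n \<in> carr FD" for n using X by (simp add: carr_H)
  have gc: "g \<in> carr K" using g by (rule represents_carr)
  then have ge: "g \<in> carr (ell2 (L2 \<nu>))" by (simp add: carr_K_iff)
  have We: "W0 (X n) \<in> carr (ell2 (L2 \<nu>))" for n using W0_K[OF Xc[of n]] by (simp only: carr_K_iff)
  obtain \<phi> where \<phi>: "fourier_transform \<nu> g \<phi>" using fourier_transform_exists[OF ge] by blast
  have \<phi>c: "\<phi> \<in> carr (L2 P)" by (rule fourier_transform_carr[OF \<phi>])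
  let ?T = "\<lambda>n. T_fin q adj x0 (X n)"
  have Tc: "?T n \<in> carr (L2 P)" for n by (rule T_fin_L2[OF Xc])
  have d: "(hdist (L2 P) (?T n) (reflect \<phi>))\<^sup>2 = 2 * pi / cc * (hdist K (W0 (X n)) g)\<^sup>2" for n
  proof -
    have "hdist (L2 P) (?T n) (reflect \<phi>) = hdist (L2 P) (reflect (?T n)) \<phi>"
      using reflect_hdist[OF Tc[of n] reflect_L2(1)[OF \<phi>c]] by (simp add: reflect_reflect)
    then have "(hdist (L2 P) (?T n) (reflect \<phi>))\<^sup>2 = 2 * pi * (hdist (ell2 (L2 \<nu>)) (W0 (X n)) g)\<^sup>2"
      using fourier_transform_hdist[OF We ge fourier_W0[OF Xc] \<phi>] by simp
    then show ?thesis using hdist_K[OF W0_K[OF Xc] gc] cc_pos by simp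
  qed
  have "(\<lambda>n. 2 * pi / cc * (hdist K (W0 (X n)) g)\<^sup>2) \<longlonglongrightarrow> 2 * pi / cc * 0\<^sup>2"
    using g by (intro tendsto_intros) (simp add: represents_def hlimit_def)
  then have "(\<lambda>n. (hdist (L2 P) (?T n) (reflect \<phi>))\<^sup>2) \<longlonglongrightarrow> 0" by (simp add: d)
  then have lim: "hlimit (L2 P) ?T (reflect \<phi>)"
    using L2.hlimit_tendsto_const_iff[of ?T P "reflect \<phi>"] Tc reflect_L2(1)[OF \<phi>c] by blast
  then have limT: "hlimit (L2 P) ?T (T_plus q adj x0 \<nu> X)"
    unfolding T_plus_def by (rule someI[of "hlimit (L2 P) ?T"])
  then show Tp: "T_plus q adj x0 \<nu> X \<in> carr (L2 P)" by (simp add: hlimit_def)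
  have "heq (L2 P) (reflect \<phi>) (T_plus q adj x0 \<nu> X)" by (rule L2.hlimit_unique[OF lim limT Tc])
  then have "heq (L2 P) \<phi> (T_plus_check q adj x0 \<nu> X)"
    using reflect_hdist[OF reflect_L2(1)[OF \<phi>c] Tp] by (simp add: heq_def reflect_reflect T_plus_check_reflect)
  then show "fourier_transform \<nu> g (T_plus_check q adj x0 \<nu> X)"
    using gc by (intro fourier_transform_cong[OF \<phi>] K_carr_L2 L2.heq_refl)
      (auto simp: T_plus_check_reflect intro: reflect_L2(1)[OF Tp])
qed

lemma g_plus_measurable:
  assumes T: "T_plus q adj x0 \<nu> X \<in> carr (L2 P)"
  shows "g_plus q adj x0 \<nu> X t \<in> borel_measurable \<nu>"
proof -
  have Tm [measurable]: "T_plus q adj x0 \<nu> X \<in> borel_measurable P" by (rule L2_measurable[OF T])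
  have im: "(\<lambda>\<xi>. inverse \<xi>) \<in> borel_measurable circle"
    using powi_measurable[of "-1"] by (simp add: power_int_minus)
  have idm: "(\<lambda>\<xi>. \<xi>) \<in> borel_measurable circle" using powi_measurable[of 1] by simp
  note [measurable] = im idm
  have "(\<lambda>p. R_plus q adj x0 \<nu> X p) \<in> borel_measurable P"
    unfolding R_plus_def case_prod_unfold by measurable
  then have Rm [measurable]: "R_plus q adj x0 \<nu> X \<in> borel_measurable P" by simp
  have k: "(\<lambda>\<omega>. k_plus q adj x0 \<nu> X t \<omega>) \<in> borel_measurable \<nu>" for t
    unfolding k_plus_def
    by (intro borel_measurable_times borel_measurable_const circle.borel_measurable_lebesgue_integral) measurable
  show ?thesis unfolding g_plus_def[abs_def] using k[of "t + 1"] k[of "t - 1"] by measurable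
qed

text \<open>The combination of \<open>k_plus\<close> at \<open>t + 1\<close> and \<open>t - 1\<close> multiplies the integrand by \<open>\<xi> - q\<^sup>-\<^sup>1 \<xi>\<^sup>-\<^sup>1\<close>, which
  undoes the division in \<open>R_plus\<close>.\<close>

lemma g_plus_AE:
  assumes T: "T_plus q adj x0 \<nu> X \<in> carr (L2 P)"
  shows "AE \<omega> in \<nu>. g_plus q adj x0 \<nu> X t \<omega>
    = 1 / complex_of_real (2 * pi) * (\<integral>\<xi>. T_plus_check q adj x0 \<nu> X (\<xi>, \<omega>) * \<xi> powi (- t) \<partial>circle)"
proof -
  let ?T = "T_plus q adj x0 \<nu> X"
  have Tm [measurable]: "?T \<in> borel_measurable P" by (rule L2_measurable[OF T])
  have "integrable P (\<lambda>(\<xi>, \<omega>). ?T (\<xi>, \<omega>))" using P.L2_L1(1)[OF T] by simp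
  from circ.AE_integrable_snd[OF this]
  have ae: "AE \<omega> in \<nu>. integrable circle (\<lambda>\<xi>. ?T (\<xi>, \<omega>))" by simp
  show ?thesis
    using ae AE_space
  proof eventually_elim
    case (elim \<omega>)
    note [measurable] = powi_measurable
    have sm [measurable]: "(\<lambda>\<xi>. ?T (\<xi>, \<omega>)) \<in> borel_measurable circle"
      using elim(1) by (rule borel_measurable_integrable)
    have im [measurable]: "(\<lambda>\<xi>. inverse \<xi>) \<in> borel_measurable circle"
      using powi_measurable[of "-1"] by (simp add: power_int_minus)
    have idm [measurable]: "(\<lambda>\<xi>. \<xi>) \<in> borel_measurable circle" using powi_measurable[of 1] by simp
    let ?R = "\<lambda>\<xi>. R_plus q adj x0 \<nu> X (\<xi>, \<omega>)"
    have Req: "?R \<xi> = ?T (\<xi>, \<omega>) * ((1 + inverse (of_nat q)) / den \<xi>)" for \<xi>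
      by (simp add: R_plus_def den_def)
    have denb: "cmod (1 / den \<xi>) \<le> 2" if "\<xi> \<in> sphere 0 1" for \<xi>
    proof -
      have "1 - inverse (real q) \<le> cmod (den \<xi>)"
        using norm_triangle_ineq2[of \<xi> "inverse (of_nat q) * inverse \<xi>"] that
        by (simp add: den_def norm_mult norm_inverse)
      moreover have "inverse (real q) \<le> 1 / 2" using q2 by (simp add: field_simps)
      ultimately have h: "1 / 2 \<le> cmod (den \<xi>)" by linarith
      then have "cmod (den \<xi>) > 0" by linarith
      then show ?thesis using h by (simp add: norm_divide divide_le_eq)
    qed
    have Ri: "integrable circle (\<lambda>\<xi>. ?R \<xi> * \<xi> powi k)" for k
    proof (rule Bochner_Integration.integrable_bound[where f = "\<lambda>\<xi>. complex_of_real (2 * (1 + inverse (real q))) * ?T (\<xi>, \<omega>)"])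
      show "integrable circle (\<lambda>\<xi>. complex_of_real (2 * (1 + inverse (real q))) * ?T (\<xi>, \<omega>))"
        using elim(1) by simp
      show "(\<lambda>\<xi>. ?R \<xi> * \<xi> powi k) \<in> borel_measurable circle" unfolding Req den_def by measurable
      show "AE \<xi> in circle. norm (?R \<xi> * \<xi> powi k) \<le> norm (complex_of_real (2 * (1 + inverse (real q))) * ?T (\<xi>, \<omega>))"
      proof (intro AE_I2)
        fix \<xi> assume "\<xi> \<in> space circle"
        then have x: "\<xi> \<in> sphere 0 1" by simp
        have "norm (?R \<xi> * \<xi> powi k) = cmod (?T (\<xi>, \<omega>)) * (1 + inverse (real q)) * cmod (1 / den \<xi>)"
        proof -
          have "cmod (1 + inverse (of_nat q)) = 1 + inverse (real q)"
          proof -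
            have "1 + inverse (of_nat q) = complex_of_real (1 + inverse (real q))" by simp
            then show ?thesis by (simp only: norm_of_real) simp
          qed
          then show ?thesis using norm_powi_circle[OF x, of k] by (simp add: Req norm_mult norm_divide)
        qed
        also have "\<dots> \<le> cmod (?T (\<xi>, \<omega>)) * (1 + inverse (real q)) * 2"
          by (intro mult_left_mono denb x) simp
        also have "\<dots> = norm (complex_of_real (2 * (1 + inverse (real q))) * ?T (\<xi>, \<omega>))"
          unfolding norm_mult norm_of_real by simp
        finally show "norm (?R \<xi> * \<xi> powi k) \<le> norm (complex_of_real (2 * (1 + inverse (real q))) * ?T (\<xi>, \<omega>))" .
      qed
    qed
    have q1: "1 + inverse (of_nat q) \<noteq> (0::complex)"
    proof
      assume "1 + inverse (of_nat q) = (0::complex)"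
      then have "complex_of_real (1 + inverse (real q)) = 0" by simp
      then have "1 + inverse (real q) = 0" by (simp only: of_real_eq_0_iff)
      then show False using q2 by (simp add: field_simps)
    qed
    have "g_plus q adj x0 \<nu> X t \<omega> = 1 / complex_of_real (2 * pi) * (1 / (1 + inverse (of_nat q)) *
        ((\<integral>\<xi>. ?R \<xi> * \<xi> powi (t + 1) \<partial>circle) - inverse (of_nat q) * (\<integral>\<xi>. ?R \<xi> * \<xi> powi (t - 1) \<partial>circle)))"
      by (simp add: g_plus_def k_plus_def right_diff_distrib mult_ac)
    also have "(\<integral>\<xi>. ?R \<xi> * \<xi> powi (t + 1) \<partial>circle) - inverse (of_nat q) * (\<integral>\<xi>. ?R \<xi> * \<xi> powi (t - 1) \<partial>circle)
        = (\<integral>\<xi>. ?R \<xi> * \<xi> powi (t + 1) - inverse (of_nat q) * (?R \<xi> * \<xi> powi (t - 1)) \<partial>circle)"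
      using Ri by simp
    also have "\<dots> = (\<integral>\<xi>. (1 + inverse (of_nat q)) * (?T (\<xi>, \<omega>) * \<xi> powi t) \<partial>circle)"
    proof (rule Bochner_Integration.integral_cong)
      fix \<xi> assume "\<xi> \<in> space circle"
      then have x: "\<xi> \<in> sphere 0 1" "\<xi> \<noteq> 0" by auto
      have "?R \<xi> * \<xi> powi (t + 1) - inverse (of_nat q) * (?R \<xi> * \<xi> powi (t - 1)) = ?R \<xi> * den \<xi> * \<xi> powi t"
        using x(2) by (simp add: den_def power_int_add power_int_diff divide_inverse algebra_simps)
      then show "?R \<xi> * \<xi> powi (t + 1) - inverse (of_nat q) * (?R \<xi> * \<xi> powi (t - 1)) = (1 + inverse (of_nat q)) * (?T (\<xi>, \<omega>) * \<xi> powi t)"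
        unfolding Req using den_nonzero[OF x(1)] by simp
    qed simp
    also have "1 / (1 + inverse (of_nat q)) * \<dots> = (\<integral>\<xi>. ?T (\<xi>, \<omega>) * \<xi> powi t \<partial>circle)"
      using q1 by simp
    also have "\<dots> = (\<integral>\<xi>. ?T (\<xi>, \<omega>) * \<xi> powi t \<partial>distr circle circle inverse)" by (simp add: distr_circle_inverse)
    also have "\<dots> = (\<integral>\<xi>. ?T (inverse \<xi>, \<omega>) * inverse \<xi> powi t \<partial>circle)"
      by (rule integral_distr) measurable
    also have "\<dots> = (\<integral>\<xi>. T_plus_check q adj x0 \<nu> X (\<xi>, \<omega>) * \<xi> powi (- t) \<partial>circle)"
      by (simp add: T_plus_check_def power_int_minus power_int_inverse)
    finally show ?case .
  qed
qed

lemma represents_g_plus: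
  assumes X: "X \<in> carr H"
  shows "represents X (g_plus q adj x0 \<nu> X)"
    "fourier_transform \<nu> (g_plus q adj x0 \<nu> X) (T_plus_check q adj x0 \<nu> X)"
proof -
  let ?g = "g_plus q adj x0 \<nu> X"
  obtain g where g: "represents X g" using represents_exists[OF X] by blast
  have gc: "g \<in> carr K" using g by (rule represents_carr)
  note T = T_plus_fourier[OF X g]
  have ae: "AE \<omega> in \<nu>. g n \<omega> = ?g n \<omega>" for n
    using fourier_coefficient[OF _ T(1), of n] g_plus_AE[OF T(2), of n] gc by (auto simp: carr_K_iff)
  have gL: "?g n \<in> carr (L2 \<nu>)" for n
    by (rule L2_AE_cong[OF K_carr_L2[OF gc] g_plus_measurable[OF T(2)] ae])
  have heq: "heq (L2 \<nu>) (g n) (?g n)" for n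
    using L2_heq_iff[OF K_carr_L2[OF gc] gL] ae by blast
  have "hnorm (L2 \<nu>) (?g n) = hnorm (L2 \<nu>) (g n)" for n
    using L2.heq_hnorm[OF heq K_carr_L2[OF gc] gL] by simp
  then have gK: "?g \<in> carr K" using gc gL by (simp add: N.carr_ell2_iff hnorm_rescale cc_pos less_imp_le)
  have heqK: "heq K g ?g" using N.ell2_heq_iff[OF gc gK] heq cc_pos by (simp add: heq_rescale)
  have Xc: "X n \<in> carr FD" for n using X by (simp add: carr_H)
  show "represents X ?g"
    unfolding represents_def
    by (rule K.hlimit_heq[OF g[unfolded represents_def] heqK gK W0_K[OF Xc]])
  show "fourier_transform \<nu> ?g (T_plus_check q adj x0 \<nu> X)"
    by (rule fourier_transform_cong[OF T(1) K_carr_L2[OF gc] gL heq])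
      (use fourier_transform_carr[OF T(1)] in auto)
qed

section \<open>The translation representation\<close>

lemma g_plus_ip:
  "X \<in> carr H \<Longrightarrow> Y \<in> carr H \<Longrightarrow> ip K (g_plus q adj x0 \<nu> X) (g_plus q adj x0 \<nu> Y) = ip H X Y"
  unfolding H_eq
  by (rule completion_extension_ip[OF prehilbert_FD K.prehilbert_axioms W0_K W0_isometry])
    (use represents_g_plus(1) in \<open>auto simp: represents_def H_eq\<close>)

lemma g_plus_wave:
  assumes f: "f \<in> carr FD"
  shows "(\<lambda>_. f) \<in> carr H" "heq K (g_plus q adj x0 \<nu> (\<lambda>_. f)) (W0 f)"
proof -
  show H: "(\<lambda>_. f) \<in> carr H" using f by (auto simp: carr_H hcauchy_def FD.hdist_self)
  show "heq K (g_plus q adj x0 \<nu> (\<lambda>_. f)) (W0 f)"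
    by (rule K.hlimit_unique[of "\<lambda>_. W0 f"])
      (use represents_g_plus(1)[OF H] f in \<open>auto simp: represents_def intro: K.hlimit_const\<close>)
qed

lemma W0_delta: "W0 (\<lambda>_. 0, \<lambda>x. if x = v then 1 else 0) = vel_wave v"
proof -
  have "lincomb (\<lambda>x. if x = v then 1 else 0) e = e v" for e
    by (simp add: lincomb_def cong: if_cong)
  then show ?thesis by (simp add: W0_def fun_eq_iff lincomb_def[of "\<lambda>_. 0"])
qed

text \<open>Shifts into the future are realised by propagating \<open>(0, \<delta>\<^sub>v)\<close>.\<close>

lemma tshift_vel_wave_in_range: "\<exists>f\<in>carr FD. W0 f = tshift (int k) (vel_wave v)"
proof (induction k)
  case 0
  have "(\<lambda>_. 0, \<lambda>x. if x = v then 1 else 0) \<in> carr FD" by (simp add: carr_FD finsupp_def)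
  then show ?case using W0_delta by auto
next
  case (Suc k)
  then obtain f where f: "f \<in> carr FD" "W0 f = tshift (int k) (vel_wave v)" by blast
  then show ?case using prop_closed[OF f(1)] W0_prop[OF f(1)] by (intro bexI[of _ "prop_fin q adj f"]) auto
qed

text \<open>Orthogonality to \<open>S\<^sup>k a\<^sub>v\<close> for \<open>k \<ge> 0\<close> extends to negative \<open>k\<close> by the recursion over neighbours, solved
  backwards in time.\<close>

lemma range_orthogonal:
  assumes z: "z \<in> carr K" and o: "\<And>X. X \<in> carr H \<Longrightarrow> ip K z (g_plus q adj x0 \<nu> X) = 0"
  shows "hnorm K z = 0"
proof -
  have W: "ip K z (W0 f) = 0" if f: "f \<in> carr FD" for f
  proof -
    have gc: "g_plus q adj x0 \<nu> (\<lambda>_. f) \<in> carr K"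
      by (rule represents_carr[OF represents_g_plus(1)[OF g_plus_wave(1)[OF f]]])
    have "ip K z (g_plus q adj x0 \<nu> (\<lambda>_. f)) = ip K z (W0 f)"
      by (rule K.heq_ip[OF K.heq_refl[OF z] g_plus_wave(2)[OF f] z gc z W0_K[OF f]])
    then show ?thesis using o[OF g_plus_wave(1)[OF f]] by simp
  qed
  define y where "y k v = ip K z (tshift k (vel_wave v))" for k v
  have pos: "y (int k) v = 0" for k v
    using tshift_vel_wave_in_range[of k v] W unfolding y_def by metis
  have rec: "y (k + 1) v + y (k - 1) v = (\<Sum>u | adj v u. y k u) / complex_of_real rt" for k v
  proof -
    have "add K (tshift (k + 1) (vel_wave v)) (tshift (k - 1) (vel_wave v))
        = smul K (1 / complex_of_real rt) (\<lambda>n \<omega>. \<Sum>u | adj v u. tshift k (vel_wave u) n \<omega>)"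
    proof (intro ext)
      fix n \<omega>
      show "add K (tshift (k + 1) (vel_wave v)) (tshift (k - 1) (vel_wave v)) n \<omega>
        = smul K (1 / complex_of_real rt) (\<lambda>n \<omega>. \<Sum>u | adj v u. tshift k (vel_wave u) n \<omega>) n \<omega>"
        using vel_wave_recursion[of v "n - k" \<omega>] by (simp add: K_add K_smul tshift_def algebra_simps)
    qed
    then have "y (k + 1) v + y (k - 1) v = ip K z (smul K (1 / complex_of_real rt) (\<lambda>n \<omega>. \<Sum>u | adj v u. tshift k (vel_wave u) n \<omega>))"
      using K.ip_add_right[of "tshift (k + 1) (vel_wave v)" "tshift (k - 1) (vel_wave v)" z] z by (simp add: y_def)
    also have "\<dots> = (\<Sum>u | adj v u. y k u) / complex_of_real rt"
      using K_nbrs_ip'[where e = "\<lambda>u. tshift k (vel_wave u)" and v = v, OF _ z] K_nbrs_closed[where e = "\<lambda>u. tshift k (vel_wave u)" and v = v] z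
      by (simp add: K.ip_smul_right y_def)
    finally show ?thesis .
  qed
  have neg: "(\<forall>v. y (- int k) v = 0) \<and> (\<forall>v. y (- int k + 1) v = 0)" for k
  proof (induction k)
    case 0 show ?case using pos[of 0] pos[of 1] by simp
  next
    case (Suc k)
    have e: "- int (Suc k) = - int k - 1" "- int (Suc k) + 1 = - int k" by simp_all
    have "y (- int k - 1) v = 0" for v using rec[of "- int k" v] Suc by simp
    then show ?case unfolding e(2) unfolding e(1) using Suc by blast
  qed
  have "y k v = 0" for k v using pos[of "nat k" v] neg[of "nat (- k)"] by (cases "k \<ge> 0") auto
  then have "ip K (tshift k z) (vel_wave v) = 0" for k v by (simp add: y_def tshift_ip_left)
  then show ?thesis by (rule orthogonal_to_waves_null[OF z])
qed

lemma intertwiner: "shift_intertwiner H N (propagator q adj) (g_plus q adj x0 \<nu>) (D_plus q adj x0)"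
proof
  have gK: "g_plus q adj x0 \<nu> X \<in> carr K" if "X \<in> carr H" for X
    by (rule represents_carr[OF represents_g_plus(1)[OF that]])
  show "hilbert_space H" by (rule hilbert_H)
  show "hilbert_space N" by (rule hilbert_N)
  show "propagator q adj X \<in> carr H" if "X \<in> carr H" for X by (rule propagator_closed[OF that])
  show "g_plus q adj x0 \<nu> X \<in> carr K" if "X \<in> carr H" for X by (rule gK[OF that])
  show "ip K (g_plus q adj x0 \<nu> X) (g_plus q adj x0 \<nu> Y) = ip H X Y" if "X \<in> carr H" "Y \<in> carr H" for X Y
    by (rule g_plus_ip[OF that])
  show "\<exists>X\<in>carr H. heq K (g_plus q adj x0 \<nu> X) h" if "h \<in> carr K" for h
    by (rule ip_preserving_onto[OF hilbert_H K.prehilbert_axioms gK g_plus_ip range_orthogonal that])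
  show "heq K (g_plus q adj x0 \<nu> (propagator q adj X)) (right_shift (g_plus q adj x0 \<nu> X))" if X: "X \<in> carr H" for X
  proof -
    have "right_shift (g_plus q adj x0 \<nu> X) = tshift 1 (g_plus q adj x0 \<nu> X)"
      by (simp add: right_shift_def tshift_def fun_eq_iff)
    then show ?thesis
      using represents_propagator[OF X represents_g_plus(1)[OF X] represents_g_plus(1)[OF propagator_closed[OF X]]]
      by simp
  qed
  show "D_plus q adj x0 = {X \<in> carr H. g_plus q adj x0 \<nu> X \<in> ell2_nonneg N}"
    using D_plus_iff represents_g_plus(1) by (auto simp: D_plus_def)
qed

end

theorem theorem3p15:
  fixes q :: nat and adj :: "'v \<Rightarrow> 'v \<Rightarrow> bool" and x0 :: 'v
    and \<nu> :: "(nat \<Rightarrow> 'v) set measure"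
  assumes "q \<ge> 2" and "regular_tree q adj" and "boundary_measure q adj x0 \<nu>"
  shows "outgoing (energy_space q adj) (propagator q adj) (D_plus q adj x0)
    \<and> spectral_rep (energy_space q adj) (propagator q adj) (D_plus q adj x0)
        (rep_const q) \<nu> (T_plus_check q adj x0 \<nu>)
    \<and> translation_rep (energy_space q adj) (propagator q adj) (D_plus q adj x0)
        (rescale (rep_const q) (L2 \<nu>)) (g_plus q adj x0 \<nu>)"
proof -
  interpret boundary_tree q adj x0 \<nu>
    using assms by unfold_locales
  interpret I: shift_intertwiner H N "propagator q adj" "g_plus q adj x0 \<nu>" "D_plus q adj x0"
    by (rule intertwiner)
  have t: "translation_rep (energy_space q adj) (propagator q adj) (D_plus q adj x0)
        (rescale (rep_const q) (L2 \<nu>)) (g_plus q adj x0 \<nu>)"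
    using I.translation_rep by (simp add: cc_def)
  moreover have "spectral_rep (energy_space q adj) (propagator q adj) (D_plus q adj x0)
        (rep_const q) \<nu> (T_plus_check q adj x0 \<nu>)"
    unfolding spectral_rep_def using t represents_g_plus(2) by blast
  ultimately show ?thesis using I.outgoing by blast
qed

end
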